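(* Let $\kappa>0$, $\lambda\ge0$, $\varepsilon>0$, $f_0,f_1\in L^2(0,1)$, and let $(f,v,z)\in\mathcal A(f_0,f_1)$ be a minimizer over $\mathcal A(f_0,f_1)$ of the action $$A_{\kappa,\lambda,\varepsilon}(f,v,z)=\frac12\int_0^1\int_0^1\kappa v^2+\lambda v_x^2+\varepsilon v_{xx}^2+z^2\,dx\,dt.$$ Then: (1) for all $u\in R_T(f)$, $$\int_0^1\int_0^1\kappa vu+\lambda v_xu_x+\varepsilon v_{xx}u_{xx}+z\,(uf_x)\,dx\,dt=0;$$ (2) $z$ is a weak solution of $\partial_t z+\partial_x(zv)=0$ on $(0,1)^2$. If moreover $f_0,f_1\in H^1(0,1)$, then condition (1) takes the form that $v$ is a weak solution of $$\varepsilon v_{xxxx}-\lambda v_{xx}+\kappa v+zf_x=0\ \text{ on }(0,1)^2,\qquad v=0\ \text{ and }\ v_{xx}=0\ \text{ on }\{0,1\}\times[0,1].$$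
   Context: Let $\mathcal V=L^2((0,1),H^2(0,1)\cap H^1_0(0,1))$ (time in the outer interval, space in the inner one). For $f_0,f_1\in L^2(0,1)$ the set of admissible paths $\mathcal A(f_0,f_1)$ consists of all triples $(f,v,z)$ of functions of $(x,t)\in(0,1)\times(0,1)$ with $f\in L^2((0,1),L^2(0,1))\cap C([0,1],H^{-1}(0,1))$, $v\in\mathcal V$, $z\in L^2((0,1),L^2(0,1))$, $f(\cdot,0)=f_0$, $f(\cdot,1)=f_1$, and $\partial_t f+\partial_x f\cdot v=z$ weakly, i.e. for every $\phi\in C^\infty([0,1]^2)$, $$-\int_0^1\!\!\int_0^1 f\,\partial_t\phi\,dx\,dt+\int_0^1 f_1(x)\phi(x,1)\,dx-\int_0^1 f_0(x)\phi(x,0)\,dx=\int_0^1\!\!\int_0^1 f\phi\,\partial_x v\,dx\,dt+\int_0^1\!\!\int_0^1 f\,\partial_x\phi\, v\,dx\,dt+\int_0^1\!\!\int_0^1\phi z\,dx\,dt.$$ For $f\in L^2((0,1)^2)$ set $$R_T(f)=\{u\in L^2((0,1),H^2(0,1)\cap H^1_0(0,1)) : uf\in L^2((0,1),H^1(0,1))\},$$ and for $u\in R_T(f)$ let $uf_x:=(uf)_x-u_xf\in L^2((0,1)^2)$. A weak solution of $\partial_t z+\partial_x(zv)=0$ is $z$ with $\int_0^1\int_0^1 z\phi_t+zv\phi_x\,dx\,dt=0$ for all $\phi\in C_c^\infty((0,1)^2)$. The weak form of the fourth-order boundary value problem (including the natural boundary condition $v_{xx}=0$) is: $v\in\mathcal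 V$ and $\int_0^1\int_0^1\kappa vu+\lambda v_xu_x+\varepsilon v_{xx}u_{xx}+zf_xu\,dx\,dt=0$ for all $u\in\mathcal V$ (when $f_0,f_1\in H^1(0,1)$ a minimizer satisfies $f\in L^\infty((0,1),H^1(0,1))$). *)

theory Defs
  imports "HOL-Analysis.Analysis"
begin

text \<open>
  Functions on the square are functions of pairs \<open>(x, t)\<close>, space first and time second.
  Elements of \<open>L\<^sup>2\<close> are given by Borel measurable representatives; all notions below are invariant
  under changes on null sets.
\<close>

definition unit_interval :: "real measure"
  where "unit_interval = restrict_space lborel {0<..<1}"

definition unit_square :: "(real \<times> real) measure"
  where "unit_square = unit_interval \<Otimes>\<^sub>M unit_interval"

definition L2 :: "'a measure \<Rightarrow> ('a \<Rightarrow> real) set"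
  where "L2 M = {f \<in> borel_measurable M. integrable M (\<lambda>p. (f p)\<^sup>2)}"


subsection \<open>Test functions\<close>

definition test_fun :: "(real \<Rightarrow> real) set"
  where "test_fun = {\<phi>. (\<forall>k x. (deriv ^^ k) \<phi> field_differentiable at x) \<and>
    (\<exists>K. compact K \<and> K \<subseteq> {0<..<1} \<and> (\<forall>x. x \<notin> K \<longrightarrow> \<phi> x = 0))}"

definition partial_x :: "(real \<times> real \<Rightarrow> real) \<Rightarrow> real \<times> real \<Rightarrow> real"
  where "partial_x \<phi> = (\<lambda>(x, t). deriv (\<lambda>y. \<phi> (y, t)) x)"

definition partial_t :: "(real \<times> real \<Rightarrow> real) \<Rightarrow> real \<times> real \<Rightarrow> real"
  where "partial_t \<phi> = (\<lambda>(x, t). deriv (\<lambda>s. \<phi> (x, s)) t)"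

primrec Ck :: "nat \<Rightarrow> (real \<times> real \<Rightarrow> real) \<Rightarrow> bool"
  where
    "Ck 0 \<phi> \<longleftrightarrow> continuous_on UNIV \<phi>"
  | "Ck (Suc k) \<phi> \<longleftrightarrow> \<phi> differentiable_on UNIV \<and> Ck k (partial_x \<phi>) \<and> Ck k (partial_t \<phi>)"

text \<open>
  \<open>C\<^sup>\<infinity>\<close> functions on the closed unit square are taken to be the restrictions of smooth functions
  on the whole plane. Such a function is represented by one of its extensions.
\<close>

definition smooth_fun :: "(real \<times> real \<Rightarrow> real) set"
  where "smooth_fun = {\<phi>. \<forall>k. Ck k \<phi>}"

definition smooth_compact_fun :: "(real \<times> real \<Rightarrow> real) set"
  where "smooth_compact_fun = {\<phi> \<in> smooth_fun.
    \<exists>K. compact K \<and> K \<subseteq> {0<..<1} \<times> {0<..<1} \<and> (\<forall>p. p \<notin> K \<longrightarrow> \<phi> p = 0)}"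


subsection \<open>Sobolev spaces on the unit interval\<close>

definition has_weak_deriv :: "(real \<Rightarrow> real) \<Rightarrow> (real \<Rightarrow> real) \<Rightarrow> bool"
  where "has_weak_deriv w g \<longleftrightarrow> w \<in> L2 unit_interval \<and> g \<in> L2 unit_interval \<and>
    (\<forall>\<phi>\<in>test_fun.
      (LINT x|unit_interval. w x * deriv \<phi> x) = - (LINT x|unit_interval. g x * \<phi> x))"

definition H1 :: "(real \<Rightarrow> real) set"
  where "H1 = {w. \<exists>g. has_weak_deriv w g}"

definition weak_deriv :: "(real \<Rightarrow> real) \<Rightarrow> real \<Rightarrow> real"
  where "weak_deriv w = (SOME g. has_weak_deriv w g)"

definition H1_norm :: "(real \<Rightarrow> real) \<Rightarrow> real"
  where "H1_norm w = sqrt (LINT x|unit_interval. (w x)\<^sup>2 + (weak_deriv w x)\<^sup>2)"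

text \<open>\<open>H\<^sup>1\<^sub>0\<close> is the closure of the test functions in \<open>H\<^sup>1\<close>.\<close>

definition H10 :: "(real \<Rightarrow> real) set"
  where "H10 = {w \<in> H1. \<forall>e>0. \<exists>\<phi>\<in>test_fun. H1_norm (\<lambda>x. w x - \<phi> x) < e}"

text \<open>
  The dual of \<open>H\<^sup>1\<^sub>0\<close>. Only the values of a functional on \<^const>\<open>H10\<close> are meaningful; boundedness
  makes them independent of the representative.
\<close>

definition Hm1 :: "((real \<Rightarrow> real) \<Rightarrow> real) set"
  where "Hm1 = {F.
    (\<forall>w\<in>H10. \<forall>w'\<in>H10. F (\<lambda>x. w x + w' x) = F w + F w') \<and>
    (\<forall>w\<in>H10. \<forall>c. F (\<lambda>x. c * w x) = c * F w) \<and>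
    (\<exists>C. \<forall>w\<in>H10. \<bar>F w\<bar> \<le> C * H1_norm w)}"

definition continuous_Hm1 :: "(real \<Rightarrow> (real \<Rightarrow> real) \<Rightarrow> real) \<Rightarrow> bool"
  where "continuous_Hm1 F \<longleftrightarrow> (\<forall>t\<in>{0..1}. F t \<in> Hm1) \<and>
    (\<forall>t\<in>{0..1}. \<forall>e>0. \<exists>d>0. \<forall>s\<in>{0..1}. \<bar>s - t\<bar> < d \<longrightarrow>
      (\<forall>w\<in>H10. \<bar>F s w - F t w\<bar> \<le> e * H1_norm w))"

text \<open>\<open>represents_Hm1 F g\<close>: the functional \<open>F\<close> is the image of \<open>g \<in> L\<^sup>2\<close> in \<open>H\<^sup>-\<^sup>1\<close>.\<close>

definition represents_Hm1 :: "((real \<Rightarrow> real) \<Rightarrow> real) \<Rightarrow> (real \<Rightarrow> real) \<Rightarrow> bool"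
  where "represents_Hm1 F g \<longleftrightarrow> (\<forall>w\<in>H10. F w = (LINT x|unit_interval. g x * w x))"

text \<open>
  An \<open>L\<^sup>2\<close> function \<open>f\<close> on the square lies in \<open>C([0,1], H\<^sup>-\<^sup>1)\<close> if \<open>t \<mapsto> f(\<cdot>, t)\<close> agrees almost
  everywhere with a continuous curve \<open>F\<close> in \<open>H\<^sup>-\<^sup>1\<close>; the end point conditions refer to this curve.
\<close>

definition Hm1_curve_between ::
    "(real \<times> real \<Rightarrow> real) \<Rightarrow> (real \<Rightarrow> real) \<Rightarrow> (real \<Rightarrow> real) \<Rightarrow> bool"
  where "Hm1_curve_between f f0 f1 \<longleftrightarrow> (\<exists>F. continuous_Hm1 F \<and>
    (AE t in unit_interval. represents_Hm1 (F t) (\<lambda>x. f (x, t))) \<and>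
    represents_Hm1 (F 0) f0 \<and> represents_Hm1 (F 1) f1)"


subsection \<open>Bochner spaces in time with values in Sobolev spaces\<close>

text \<open>
  The space \<open>L\<^sup>2((0,1), H\<^sup>1)\<close> consists of the \<open>L\<^sup>2\<close> functions on the square whose weak derivatives
  on almost all time slices are the slices of one \<open>L\<^sup>2\<close> function on the square. The joint
  measurability of that function amounts to the strong measurability of \<open>t \<mapsto> w(\<cdot>, t)\<close> in \<open>H\<^sup>1\<close>,
  and its square integrability to that of the \<open>H\<^sup>1\<close> norm in time.
\<close>

definition has_weak_dx :: "(real \<times> real \<Rightarrow> real) \<Rightarrow> (real \<times> real \<Rightarrow> real) \<Rightarrow> bool"
  where "has_weak_dx w g \<longleftrightarrow> w \<in> L2 unit_square \<and> g \<in> L2 unit_square \<and>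
    (AE t in unit_interval. has_weak_deriv (\<lambda>x. w (x, t)) (\<lambda>x. g (x, t)))"

definition weak_dx :: "(real \<times> real \<Rightarrow> real) \<Rightarrow> real \<times> real \<Rightarrow> real"
  where "weak_dx w = (SOME g. has_weak_dx w g)"

definition L2_H1 :: "(real \<times> real \<Rightarrow> real) set"
  where "L2_H1 = {w. \<exists>g. has_weak_dx w g}"

definition Linf_H1 :: "(real \<times> real \<Rightarrow> real) set"
  where "Linf_H1 = {w \<in> L2_H1. \<exists>C. AE t in unit_interval. H1_norm (\<lambda>x. w (x, t)) \<le> C}"

text \<open>\<open>L\<^sup>2((0,1), H\<^sup>2 \<inter> H\<^sup>1\<^sub>0)\<close>\<close>

definition V_space :: "(real \<times> real \<Rightarrow> real) set"
  where "V_space = {v. (\<exists>g h. has_weak_dx v g \<and> has_weak_dx g h) \<and>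
    (AE t in unit_interval. (\<lambda>x. v (x, t)) \<in> H10)}"


subsection \<open>Admissible paths, action and optimality conditions\<close>

definition transport_equation ::
    "(real \<Rightarrow> real) \<Rightarrow> (real \<Rightarrow> real) \<Rightarrow> (real \<times> real \<Rightarrow> real) \<Rightarrow> (real \<times> real \<Rightarrow> real) \<Rightarrow>
     (real \<times> real \<Rightarrow> real) \<Rightarrow> bool"
  where "transport_equation f0 f1 f v z \<longleftrightarrow> (\<forall>\<phi>\<in>smooth_fun.
    - (LINT p|unit_square. f p * partial_t \<phi> p)
      + (LINT x|unit_interval. f1 x * \<phi> (x, 1)) - (LINT x|unit_interval. f0 x * \<phi> (x, 0))
    = (LINT p|unit_square. f p * \<phi> p * weak_dx v p)
      + (LINT p|unit_square. f p * partial_x \<phi> p * v p)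
      + (LINT p|unit_square. \<phi> p * z p))"

definition admissible ::
    "(real \<Rightarrow> real) \<Rightarrow> (real \<Rightarrow> real) \<Rightarrow>
     ((real \<times> real \<Rightarrow> real) \<times> (real \<times> real \<Rightarrow> real) \<times> (real \<times> real \<Rightarrow> real)) set"
  where "admissible f0 f1 = {(f, v, z).
    f \<in> L2 unit_square \<and> v \<in> V_space \<and> z \<in> L2 unit_square \<and>
    Hm1_curve_between f f0 f1 \<and> transport_equation f0 f1 f v z}"

definition action ::
    "real \<Rightarrow> real \<Rightarrow> real \<Rightarrow>
     (real \<times> real \<Rightarrow> real) \<times> (real \<times> real \<Rightarrow> real) \<times> (real \<times> real \<Rightarrow> real) \<Rightarrow> real"
  where "action \<kappa> lam \<epsilon> = (\<lambda>(f, v, z). 1/2 * (LINT p|unit_square.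
    \<kappa> * (v p)\<^sup>2 + lam * (weak_dx v p)\<^sup>2 + \<epsilon> * (weak_dx (weak_dx v) p)\<^sup>2 + (z p)\<^sup>2))"

definition R_T :: "(real \<times> real \<Rightarrow> real) \<Rightarrow> (real \<times> real \<Rightarrow> real) set"
  where "R_T f = {u \<in> V_space. (\<lambda>p. u p * f p) \<in> L2_H1}"

text \<open>\<open>u f\<^sub>x\<close>, defined by the product rule as \<open>f\<close> itself need not have a weak derivative\<close>

definition times_dx :: "(real \<times> real \<Rightarrow> real) \<Rightarrow> (real \<times> real \<Rightarrow> real) \<Rightarrow> real \<times> real \<Rightarrow> real"
  where "times_dx u f = (\<lambda>p. weak_dx (\<lambda>q. u q * f q) p - weak_dx u p * f p)"

definition weak_continuity_equation ::
    "(real \<times> real \<Rightarrow> real) \<Rightarrow> (real \<times> real \<Rightarrow> real) \<Rightarrow> bool"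
  where "weak_continuity_equation z v \<longleftrightarrow> (\<forall>\<phi>\<in>smooth_compact_fun.
    (LINT p|unit_square. z p * partial_t \<phi> p + z p * v p * partial_x \<phi> p) = 0)"

definition weak_boundary_value_problem ::
    "real \<Rightarrow> real \<Rightarrow> real \<Rightarrow> (real \<times> real \<Rightarrow> real) \<Rightarrow> (real \<times> real \<Rightarrow> real) \<Rightarrow>
     (real \<times> real \<Rightarrow> real) \<Rightarrow> bool"
  where "weak_boundary_value_problem \<kappa> lam \<epsilon> f z v \<longleftrightarrow> v \<in> V_space \<and> (\<forall>u\<in>V_space.
    (LINT p|unit_square. \<kappa> * v p * u p + lam * weak_dx v p * weak_dx u p
      + \<epsilon> * weak_dx (weak_dx v) p * weak_dx (weak_dx u) p + z p * weak_dx f p * u p) = 0)"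

end

theory Submission
  imports Defs
begin

text \<open>
  The velocity has \<open>L\<^sup>2\<close> Lipschitz constants in time, hence a flow \<open>X\<close> whose Jacobian \<open>J\<close> is bounded
  above and below and has a square integrable space derivative. The transport equation has a unique
  solution, namely \<open>f(X(y, t), t) = f\<^sub>0(y) + \<integral>\<^sub>0\<^sup>t z(X(y, s), s) ds\<close>. For uniqueness a solution \<open>d\<close> with zero
  data is tested with \<open>\<phi>\<close> that solves the dual continuity equation: \<open>D(t, s) = \<integral> d(x, t) \<phi>(x, s) dx\<close> is
  absolutely continuous in each variable, and the two rates cancel on the diagonal, in the mean over
  a thin strip. In particular \<open>f\<close> is bounded in time with values in \<open>L\<^sup>2\<close>.

  (1) For \<open>u \<in> R\<^sub>T(f)\<close> the product \<open>u f\<close> has zero traces, because \<open>u\<close> vanishes linearly at the boundary,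
  so that \<open>(f, v + s u, z + s u f\<^sub>x)\<close> is admissible for all \<open>s\<close>. (2) So is \<open>(f + s g, v, z + s (g\<^sub>t + v g\<^sub>x))\<close> if
  \<open>g\<close> vanishes at the initial and the final time.

  If \<open>f\<^sub>0\<close> and \<open>f\<^sub>1\<close> are in \<open>H\<^sup>1\<close>, then (2) with functions \<open>g\<close> that are smooth along the flow shows that
  \<open>z(X(y, t), t) J(y, t) = z\<^sub>0(y)\<close>. Hence \<open>f\<^sub>1(X(y, 1)) = f\<^sub>0(y) + z\<^sub>0(y) \<integral>\<^sub>0\<^sup>1 1 / J(y, s) ds\<close>, so \<open>z\<^sub>0\<close> is in \<open>H\<^sup>1\<close>,
  and then so is \<open>f\<close> at every time, with uniform bounds. Thus \<open>R\<^sub>T(f)\<close> is the whole velocity space.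
\<close>

text \<open>The velocity is only square integrable in time, and f is only known to be in L2 of the
  square, so a product such as \<open>weak_dx u p * f p\<close> could leave L2. Uniqueness for the
  transport equation is the way out: it identifies f with the explicit solution, whose L2 norm is
  bounded in time. Separate absolute continuity of D(t, s) in t and in s says nothing about the
  diagonal, which is a null set; hence the averages over a strip. Derivatives in time are not taken
  pointwise: absolutely continuous functions are written as c + \<open>prim k\<close>, and
  differential equations become identities between integrals. Equality almost everywhere is mostly
  decided by moments. Test functions for the transport equation need not vanish at the boundary of
  the square, so monomials are allowed, and polynomials are dense in L2 of the interval. As there
  are only countably many monomials, one null set of times serves all of them, and by density it
  serves uncountable families of test functions as well.\<close>

abbreviation U :: "real measure" where "U \<equiv> unit_interval"
abbreviation US :: "(real \<times> real) measure" where "US \<equiv> unit_interval \<Otimes>\<^sub>M unit_interval"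

section \<open>Integration on the unit interval and the unit square: L2 estimates, density,
  Fubini\<close>

subsection \<open>Square integrable functions\<close>

lemma space_U [simp]: "space U = {0<..<1}"
  by (simp add: unit_interval_def space_restrict_space)

lemma sets_U: "sets U = (\<inter>) {0<..<1} ` sets borel"
  by (simp add: unit_interval_def sets_restrict_space)

lemma borel_ident_U [measurable]: "(\<lambda>x. x) \<in> borel_measurable U"
  unfolding unit_interval_def by (rule measurable_restrict_space1) simp

lemma emeasure_U: "emeasure U {0<..<1} = 1"
  unfolding unit_interval_def by (subst emeasure_restrict_space) auto

interpretation U: finite_measure U
  by standard (simp add: emeasure_U)

interpretation UU: pair_sigma_finite U U ..

lemma emeasure_US: "emeasure US (space US) = 1"
  by (simp add: space_pair_measure U.emeasure_pair_measure_Times emeasure_U sets.top[of U, simplified])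

interpretation US: finite_measure US
  by standard (simp add: emeasure_US)

lemma measure_U [simp]: "measure U {0<..<1} = 1"
  by (simp add: measure_def emeasure_U)

lemma measure_US [simp]: "measure US (space US) = 1"
  by (simp only: measure_def emeasure_US) simp

lemma space_US: "space US = {0<..<1} \<times> {0<..<1}"
  by (simp add: space_pair_measure)

lemma borel_ident_US [measurable]: "(\<lambda>x. x) \<in> borel_measurable US"
proof -
  have "(\<lambda>x. (fst x, snd x)) \<in> measurable US (borel \<Otimes>\<^sub>M borel)"
    by measurable
  then show ?thesis by (simp add: borel_prod)
qed

lemma L2D: "f \<in> L2 M \<Longrightarrow> f \<in> borel_measurable M" "f \<in> L2 M \<Longrightarrow> integrable M (\<lambda>p. (f p)\<^sup>2)"
  by (auto simp: L2_def)

lemma L2I: "f \<in> borel_measurable M \<Longrightarrow> integrable M (\<lambda>p. (f p)\<^sup>2) \<Longrightarrow> f \<in> L2 M"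
  by (auto simp: L2_def)

lemma two_mult_le: "\<bar>x * y\<bar> \<le> x\<^sup>2 + (y::real)\<^sup>2"
proof -
  have "2 * (\<bar>x\<bar> * \<bar>y\<bar>) \<le> \<bar>x\<bar>\<^sup>2 + \<bar>y\<bar>\<^sup>2" using sum_squares_bound[of "\<bar>x\<bar>" "\<bar>y\<bar>"] by (simp add: mult.assoc)
  moreover have "0 \<le> \<bar>x\<bar> * \<bar>y\<bar>" by simp
  ultimately show ?thesis unfolding abs_mult power2_abs by linarith
qed

lemma square_add_le: "(x + y)\<^sup>2 \<le> 2 * x\<^sup>2 + 2 * (y::real)\<^sup>2"
  using sum_squares_bound[of x y] by (simp add: power2_sum)

lemma integrable_mult_L2:
  assumes "f \<in> L2 M" "g \<in> L2 M" shows "integrable M (\<lambda>x. f x * g x)"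
proof (rule Bochner_Integration.integrable_bound)
  show "integrable M (\<lambda>x. (f x)\<^sup>2 + (g x)\<^sup>2)" using assms by (auto intro: L2D)
  show "(\<lambda>x. f x * g x) \<in> borel_measurable M" using L2D(1)[OF assms(1)] L2D(1)[OF assms(2)] by measurable
  show "AE x in M. norm (f x * g x) \<le> norm ((f x)\<^sup>2 + (g x)\<^sup>2)"
    using two_mult_le by auto
qed

lemma L2_bound:
  assumes "f \<in> borel_measurable M" "g \<in> L2 M" "AE x in M. \<bar>f x\<bar> \<le> \<bar>g x\<bar>"
  shows "f \<in> L2 M"
proof (rule L2I[OF assms(1)], rule Bochner_Integration.integrable_bound)
  show "integrable M (\<lambda>x. (g x)\<^sup>2)" using assms(2) by (rule L2D)
  show "(\<lambda>x. (f x)\<^sup>2) \<in> borel_measurable M" using assms(1) by measurable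
  show "AE x in M. norm ((f x)\<^sup>2) \<le> norm ((g x)\<^sup>2)"
    using assms(3) by eventually_elim (simp add: abs_le_square_iff)
qed

lemma L2_cong_AE:
  assumes "f \<in> borel_measurable M" "g \<in> L2 M" "AE x in M. f x = g x"
  shows "f \<in> L2 M"
  by (rule L2_bound[OF assms(1,2)]) (use assms(3) in auto)

lemma L2_cmult [intro]:
  assumes "f \<in> L2 M" shows "(\<lambda>x. c * f x) \<in> L2 M"
  using assms by (auto simp: L2_def power_mult_distrib)

lemma L2_add [intro]:
  assumes "f \<in> L2 M" "g \<in> L2 M" shows "(\<lambda>x. f x + g x) \<in> L2 M"
proof (rule L2I)
  show "(\<lambda>x. f x + g x) \<in> borel_measurable M" using L2D(1)[OF assms(1)] L2D(1)[OF assms(2)] by measurable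
  show "integrable M (\<lambda>x. (f x + g x)\<^sup>2)"
    unfolding power2_sum mult.assoc
    by (intro Bochner_Integration.integrable_add integrable_mult_right integrable_mult_L2 L2D(2) assms)
qed

lemma L2_minus [intro]: "f \<in> L2 M \<Longrightarrow> (\<lambda>x. - f x) \<in> L2 M"
  using L2_cmult[of f M "-1"] by simp

lemma L2_diff [intro]:
  assumes "f \<in> L2 M" "g \<in> L2 M" shows "(\<lambda>x. f x - g x) \<in> L2 M"
  using L2_add[OF assms(1) L2_minus[OF assms(2)]] by simp

lemma L2_abs: "f \<in> L2 M \<Longrightarrow> (\<lambda>x. \<bar>f x\<bar>) \<in> L2 M"
  by (auto simp: L2_def)

lemma (in finite_measure) L2_const [intro]: "(\<lambda>x. c) \<in> L2 M"
  by (rule L2I) auto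

lemma (in finite_measure) L2_bdd:
  assumes "f \<in> borel_measurable M" "\<And>x. x \<in> space M \<Longrightarrow> \<bar>f x\<bar> \<le> C" shows "f \<in> L2 M"
  by (rule L2_bound[OF assms(1) L2_const[of C]]) (use assms(2) in \<open>auto intro!: AE_I2 simp: order_trans[OF assms(2) abs_ge_self]\<close>)

lemma (in finite_measure) L2_integrable: "f \<in> L2 M \<Longrightarrow> integrable M f"
  using integrable_mult_L2[OF _ L2_const[of 1], of f] by simp

lemma L2_mult_bdd:
  assumes "f \<in> L2 M" "g \<in> borel_measurable M" "\<And>x. x \<in> space M \<Longrightarrow> \<bar>g x\<bar> \<le> C"
  shows "(\<lambda>x. g x * f x) \<in> L2 M"
proof (rule L2_bound)
  show "(\<lambda>x. g x * f x) \<in> borel_measurable M" using L2D(1)[OF assms(1)] assms(2) by measurable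
  show "(\<lambda>x. C * f x) \<in> L2 M" using assms(1) by auto
  show "AE x in M. \<bar>g x * f x\<bar> \<le> \<bar>C * f x\<bar>"
    by (rule AE_I2) (auto simp: abs_mult intro!: mult_right_mono order_trans[OF assms(3) abs_ge_self])
qed

lemma nonneg_quadratic:
  fixes b c :: real
  assumes "\<And>s. 0 \<le> a + 2 * s * b + s\<^sup>2 * c" "0 \<le> c"
  shows "b\<^sup>2 \<le> a * c"
proof (cases "c = 0")
  case True
  have "b = 0"
  proof (rule ccontr)
    assume "b \<noteq> 0"
    \<comment> \<open>This s makes a + 2 s b equal to -1.\<close>
    then show False using assms(1)[of "- (a + 1) / (2 * b)"] True by (simp add: field_simps)
  qed
  then show ?thesis using True by simp
next
  case False
  then have "0 < c" using assms(2) by simp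
  have "0 \<le> a - b\<^sup>2 / c"
    using assms(1)[of "- b / c"] \<open>0 < c\<close> by (simp add: field_simps power2_eq_square)
  then show ?thesis using \<open>0 < c\<close> by (simp add: field_simps)
qed

lemma L2_Cauchy_Schwarz:
  assumes f: "f \<in> L2 M" and g: "g \<in> L2 M"
  shows "(LINT x|M. f x * g x)\<^sup>2 \<le> (LINT x|M. (f x)\<^sup>2) * (LINT x|M. (g x)\<^sup>2)"
proof (rule nonneg_quadratic)
  fix s :: real
  have "0 \<le> (LINT x|M. (f x + s * g x)\<^sup>2)" by simp
  also have "\<dots> = (LINT x|M. (f x)\<^sup>2 + (2 * s * (f x * g x) + s\<^sup>2 * (g x)\<^sup>2))"
    by (rule Bochner_Integration.integral_cong) (auto simp: power2_sum power_mult_distrib algebra_simps)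
  also have "\<dots> = (LINT x|M. (f x)\<^sup>2) + (2 * s * (LINT x|M. f x * g x) + s\<^sup>2 * (LINT x|M. (g x)\<^sup>2))"
    using f g integrable_mult_L2[OF f g]
    by (subst Bochner_Integration.integral_add, force intro: L2D, force intro: L2D)
       (subst Bochner_Integration.integral_add, auto intro: L2D)
  finally show "0 \<le> (LINT x|M. (f x)\<^sup>2) + 2 * s * (LINT x|M. f x * g x) + s\<^sup>2 * (LINT x|M. (g x)\<^sup>2)"
    by simp
qed simp

lemma L2_Cauchy_Schwarz_abs:
  assumes f: "f \<in> L2 M" and g: "g \<in> L2 M"
  shows "(LINT x|M. \<bar>f x * g x\<bar>) \<le> sqrt (LINT x|M. (f x)\<^sup>2) * sqrt (LINT x|M. (g x)\<^sup>2)"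
proof -
  have "(LINT x|M. \<bar>f x\<bar> * \<bar>g x\<bar>)\<^sup>2 \<le> (LINT x|M. (f x)\<^sup>2) * (LINT x|M. (g x)\<^sup>2)"
    using L2_Cauchy_Schwarz[OF L2_abs[OF f] L2_abs[OF g]] by simp
  then show ?thesis
    by (simp add: abs_mult real_le_rsqrt flip: real_sqrt_mult)
qed

lemma (in finite_measure) L2_integral_square:
  assumes "f \<in> L2 M" shows "(LINT x|M. \<bar>f x\<bar>)\<^sup>2 \<le> measure M (space M) * (LINT x|M. (f x)\<^sup>2)"
  using L2_Cauchy_Schwarz[OF L2_const[of 1] L2_abs[OF assms]] by simp

lemma integral_square_add_le:
  assumes f: "f \<in> L2 M" and g: "g \<in> L2 M"
  shows "(LINT x|M. (f x + g x)\<^sup>2) \<le> 2 * (LINT x|M. (f x)\<^sup>2) + 2 * (LINT x|M. (g x)\<^sup>2)"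
proof -
  have "(LINT x|M. (f x + g x)\<^sup>2) \<le> (LINT x|M. 2 * (f x)\<^sup>2 + 2 * (g x)\<^sup>2)"
    by (intro integral_mono Bochner_Integration.integrable_add integrable_mult_right L2D(2) L2_add f g square_add_le)
  also have "\<dots> = 2 * (LINT x|M. (f x)\<^sup>2) + 2 * (LINT x|M. (g x)\<^sup>2)"
    using f g by (subst Bochner_Integration.integral_add) (auto intro: L2D)
  finally show ?thesis .
qed

subsection \<open>Density of continuous functions and of polynomials\<close>

text \<open>Continuity is asked on the whole space, not only where the measure lives, so that these
  functions are uniformly continuous on the closed square. Boundedness puts them into L2.\<close>

definition bounded_continuous :: "('a::metric_space \<Rightarrow> real) set"
  where "bounded_continuous = {c. continuous_on UNIV c \<and> (\<exists>B. \<forall>x. \<bar>c x\<bar> \<le> B)}"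

definition continuous_approx :: "'a::metric_space measure \<Rightarrow> ('a \<Rightarrow> real) \<Rightarrow> bool"
  where "continuous_approx M k \<longleftrightarrow>
    (\<forall>e>0. \<exists>c\<in>bounded_continuous. (LINT x|M. (k x - c x)\<^sup>2) < e)"

lemma continuous_approx_cong:
  assumes "\<And>x. x \<in> space M \<Longrightarrow> k x = k' x"
  shows "continuous_approx M k \<longleftrightarrow> continuous_approx M k'"
proof -
  have "(LINT x|M. (k x - c x)\<^sup>2) = (LINT x|M. (k' x - c x)\<^sup>2)" for c
    by (rule Bochner_Integration.integral_cong) (simp_all add: assms)
  then show ?thesis by (simp add: continuous_approx_def)
qed

text \<open>The measure may live on a subset with the trace of the Borel sets, as \<open>U\<close>
  does. Measurability of the identity says that restrictions of Borel functions are
  measurable.\<close>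

locale continuous_density = finite_measure M for M :: "'a::metric_space measure" +
  assumes ident: "(\<lambda>x. x) \<in> borel_measurable M"
begin

lemma bc_L2:
  assumes "c \<in> bounded_continuous" shows "c \<in> L2 M"
proof -
  obtain B where B: "\<And>x. \<bar>c x\<bar> \<le> B" and "continuous_on UNIV c"
    using assms by (auto simp: bounded_continuous_def)
  then have [measurable]: "c \<in> borel_measurable borel" by (intro borel_measurable_continuous_onI) auto
  have "c \<in> borel_measurable M" using measurable_compose[OF ident, of c borel] by simp
  then show ?thesis using B by (rule L2_bdd)
qed

lemma approx_limit:
  assumes k: "k \<in> L2 M"
    and lim: "\<And>e. e > 0 \<Longrightarrow> \<exists>k'\<in>L2 M. continuous_approx M k' \<and> (LINT x|M. (k x - k' x)\<^sup>2) < e"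
  shows "continuous_approx M k"
  unfolding continuous_approx_def
proof (intro allI impI)
  fix e :: real assume "e > 0"
  then obtain k' where k': "k' \<in> L2 M" "continuous_approx M k'" "(LINT x|M. (k x - k' x)\<^sup>2) < e / 4"
    using lim[of "e / 4"] by auto
  then obtain c where c: "c \<in> bounded_continuous" "(LINT x|M. (k' x - c x)\<^sup>2) < e / 4"
    using \<open>e > 0\<close> by (auto simp: continuous_approx_def dest: spec[of _ "e / 4"])
  have "(LINT x|M. ((k x - k' x) + (k' x - c x))\<^sup>2) \<le>
      2 * (LINT x|M. (k x - k' x)\<^sup>2) + 2 * (LINT x|M. (k' x - c x)\<^sup>2)"
    by (rule integral_square_add_le) (use k k' bc_L2[OF c(1)] in auto)
  also have "\<dots> < e" using k' c by simp
  finally show "\<exists>c\<in>bounded_continuous. (LINT x|M. (k x - c x)\<^sup>2) < e"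
    using c(1) by auto
qed

lemma approx_limit_seq:
  assumes k: "k \<in> L2 M" and s: "\<And>i::nat. s i \<in> borel_measurable M" "\<And>i. continuous_approx M (s i)"
    and B: "B \<in> L2 M" "\<And>i x. x \<in> space M \<Longrightarrow> \<bar>s i x\<bar> \<le> B x"
    and lim: "\<And>x. x \<in> space M \<Longrightarrow> (\<lambda>i. s i x) \<longlonglongrightarrow> k x"
  shows "continuous_approx M k"
proof (rule approx_limit[OF k])
  fix e :: real assume "e > 0"
  have [measurable]: "k \<in> borel_measurable M" "B \<in> borel_measurable M" using k B by (auto intro: L2D)
  note s(1)[measurable]
  have sL2: "s i \<in> L2 M" for i
    by (rule L2_bound[OF s(1) B(1)]) (rule AE_I2, use B(2) abs_ge_self order_trans in blast)
  have "(\<lambda>i. LINT x|M. (k x - s i x)\<^sup>2) \<longlonglongrightarrow> (LINT x|M. 0)"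
  proof (rule integral_dominated_convergence)
    show "integrable M (\<lambda>x. 2 * (k x)\<^sup>2 + 2 * (B x)\<^sup>2)"
      by (intro Bochner_Integration.integrable_add integrable_mult_right L2D(2) k B(1))
    show "AE x in M. (\<lambda>i. (k x - s i x)\<^sup>2) \<longlonglongrightarrow> 0"
    proof (rule AE_I2)
      fix x assume "x \<in> space M"
      then have "(\<lambda>i. (k x - s i x)\<^sup>2) \<longlonglongrightarrow> (k x - k x)\<^sup>2" by (intro tendsto_intros lim)
      then show "(\<lambda>i. (k x - s i x)\<^sup>2) \<longlonglongrightarrow> 0" by simp
    qed
    show "AE x in M. norm ((k x - s i x)\<^sup>2) \<le> 2 * (k x)\<^sup>2 + 2 * (B x)\<^sup>2" for i
    proof (rule AE_I2)
      fix x assume "x \<in> space M"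
      then have "(s i x)\<^sup>2 \<le> (B x)\<^sup>2" using B(2)[of x i] by (meson abs_le_square_iff abs_ge_self order_trans)
      then show "norm ((k x - s i x)\<^sup>2) \<le> 2 * (k x)\<^sup>2 + 2 * (B x)\<^sup>2"
        using square_add_le[of "k x" "- s i x"] by simp
    qed
  qed auto
  then have "\<forall>\<^sub>F i in sequentially. (LINT x|M. (k x - s i x)\<^sup>2) < e"
    using \<open>e > 0\<close> by (auto dest: order_tendstoD)
  then obtain i where "(LINT x|M. (k x - s i x)\<^sup>2) < e" by (auto simp: eventually_sequentially)
  then show "\<exists>k'\<in>L2 M. continuous_approx M k' \<and> (LINT x|M. (k x - k' x)\<^sup>2) < e"
    using sL2 s(2) by auto
qed

lemma approx_add:
  assumes "k \<in> L2 M" "k' \<in> L2 M" "continuous_approx M k" "continuous_approx M k'"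
  shows "continuous_approx M (\<lambda>x. k x + k' x)"
  unfolding continuous_approx_def
proof (intro allI impI)
  fix e :: real assume "e > 0"
  then obtain c c' where c: "c \<in> bounded_continuous" "(LINT x|M. (k x - c x)\<^sup>2) < e / 4"
      "c' \<in> bounded_continuous" "(LINT x|M. (k' x - c' x)\<^sup>2) < e / 4"
    using assms(3,4) unfolding continuous_approx_def by (meson divide_pos_pos zero_less_numeral)
  have "(LINT x|M. ((k x - c x) + (k' x - c' x))\<^sup>2) \<le>
      2 * (LINT x|M. (k x - c x)\<^sup>2) + 2 * (LINT x|M. (k' x - c' x)\<^sup>2)"
    by (rule integral_square_add_le) (use assms c bc_L2 in auto)
  also have "\<dots> < e" using c by simp
  finally have "(LINT x|M. ((k x + k' x) - (c x + c' x))\<^sup>2) < e" by (simp add: algebra_simps)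
  moreover have "(\<lambda>x. c x + c' x) \<in> bounded_continuous"
    using c(1,3) unfolding bounded_continuous_def
    by (auto intro!: continuous_intros) (meson abs_triangle_ineq add_mono order_trans)
  ultimately show "\<exists>c\<in>bounded_continuous. (LINT x|M. ((k x + k' x) - c x)\<^sup>2) < e"
    by (intro bexI[of _ "\<lambda>x. c x + c' x"])
qed

lemma approx_cmult:
  assumes "continuous_approx M k"
  shows "continuous_approx M (\<lambda>x. a * k x)"
  unfolding continuous_approx_def
proof (intro allI impI)
  fix e :: real assume "e > 0"
  then have "e / (a\<^sup>2 + 1) > 0" by (simp add: add_nonneg_pos)
  then obtain c where c: "c \<in> bounded_continuous" "(LINT x|M. (k x - c x)\<^sup>2) < e / (a\<^sup>2 + 1)"
    using assms by (auto simp: continuous_approx_def)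
  have "(LINT x|M. (a * k x - a * c x)\<^sup>2) = a\<^sup>2 * (LINT x|M. (k x - c x)\<^sup>2)"
    by (simp add: power_mult_distrib flip: right_diff_distrib)
  also have "\<dots> \<le> (a\<^sup>2 + 1) * (LINT x|M. (k x - c x)\<^sup>2)" by (simp add: mult_right_mono)
  also have "\<dots> < e" using c(2) by (subst (asm) pos_less_divide_eq) (simp_all add: mult.commute add_nonneg_pos)
  finally have "(LINT x|M. (a * k x - a * c x)\<^sup>2) < e" .
  moreover obtain B where "continuous_on UNIV c" "\<And>x. \<bar>c x\<bar> \<le> B"
    using c(1) by (auto simp: bounded_continuous_def)
  then have "(\<lambda>x. a * c x) \<in> bounded_continuous"
    unfolding bounded_continuous_def
    by (auto intro!: continuous_intros exI[of _ "\<bar>a\<bar> * B"] mult_left_mono simp: abs_mult)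
  ultimately show "\<exists>c\<in>bounded_continuous. (LINT x|M. (a * k x - c x)\<^sup>2) < e"
    by (intro bexI[of _ "\<lambda>x. a * c x"])
qed

lemma approx_self: "c \<in> bounded_continuous \<Longrightarrow> continuous_approx M c"
  unfolding continuous_approx_def by (auto intro!: bexI[of _ c])

text \<open>The sets with an approximable indicator form a Dynkin system: complements by linearity,
  disjoint unions by dominated convergence. From sets the property passes to simple functions and,
  along a dominated sequence of these, to L2.\<close>

lemma approx_all:
  assumes G: "Int_stable G" "G \<subseteq> Pow (space M)" "sets M = sigma_sets (space M) G"
    and base: "\<And>A. A \<in> G \<Longrightarrow> continuous_approx M (indicator A)"
    and k: "k \<in> L2 M"
  shows "continuous_approx M k"
proof -
  have one: "continuous_approx M (\<lambda>x. c)" for c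
    by (rule approx_self) (auto simp: bounded_continuous_def)
  have ind: "indicator A \<in> L2 M" if "A \<in> sets M" for A
    by (rule L2_bdd[where C = 1]) (use that in \<open>auto simp: indicator_def\<close>)
  have sets: "continuous_approx M (indicator A)" if "A \<in> sets M" for A
    using G(1,2) that[unfolded G(3)]
  proof (induction rule: sigma_sets_induct_disjoint)
    case (basic A) then show ?case by (rule base)
  next
    case empty
    show ?case using one[of 0] by (simp add: indicator_def[abs_def])
  next
    case (compl A)
    then have "A \<in> sets M" by (simp add: G(3))
    have "continuous_approx M (\<lambda>x. 1 + (-1) * indicator A x)"
      by (intro approx_add approx_cmult one compl L2_cmult ind L2_const \<open>A \<in> sets M\<close>)
    then show ?case
      by (rule continuous_approx_cong[THEN iffD1, rotated]) (auto simp: indicator_def)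
  next
    case (union A)
    then have A: "A i \<in> sets M" for i using G(3) by auto
    have "continuous_approx M (\<lambda>x. \<Sum>j<i. indicator (A j) x)" for i
    proof (induction i)
      case 0 then show ?case using one[of 0] by simp
    next
      case (Suc i)
      have "(\<lambda>x. \<Sum>j<i. indicator (A j) x) \<in> L2 M"
        by (induction i) (use A in \<open>auto intro!: L2_add ind\<close>)
      with Suc show ?case using approx_add[OF _ ind[OF A[of i]] Suc union.IH(1)[of i]]
        by (simp add: union)
    qed
    note fin = this
    show ?case
    proof (rule approx_limit_seq[where B = "\<lambda>x. 1"])
      show "indicator (\<Union> (range A)) \<in> L2 M" using A by (intro ind) auto
      show "continuous_approx M (\<lambda>x. \<Sum>j<i. indicator (A j) x)" for i by (rule fin)
      show "\<bar>\<Sum>j<i. indicator (A j) x\<bar> \<le> (1::real)" for i x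
      proof -
        have "(\<Sum>j<i. indicator (A j) x) = (indicator (\<Union>j<i. A j) x :: real)"
          by (rule indicator_UN_disjoint[symmetric]) (use union in \<open>auto simp: disjoint_family_on_def\<close>)
        then show ?thesis by (simp add: indicator_def)
      qed
      show "(\<lambda>i. \<Sum>j<i. indicator (A j) x) \<longlonglongrightarrow> (indicator (\<Union> (range A)) x::real)" for x
      proof -
        have "(\<Sum>j<i. indicator (A j) x) = (indicator (\<Union>j<i. A j) x :: real)" for i
          by (rule indicator_UN_disjoint[symmetric]) (use union in \<open>auto simp: disjoint_family_on_def\<close>)
        then show ?thesis using LIMSEQ_indicator_UN[of A x] by simp
      qed
    qed (use A in auto)
  qed
  have simple: "continuous_approx M s" if s: "simple_function M s" for s :: "'a \<Rightarrow> real"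
  proof -
    have S: "s -` {y} \<inter> space M \<in> sets M" for y using s by (rule simple_functionD)
    have "continuous_approx M (\<lambda>x. \<Sum>y\<in>I. y * indicator (s -` {y} \<inter> space M) x) \<and>
        (\<lambda>x. \<Sum>y\<in>I. y * indicator (s -` {y} \<inter> space M) x) \<in> L2 M" if "finite I" for I
      using that
    proof (induction I rule: finite_induct)
      case empty
      then show ?case using one[of 0] L2_const[of 0] by simp
    next
      case (insert y I)
      then show ?case
        by (simp only: sum.insert[OF insert.hyps]) (intro conjI approx_add approx_cmult sets S L2_cmult L2_add ind; simp)
    qed
    note approx = this
    have fin: "finite (s ` space M)" using s by (rule simple_functionD)
    have *: "(\<Sum>y\<in>s ` space M. y * indicator (s -` {y} \<inter> space M) x) = s x" if "x \<in> space M" for x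
    proof -
      have "(\<Sum>y\<in>s ` space M. y * indicator (s -` {y} \<inter> space M) x) = (\<Sum>y\<in>s ` space M. if y = s x then y else 0)"
        using that by (intro sum.cong) (auto simp: indicator_def)
      then show ?thesis using fin that by simp
    qed
    from conjunct1[OF approx[OF fin]] show ?thesis
      by (rule continuous_approx_cong[THEN iffD1, rotated])
         (simp add: *)
  qed
  obtain s where s: "\<And>i. simple_function M (s i)" "\<And>x. x \<in> space M \<Longrightarrow> (\<lambda>i. s i x) \<longlonglongrightarrow> k x"
      "\<And>i x. x \<in> space M \<Longrightarrow> dist (s i x) 0 \<le> 2 * dist (k x) 0"
    using borel_measurable_implies_sequence_metric[OF L2D(1)[OF k], of 0] by metis
  show ?thesis
    by (rule approx_limit_seq[OF k _ simple[OF s(1)] L2_cmult[OF L2_abs[OF k], of 2]])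
       (use s in \<open>auto intro: borel_measurable_simple_function\<close>)
qed

end

lemma approx_U:
  assumes "k \<in> L2 U" shows "continuous_approx U k"
proof -
  interpret continuous_density U by standard (rule borel_ident_U)
  define G where "G = (\<inter>) {0<..<1::real} ` range atMost"
  have "sets U = (\<inter>) {0<..<1} ` sigma_sets UNIV (range atMost)"
    unfolding sets_U by (simp add: borel_eq_atMost)
  also have "\<dots> = sigma_sets {0<..<1} G"
    unfolding G_def
    by (rule sigma_sets_Int) (use greaterThanLessThan_borel[of "0::real" 1] in \<open>auto simp: borel_eq_atMost\<close>)
  finally have sets: "sets U = sigma_sets (space U) G" by simp
  show ?thesis
  proof (rule approx_all[OF _ _ sets _ assms])
    show "Int_stable G"
    proof (rule Int_stableI)
      fix A B assume "A \<in> G" "B \<in> G"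
      then obtain a b where "A = {0<..<1} \<inter> {..a}" "B = {0<..<1} \<inter> {..b}" by (auto simp: G_def)
      then have "A \<inter> B = {0<..<1} \<inter> {..min a b}" by auto
      then show "A \<inter> B \<in> G" by (auto simp: G_def)
    qed
    show "G \<subseteq> Pow (space U)" by (auto simp: G_def)
    fix A assume "A \<in> G"
    then obtain a where A: "A = {0<..<1} \<inter> {..a}" by (auto simp: G_def)
    have AS: "A \<in> sets U" unfolding sets using \<open>A \<in> G\<close> by blast
    \<comment> \<open>Ramps that are 1 up to a and, for positive n, fall linearly to 0 on an
      interval of length 1 / n.\<close>
    define c where "c = (\<lambda>(n::nat) x. max 0 (min 1 (1 - real n * (x - a))))"
    have c: "c n \<in> bounded_continuous" for n
      unfolding bounded_continuous_def c_def by (auto intro!: continuous_intros exI[of _ 1])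
    show "continuous_approx U (indicator A)"
    proof (rule approx_limit_seq[where s = c and B = "\<lambda>x. 1"])
      show "indicator A \<in> L2 U"
        by (rule U.L2_bdd[where C = 1]) (use AS in \<open>auto simp: indicator_def\<close>)
      show "c n \<in> borel_measurable U" for n using bc_L2[OF c] by (rule L2D)
      show "continuous_approx U (c n)" for n using c by (rule approx_self)
      show "\<bar>c n x\<bar> \<le> 1" for n x by (auto simp: c_def)
      fix x assume "x \<in> space U"
      show "(\<lambda>i. c i x) \<longlonglongrightarrow> indicator A x"
      proof (cases "x \<le> a")
        case True
        then have "c i x = 1" for i by (auto simp: c_def mult_nonneg_nonpos)
        then show ?thesis using True \<open>x \<in> space U\<close> by (simp add: A)
      next
        case False
        then obtain N where N: "1 < real N * (x - a)" using ex_less_of_nat_mult[of "x - a" 1] by auto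
        have "c i x = 0" if "i \<ge> N" for i
        proof -
          have "real N * (x - a) \<le> real i * (x - a)" using False that by (intro mult_right_mono) auto
          then show ?thesis using N by (auto simp: c_def)
        qed
        then have "\<forall>\<^sub>F i in sequentially. c i x = 0" by (auto simp: eventually_sequentially)
        then show ?thesis using False by (simp add: A tendsto_eventually)
      qed
    qed auto
  qed
qed

lemma integral_US_fst:
  fixes f :: "real \<Rightarrow> real"
  assumes "integrable U f" shows "(LINT p|US. f (fst p)) = (LINT x|U. f x)" "integrable US (\<lambda>p. f (fst p))"
proof -
  note [measurable] = borel_measurable_integrable[OF assms]
  show i: "integrable US (\<lambda>p. f (fst p))"
    by (rule UU.Fubini_integrable) (use assms in auto)
  show "(LINT p|US. f (fst p)) = (LINT x|U. f x)"
    using UU.integral_fst'[OF i] by simp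
qed

lemma integral_US_snd:
  fixes f :: "real \<Rightarrow> real"
  assumes "integrable U f" shows "(LINT p|US. f (snd p)) = (LINT x|U. f x)" "integrable US (\<lambda>p. f (snd p))"
proof -
  note [measurable] = borel_measurable_integrable[OF assms]
  show i: "integrable US (\<lambda>p. f (snd p))"
    by (rule UU.Fubini_integrable) (use assms in auto)
  show "(LINT p|US. f (snd p)) = (LINT x|U. f x)"
    using UU.integral_fst'[OF i] by simp
qed

lemma L2_US_fst: "f \<in> L2 U \<Longrightarrow> (\<lambda>p. f (fst p)) \<in> L2 US"
  by (rule L2I, rule measurable_compose[OF measurable_fst L2D(1)], assumption, rule integral_US_fst(2), erule L2D(2))

lemma L2_US_snd: "f \<in> L2 U \<Longrightarrow> (\<lambda>p. f (snd p)) \<in> L2 US"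
  by (rule L2I, rule measurable_compose[OF measurable_snd L2D(1)], assumption, rule integral_US_snd(2), erule L2D(2))

lemma approx_US:
  assumes "k \<in> L2 US" shows "continuous_approx US k"
proof -
  interpret C1: continuous_density U by standard (rule borel_ident_U)
  interpret continuous_density US by standard (rule borel_ident_US)
  \<comment> \<open>Values in [0, 1] let the squared error of a product c(x) d(t) be bounded by
    twice the sum of the squared errors of its factors.\<close>
  have clamp: "\<exists>c\<in>bounded_continuous. (\<forall>x. 0 \<le> c x \<and> c x \<le> 1) \<and> (LINT x|U. (indicator A x - c x)\<^sup>2) < e"
    if A: "A \<in> sets U" and "e > 0" for A e
  proof -
    have ind: "indicator A \<in> L2 U"
      by (rule U.L2_bdd[where C = 1]) (use A in \<open>auto simp: indicator_def\<close>)
    then obtain c where c: "c \<in> bounded_continuous" "(LINT x|U. (indicator A x - c x)\<^sup>2) < e"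
      using approx_U \<open>e > 0\<close> by (auto simp: continuous_approx_def)
    define d where "d = (\<lambda>x. max 0 (min 1 (c x)))"
    have d: "d \<in> bounded_continuous"
      using c(1) by (auto simp: d_def bounded_continuous_def intro!: continuous_intros exI[of _ 1])
    have "(LINT x|U. (indicator A x - d x)\<^sup>2) \<le> (LINT x|U. (indicator A x - c x)\<^sup>2)"
    proof (rule integral_mono)
      show "(indicator A x - d x)\<^sup>2 \<le> (indicator A x - c x)\<^sup>2" for x
        unfolding abs_le_square_iff[symmetric] by (auto simp: indicator_def d_def)
    qed (intro L2D(2) L2_diff ind C1.bc_L2 c d)+
    then show ?thesis using c(2) d by (auto simp: d_def intro!: bexI[of _ d])
  qed
  show ?thesis
  proof (rule approx_all[OF Int_stable_pair_measure_generator[of U U] _ sets_pair_measure[of U U, folded space_pair_measure] _ assms])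
    show "{a \<times> b |a b. a \<in> sets U \<and> b \<in> sets U} \<subseteq> Pow (space US)"
      using sets.space_closed[of U] by (auto simp: space_pair_measure)
    fix R assume "R \<in> {a \<times> b |a b. a \<in> sets U \<and> b \<in> sets U}"
    then obtain A B where R: "R = A \<times> B" and [measurable]: "A \<in> sets U" "B \<in> sets U" by blast
    have ind: "indicator S \<in> L2 U" if "S \<in> sets U" for S
      by (rule U.L2_bdd[where C = 1]) (use that in \<open>auto simp: indicator_def\<close>)
    show "continuous_approx US (indicator R)"
      unfolding continuous_approx_def
    proof (intro allI impI)
      fix e :: real assume "e > 0"
      obtain c where c: "c \<in> bounded_continuous" "\<And>x. 0 \<le> c x \<and> c x \<le> 1" "(LINT x|U. (indicator A x - c x)\<^sup>2) < e / 4"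
        using clamp[of A "e / 4"] \<open>e > 0\<close> by auto
      obtain d where d: "d \<in> bounded_continuous" "\<And>x. 0 \<le> d x \<and> d x \<le> 1" "(LINT x|U. (indicator B x - d x)\<^sup>2) < e / 4"
        using clamp[of B "e / 4"] \<open>e > 0\<close> by auto
      have cd: "(\<lambda>p. c (fst p) * d (snd p)) \<in> bounded_continuous"
      proof -
        have "continuous_on UNIV c" "continuous_on UNIV d" using c d by (auto simp: bounded_continuous_def)
        then have "continuous_on UNIV (\<lambda>p::real\<times>real. c (fst p) * d (snd p))"
          by (intro continuous_on_mult continuous_on_compose2[OF _ continuous_on_fst[OF continuous_on_id], of UNIV c]
              continuous_on_compose2[OF _ continuous_on_snd[OF continuous_on_id], of UNIV d] subset_UNIV)
        moreover have "\<bar>c (fst p) * d (snd p)\<bar> \<le> 1" for p :: "real \<times> real"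
          using c(2)[of "fst p"] d(2)[of "snd p"] by (simp add: abs_mult mult_le_one)
        ultimately show ?thesis unfolding bounded_continuous_def by (intro CollectI conjI exI[of _ 1] allI)
      qed
      have cL: "(\<lambda>x. indicator A x - c x) \<in> L2 U" "(\<lambda>x. indicator B x - d x) \<in> L2 U"
        by (intro L2_diff ind C1.bc_L2 c d; simp)+
      have "(LINT p|US. (indicator R p - c (fst p) * d (snd p))\<^sup>2) \<le>
          (LINT p|US. 2 * (indicator A (fst p) - c (fst p))\<^sup>2 + 2 * (indicator B (snd p) - d (snd p))\<^sup>2)"
      proof (rule integral_mono)
        show "integrable US (\<lambda>p. (indicator R p - c (fst p) * d (snd p))\<^sup>2)"
          by (rule L2D(2), rule L2_diff[OF US.L2_bdd[where C = 1] bc_L2[OF cd]]) (auto simp: R indicator_def)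
        show "integrable US (\<lambda>p. 2 * (indicator A (fst p) - c (fst p))\<^sup>2 + 2 * (indicator B (snd p) - d (snd p))\<^sup>2)"
          by (intro Bochner_Integration.integrable_add integrable_mult_right L2D(2)
              L2_US_fst[of "\<lambda>x. indicator A x - c x"] L2_US_snd[of "\<lambda>x. indicator B x - d x"] cL)
        fix p :: "real \<times> real"
        define i j where "i = (indicator A (fst p) :: real)" and "j = (indicator B (snd p) :: real)"
        have "indicator R p = i * j" unfolding i_def j_def R by (cases p) (auto simp: indicator_def)
        then have "(indicator R p - c (fst p) * d (snd p))\<^sup>2
            = ((i - c (fst p)) * j + c (fst p) * (j - d (snd p)))\<^sup>2" by (simp add: algebra_simps)
        also have "\<dots> \<le> 2 * ((i - c (fst p)) * j)\<^sup>2 + 2 * (c (fst p) * (j - d (snd p)))\<^sup>2"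
          by (rule square_add_le)
        also have "((i - c (fst p)) * j)\<^sup>2 \<le> (i - c (fst p))\<^sup>2"
          by (auto simp: j_def indicator_def power_mult_distrib)
        also have "(c (fst p) * (j - d (snd p)))\<^sup>2 \<le> (j - d (snd p))\<^sup>2"
          using c(2)[of "fst p"] by (simp add: power_mult_distrib mult_left_le_one_le power_le_one)
        finally show "(indicator R p - c (fst p) * d (snd p))\<^sup>2 \<le>
            2 * (indicator A (fst p) - c (fst p))\<^sup>2 + 2 * (indicator B (snd p) - d (snd p))\<^sup>2"
          by (simp add: i_def j_def)
      qed
      also have "\<dots> = 2 * (LINT x|U. (indicator A x - c x)\<^sup>2) + 2 * (LINT x|U. (indicator B x - d x)\<^sup>2)"
        using integral_US_fst[OF L2D(2)[OF cL(1)]] integral_US_snd[OF L2D(2)[OF cL(2)]] by simp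
      also have "\<dots> < e" using c d by simp
      finally show "\<exists>c\<in>bounded_continuous. (LINT x|US. (indicator R x - c x)\<^sup>2) < e"
        using cd by (intro bexI[of _ "\<lambda>p. c (fst p) * d (snd p)"])
    qed
  qed
qed

lemma L2_poly_approx:
  assumes k: "k \<in> L2 U" and "e > 0"
  obtains a :: "nat \<Rightarrow> real" and n where "(LINT x|U. (k x - (\<Sum>i\<le>n. a i * x ^ i))\<^sup>2) < e"
proof -
  interpret C1: continuous_density U by standard (rule borel_ident_U)
  obtain c where c: "c \<in> bounded_continuous" "(LINT x|U. (k x - c x)\<^sup>2) < e / 4"
    using approx_U[OF k] \<open>e > 0\<close> by (auto simp: continuous_approx_def dest: spec[of _ "e / 4"])
  have "continuous_on {0..1} c" using c(1) by (auto simp: bounded_continuous_def intro: continuous_on_subset)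
  then obtain p where p: "real_polynomial_function p" "\<And>x. x \<in> {0..1} \<Longrightarrow> \<bar>c x - p x\<bar> < sqrt (e / 4)"
    using Stone_Weierstrass_real_polynomial_function[of "{0..1::real}" c "sqrt (e / 4)"] \<open>e > 0\<close> by auto
  then obtain a n where a: "p = (\<lambda>x. \<Sum>i\<le>n. a i * x ^ i)"
    by (auto simp: real_polynomial_function_iff_sum)
  have cp: "(c x - p x)\<^sup>2 \<le> e / 4" if "x \<in> space U" for x
    using p(2)[of x] that \<open>e > 0\<close> power_mono[of "\<bar>c x - p x\<bar>" "sqrt (e / 4)" 2] by auto
  have pm [measurable]: "p \<in> borel_measurable U" unfolding a by measurable
  have pL: "(\<lambda>x. c x - p x) \<in> L2 U"
    by (rule U.L2_bdd[where C = "sqrt (e / 4)"])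
       (use p(2) L2D(1)[OF C1.bc_L2[OF c(1)]] in \<open>auto intro: less_imp_le\<close>)
  have "(LINT x|U. ((k x - c x) + (c x - p x))\<^sup>2) \<le>
      2 * (LINT x|U. (k x - c x)\<^sup>2) + 2 * (LINT x|U. (c x - p x)\<^sup>2)"
    by (intro integral_square_add_le L2_diff k C1.bc_L2 c pL)
  also have "(LINT x|U. (c x - p x)\<^sup>2) \<le> (LINT x|U. e / 4)"
    by (intro integral_mono L2D(2) pL cp) auto
  finally have "(LINT x|U. (k x - p x)\<^sup>2) < e" using c(2) by simp
  then show ?thesis using that unfolding a by blast
qed

lemma L2_poly: "(\<lambda>x. \<Sum>i\<le>n. a i * x ^ i) \<in> L2 U"
proof (rule U.L2_bdd)
  show "\<bar>\<Sum>i\<le>n. a i * x ^ i\<bar> \<le> (\<Sum>i\<le>n. \<bar>a i\<bar>)" if "x \<in> space U" for x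
    using that by (intro order_trans[OF sum_abs] sum_mono) (auto simp: abs_mult mult_right_le_one_le power_le_one)
qed measurable

lemma L2_monomial: "(\<lambda>x. x ^ n) \<in> L2 U"
  by (rule U.L2_bdd[where C = 1]) (auto simp: power_le_one)

text \<open>If k is orthogonal to a polynomial p, then the norm of k is at most that of k - p, which
  can be made small. This is the standard way below to show that a function vanishes almost
  everywhere.\<close>

lemma L2_moments_zero:
  assumes k: "k \<in> L2 U" and "\<And>j. (LINT x|U. k x * x ^ j) = 0"
  shows "AE x in U. k x = 0"
proof -
  have "(LINT x|U. (k x)\<^sup>2) \<le> e" if e: "e > 0" for e
  proof -
    obtain a n where a: "(LINT x|U. (k x - (\<Sum>i\<le>n. a i * x ^ i))\<^sup>2) < e"
      using L2_poly_approx[OF k e] by blast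
    define p where "p x = (\<Sum>i\<le>n. a i * x ^ i)" for x
    have p: "p \<in> L2 U" unfolding p_def[abs_def] by (rule L2_poly)
    have "(LINT x|U. k x * p x) = (\<Sum>i\<le>n. a i * (LINT x|U. k x * x ^ i))"
    proof -
      have "k x * p x = (\<Sum>i\<le>n. a i * (k x * x ^ i))" for x
        by (simp add: p_def sum_distrib_left mult.left_commute)
      then show ?thesis
        by (simp add: Bochner_Integration.integral_sum integrable_mult_L2[OF k L2_monomial])
    qed
    then have 0: "(LINT x|U. k x * p x) = 0" using assms(2) by simp
    have "(LINT x|U. (k x)\<^sup>2) = (LINT x|U. (k x)\<^sup>2 - 2 * (k x * p x))"
      using k p 0 integrable_mult_L2[OF k p] by (subst Bochner_Integration.integral_diff) (auto intro: L2D)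
    also have "\<dots> \<le> (LINT x|U. (k x - p x)\<^sup>2)"
      by (intro integral_mono Bochner_Integration.integrable_diff integrable_mult_right integrable_mult_L2 L2D(2) L2_diff k p)
         (simp add: power2_diff mult.assoc)
    finally show ?thesis using a by (simp add: p_def)
  qed
  then have "(LINT x|U. (k x)\<^sup>2) \<le> 0" by (meson field_le_epsilon add_0 dense_ge)
  then have "(LINT x|U. (k x)\<^sup>2) = 0" by (simp add: antisym)
  then have "AE x in U. (k x)\<^sup>2 = 0"
    using integral_nonneg_eq_0_iff_AE[OF L2D(2)[OF k]] by simp
  then show ?thesis by simp
qed

subsection \<open>Iterated integrals on the unit square\<close>

lemma distr_swap_US: "distr US US (\<lambda>p. (snd p, fst p)) = US"
  using UU.distr_pair_swap by (simp add: case_prod_beta')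

lemma US_swap:
  fixes f :: "real \<times> real \<Rightarrow> real"
  assumes "integrable US f"
  shows "integrable US (\<lambda>p. f (snd p, fst p))" "(LINT p|US. f (snd p, fst p)) = (LINT p|US. f p)"
proof -
  note [measurable] = borel_measurable_integrable[OF assms]
  have m: "(\<lambda>p. (snd p, fst p)) \<in> measurable US US" by measurable
  show "integrable US (\<lambda>p. f (snd p, fst p))"
    using integrable_distr[OF m, of f] assms by (simp add: distr_swap_US)
  show "(LINT p|US. f (snd p, fst p)) = (LINT p|US. f p)"
    using integral_distr[OF m, of f] by (simp add: distr_swap_US)
qed

lemma US_Fubini:
  fixes f :: "real \<times> real \<Rightarrow> real"
  assumes "integrable US f"
  shows "integrable U (\<lambda>x. LINT t|U. f (x, t))" "(LINT x|U. LINT t|U. f (x, t)) = (LINT p|US. f p)"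
    "integrable U (\<lambda>t. LINT x|U. f (x, t))" "(LINT t|U. LINT x|U. f (x, t)) = (LINT p|US. f p)"
    "AE x in U. integrable U (\<lambda>t. f (x, t))" "AE t in U. integrable U (\<lambda>x. f (x, t))"
  using UU.integrable_fst'[OF assms] UU.integral_fst'[OF assms] UU.AE_integrable_fst'[OF assms]
    UU.integrable_fst'[OF US_swap(1)[OF assms]] UU.integral_fst'[OF US_swap(1)[OF assms]]
    UU.AE_integrable_fst'[OF US_swap(1)[OF assms]] US_swap(2)[OF assms]
  by simp_all

lemma AE_US_swap:
  assumes "AE p in US. P p" shows "AE p in US. P (snd p, fst p)"
  using AE_distrD[of "\<lambda>p. (snd p, fst p)" US US P] assms unfolding distr_swap_US by measurable

lemma AE_US_D:
  assumes "AE p in US. P p" shows "AE x in U. AE t in U. P (x, t)" "AE t in U. AE x in U. P (x, t)"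
  using UU.AE_pair[OF assms] UU.AE_pair[OF AE_US_swap[OF assms]] by auto

lemma AE_US_I:
  assumes "{p \<in> space US. P p} \<in> sets US" "AE t in U. AE x in U. P (x, t)" shows "AE p in US. P p"
  using UU.AE_commute[of "\<lambda>x t. P (x, t)"] UU.AE_pair_measure[of P] assms by simp

lemma AE_US_eqI:
  fixes f g :: "real \<times> real \<Rightarrow> real"
  assumes [measurable]: "f \<in> borel_measurable US" "g \<in> borel_measurable US"
    and "AE t in U. AE x in U. f (x, t) = g (x, t)"
  shows "AE p in US. f p = g p"
  by (rule AE_US_I) (use assms in auto)

lemma L2_slices:
  assumes "f \<in> L2 US"
  shows "AE t in U. (\<lambda>x. f (x, t)) \<in> L2 U" "AE x in U. (\<lambda>t. f (x, t)) \<in> L2 U"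
proof -
  note [measurable] = L2D(1)[OF assms]
  show "AE t in U. (\<lambda>x. f (x, t)) \<in> L2 U"
    by (rule AE_mp[OF US_Fubini(6)[OF L2D(2)[OF assms]]]) (auto intro!: AE_I2 L2I)
  show "AE x in U. (\<lambda>t. f (x, t)) \<in> L2 U"
    by (rule AE_mp[OF US_Fubini(5)[OF L2D(2)[OF assms]]]) (auto intro!: AE_I2 L2I)
qed

lemma L2_tensor:
  assumes "p \<in> L2 U" "q \<in> L2 U" shows "(\<lambda>y. p (fst y) * q (snd y)) \<in> L2 US"
proof -
  note [measurable] = L2D(1)[OF assms(1)] L2D(1)[OF assms(2)]
  have "integrable US (\<lambda>y. (p (fst y))\<^sup>2 * (q (snd y))\<^sup>2)"
    by (rule UU.Fubini_integrable) (use L2D(2)[OF assms(1)] L2D(2)[OF assms(2)] in \<open>auto\<close>)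
  then show ?thesis by (intro L2I) (auto simp: power_mult_distrib)
qed

section \<open>Absolutely continuous functions, test functions and Sobolev spaces in one
  variable\<close>

subsection \<open>Absolutely continuous functions\<close>

text \<open>The primitive that vanishes at 0, extended to the whole line by constants. With a
  cut-off instead of a variable domain all integrals are over the one measure \<open>U\<close>, to
  which Fubini and dominated convergence apply directly.\<close>

definition prim :: "(real \<Rightarrow> real) \<Rightarrow> real \<Rightarrow> real"
  where "prim k t = (LINT r|U. (if r \<le> t then k r else 0))"

lemma AE_U_neq: "AE r in U. r \<noteq> t"
  unfolding unit_interval_def
  by (subst AE_restrict_space_iff) (use AE_lborel_singleton[of t] in auto)

lemma integrable_prim [intro]:
  fixes k :: "real \<Rightarrow> real"
  shows "integrable U k \<Longrightarrow> integrable U (\<lambda>r. if r \<le> t then k r else 0)"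
  by (rule Bochner_Integration.integrable_bound[where f = k]) (auto dest: borel_measurable_integrable)

lemma prim_0: "t \<le> 0 \<Longrightarrow> prim k t = 0"
  unfolding prim_def by (subst Bochner_Integration.integral_cong[where N = U and g = "\<lambda>_. 0"]) auto

lemma prim_1: "t \<ge> 1 \<Longrightarrow> prim k t = (LINT r|U. k r)"
  unfolding prim_def by (rule Bochner_Integration.integral_cong) auto

lemma prim_cong: "(\<And>r. 0 < r \<Longrightarrow> r < 1 \<Longrightarrow> k r = k' r) \<Longrightarrow> prim k t = prim k' t"
  unfolding prim_def by (rule Bochner_Integration.integral_cong) auto

lemma prim_cong_AE:
  assumes "k \<in> borel_measurable U" "k' \<in> borel_measurable U" "AE r in U. k r = k' r"
  shows "prim k t = prim k' t"
proof -
  note [measurable] = assms(1,2)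
  show ?thesis unfolding prim_def by (rule integral_cong_AE) (use assms(3) in auto)
qed

lemma prim_add: "integrable U k \<Longrightarrow> integrable U k' \<Longrightarrow> prim (\<lambda>r. k r + k' r) t = prim k t + prim k' t"
  unfolding prim_def
  by (subst Bochner_Integration.integral_add[symmetric]) (auto intro!: Bochner_Integration.integral_cong)

lemma prim_diff: "integrable U k \<Longrightarrow> integrable U k' \<Longrightarrow> prim (\<lambda>r. k r - k' r) t = prim k t - prim k' t"
  unfolding prim_def
  by (subst Bochner_Integration.integral_diff[symmetric]) (auto intro!: Bochner_Integration.integral_cong)

lemma prim_cmult: "prim (\<lambda>r. c * k r) t = c * prim k t"
  unfolding prim_def
  by (subst integral_mult_right_zero[symmetric]) (rule Bochner_Integration.integral_cong, auto)

lemma prim_increment: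
  assumes "integrable U k" "s \<le> t"
  shows "prim k t - prim k s = (LINT r|U. (if s < r \<and> r \<le> t then k r else 0))"
  unfolding prim_def
  by (subst Bochner_Integration.integral_diff[symmetric])
     (use assms in \<open>auto intro!: Bochner_Integration.integral_cong integrable_prim\<close>)

lemma abs_prim_le: "integrable U k \<Longrightarrow> \<bar>prim k t\<bar> \<le> (LINT r|U. \<bar>k r\<bar>)"
  unfolding prim_def
  by (rule order_trans[OF integral_abs_bound], rule integral_mono) auto

lemma prim_mono: "integrable U k \<Longrightarrow> integrable U k' \<Longrightarrow> (\<And>r. 0 < r \<Longrightarrow> r < 1 \<Longrightarrow> k r \<le> k' r) \<Longrightarrow> prim k t \<le> prim k' t"
  unfolding prim_def by (rule integral_mono) auto

lemma continuous_prim: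
  assumes "integrable U k" shows "continuous_on S (prim k)"
proof (rule continuous_on_subset[of UNIV])
  show "continuous_on UNIV (prim k)"
    unfolding continuous_on_sequentially
  proof (intro ballI allI impI, elim conjE)
    fix t and s :: "nat \<Rightarrow> real" assume s: "s \<longlonglongrightarrow> t"
    note [measurable] = borel_measurable_integrable[OF assms]
    show "(prim k \<circ> s) \<longlonglongrightarrow> prim k t"
      unfolding o_def prim_def
    proof (rule integral_dominated_convergence[where w = "\<lambda>r. \<bar>k r\<bar>"])
      show "AE r in U. (\<lambda>i. if r \<le> s i then k r else 0) \<longlonglongrightarrow> (if r \<le> t then k r else 0)"
        using AE_U_neq[of t]
      proof eventually_elim
        case (elim r)
        then consider "r < t" | "t < r" by linarith
        then show ?case
        proof cases
          case 1
          then have "\<forall>\<^sub>F i in sequentially. r < s i" using s by (auto dest: order_tendstoD)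
          then show ?thesis using 1
            by (intro tendsto_eventually) (erule eventually_mono, simp)
        next
          case 2
          then have "\<forall>\<^sub>F i in sequentially. s i < r" using s by (auto dest: order_tendstoD)
          then show ?thesis using 2
            by (intro tendsto_eventually) (erule eventually_mono, simp)
        qed
      qed
    qed (use assms in auto)
  qed
qed simp

lemma measurable_prim [measurable]:
  assumes "integrable U k" shows "prim k \<in> borel_measurable borel"
  by (intro borel_measurable_continuous_onI continuous_prim assms)

lemma prim_eq_integral:
  assumes "continuous_on {0..1} k" "0 \<le> t" "t \<le> 1"
  shows "prim k t = integral {0..t} k" "integrable U k"
proof -
  have c: "set_integrable lborel {0..t} k" if "0 \<le> t" "t \<le> 1" for t
    using assms(1) that by (intro borel_integrable_atLeastAtMost') (auto intro: continuous_on_subset)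
  then have c': "set_integrable lborel {0<..<1} k"
    by (rule set_integrable_subset[of _ "{0..1}"]) auto
  show "integrable U k"
    unfolding unit_interval_def by (subst integrable_restrict_space) (use c' in \<open>auto simp: set_integrable_def\<close>)
  have "prim k t = (LINT r|lborel. indicator {0<..<1} r *\<^sub>R (if r \<le> t then k r else 0))"
    unfolding prim_def unit_interval_def by (subst integral_restrict_space) auto
  also have "\<dots> = (LINT r:{0..t}|lborel. k r)"
    unfolding set_lebesgue_integral_def
  proof (rule integral_cong_AE)
    have [measurable]: "(\<lambda>r. indicator {0<..<1} r *\<^sub>R k r) \<in> borel_measurable lborel"
      using c' by (auto simp: set_integrable_def dest: borel_measurable_integrable)
    have "(\<lambda>r. if r \<le> t then indicator {0<..<1} r *\<^sub>R k r else 0) \<in> borel_measurable lborel" by measurable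
    then show "(\<lambda>r. indicator {0<..<1} r *\<^sub>R (if r \<le> t then k r else 0)) \<in> borel_measurable lborel"
      by (rule measurable_cong[THEN iffD1, rotated]) auto
    show "(\<lambda>r. indicator {0..t} r *\<^sub>R k r) \<in> borel_measurable lborel"
      using c[of t] assms by (auto simp: set_integrable_def dest: borel_measurable_integrable)
    show "AE r in lborel. indicator {0<..<1} r *\<^sub>R (if r \<le> t then k r else 0) = indicator {0..t} r *\<^sub>R k r"
      using AE_lborel_singleton[of "0::real"] AE_lborel_singleton[of "1::real"]
      by eventually_elim (use assms in \<open>auto simp: indicator_def\<close>)
  qed
  also have "\<dots> = integral {0..t} k"
    using c[of t] assms by (intro set_borel_integral_eq_integral) auto
  finally show "prim k t = integral {0..t} k" .
qed

lemma prim_FTC: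
  assumes "continuous_on {0..1} k" "0 \<le> t" "t \<le> 1"
    and "\<And>r. 0 \<le> r \<Longrightarrow> r \<le> 1 \<Longrightarrow> (F has_real_derivative k r) (at r within {0..1})"
  shows "F t = F 0 + prim k t"
proof -
  have "(k has_integral (F t - F 0)) {0..t}"
    using assms(2-)
    by (intro fundamental_theorem_of_calculus)
       (auto intro!: DERIV_subset[OF assms(4)] simp flip: has_real_derivative_iff_has_vector_derivative)
  then show ?thesis using prim_eq_integral[OF assms(1-3)] by (simp add: integral_unique)
qed

lemma prim_has_derivative:
  assumes "continuous_on {0..1} k" "0 \<le> t" "t \<le> 1"
  shows "(prim k has_real_derivative k t) (at t within {0..1})"
proof -
  have "((\<lambda>t. integral {0..t} k) has_real_derivative k t) (at t within {0..1})"
    using assms by (intro integral_has_real_derivative) auto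
  then show ?thesis
    by (rule has_field_derivative_transform_within[OF _ zero_less_one]) (use assms prim_eq_integral in auto)
qed

lemma abs_prim_L2:
  assumes "k \<in> L2 U" shows "\<bar>prim k t\<bar> \<le> sqrt (LINT r|U. (k r)\<^sup>2)"
proof -
  have "\<bar>prim k t\<bar> \<le> (LINT r|U. \<bar>k r\<bar>)" using abs_prim_le U.L2_integrable[OF assms] by blast
  also have "\<dots> \<le> sqrt (LINT r|U. (k r)\<^sup>2)"
    by (rule real_le_rsqrt) (use U.L2_integral_square[OF assms] in simp)
  finally show ?thesis .
qed

text \<open>The chain rule for two absolutely continuous functions. The densities are approximated
  in L2 by continuous ones, for which the classical rule holds; their primitives converge uniformly,
  and both sides pass to the limit.\<close>

lemma prim_chain2:
  fixes \<Phi> :: "real \<times> real \<Rightarrow> real" and c1 c2 :: real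
  assumes D: "\<And>p. (\<Phi> has_derivative (\<lambda>(a, b). \<Phi>1 p * a + \<Phi>2 p * b)) (at p)"
    and c: "continuous_on UNIV \<Phi>1" "continuous_on UNIV \<Phi>2"
    and k: "k1 \<in> L2 U" "k2 \<in> L2 U" and t: "0 \<le> t" "t \<le> 1"
  defines "g1 \<equiv> \<lambda>t. c1 + prim k1 t" and "g2 \<equiv> \<lambda>t. c2 + prim k2 t"
  shows "\<Phi> (g1 t, g2 t) = \<Phi> (c1, c2) + prim (\<lambda>r. \<Phi>1 (g1 r, g2 r) * k1 r + \<Phi>2 (g1 r, g2 r) * k2 r) t"
proof -
  interpret C1: continuous_density U by standard (rule borel_ident_U)
  have "\<exists>b\<in>bounded_continuous. (LINT x|U. (k1 x - b x)\<^sup>2) < 1 / (real n + 1)" for n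
    using approx_U[OF k(1)] by (auto simp: continuous_approx_def)
  then obtain b1 where b1: "\<And>n. b1 n \<in> bounded_continuous" "\<And>n. (LINT x|U. (k1 x - b1 n x)\<^sup>2) < 1 / (real n + 1)"
    by metis
  have "\<exists>b\<in>bounded_continuous. (LINT x|U. (k2 x - b x)\<^sup>2) < 1 / (real n + 1)" for n
    using approx_U[OF k(2)] by (auto simp: continuous_approx_def)
  then obtain b2 where b2: "\<And>n. b2 n \<in> bounded_continuous" "\<And>n. (LINT x|U. (k2 x - b2 n x)\<^sup>2) < 1 / (real n + 1)"
    by metis
  have bc: "continuous_on S (b1 n)" "continuous_on S (b2 n)" for S n
    using b1(1)[of n] b2(1)[of n] by (auto simp: bounded_continuous_def intro: continuous_on_subset)
  have bL: "b1 n \<in> L2 U" "b2 n \<in> L2 U" for n using b1(1) b2(1) C1.bc_L2 by auto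
  have kI: "integrable U k1" "integrable U k2" "\<And>n. integrable U (b1 n)" "\<And>n. integrable U (b2 n)"
    using k bL U.L2_integrable by auto
  define d where "d n = sqrt (1 / (real n + 1))" for n
  have d: "d \<longlonglongrightarrow> 0" unfolding d_def by real_asymp
  have d1: "d n \<le> 1" "0 \<le> d n" for n by (auto simp: d_def)
  define g1n g2n where "g1n n t = c1 + prim (b1 n) t" and "g2n n t = c2 + prim (b2 n) t" for n t
  have close1: "\<bar>g1n n s - g1 s\<bar> \<le> d n" for n s
  proof -
    have "\<bar>g1n n s - g1 s\<bar> = \<bar>prim (\<lambda>r. k1 r - b1 n r) s\<bar>"
      using kI by (simp add: g1n_def g1_def prim_diff)
    also have "\<dots> \<le> d n" unfolding d_def using b1(2)[of n]
      by (intro order_trans[OF abs_prim_L2]) (auto intro!: L2_diff k bL)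
    finally show ?thesis .
  qed
  have close2: "\<bar>g2n n s - g2 s\<bar> \<le> d n" for n s
  proof -
    have "\<bar>g2n n s - g2 s\<bar> = \<bar>prim (\<lambda>r. k2 r - b2 n r) s\<bar>"
      using kI by (simp add: g2n_def g2_def prim_diff)
    also have "\<dots> \<le> d n" unfolding d_def using b2(2)[of n]
      by (intro order_trans[OF abs_prim_L2]) (auto intro!: L2_diff k bL)
    finally show ?thesis .
  qed
  have lim1: "(\<lambda>n. g1n n s) \<longlonglongrightarrow> g1 s" for s
    by (rule LIM_zero_cancel, rule Lim_null_comparison[OF _ d]) (use close1 in auto)
  have lim2: "(\<lambda>n. g2n n s) \<longlonglongrightarrow> g2 s" for s
    by (rule LIM_zero_cancel, rule Lim_null_comparison[OF _ d]) (use close2 in auto)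
  \<comment> \<open>The added 1 leaves room for the approximating curves, which are within
    \<open>d n \<le> 1\<close> of the limit. So one compact rectangle \<open>Q\<close> contains all
    curves, and the partial derivatives are bounded there.\<close>
  define R1 R2 where "R1 = \<bar>c1\<bar> + (LINT r|U. \<bar>k1 r\<bar>) + 1" and "R2 = \<bar>c2\<bar> + (LINT r|U. \<bar>k2 r\<bar>) + 1"
  have g_le: "\<bar>g1 s\<bar> \<le> R1 - 1" "\<bar>g2 s\<bar> \<le> R2 - 1" for s
    using abs_prim_le[OF kI(1), of s] abs_prim_le[OF kI(2), of s] unfolding g1_def g2_def R1_def R2_def by linarith+
  have gn_le: "\<bar>g1n n s\<bar> \<le> R1" "\<bar>g2n n s\<bar> \<le> R2" for n s
    using g_le[of s] close1[of n s] close2[of n s] d1[of n] by linarith+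
  define Q where "Q = {-R1..R1} \<times> {-R2..R2}"
  have inQ: "(g1 s, g2 s) \<in> Q" "(g1n n s, g2n n s) \<in> Q" for n s
    using g_le[of s] gn_le[of n s] by (auto simp: Q_def abs_le_iff)
  have "compact Q" unfolding Q_def by (intro compact_Times) auto
  then have "bounded (\<Phi>1 ` Q)" "bounded (\<Phi>2 ` Q)"
    using c by (auto intro!: compact_imp_bounded compact_continuous_image intro: continuous_on_subset)
  then obtain C1 C2 where C: "\<And>p. p \<in> Q \<Longrightarrow> \<bar>\<Phi>1 p\<bar> \<le> C1" "\<And>p. p \<in> Q \<Longrightarrow> \<bar>\<Phi>2 p\<bar> \<le> C2"
    by (auto simp: bounded_iff)
  have Cpos: "0 \<le> C1" "0 \<le> C2" using C(1)[OF inQ(1), of 0] C(2)[OF inQ(1), of 0] by auto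
  have cg: "continuous_on S g1" "continuous_on S g2" "continuous_on S (g1n n)" "continuous_on S (g2n n)" for S n
    unfolding g1_def g2_def g1n_def g2n_def by (intro continuous_intros continuous_prim kI)+
  have c\<Phi>: "continuous_on S (\<lambda>r. \<Phi>1 (u r, w r))" "continuous_on S (\<lambda>r. \<Phi>2 (u r, w r))"
    if "continuous_on S u" "continuous_on S w" for S and u w :: "real \<Rightarrow> real"
    using that by (auto intro!: continuous_on_compose2[OF c(1)] continuous_on_compose2[OF c(2)] continuous_intros)
  have smooth: "\<Phi> (g1n n t, g2n n t) = \<Phi> (c1, c2) +
      prim (\<lambda>r. \<Phi>1 (g1n n r, g2n n r) * b1 n r + \<Phi>2 (g1n n r, g2n n r) * b2 n r) t" for n
  proof -
    have "\<Phi> (g1n n t, g2n n t) = \<Phi> (g1n n 0, g2n n 0) +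
      prim (\<lambda>r. \<Phi>1 (g1n n r, g2n n r) * b1 n r + \<Phi>2 (g1n n r, g2n n r) * b2 n r) t"
    proof (rule prim_FTC[where F = "\<lambda>t. \<Phi> (g1n n t, g2n n t)", OF _ t])
      show "continuous_on {0..1} (\<lambda>r. \<Phi>1 (g1n n r, g2n n r) * b1 n r + \<Phi>2 (g1n n r, g2n n r) * b2 n r)"
        by (intro continuous_intros c\<Phi> cg bc)
      fix r :: real assume r: "0 \<le> r" "r \<le> 1"
      have 1: "(g1n n has_real_derivative b1 n r) (at r within {0..1})"
        unfolding g1n_def using DERIV_add[OF DERIV_const prim_has_derivative[OF bc(1) r]] by simp
      have 2: "(g2n n has_real_derivative b2 n r) (at r within {0..1})"
        unfolding g2n_def using DERIV_add[OF DERIV_const prim_has_derivative[OF bc(2) r]] by simp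
      have "((\<lambda>t. (g1n n t, g2n n t)) has_derivative (\<lambda>x. (b1 n r * x, b2 n r * x))) (at r within {0..1})"
        using 1 2 unfolding has_field_derivative_def by (rule has_derivative_Pair)
      from diff_chain_within[OF this, of \<Phi> "(\<lambda>(a, b). \<Phi>1 (g1n n r, g2n n r) * a + \<Phi>2 (g1n n r, g2n n r) * b)"]
      have "((\<lambda>t. \<Phi> (g1n n t, g2n n t)) has_derivative
          (\<lambda>x. \<Phi>1 (g1n n r, g2n n r) * (b1 n r * x) + \<Phi>2 (g1n n r, g2n n r) * (b2 n r * x))) (at r within {0..1})"
        using has_derivative_at_withinI[OF D] by (simp add: o_def)
      then show "((\<lambda>t. \<Phi> (g1n n t, g2n n t)) has_real_derivative
          \<Phi>1 (g1n n r, g2n n r) * b1 n r + \<Phi>2 (g1n n r, g2n n r) * b2 n r) (at r within {0..1})"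
        unfolding has_field_derivative_def by (rule has_derivative_eq_rhs) (simp add: fun_eq_iff algebra_simps)
    qed
    then show ?thesis by (simp add: g1n_def g2n_def prim_0)
  qed
  \<comment> \<open>Replacing the approximate density by its limit costs at most C times the L2
    distance \<open>d n\<close>; the remaining difference tends to 0 by dominated
    convergence.\<close>
  have part: "(\<lambda>n. LINT r|U. \<bar>\<Psi> (g1n n r, g2n n r) * b n r - \<Psi> (g1 r, g2 r) * k r\<bar>) \<longlonglongrightarrow> 0"
    if c\<Psi>: "continuous_on UNIV \<Psi>" and C: "\<And>p. p \<in> Q \<Longrightarrow> \<bar>\<Psi> p\<bar> \<le> C" and "0 \<le> C"
      and kL: "k \<in> L2 U" and bL: "\<And>n. b n \<in> L2 U" and bk: "\<And>n. (LINT x|U. (k x - b n x)\<^sup>2) < 1 / (real n + 1)"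
    for \<Psi> C k b
  proof -
    have m: "(\<lambda>r. \<Psi> (u r, w r)) \<in> borel_measurable U" if "continuous_on UNIV u" "continuous_on UNIV w" for u w :: "real \<Rightarrow> real"
    proof -
      have "(\<lambda>r. \<Psi> (u r, w r)) \<in> borel_measurable borel"
        using that by (intro borel_measurable_continuous_onI) (auto intro!: continuous_on_compose2[OF c\<Psi>] continuous_intros)
      from measurable_compose[OF borel_ident_U this] show ?thesis .
    qed
    have mm [measurable]: "(\<lambda>r. \<Psi> (g1 r, g2 r)) \<in> borel_measurable U" "(\<lambda>r. \<Psi> (g1n n r, g2n n r)) \<in> borel_measurable U" for n
      by (intro m cg)+
    have [measurable]: "k \<in> borel_measurable U" "b n \<in> borel_measurable U" for n using kL bL by (auto dest: L2D)
    have i1: "integrable U (\<lambda>r. \<Psi> (g1 r, g2 r) * k r)" "integrable U (\<lambda>r. \<Psi> (g1n n r, g2n n r) * k r)"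
        "integrable U (\<lambda>r. \<Psi> (g1n n r, g2n n r) * b n r)" for n
      by (rule U.L2_integrable, rule L2_mult_bdd[where C = C]; use mm C inQ kL bL in auto)+
    have "(\<lambda>n. LINT r|U. \<bar>\<Psi> (g1n n r, g2n n r) * k r - \<Psi> (g1 r, g2 r) * k r\<bar>) \<longlonglongrightarrow> (LINT r|U. 0)"
    proof (rule integral_dominated_convergence[where w = "\<lambda>r. 2 * C * \<bar>k r\<bar>"])
      show "integrable U (\<lambda>r. 2 * C * \<bar>k r\<bar>)" using U.L2_integrable[OF kL] by auto
      show "AE r in U. (\<lambda>n. \<bar>\<Psi> (g1n n r, g2n n r) * k r - \<Psi> (g1 r, g2 r) * k r\<bar>) \<longlonglongrightarrow> 0"
      proof (rule AE_I2)
        fix r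
        have "isCont \<Psi> (g1 r, g2 r)" using c\<Psi> by (simp add: continuous_on_eq_continuous_at)
        then have "(\<lambda>n. \<Psi> (g1n n r, g2n n r)) \<longlonglongrightarrow> \<Psi> (g1 r, g2 r)"
          by (rule isCont_tendsto_compose) (intro tendsto_intros lim1 lim2)
        then have "(\<lambda>n. \<bar>\<Psi> (g1n n r, g2n n r) * k r - \<Psi> (g1 r, g2 r) * k r\<bar>) \<longlonglongrightarrow> \<bar>\<Psi> (g1 r, g2 r) * k r - \<Psi> (g1 r, g2 r) * k r\<bar>"
          by (intro tendsto_intros)
        then show "(\<lambda>n. \<bar>\<Psi> (g1n n r, g2n n r) * k r - \<Psi> (g1 r, g2 r) * k r\<bar>) \<longlonglongrightarrow> 0" by simp
      qed
      show "AE r in U. norm \<bar>\<Psi> (g1n n r, g2n n r) * k r - \<Psi> (g1 r, g2 r) * k r\<bar> \<le> 2 * C * \<bar>k r\<bar>" for n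
      proof (rule AE_I2)
        fix r
        have "\<bar>\<Psi> (g1n n r, g2n n r) - \<Psi> (g1 r, g2 r)\<bar> \<le> 2 * C"
          using C[OF inQ(1), of r] C[OF inQ(2), of n r] by linarith
        then have "\<bar>\<Psi> (g1n n r, g2n n r) - \<Psi> (g1 r, g2 r)\<bar> * \<bar>k r\<bar> \<le> 2 * C * \<bar>k r\<bar>" by (rule mult_right_mono) simp
        then show "norm \<bar>\<Psi> (g1n n r, g2n n r) * k r - \<Psi> (g1 r, g2 r) * k r\<bar> \<le> 2 * C * \<bar>k r\<bar>"
          by (simp add: left_diff_distrib[symmetric] abs_mult)
      qed
    qed measurable
    then have "(\<lambda>n. C * d n + (LINT r|U. \<bar>\<Psi> (g1n n r, g2n n r) * k r - \<Psi> (g1 r, g2 r) * k r\<bar>)) \<longlonglongrightarrow> C * 0 + 0"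
      by (intro tendsto_intros d) simp
    then have lim: "(\<lambda>n. C * d n + (LINT r|U. \<bar>\<Psi> (g1n n r, g2n n r) * k r - \<Psi> (g1 r, g2 r) * k r\<bar>)) \<longlonglongrightarrow> 0" by simp
    show ?thesis
    proof (rule Lim_null_comparison[OF _ lim])
      show "\<forall>\<^sub>F n in sequentially. norm (LINT r|U. \<bar>\<Psi> (g1n n r, g2n n r) * b n r - \<Psi> (g1 r, g2 r) * k r\<bar>)
          \<le> C * d n + (LINT r|U. \<bar>\<Psi> (g1n n r, g2n n r) * k r - \<Psi> (g1 r, g2 r) * k r\<bar>)"
      proof (rule always_eventually, intro allI)
        fix n
        have kb: "(\<lambda>x. k x - b n x) \<in> L2 U" by (intro L2_diff kL bL)
        have "(LINT r|U. \<bar>\<Psi> (g1n n r, g2n n r) * b n r - \<Psi> (g1 r, g2 r) * k r\<bar>)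
          \<le> (LINT r|U. C * \<bar>k r - b n r\<bar> + \<bar>\<Psi> (g1n n r, g2n n r) * k r - \<Psi> (g1 r, g2 r) * k r\<bar>)"
        proof (rule integral_mono)
          fix r
          have "\<bar>\<Psi> (g1n n r, g2n n r) * b n r - \<Psi> (g1 r, g2 r) * k r\<bar> \<le>
            \<bar>\<Psi> (g1n n r, g2n n r) * (k r - b n r)\<bar> + \<bar>\<Psi> (g1n n r, g2n n r) * k r - \<Psi> (g1 r, g2 r) * k r\<bar>"
            by (simp add: right_diff_distrib)
          also have "\<bar>\<Psi> (g1n n r, g2n n r) * (k r - b n r)\<bar> \<le> C * \<bar>k r - b n r\<bar>"
            unfolding abs_mult using C[OF inQ(2), of n r] by (rule mult_right_mono) simp
          finally show "\<bar>\<Psi> (g1n n r, g2n n r) * b n r - \<Psi> (g1 r, g2 r) * k r\<bar> \<le> 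
            C * \<bar>k r - b n r\<bar> + \<bar>\<Psi> (g1n n r, g2n n r) * k r - \<Psi> (g1 r, g2 r) * k r\<bar>" by simp
        qed (use i1 U.L2_integrable[OF kb] in auto)
        also have "\<dots> = C * (LINT r|U. \<bar>k r - b n r\<bar>) + (LINT r|U. \<bar>\<Psi> (g1n n r, g2n n r) * k r - \<Psi> (g1 r, g2 r) * k r\<bar>)"
          using i1 U.L2_integrable[OF kb] by (subst Bochner_Integration.integral_add) auto
        also have "(LINT r|U. \<bar>k r - b n r\<bar>) \<le> d n"
          unfolding d_def by (rule real_le_rsqrt) (use U.L2_integral_square[OF kb] bk[of n] in simp)
        finally show "norm (LINT r|U. \<bar>\<Psi> (g1n n r, g2n n r) * b n r - \<Psi> (g1 r, g2 r) * k r\<bar>)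
          \<le> C * d n + (LINT r|U. \<bar>\<Psi> (g1n n r, g2n n r) * k r - \<Psi> (g1 r, g2 r) * k r\<bar>)"
          using \<open>0 \<le> C\<close> by (simp add: mult_left_mono)
      qed
    qed
  qed
  have int: "integrable U (\<lambda>r. \<Psi> (u r, w r) * k r)"
    if "continuous_on UNIV \<Psi>" "continuous_on UNIV u" "continuous_on UNIV w" "\<And>p. p \<in> Q \<Longrightarrow> \<bar>\<Psi> p\<bar> \<le> C" "k \<in> L2 U"
      "\<And>r. (u r, w r) \<in> Q" for \<Psi> :: "real \<times> real \<Rightarrow> real" and u w C k
  proof (rule U.L2_integrable, rule L2_mult_bdd[where C = C])
    have "(\<lambda>r. \<Psi> (u r, w r)) \<in> borel_measurable borel"
      using that by (intro borel_measurable_continuous_onI) (auto intro!: continuous_on_compose2[OF that(1)] continuous_intros)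
    from measurable_compose[OF borel_ident_U this] show "(\<lambda>r. \<Psi> (u r, w r)) \<in> borel_measurable U" .
  qed (use that in auto)
  note int1 = int[OF c(1) cg(1,2) C(1) k(1) inQ(1)] int[OF c(2) cg(1,2) C(2) k(2) inQ(1)]
  note intn = int[OF c(1) cg(3,4) C(1) bL(1) inQ(2)] int[OF c(2) cg(3,4) C(2) bL(2) inQ(2)]
  have "(\<lambda>n. prim (\<lambda>r. \<Phi>1 (g1n n r, g2n n r) * b1 n r + \<Phi>2 (g1n n r, g2n n r) * b2 n r) t)
      \<longlonglongrightarrow> prim (\<lambda>r. \<Phi>1 (g1 r, g2 r) * k1 r + \<Phi>2 (g1 r, g2 r) * k2 r) t"
  proof (rule LIM_zero_cancel, rule Lim_null_comparison)
    show "(\<lambda>n. (LINT r|U. \<bar>\<Phi>1 (g1n n r, g2n n r) * b1 n r - \<Phi>1 (g1 r, g2 r) * k1 r\<bar>) +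
        (LINT r|U. \<bar>\<Phi>2 (g1n n r, g2n n r) * b2 n r - \<Phi>2 (g1 r, g2 r) * k2 r\<bar>)) \<longlonglongrightarrow> 0"
      using tendsto_add[OF part[OF c(1) C(1) Cpos(1) k(1) bL(1) b1(2)] part[OF c(2) C(2) Cpos(2) k(2) bL(2) b2(2)]] by simp
    show "\<forall>\<^sub>F n in sequentially. norm (prim (\<lambda>r. \<Phi>1 (g1n n r, g2n n r) * b1 n r + \<Phi>2 (g1n n r, g2n n r) * b2 n r) t
      - prim (\<lambda>r. \<Phi>1 (g1 r, g2 r) * k1 r + \<Phi>2 (g1 r, g2 r) * k2 r) t)
       \<le> (LINT r|U. \<bar>\<Phi>1 (g1n n r, g2n n r) * b1 n r - \<Phi>1 (g1 r, g2 r) * k1 r\<bar>) +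
        (LINT r|U. \<bar>\<Phi>2 (g1n n r, g2n n r) * b2 n r - \<Phi>2 (g1 r, g2 r) * k2 r\<bar>)"
    proof (rule always_eventually, intro allI)
      fix n
      have "prim (\<lambda>r. \<Phi>1 (g1n n r, g2n n r) * b1 n r + \<Phi>2 (g1n n r, g2n n r) * b2 n r) t
        - prim (\<lambda>r. \<Phi>1 (g1 r, g2 r) * k1 r + \<Phi>2 (g1 r, g2 r) * k2 r) t
        = prim (\<lambda>r. \<Phi>1 (g1n n r, g2n n r) * b1 n r - \<Phi>1 (g1 r, g2 r) * k1 r) t +
          prim (\<lambda>r. \<Phi>2 (g1n n r, g2n n r) * b2 n r - \<Phi>2 (g1 r, g2 r) * k2 r) t"
        using int1 intn by (simp add: prim_add prim_diff)
      then show "norm (prim (\<lambda>r. \<Phi>1 (g1n n r, g2n n r) * b1 n r + \<Phi>2 (g1n n r, g2n n r) * b2 n r) t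
      - prim (\<lambda>r. \<Phi>1 (g1 r, g2 r) * k1 r + \<Phi>2 (g1 r, g2 r) * k2 r) t)
       \<le> (LINT r|U. \<bar>\<Phi>1 (g1n n r, g2n n r) * b1 n r - \<Phi>1 (g1 r, g2 r) * k1 r\<bar>) +
        (LINT r|U. \<bar>\<Phi>2 (g1n n r, g2n n r) * b2 n r - \<Phi>2 (g1 r, g2 r) * k2 r\<bar>)"
        using int1 intn by (auto intro!: order_trans[OF abs_triangle_ineq] add_mono abs_prim_le)
    qed
  qed
  then have "(\<lambda>n. \<Phi> (g1n n t, g2n n t)) \<longlonglongrightarrow> \<Phi> (c1, c2) + prim (\<lambda>r. \<Phi>1 (g1 r, g2 r) * k1 r + \<Phi>2 (g1 r, g2 r) * k2 r) t"
    unfolding smooth by (intro tendsto_intros)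
  moreover have "(\<lambda>n. \<Phi> (g1n n t, g2n n t)) \<longlonglongrightarrow> \<Phi> (g1 t, g2 t)"
    by (rule isCont_tendsto_compose[OF has_derivative_continuous[OF D]]) (intro tendsto_intros lim1 lim2)
  ultimately show ?thesis by (rule LIMSEQ_unique[rotated])
qed

text \<open>Integration by parts in the form that most later arguments use, for two densities in
  L2.\<close>

lemma prim_mult:
  assumes k: "k1 \<in> L2 U" "k2 \<in> L2 U" and t: "0 \<le> t" "t \<le> 1"
  shows "(c1 + prim k1 t) * (c2 + prim k2 t) =
    c1 * c2 + prim (\<lambda>r. k1 r * (c2 + prim k2 r) + (c1 + prim k1 r) * k2 r) t"
proof -
  have D: "((\<lambda>p::real\<times>real. fst p * snd p) has_derivative (\<lambda>(a, b). snd p * a + fst p * b)) (at p)" for p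
    by (auto intro!: derivative_eq_intros simp: case_prod_beta' algebra_simps)
  show ?thesis
    using prim_chain2[OF D _ _ k t, of c1 c2] by (simp add: continuous_on_fst continuous_on_snd continuous_on_id mult.commute)
qed

lemma prim_chain:
  assumes D: "\<And>x. (\<Phi> has_real_derivative \<Phi>' x) (at x)" "continuous_on UNIV \<Phi>'"
    and k: "k \<in> L2 U" and t: "0 \<le> t" "t \<le> 1"
  shows "\<Phi> (c + prim k t) = \<Phi> c + prim (\<lambda>r. \<Phi>' (c + prim k r) * k r) t"
proof -
  have D': "((\<lambda>p::real\<times>real. \<Phi> (fst p)) has_derivative (\<lambda>(a, b). \<Phi>' (fst p) * a + 0 * b)) (at p)" for p
    using has_derivative_compose[OF has_derivative_fst[OF has_derivative_ident] D(1)[unfolded has_field_derivative_def], of "p"]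
    by (simp add: case_prod_beta')
  show ?thesis
    using prim_chain2[OF D' _ _ k k t, of c c] continuous_on_compose2[OF D(2), of UNIV fst]
    by (simp add: continuous_on_fst continuous_on_id)
qed

subsection \<open>Test functions\<close>

text \<open>The exponent i makes the family closed under differentiation up to linear
  combinations.\<close>

definition flat_exp :: "real \<Rightarrow> nat \<Rightarrow> real \<Rightarrow> real"
  where "flat_exp c i y = (if y > 0 then exp (- c / y) / y ^ i else 0)"

lemma power_div_fact_le_exp:
  assumes "0 \<le> (x::real)" shows "x ^ n / fact n \<le> exp x"
proof -
  have s: "(\<lambda>n. x ^ n / fact n) sums exp x"
    using exp_converges[of x] by (simp add: divide_inverse mult.commute)
  then have "(\<Sum>n\<in>{n}. x ^ n / fact n) \<le> (\<Sum>n. x ^ n / fact n)"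
    using assms by (intro sum_le_suminf) (auto dest: sums_summable)
  then show ?thesis using s by (simp add: sums_iff)
qed

text \<open>The quadratic bound forces derivative 0 at y = 0. It comes from a single term of the
  exponential series, of order i + 2.\<close>

lemma flat_exp_le:
  assumes "c > 0"
  obtains C where "\<And>y. \<bar>flat_exp c i y\<bar> \<le> C * y\<^sup>2"
proof
  fix y
  show "\<bar>flat_exp c i y\<bar> \<le> (fact (i + 2) / c ^ (i + 2)) * y\<^sup>2"
  proof (cases "y > 0")
    case True
    have "(c / y) ^ (i + 2) / fact (i + 2) \<le> exp (c / y)"
      using True assms by (intro power_div_fact_le_exp) auto
    then have "exp (- (c / y)) \<le> fact (i + 2) * y ^ (i + 2) / c ^ (i + 2)"
      using True assms by (simp add: exp_minus field_simps power_divide del: fact_Suc power_Suc)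
    then have "exp (- c / y) / y ^ i \<le> (fact (i + 2) * y ^ (i + 2) / c ^ (i + 2)) / y ^ i"
      using True by (intro divide_right_mono) auto
    also have "\<dots> = (fact (i + 2) / c ^ (i + 2)) * y\<^sup>2"
      using True by (simp add: field_simps power2_eq_square del: fact_Suc)
    finally show ?thesis using True by (simp add: flat_exp_def)
  qed (use assms in \<open>simp add: flat_exp_def\<close>)
qed

lemma DERIV_flat_exp:
  assumes "c > 0"
  shows "(flat_exp c i has_real_derivative c * flat_exp c (i + 2) y - real i * flat_exp c (i + 1) y) (at y)"
proof -
  consider "y > 0" | "y < 0" | "y = 0" by linarith
  then show ?thesis
  proof cases
    case 1
    have "((\<lambda>y. exp (- c / y) / y ^ i) has_real_derivative
        c * (exp (- c / y) / y ^ (i + 2)) - real i * (exp (- c / y) / y ^ (i + 1))) (at y)"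
      using 1 by (auto intro!: derivative_eq_intros simp: field_simps power2_eq_square)
         (cases i; simp add: field_simps power2_eq_square)
    moreover have "\<forall>\<^sub>F y in nhds y. exp (- c / y) / y ^ i = flat_exp c i y"
      using 1 eventually_nhds_in_open[of "{0<..}" y] by (auto simp: flat_exp_def elim!: eventually_mono)
    ultimately show ?thesis
      using 1 by (subst DERIV_cong_ev[symmetric]) (auto simp: flat_exp_def)
  next
    case 2
    have "\<forall>\<^sub>F y in nhds y. 0 = flat_exp c i y"
      using 2 eventually_nhds_in_open[of "{..<0}" y] by (auto simp: flat_exp_def elim!: eventually_mono)
    then show ?thesis
      using 2 by (subst DERIV_cong_ev[symmetric, of y y "\<lambda>_. 0" _ 0]) (auto simp: flat_exp_def)
  next
    case 3
    obtain C where C: "\<And>y. \<bar>flat_exp c i y\<bar> \<le> C * y\<^sup>2" using flat_exp_le[OF assms] by blast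
    have "((\<lambda>h. (flat_exp c i (0 + h) - flat_exp c i 0) / h) \<longlongrightarrow> 0) (at 0)"
    proof (rule Lim_null_comparison)
      show "\<forall>\<^sub>F h in at 0. norm ((flat_exp c i (0 + h) - flat_exp c i 0) / h) \<le> C * \<bar>h\<bar>"
      proof (rule always_eventually, intro allI)
        fix h :: real
        show "norm ((flat_exp c i (0 + h) - flat_exp c i 0) / h) \<le> C * \<bar>h\<bar>"
        proof (cases "h = 0")
          case False
          then have "\<bar>flat_exp c i h\<bar> \<le> (C * \<bar>h\<bar>) * \<bar>h\<bar>" using C[of h] by (simp add: power2_eq_square)
          then show ?thesis using False by (simp add: flat_exp_def[of c i 0] pos_divide_le_eq)
        qed simp
      qed
      have "((\<lambda>h::real. C * \<bar>h\<bar>) \<longlongrightarrow> C * \<bar>0\<bar>) (at 0)" by (intro tendsto_intros)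
      then show "((\<lambda>h::real. C * \<bar>h\<bar>) \<longlongrightarrow> 0) (at 0)" by simp
    qed
    then show ?thesis using 3 by (simp add: DERIV_def flat_exp_def[of c _ 0])
  qed
qed

text \<open>Differentiation maps this span into itself, which yields derivatives of all orders by
  induction, without formulas for them.\<close>

inductive_set bump_span :: "real \<Rightarrow> real \<Rightarrow> real \<Rightarrow> (real \<Rightarrow> real) set" for c a b
  where
    base: "(\<lambda>x. flat_exp c i (x - a) * flat_exp c j (b - x)) \<in> bump_span c a b"
  | add: "\<phi> \<in> bump_span c a b \<Longrightarrow> \<psi> \<in> bump_span c a b \<Longrightarrow> (\<lambda>x. \<phi> x + \<psi> x) \<in> bump_span c a b"
  | scale: "\<phi> \<in> bump_span c a b \<Longrightarrow> (\<lambda>x. r * \<phi> x) \<in> bump_span c a b"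

lemma bump_span_deriv:
  assumes "c > 0" "\<phi> \<in> bump_span c a b"
  shows "\<exists>\<phi>'\<in>bump_span c a b. \<forall>x. (\<phi> has_real_derivative \<phi>' x) (at x)"
  using assms(2)
proof induction
  case (base i j)
  let ?e = "\<lambda>i j x. flat_exp c i (x - a) * flat_exp c j (b - x)"
  let ?d = "\<lambda>x. (c * ?e (i + 2) j x + (- real i) * ?e (i + 1) j x) + ((- c) * ?e i (j + 2) x + real j * ?e i (j + 1) x)"
  have "?d \<in> bump_span c a b"
    by (intro bump_span.intros)
  moreover have "(?e i j has_real_derivative ?d x) (at x)" for x
  proof -
    have 1: "((\<lambda>x. flat_exp c i (x - a)) has_real_derivative
        (c * flat_exp c (i + 2) (x - a) - real i * flat_exp c (i + 1) (x - a)) * 1) (at x)"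
      by (rule DERIV_chain2[OF DERIV_flat_exp[OF assms(1)]]) (auto intro!: derivative_eq_intros)
    have 2: "((\<lambda>x. flat_exp c j (b - x)) has_real_derivative
        (c * flat_exp c (j + 2) (b - x) - real j * flat_exp c (j + 1) (b - x)) * (-1)) (at x)"
      by (rule DERIV_chain2[OF DERIV_flat_exp[OF assms(1)]]) (auto intro!: derivative_eq_intros)
    from DERIV_mult[OF 1 2] show ?thesis
      by (rule DERIV_cong) (simp add: algebra_simps)
  qed
  ultimately show ?case by (intro bexI[of _ ?d] allI)
next
  case (add \<phi> \<psi>)
  then obtain \<phi>' \<psi>' where "\<phi>' \<in> bump_span c a b" "\<And>x. (\<phi> has_real_derivative \<phi>' x) (at x)"
    "\<psi>' \<in> bump_span c a b" "\<And>x. (\<psi> has_real_derivative \<psi>' x) (at x)" by blast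
  then show ?case by (intro bexI[of _ "\<lambda>x. \<phi>' x + \<psi>' x"]) (auto intro: bump_span.add DERIV_add)
next
  case (scale \<phi> r)
  then obtain \<phi>' where "\<phi>' \<in> bump_span c a b" "\<And>x. (\<phi> has_real_derivative \<phi>' x) (at x)" by blast
  then show ?case by (intro bexI[of _ "\<lambda>x. r * \<phi>' x"]) (auto intro: bump_span.scale DERIV_cmult)
qed

lemma bump_span_smooth:
  assumes "c > 0" "\<phi> \<in> bump_span c a b"
  shows "(deriv ^^ k) \<phi> \<in> bump_span c a b"
proof (induction k)
  case (Suc k)
  from bump_span_deriv[OF assms(1) Suc] obtain \<phi>' where
    "\<phi>' \<in> bump_span c a b" "\<And>x. ((deriv ^^ k) \<phi> has_real_derivative \<phi>' x) (at x)" by blast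
  then have "deriv ((deriv ^^ k) \<phi>) = \<phi>'" by (auto intro!: ext DERIV_imp_deriv)
  then show ?case using \<open>\<phi>' \<in> _\<close> by simp
qed (use assms in simp)

text \<open>For c tending to 0 these functions tend to the indicator of the open interval from a to
  b and stay between 0 and 1.\<close>

definition bump :: "real \<Rightarrow> real \<Rightarrow> real \<Rightarrow> real \<Rightarrow> real"
  where "bump c a b x = flat_exp c 0 (x - a) * flat_exp c 0 (b - x)"

lemma bump_test:
  assumes "c > 0" "0 < a" "b < 1" shows "bump c a b \<in> test_fun"
proof -
  have "bump c a b \<in> bump_span c a b"
    unfolding bump_def[abs_def] by (rule bump_span.base)
  then have "(deriv ^^ k) (bump c a b) field_differentiable at x" for k x
    using bump_span_deriv[OF assms(1) bump_span_smooth[OF assms(1)]] by (metis field_differentiable_def)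
  moreover have "x \<notin> {a..b} \<Longrightarrow> bump c a b x = 0" for x by (auto simp: bump_def flat_exp_def)
  ultimately show ?thesis unfolding test_fun_def
    using assms by (auto intro!: exI[of _ "{a..b}"])
qed

lemma test_fun_diff:
  assumes "\<phi> \<in> test_fun"
  shows "(\<phi> has_real_derivative deriv \<phi> x) (at x)" "deriv \<phi> \<in> test_fun"
proof -
  have d: "(deriv ^^ k) \<phi> field_differentiable at x" for k x using assms by (simp add: test_fun_def)
  show D: "(\<phi> has_real_derivative deriv \<phi> x) (at x)" for x
    using d[of 0 x] by (simp add: DERIV_deriv_iff_field_differentiable)
  have s: "(deriv ^^ k) (deriv \<phi>) = (deriv ^^ Suc k) \<phi>" for k by (simp only: funpow_Suc_right o_apply)
  obtain K where K: "compact K" "K \<subseteq> {0<..<1}" "\<And>x. x \<notin> K \<Longrightarrow> \<phi> x = 0" using assms by (auto simp: test_fun_def)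
  have "deriv \<phi> x = 0" if "x \<notin> K" for x
  proof -
    have "\<forall>\<^sub>F y in nhds x. \<phi> y = 0"
      using eventually_nhds_in_open[of "- K" x] K that by (auto simp: compact_imp_closed open_Compl elim!: eventually_mono)
    then have "(\<phi> has_real_derivative 0) (at x)"
      by (subst DERIV_cong_ev[OF refl _ refl, of _ "\<lambda>_. 0"]) auto
    then show ?thesis by (rule DERIV_imp_deriv)
  qed
  then show "deriv \<phi> \<in> test_fun"
    using K d unfolding test_fun_def s[symmetric] by (auto simp: s simp del: funpow.simps)
qed

lemma test_fun_cont: "\<phi> \<in> test_fun \<Longrightarrow> continuous_on S \<phi>"
  using test_fun_diff(1) by (meson DERIV_isCont continuous_at_imp_continuous_on)

lemma test_fun_0: "\<phi> \<in> test_fun \<Longrightarrow> x \<le> 0 \<or> 1 \<le> x \<Longrightarrow> \<phi> x = 0"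
  by (fastforce simp: test_fun_def)

lemma continuous_L2:
  assumes "continuous_on UNIV \<phi>" shows "\<phi> \<in> L2 U"
proof -
  have "continuous_on {0..1} \<phi>" using assms by (rule continuous_on_subset) simp
  then have "bounded (\<phi> ` {0..1})" by (intro compact_imp_bounded compact_continuous_image) auto
  then obtain C where "\<forall>x\<in>{0..1}. \<bar>\<phi> x\<bar> \<le> C" by (auto simp: bounded_iff)
  moreover have "\<phi> \<in> borel_measurable U"
    using measurable_compose[OF borel_ident_U borel_measurable_continuous_onI[OF assms]] .
  ultimately show ?thesis by (intro U.L2_bdd[where C = C]) auto
qed

lemma test_fun_L2: "\<phi> \<in> test_fun \<Longrightarrow> \<phi> \<in> L2 U"
  by (intro continuous_L2 test_fun_cont)

lemma test_fun_prim:
  assumes "\<phi> \<in> test_fun" "0 \<le> x" "x \<le> 1" shows "\<phi> x = prim (deriv \<phi>) x"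
  using prim_FTC[OF test_fun_cont[OF test_fun_diff(2)[OF assms(1)]] assms(2,3), of \<phi>] test_fun_0[OF assms(1), of 0]
    has_field_derivative_at_within[OF test_fun_diff(1)[OF assms(1)]] by simp

lemma test_fun_add: "\<phi> \<in> test_fun \<Longrightarrow> \<psi> \<in> test_fun \<Longrightarrow> (\<lambda>x. \<phi> x + r * \<psi> x) \<in> test_fun"
proof -
  assume 1: "\<phi> \<in> test_fun" and 2: "\<psi> \<in> test_fun"
  have "(deriv ^^ k) (\<lambda>x. \<phi> x + r * \<psi> x) = (\<lambda>x. (deriv ^^ k) \<phi> x + r * (deriv ^^ k) \<psi> x)" for k
  proof (induction k)
    case (Suc k)
    have "((deriv ^^ k) \<phi>) field_differentiable at x" "((deriv ^^ k) \<psi>) field_differentiable at x" for x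
      using 1 2 by (auto simp: test_fun_def)
    then show ?case using Suc
      by (auto intro!: ext DERIV_imp_deriv DERIV_add DERIV_cmult simp: DERIV_deriv_iff_field_differentiable)
  qed simp
  moreover obtain K1 K2 where "compact K1" "K1 \<subseteq> {0<..<1}" "\<forall>x. x \<notin> K1 \<longrightarrow> \<phi> x = 0"
     "compact K2" "K2 \<subseteq> {0<..<1}" "\<forall>x. x \<notin> K2 \<longrightarrow> \<psi> x = 0"
    using 1 2 unfolding test_fun_def by blast
  then have "\<exists>K. compact K \<and> K \<subseteq> {0<..<1} \<and> (\<forall>x. x \<notin> K \<longrightarrow> \<phi> x + r * \<psi> x = 0)"
    by (intro exI[of _ "K1 \<union> K2"]) auto
  moreover have "(\<lambda>x. (deriv ^^ k) \<phi> x + r * (deriv ^^ k) \<psi> x) field_differentiable at x" for k x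
    using 1 2 by (intro field_differentiable_add field_differentiable_mult field_differentiable_const)
      (simp_all add: test_fun_def)
  ultimately show ?thesis unfolding test_fun_def by simp
qed

text \<open>By continuity the primitive also vanishes at 0 and 1, and integration by parts against
  \<open>x ^ j\<close> shows that all moments of k are zero.\<close>

lemma prim_zero_imp_AE:
  assumes k: "k \<in> L2 U" and z: "\<And>t. 0 < t \<Longrightarrow> t < 1 \<Longrightarrow> prim k t = 0"
  shows "AE x in U. k x = 0"
proof (rule L2_moments_zero[OF k])
  have "continuous_on {0..1} (prim k)" by (intro continuous_prim U.L2_integrable k)
  then have "\<forall>x\<in>{0..1}. prim k x = 0"
  proof -
    have c: "closure {0<..<1::real} = {0..1}" by simp
    show ?thesis
      using continuous_constant_on_closure[of "{0<..<1}" "prim k" 0, unfolded c, OF \<open>continuous_on {0..1} (prim k)\<close>] z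
      by simp
  qed
  then have z1: "prim k t = 0" for t using prim_0[of t k] prim_1[of t k] prim_1[of 1 k]
    by (cases "t \<le> 0"; cases "t \<ge> 1") auto
  fix j
  have p: "x ^ j = 0 ^ j + prim (\<lambda>x. real j * x ^ (j - 1)) x" if "0 \<le> x" "x \<le> 1" for x :: real
    by (rule prim_FTC[OF _ that]) (auto intro!: continuous_intros derivative_eq_intros)
  have L: "(\<lambda>x. real j * x ^ (j - 1)) \<in> L2 U" by (intro continuous_L2 continuous_intros)
  have "(0 + prim k 1) * (0 ^ j + prim (\<lambda>x. real j * x ^ (j - 1)) 1) =
      0 * 0 ^ j + prim (\<lambda>r. k r * (0 ^ j + prim (\<lambda>x. real j * x ^ (j - 1)) r) + (0 + prim k r) * (real j * r ^ (j - 1))) 1"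
    by (rule prim_mult[OF k L]) auto
  then have "0 = prim (\<lambda>r. k r * (0 ^ j + prim (\<lambda>x. real j * x ^ (j - 1)) r)) 1" by (simp add: z1)
  also have "\<dots> = prim (\<lambda>r. k r * r ^ j) 1" by (rule prim_cong) (subst p, auto)
  also have "\<dots> = (LINT x|U. k x * x ^ j)" by (simp add: prim_1)
  finally show "(LINT x|U. k x * x ^ j) = 0" by simp
qed

text \<open>Bump functions converge boundedly to indicators of intervals inside (0, 1). So k has
  integral zero over these, its primitive is constant on (0, 1), and continuity at 0 makes the
  constant zero.\<close>

lemma test_fun_zero_imp_AE:
  assumes k: "k \<in> L2 U" and z: "\<And>\<phi>. \<phi> \<in> test_fun \<Longrightarrow> (LINT x|U. k x * \<phi> x) = 0"
  shows "AE x in U. k x = 0"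
proof (rule prim_zero_imp_AE[OF k])
  note [measurable] = L2D(1)[OF k]
  have kI: "integrable U k" using k by (rule U.L2_integrable)
  have I: "(LINT x|U. (if a < x \<and> x < b then k x else 0)) = 0" if "0 < a" "b < 1" for a b
  proof -
    let ?c = "\<lambda>n. 1 / (real n + 1)"
    have "(\<lambda>n. LINT x|U. k x * bump (?c n) a b x) \<longlonglongrightarrow> (LINT x|U. (if a < x \<and> x < b then k x else 0))"
    proof (rule integral_dominated_convergence[where w = "\<lambda>x. \<bar>k x\<bar>"])
      show "(\<lambda>x. k x * bump (?c n) a b x) \<in> borel_measurable U" for n
        using L2D(1)[OF test_fun_L2[OF bump_test[of "?c n" a b]]] that L2D(1)[OF k]
        by (intro borel_measurable_times) auto
      show "AE x in U. (\<lambda>n. k x * bump (?c n) a b x) \<longlonglongrightarrow> (if a < x \<and> x < b then k x else 0)"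
      proof (rule AE_I2)
        fix x
        show "(\<lambda>n. k x * bump (?c n) a b x) \<longlonglongrightarrow> (if a < x \<and> x < b then k x else 0)"
        proof (cases "a < x \<and> x < b")
          case True
          have "(\<lambda>n. exp (- ?c n / y)) \<longlonglongrightarrow> 1" for y :: real
          proof -
            have "(\<lambda>n. ?c n) \<longlonglongrightarrow> 0" by real_asymp
            then have "(\<lambda>n. exp (- ?c n / y)) \<longlonglongrightarrow> exp (- 0 / y)"
              unfolding divide_inverse by (intro tendsto_intros)
            then show ?thesis by simp
          qed
          then have "(\<lambda>n. k x * (exp (- ?c n / (x - a)) * exp (- ?c n / (b - x)))) \<longlonglongrightarrow> k x * (1 * 1)"
            by (intro tendsto_intros)
          then show ?thesis using True by (simp add: bump_def flat_exp_def)
        next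
          case False
          then have "bump (?c n) a b x = 0" for n by (auto simp: bump_def flat_exp_def)
          then show ?thesis by (simp add: if_not_P[OF False])
        qed
      qed
      have "\<bar>bump (?c n) a b x\<bar> \<le> 1" for n x
        by (auto simp: bump_def flat_exp_def abs_mult intro!: mult_le_one)
      then show "AE x in U. norm (k x * bump (?c n) a b x) \<le> \<bar>k x\<bar>" for n
        by (auto simp: abs_mult mult_left_le)
    qed (use kI in auto)
    moreover have "(LINT x|U. k x * bump (?c n) a b x) = 0" for n
      by (rule z, rule bump_test) (use that in auto)
    ultimately show ?thesis by (simp add: LIMSEQ_const_iff)
  qed
  have inc: "prim k t = prim k s" if "0 < s" "s \<le> t" "t < 1" for s t
  proof -
    have "prim k t - prim k s = (LINT r|U. (if s < r \<and> r \<le> t then k r else 0))"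
      by (rule prim_increment[OF kI that(2)])
    also have "\<dots> = (LINT x|U. (if s < x \<and> x < t then k x else 0))"
      by (rule integral_cong_AE, measurable) (use AE_U_neq[of t] in \<open>auto elim!: eventually_mono\<close>)
    also have "\<dots> = 0" using that by (intro I) auto
    finally show ?thesis by simp
  qed
  fix t :: real assume t: "0 < t" "t < 1"
  have "(\<lambda>n. prim k (t / (real n + 1))) \<longlonglongrightarrow> prim k 0"
  proof (rule continuous_on_tendsto_compose[OF continuous_prim[OF kI, of UNIV]])
    show "(\<lambda>n. t / (real n + 1)) \<longlonglongrightarrow> 0" by real_asymp
  qed auto
  moreover have "prim k (t / (real n + 1)) = prim k t" for n
    using t by (intro inc[symmetric]) (auto simp: field_simps)
  ultimately show "prim k t = 0" by (simp add: prim_0 LIMSEQ_const_iff)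
qed

text \<open>Mean zero makes the primitive vanish also to the right of the support, so it is a test
  function.\<close>

lemma test_fun_antiderivative:
  assumes \<omega>: "\<omega> \<in> test_fun" and m: "(LINT x|U. \<omega> x) = 0"
  obtains \<phi> where "\<phi> \<in> test_fun" "deriv \<phi> = \<omega>"
proof -
  obtain K where K: "compact K" "K \<subseteq> {0<..<1}" "\<And>x. x \<notin> K \<Longrightarrow> \<omega> x = 0" using \<omega> by (auto simp: test_fun_def)
  obtain a b where ab: "0 < a" "a < 1" "0 < b" "b < 1" "K \<subseteq> {a..b}"
  proof (cases "K = {}")
    case True then show ?thesis using that[of "1/2" "1/2"] by auto
  next
    case False
    then obtain a b where "a \<in> K" "b \<in> K" "\<And>x. x \<in> K \<Longrightarrow> a \<le> x" "\<And>x. x \<in> K \<Longrightarrow> x \<le> b"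
      using compact_attains_inf[OF K(1)] compact_attains_sup[OF K(1)] by meson
    then show ?thesis using that[of a b] K(2) by fastforce
  qed
  have z: "prim \<omega> x = 0" if "x < a \<or> b < x" for x
  proof (cases "x < a")
    case True
    have "prim \<omega> x = prim (\<lambda>_. 0) x" unfolding prim_def
      using K(3) ab True by (intro Bochner_Integration.integral_cong) force+
    then show ?thesis by (simp add: prim_def)
  next
    case False
    then have "prim \<omega> x = (LINT x|U. \<omega> x)" unfolding prim_def
      using K(3) ab that by (intro Bochner_Integration.integral_cong) force+
    then show ?thesis using m by simp
  qed
  have D: "(prim \<omega> has_real_derivative \<omega> x) (at x)" for x
  proof -
    consider "0 < x" "x < 1" | "x < a" | "b < x" using ab by linarith
    then show ?thesis
    proof cases
      case 1
      then have "(prim \<omega> has_real_derivative \<omega> x) (at x within {0..1})"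
        by (intro prim_has_derivative test_fun_cont[OF \<omega>]) auto
      then show ?thesis using 1 at_within_interior[of x "{0..1}"] by simp
    next
      case 2
      have "\<forall>\<^sub>F y in nhds x. prim \<omega> y = 0"
        using 2 eventually_nhds_in_open[of "{..<a}" x] z by (auto elim!: eventually_mono)
      moreover have "\<omega> x = 0" using K(3)[of x] ab 2 by force
      ultimately show ?thesis
        by (subst DERIV_cong_ev[OF refl _ refl, of _ "\<lambda>_. 0"]) auto
    next
      case 3
      have "\<forall>\<^sub>F y in nhds x. prim \<omega> y = 0"
        using 3 eventually_nhds_in_open[of "{b<..}" x] z by (auto elim!: eventually_mono)
      moreover have "\<omega> x = 0" using K(3)[of x] ab 3 by force
      ultimately show ?thesis
        by (subst DERIV_cong_ev[OF refl _ refl, of _ "\<lambda>_. 0"]) auto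
    qed
  qed
  then have d: "deriv (prim \<omega>) = \<omega>" by (auto intro!: ext DERIV_imp_deriv)
  have "(deriv ^^ k) (prim \<omega>) field_differentiable at x" for k x
  proof (cases k)
    case 0 then show ?thesis using D by (auto simp: field_differentiable_def)
  next
    case (Suc j)
    have "(deriv ^^ Suc j) (prim \<omega>) = (deriv ^^ j) \<omega>" by (simp only: funpow_Suc_right o_apply d)
    then show ?thesis using Suc \<omega> by (simp add: test_fun_def del: funpow.simps)
  qed
  then have "prim \<omega> \<in> test_fun" unfolding test_fun_def
    using z ab by (auto intro!: exI[of _ "{a..b}"])
  then show ?thesis using d that by blast
qed

text \<open>Every test function is a multiple of one fixed \<open>\<omega>0\<close> plus a test
  function of mean zero, and the latter is a derivative. So r - c is orthogonal to all test
  functions once it is orthogonal to \<open>\<omega>0\<close>, which determines c.\<close>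

lemma du_Bois_Reymond:
  assumes r: "r \<in> L2 U" and z: "\<And>\<phi>. \<phi> \<in> test_fun \<Longrightarrow> (LINT x|U. r x * deriv \<phi> x) = 0"
  obtains c where "AE x in U. r x = c"
proof -
  obtain \<omega>0 where \<omega>0: "\<omega>0 \<in> test_fun" "(LINT x|U. \<omega>0 x) \<noteq> 0"
  proof (rule ccontr)
    assume "\<not> thesis"
    \<comment> \<open>If all test functions had integral zero, the constant 1 would vanish almost
      everywhere.\<close>
    then have "\<And>\<phi>. \<phi> \<in> test_fun \<Longrightarrow> (LINT x|U. 1 * \<phi> x) = 0" using that by auto
    from test_fun_zero_imp_AE[OF U.L2_const this] have "AE x in U. False" by simp
    then have "emeasure U (space U) = 0" using ae_filter_eq_bot_iff[of U] by (simp add: trivial_limit_def)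
    then show False using emeasure_U by simp
  qed
  define c where "c = (LINT x|U. r x * \<omega>0 x) / (LINT x|U. \<omega>0 x)"
  have "AE x in U. r x - c = 0"
  proof (rule test_fun_zero_imp_AE)
    show "(\<lambda>x. r x - c) \<in> L2 U" by (intro L2_diff r U.L2_const)
    fix \<phi> assume \<phi>: "\<phi> \<in> test_fun"
    define s where "s = (LINT x|U. \<phi> x) / (LINT x|U. \<omega>0 x)"
    have i: "integrable U \<phi>" "integrable U \<omega>0" "integrable U (\<lambda>x. r x * \<phi> x)" "integrable U (\<lambda>x. r x * \<omega>0 x)"
      using \<phi> \<omega>0 r by (auto intro: U.L2_integrable integrable_mult_L2 test_fun_L2)
    have t: "(\<lambda>x. \<phi> x + (- s) * \<omega>0 x) \<in> test_fun" using \<phi> \<omega>0 by (intro test_fun_add)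
    have "(LINT x|U. \<phi> x + (- s) * \<omega>0 x) = 0"
      using i \<omega>0 by (simp add: s_def)
    from test_fun_antiderivative[OF t this] obtain \<psi> where "\<psi> \<in> test_fun" "deriv \<psi> = (\<lambda>x. \<phi> x + (- s) * \<omega>0 x)" .
    then have "0 = (LINT x|U. r x * (\<phi> x + (- s) * \<omega>0 x))" using z by metis
    also have "\<dots> = (LINT x|U. r x * \<phi> x - s * (r x * \<omega>0 x))" by (simp add: algebra_simps)
    also have "\<dots> = (LINT x|U. r x * \<phi> x) - s * (LINT x|U. r x * \<omega>0 x)" using i by simp
    also have "\<dots> = (LINT x|U. r x * \<phi> x) - c * (LINT x|U. \<phi> x)" by (simp add: s_def c_def)
    also have "\<dots> = (LINT x|U. (r x - c) * \<phi> x)" using i by (simp add: left_diff_distrib)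
    finally show "(LINT x|U. (r x - c) * \<phi> x) = 0" by simp
  qed
  then show ?thesis using that[of c] by simp
qed

subsection \<open>Sobolev functions of one variable\<close>

lemma L2_prim: "integrable U k \<Longrightarrow> (\<lambda>x. c + prim k x) \<in> L2 U"
  by (intro continuous_L2 continuous_intros continuous_prim)

lemma prim_test_fun:
  assumes g: "g \<in> L2 U" and \<phi>: "\<phi> \<in> test_fun"
  shows "(LINT x|U. (c + prim g x) * deriv \<phi> x) = - (LINT x|U. g x * \<phi> x)"
proof -
  note d = test_fun_L2[OF test_fun_diff(2)[OF \<phi>]]
  have "(c + prim g 1) * (0 + prim (deriv \<phi>) 1) = c * 0 + prim (\<lambda>r. g r * (0 + prim (deriv \<phi>) r) + (c + prim g r) * deriv \<phi> r) 1"
    by (rule prim_mult[OF g d]) auto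
  moreover have "prim (deriv \<phi>) 1 = 0" using test_fun_prim[OF \<phi>, of 1] test_fun_0[OF \<phi>, of 1] by simp
  ultimately have "0 = prim (\<lambda>r. g r * (0 + prim (deriv \<phi>) r) + (c + prim g r) * deriv \<phi> r) 1" by simp
  also have "\<dots> = prim (\<lambda>r. g r * \<phi> r + (c + prim g r) * deriv \<phi> r) 1"
    by (rule prim_cong) (simp add: test_fun_prim[OF \<phi>])
  also have "\<dots> = (LINT r|U. g r * \<phi> r) + (LINT r|U. (c + prim g r) * deriv \<phi> r)"
    using g by (simp add: prim_1 integrable_mult_L2 test_fun_L2[OF \<phi>] d L2_prim U.L2_integrable)
  finally show ?thesis by simp
qed

text \<open>The bridge from the distributional definition to primitives; time slices of functions on
  the square are handled through it.\<close>

lemma has_weak_deriv_iff: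
  "has_weak_deriv w g \<longleftrightarrow> w \<in> L2 U \<and> g \<in> L2 U \<and> (\<exists>c. AE x in U. w x = c + prim g x)"
proof (intro iffI)
  assume "has_weak_deriv w g"
  then have w: "w \<in> L2 U" and g: "g \<in> L2 U"
    and e: "\<And>\<phi>. \<phi> \<in> test_fun \<Longrightarrow> (LINT x|U. w x * deriv \<phi> x) = - (LINT x|U. g x * \<phi> x)"
    by (auto simp: has_weak_deriv_def)
  have p: "prim g \<in> L2 U" using L2_prim[OF U.L2_integrable[OF g], of 0] by simp
  obtain c where "AE x in U. w x - prim g x = c"
  proof (rule du_Bois_Reymond)
    show "(\<lambda>x. w x - prim g x) \<in> L2 U" by (intro L2_diff w p)
    fix \<phi> assume \<phi>: "\<phi> \<in> test_fun"
    note d = test_fun_L2[OF test_fun_diff(2)[OF \<phi>]]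
    show "(LINT x|U. (w x - prim g x) * deriv \<phi> x) = 0"
      using e[OF \<phi>] prim_test_fun[OF g \<phi>, of 0] integrable_mult_L2[OF w d] integrable_mult_L2[OF p d]
      by (simp add: left_diff_distrib)
  qed
  then have "AE x in U. w x = c + prim g x" by (auto elim!: eventually_mono)
  then show "w \<in> L2 U \<and> g \<in> L2 U \<and> (\<exists>c. AE x in U. w x = c + prim g x)" using w g by auto
next
  assume "w \<in> L2 U \<and> g \<in> L2 U \<and> (\<exists>c. AE x in U. w x = c + prim g x)"
  then obtain c where w: "w \<in> L2 U" and g: "g \<in> L2 U" and c: "AE x in U. w x = c + prim g x" by auto
  show "has_weak_deriv w g" unfolding has_weak_deriv_def
  proof (intro conjI w g ballI)
    fix \<phi> assume \<phi>: "\<phi> \<in> test_fun"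
    note d = test_fun_L2[OF test_fun_diff(2)[OF \<phi>]]
    note [measurable] = L2D(1)[OF w] L2D(1)[OF d] L2D(1)[OF L2_prim[OF U.L2_integrable[OF g], of c]]
    have "(LINT x|U. w x * deriv \<phi> x) = (LINT x|U. (c + prim g x) * deriv \<phi> x)"
      by (rule integral_cong_AE, measurable) (use c in \<open>auto elim!: eventually_mono\<close>)
    then show "(LINT x|U. w x * deriv \<phi> x) = - (LINT x|U. g x * \<phi> x)"
      by (simp add: prim_test_fun[OF g \<phi>])
  qed
qed

lemma has_weak_deriv_unique:
  assumes "has_weak_deriv w g" "has_weak_deriv w g'"
  shows "AE x in U. g x = g' x"
proof -
  have L: "g \<in> L2 U" "g' \<in> L2 U" using assms by (auto simp: has_weak_deriv_def)
  have "AE x in U. g x - g' x = 0"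
  proof (rule test_fun_zero_imp_AE)
    fix \<phi> assume \<phi>: "\<phi> \<in> test_fun"
    show "(LINT x|U. (g x - g' x) * \<phi> x) = 0"
      using assms \<phi> integrable_mult_L2[OF L(1) test_fun_L2[OF \<phi>]] integrable_mult_L2[OF L(2) test_fun_L2[OF \<phi>]]
      by (auto simp: has_weak_deriv_def left_diff_distrib)
  qed (intro L2_diff L)
  then show ?thesis by simp
qed

lemma has_weak_deriv_add:
  assumes "has_weak_deriv w g" "has_weak_deriv w' g'"
  shows "has_weak_deriv (\<lambda>x. w x + r * w' x) (\<lambda>x. g x + r * g' x)"
proof -
  from assms obtain c c' where c: "AE x in U. w x = c + prim g x" "AE x in U. w' x = c' + prim g' x"
    and L: "w \<in> L2 U" "g \<in> L2 U" "w' \<in> L2 U" "g' \<in> L2 U" by (auto simp: has_weak_deriv_iff)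
  have "AE x in U. w x + r * w' x = (c + r * c') + prim (\<lambda>x. g x + r * g' x) x"
    using c by eventually_elim (simp add: prim_add prim_cmult U.L2_integrable L algebra_simps)
  then show ?thesis unfolding has_weak_deriv_iff by (intro conjI L2_add L2_cmult L exI)
qed

lemma has_weak_deriv_test: "\<phi> \<in> test_fun \<Longrightarrow> has_weak_deriv \<phi> (deriv \<phi>)"
  unfolding has_weak_deriv_iff
  by (auto intro!: test_fun_L2 test_fun_diff(2) exI[of _ 0] AE_I2 simp: test_fun_prim)

lemma has_weak_deriv_weak_deriv: "w \<in> H1 \<Longrightarrow> has_weak_deriv w (weak_deriv w)"
  unfolding H1_def weak_deriv_def by (drule CollectD, elim exE) (rule someI[of "has_weak_deriv w"])

lemma H1_norm_eq:
  assumes "has_weak_deriv w g"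
  shows "H1_norm w = sqrt ((LINT x|U. (w x)\<^sup>2) + (LINT x|U. (g x)\<^sup>2))"
proof -
  have w: "has_weak_deriv w (weak_deriv w)" using assms has_weak_deriv_weak_deriv by (auto simp: H1_def)
  have L: "w \<in> L2 U" "g \<in> L2 U" "weak_deriv w \<in> L2 U" using assms w by (auto simp: has_weak_deriv_def)
  note [measurable] = L2D(1)[OF L(1)] L2D(1)[OF L(2)] L2D(1)[OF L(3)]
  have "(LINT x|U. (w x)\<^sup>2 + (weak_deriv w x)\<^sup>2) = (LINT x|U. (w x)\<^sup>2 + (g x)\<^sup>2)"
    by (rule integral_cong_AE, measurable) (use has_weak_deriv_unique[OF w assms] in \<open>auto elim!: eventually_mono\<close>)
  also have "\<dots> = (LINT x|U. (w x)\<^sup>2) + (LINT x|U. (g x)\<^sup>2)"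
    by (rule Bochner_Integration.integral_add; intro L2D(2) L)
  finally show ?thesis by (simp add: H1_norm_def)
qed

lemma H1_norm_add_le:
  assumes "has_weak_deriv w g" "has_weak_deriv w' g'"
  shows "(H1_norm (\<lambda>x. w x + r * w' x))\<^sup>2 \<le> 2 * (H1_norm w)\<^sup>2 + 2 * r\<^sup>2 * (H1_norm w')\<^sup>2"
proof -
  have L: "w \<in> L2 U" "g \<in> L2 U" "w' \<in> L2 U" "g' \<in> L2 U" using assms by (auto simp: has_weak_deriv_def)
  have "(LINT x|U. (w x + r * w' x)\<^sup>2) \<le> 2 * (LINT x|U. (w x)\<^sup>2) + 2 * (LINT x|U. (r * w' x)\<^sup>2)"
    "(LINT x|U. (g x + r * g' x)\<^sup>2) \<le> 2 * (LINT x|U. (g x)\<^sup>2) + 2 * (LINT x|U. (r * g' x)\<^sup>2)"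
    by (intro integral_square_add_le L L2_cmult)+
  then show ?thesis
    using H1_norm_eq[OF assms(1)] H1_norm_eq[OF assms(2)] H1_norm_eq[OF has_weak_deriv_add[OF assms]]
    by (simp add: power_mult_distrib algebra_simps)
qed

lemma L2_le_H1_norm: "w \<in> H1 \<Longrightarrow> sqrt (LINT x|U. (w x)\<^sup>2) \<le> H1_norm w"
  using H1_norm_eq[OF has_weak_deriv_weak_deriv[of w]] by (auto intro!: real_sqrt_le_mono)

lemma H1_norm_nonneg: "0 \<le> H1_norm w"
  unfolding H1_norm_def by (auto intro!: integral_nonneg_AE)

lemma H10_add:
  assumes "w \<in> H10" "w' \<in> H10" shows "(\<lambda>x. w x + r * w' x) \<in> H10"
proof -
  from assms obtain g g' where g: "has_weak_deriv w g" "has_weak_deriv w' g'" by (auto simp: H10_def H1_def)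
  show ?thesis unfolding H10_def
  proof (intro CollectI conjI allI impI)
    show "(\<lambda>x. w x + r * w' x) \<in> H1" using has_weak_deriv_add[OF g] by (auto simp: H1_def)
    fix e :: real assume "e > 0"
    \<comment> \<open>Chosen for the estimate 2 d^2 + 2 r^2 d^2 \<le> (2 (1 + |r|) d)^2, whose right
      side is e^2.\<close>
    define d where "d = e / (2 * (1 + \<bar>r\<bar>))"
    have "d > 0" using \<open>e > 0\<close> by (simp add: d_def add_pos_nonneg)
    then obtain \<phi> \<psi> where t: "\<phi> \<in> test_fun" "H1_norm (\<lambda>x. w x - \<phi> x) < d"
      "\<psi> \<in> test_fun" "H1_norm (\<lambda>x. w' x - \<psi> x) < d" using assms unfolding H10_def by blast
    have 1: "has_weak_deriv (\<lambda>x. w x - \<phi> x) (\<lambda>x. g x - deriv \<phi> x)"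
      using has_weak_deriv_add[OF g(1) has_weak_deriv_test[OF t(1)], of "-1"] by simp
    have 2: "has_weak_deriv (\<lambda>x. w' x - \<psi> x) (\<lambda>x. g' x - deriv \<psi> x)"
      using has_weak_deriv_add[OF g(2) has_weak_deriv_test[OF t(3)], of "-1"] by simp
    have "(H1_norm (\<lambda>x. (w x - \<phi> x) + r * (w' x - \<psi> x)))\<^sup>2
        \<le> 2 * (H1_norm (\<lambda>x. w x - \<phi> x))\<^sup>2 + 2 * r\<^sup>2 * (H1_norm (\<lambda>x. w' x - \<psi> x))\<^sup>2"
      by (rule H1_norm_add_le[OF 1 2])
    also have "\<dots> < 2 * d\<^sup>2 + 2 * r\<^sup>2 * d\<^sup>2"
      using t(2,4) H1_norm_nonneg
      by (intro add_less_le_mono mult_left_mono mult_strict_left_mono power_strict_mono power_mono) (auto intro: less_imp_le)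
    also have "\<dots> \<le> (2 * (1 + \<bar>r\<bar>) * d)\<^sup>2"
    proof -
      have "(2 * (1 + \<bar>r\<bar>))\<^sup>2 = 4 + 8 * \<bar>r\<bar> + 4 * \<bar>r\<bar>\<^sup>2" by (simp add: power2_eq_square algebra_simps)
      then have "2 + 2 * r\<^sup>2 \<le> (2 * (1 + \<bar>r\<bar>))\<^sup>2" by simp
      from mult_right_mono[OF this, of "d\<^sup>2"] show ?thesis
        unfolding power_mult_distrib[of _ d] by (simp only: distrib_right mult.assoc) simp
    qed
    also have "2 * (1 + \<bar>r\<bar>) * d = e" by (simp add: d_def add_pos_nonneg)
    finally have "H1_norm (\<lambda>x. (w x - \<phi> x) + r * (w' x - \<psi> x)) < e"
      using \<open>e > 0\<close> by (simp add: power_less_imp_less_base)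
    then have "H1_norm (\<lambda>x. (w x + r * w' x) - (\<phi> x + r * \<psi> x)) < e" by (simp add: algebra_simps)
    then show "\<exists>\<phi>\<in>test_fun. H1_norm (\<lambda>x. w x + r * w' x - \<phi> x) < e"
      using test_fun_add[OF t(1,3), of r] by (intro bexI)
  qed
qed

text \<open>A test function is the primitive of its derivative, and this derivative has mean zero.
  Both properties survive the limit in H1, because the constant c and the mean of g are bounded by
  multiples of the H1 norm of w minus the test function.\<close>

lemma H10_traces:
  assumes "w \<in> H10" "has_weak_deriv w g"
  shows "AE x in U. w x = prim g x" "(LINT x|U. g x) = 0"
proof -
  obtain c where c: "AE x in U. w x = c + prim g x" and L: "w \<in> L2 U" "g \<in> L2 U"
    using assms(2) by (auto simp: has_weak_deriv_iff)
  have *: "\<bar>c\<bar> \<le> 2 * e \<and> \<bar>LINT x|U. g x\<bar> \<le> e" if e: "e > 0" for e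
  proof -
    obtain \<phi> where \<phi>: "\<phi> \<in> test_fun" "H1_norm (\<lambda>x. w x - \<phi> x) < e" using assms(1) e by (auto simp: H10_def)
    have d: "has_weak_deriv (\<lambda>x. w x - \<phi> x) (\<lambda>x. g x - deriv \<phi> x)"
      using has_weak_deriv_add[OF assms(2) has_weak_deriv_test[OF \<phi>(1)], of "-1"] by simp
    then have L': "(\<lambda>x. w x - \<phi> x) \<in> L2 U" "(\<lambda>x. g x - deriv \<phi> x) \<in> L2 U" by (auto simp: has_weak_deriv_def)
    have le: "sqrt (LINT x|U. (w x - \<phi> x)\<^sup>2) \<le> e" "sqrt (LINT x|U. (g x - deriv \<phi> x)\<^sup>2) \<le> e"
    proof -
      have "sqrt (LINT x|U. (w x - \<phi> x)\<^sup>2) \<le> H1_norm (\<lambda>x. w x - \<phi> x)"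
        "sqrt (LINT x|U. (g x - deriv \<phi> x)\<^sup>2) \<le> H1_norm (\<lambda>x. w x - \<phi> x)"
        unfolding H1_norm_eq[OF d] by (intro real_sqrt_le_mono; simp)+
      then show "sqrt (LINT x|U. (w x - \<phi> x)\<^sup>2) \<le> e" "sqrt (LINT x|U. (g x - deriv \<phi> x)\<^sup>2) \<le> e"
        using \<phi>(2) by linarith+
    qed
    have ig: "integrable U g" "integrable U (deriv \<phi>)" using L test_fun_L2[OF test_fun_diff(2)[OF \<phi>(1)]] by (auto intro: U.L2_integrable)
    have one: "(LINT x|U. \<bar>u x\<bar>) \<le> e" if "u \<in> L2 U" "sqrt (LINT x|U. (u x)\<^sup>2) \<le> e" for u
      by (rule order_trans[OF _ that(2)], rule real_le_rsqrt) (use U.L2_integral_square[OF that(1)] in simp)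
    have "AE x in U. c = (w x - \<phi> x) - prim (\<lambda>x. g x - deriv \<phi> x) x"
      using c AE_space by eventually_elim (simp add: prim_diff ig test_fun_prim[OF \<phi>(1)])
    then have "AE x in U. \<bar>c\<bar> \<le> \<bar>w x - \<phi> x\<bar> + e"
    proof eventually_elim
      case (elim x)
      have "\<bar>prim (\<lambda>x. g x - deriv \<phi> x) x\<bar> \<le> e" using abs_prim_L2[OF L'(2)] le(2) by (rule order_trans)
      then show ?case using elim by linarith
    qed
    then have "(LINT x|U. \<bar>c\<bar>) \<le> (LINT x|U. \<bar>w x - \<phi> x\<bar> + e)"
      using U.L2_integrable[OF L'(1)] by (intro integral_mono_AE) auto
    also have "\<dots> \<le> e + e" using one[OF L'(1) le(1)] U.L2_integrable[OF L'(1)] by simp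
    finally have 1: "\<bar>c\<bar> \<le> 2 * e" by simp
    have "(LINT x|U. deriv \<phi> x) = 0"
      using test_fun_prim[OF \<phi>(1), of 1] test_fun_0[OF \<phi>(1), of 1] by (simp add: prim_1)
    then have "\<bar>LINT x|U. g x\<bar> = \<bar>LINT x|U. g x - deriv \<phi> x\<bar>" using ig by simp
    also have "\<dots> \<le> (LINT x|U. \<bar>g x - deriv \<phi> x\<bar>)" by (rule integral_abs_bound)
    also have "\<dots> \<le> e" by (rule one[OF L'(2) le(2)])
    finally show ?thesis using 1 by simp
  qed
  have "c = 0"
    using *[of "\<bar>c\<bar> / 4"] by (cases "c = 0") auto
  then show "AE x in U. w x = prim g x" using c by simp
  show "(LINT x|U. g x) = 0"
    using *[of "\<bar>LINT x|U. g x\<bar> / 2"] by (cases "(LINT x|U. g x) = 0") auto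
qed

subsection \<open>Weak space derivatives on the square\<close>

lemma has_weak_dxD:
  assumes "has_weak_dx w g"
  shows "w \<in> L2 US" "g \<in> L2 US" "AE t in U. has_weak_deriv (\<lambda>x. w (x, t)) (\<lambda>x. g (x, t))"
  using assms by (auto simp: has_weak_dx_def unit_square_def)

lemma has_weak_dx_unique:
  assumes "has_weak_dx w g" "has_weak_dx w g'"
  shows "AE p in US. g p = g' p"
proof (rule AE_US_eqI)
  show "AE t in U. AE x in U. g (x, t) = g' (x, t)"
    using has_weak_dxD(3)[OF assms(1)] has_weak_dxD(3)[OF assms(2)]
    by eventually_elim (rule has_weak_deriv_unique)
qed (use has_weak_dxD[OF assms(1)] has_weak_dxD[OF assms(2)] in \<open>auto dest: L2D\<close>)

text \<open>Since \<open>weak_dx\<close> is a choice of representative, it is known only up to null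
  sets; this lemma permits the exchange of representatives.\<close>

lemma has_weak_dx_cong:
  assumes "has_weak_dx w g" "w' \<in> borel_measurable US" "g' \<in> borel_measurable US"
    "AE p in US. w' p = w p" "AE p in US. g' p = g p"
  shows "has_weak_dx w' g'"
proof -
  note h = has_weak_dxD[OF assms(1)]
  have L: "w' \<in> L2 US" "g' \<in> L2 US" using assms h L2_cong_AE by blast+
  have "AE t in U. has_weak_deriv (\<lambda>x. w' (x, t)) (\<lambda>x. g' (x, t))"
    using h(3) L2_slices(1)[OF L(1)] L2_slices(1)[OF L(2)] AE_US_D(2)[OF assms(4)] AE_US_D(2)[OF assms(5)]
  proof eventually_elim
    case (elim t)
    then obtain c where c: "AE x in U. w (x, t) = c + prim (\<lambda>x. g (x, t)) x" and g: "(\<lambda>x. g (x, t)) \<in> L2 U"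
      by (auto simp: has_weak_deriv_iff)
    have "prim (\<lambda>x. g (x, t)) = prim (\<lambda>x. g' (x, t))"
      using elim g by (intro ext prim_cong_AE) (auto dest: L2D)
    then have "AE x in U. w' (x, t) = c + prim (\<lambda>x. g' (x, t)) x"
      using c elim(4) by auto
    then show ?case using elim by (auto simp: has_weak_deriv_iff)
  qed
  then show ?thesis using L by (simp add: has_weak_dx_def unit_square_def)
qed

lemma has_weak_dx_add:
  assumes "has_weak_dx w g" "has_weak_dx w' g'"
  shows "has_weak_dx (\<lambda>p. w p + r * w' p) (\<lambda>p. g p + r * g' p)"
proof -
  note h = has_weak_dxD[OF assms(1)] has_weak_dxD[OF assms(2)]
  have "AE t in U. has_weak_deriv (\<lambda>x. w (x, t) + r * w' (x, t)) (\<lambda>x. g (x, t) + r * g' (x, t))"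
    using h(3,6) by eventually_elim (rule has_weak_deriv_add)
  then show ?thesis using h by (auto simp: has_weak_dx_def unit_square_def)
qed

lemma has_weak_dx_weak_dx: "has_weak_dx w g \<Longrightarrow> has_weak_dx w (weak_dx w)"
  unfolding weak_dx_def by (rule someI[of "has_weak_dx w"])

lemma weak_dx_AE:
  assumes "has_weak_dx w g" shows "AE p in US. weak_dx w p = g p"
  by (rule has_weak_dx_unique[OF has_weak_dx_weak_dx[OF assms] assms])

text \<open>\<open>V_space\<close> speaks of some first and second derivative, the action of
  iterated \<open>weak_dx\<close>. The chosen first derivative differs from the given one on a null
  set only, so it has a weak derivative, too.\<close>

lemma V_spaceD:
  assumes "v \<in> V_space"
  shows "has_weak_dx v (weak_dx v)" "has_weak_dx (weak_dx v) (weak_dx (weak_dx v))"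
    "AE t in U. (\<lambda>x. v (x, t)) \<in> H10"
proof -
  from assms obtain g h where g: "has_weak_dx v g" "has_weak_dx g h" and "AE t in U. (\<lambda>x. v (x, t)) \<in> H10"
    by (auto simp: V_space_def)
  then show "AE t in U. (\<lambda>x. v (x, t)) \<in> H10" "has_weak_dx v (weak_dx v)" by (auto intro: has_weak_dx_weak_dx)
  have "has_weak_dx (weak_dx v) h"
    using has_weak_dx_cong[OF g(2) _ _ weak_dx_AE[OF g(1)]] has_weak_dxD[OF has_weak_dx_weak_dx[OF g(1)]] has_weak_dxD[OF g(2)]
    by (auto dest: L2D)
  then show "has_weak_dx (weak_dx v) (weak_dx (weak_dx v))" by (rule has_weak_dx_weak_dx)
qed

lemma V_space_add:
  assumes "v \<in> V_space" "u \<in> V_space"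
  shows "(\<lambda>p. v p + r * u p) \<in> V_space"
    "AE p in US. weak_dx (\<lambda>p. v p + r * u p) p = weak_dx v p + r * weak_dx u p"
    "AE p in US. weak_dx (weak_dx (\<lambda>p. v p + r * u p)) p = weak_dx (weak_dx v) p + r * weak_dx (weak_dx u) p"
proof -
  note v = V_spaceD[OF assms(1)] and u = V_spaceD[OF assms(2)]
  have 1: "has_weak_dx (\<lambda>p. v p + r * u p) (\<lambda>p. weak_dx v p + r * weak_dx u p)"
    by (rule has_weak_dx_add[OF v(1) u(1)])
  have 2: "has_weak_dx (\<lambda>p. weak_dx v p + r * weak_dx u p) (\<lambda>p. weak_dx (weak_dx v) p + r * weak_dx (weak_dx u) p)"
    by (rule has_weak_dx_add[OF v(2) u(2)])
  have "AE t in U. (\<lambda>x. v (x, t) + r * u (x, t)) \<in> H10"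
    using v(3) u(3) by eventually_elim (rule H10_add)
  then show V: "(\<lambda>p. v p + r * u p) \<in> V_space" using 1 2 by (auto simp: V_space_def)
  show e: "AE p in US. weak_dx (\<lambda>p. v p + r * u p) p = weak_dx v p + r * weak_dx u p" by (rule weak_dx_AE[OF 1])
  have "has_weak_dx (weak_dx (\<lambda>p. v p + r * u p)) (\<lambda>p. weak_dx (weak_dx v) p + r * weak_dx (weak_dx u) p)"
    using has_weak_dx_cong[OF 2 _ _ e] has_weak_dxD[OF V_spaceD(1)[OF V]] has_weak_dxD[OF 2] by (auto dest: L2D)
  then show "AE p in US. weak_dx (weak_dx (\<lambda>p. v p + r * u p)) p = weak_dx (weak_dx v) p + r * weak_dx (weak_dx u) p"
    by (rule weak_dx_AE)
qed

section \<open>The velocity field and its flow\<close>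

subsection \<open>Velocity fields with square integrable second derivative\<close>

lemma measurable_U_I:
  assumes "f \<in> borel_measurable M" "\<And>x. x \<in> space M \<Longrightarrow> 0 < f x \<and> f x < 1"
  shows "f \<in> measurable M U"
  unfolding unit_interval_def
  by (rule measurable_restrict_space2) (use assms in auto)

text \<open>Lets identities proved for t in [0, 1] be used for all t.\<close>

lemma prim_clamp: "prim k t = prim k (max 0 (min 1 t))"
  unfolding prim_def by (rule Bochner_Integration.integral_cong) auto

lemma prim_nonneg: "(\<And>r. 0 < r \<Longrightarrow> r < 1 \<Longrightarrow> 0 \<le> k r) \<Longrightarrow> 0 \<le> prim k t"
  unfolding prim_def by (intro integral_nonneg_AE AE_I2) auto

lemma prim_chain_all:
  assumes "\<And>x. (\<Phi> has_real_derivative \<Phi>' x) (at x)" "continuous_on UNIV \<Phi>'" "k \<in> L2 U"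
  shows "\<Phi> (c + prim k t) = \<Phi> c + prim (\<lambda>r. \<Phi>' (c + prim k r) * k r) t"
  using prim_chain[OF assms, of "max 0 (min 1 t)" c] by (simp flip: prim_clamp)

lemma prim_mult_all:
  assumes "k1 \<in> L2 U" "k2 \<in> L2 U"
  shows "(c1 + prim k1 t) * (c2 + prim k2 t) =
    c1 * c2 + prim (\<lambda>r. k1 r * (c2 + prim k2 r) + (c1 + prim k1 r) * k2 r) t"
  using prim_mult[OF assms, of "max 0 (min 1 t)" c1 c2] by (simp flip: prim_clamp)

lemma exp_prim:
  assumes "k \<in> L2 U" shows "exp (c * prim k t) = 1 + prim (\<lambda>r. c * exp (c * prim k r) * k r) t"
proof -
  have "((\<lambda>x. exp (c * x)) has_real_derivative c * exp (c * x)) (at x)" for x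
    by (auto intro!: derivative_eq_intros)
  from prim_chain_all[OF this _ assms, of 0 t] show ?thesis
    by (simp add: continuous_on_mult continuous_on_exp continuous_on_const continuous_on_id)
qed

text \<open>h stands for v_xx. L2 slices are required at every time, not at almost every one, so
  that the velocity is defined and Lipschitz in x for all t in (0, 1); a null set of times has to be
  repaired beforehand.\<close>

locale velocity =
  fixes h :: "real \<times> real \<Rightarrow> real"
  assumes h_L2: "h \<in> L2 US"
    and h_slice: "\<And>t. 0 < t \<Longrightarrow> t < 1 \<Longrightarrow> (\<lambda>\<xi>. h (\<xi>, t)) \<in> L2 U"
begin

text \<open>The Lipschitz constant of \<open>vel\<close> at time t: the kernel of
  \<open>vel_x\<close> is bounded by 1.\<close>

definition lip :: "real \<Rightarrow> real"
  where "lip t = (LINT \<xi>|U. \<bar>h (\<xi>, t)\<bar>)"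

text \<open>The kernel is the x-derivative of the Green's function in \<open>vel\<close>.\<close>

definition vel_x :: "real \<Rightarrow> real \<Rightarrow> real"
  where "vel_x x t = (LINT \<xi>|U. ((if \<xi> \<le> x then 1 else 0) - (1 - \<xi>)) * h (\<xi>, t))"

text \<open>\<open>vel\<close> is the Green's function representation of the solution of \<open>v\<^sub>x\<^sub>x = h\<close> with
  \<open>v = 0\<close> at \<open>0\<close> and \<open>1\<close>; the formula also extends it to all \<open>x\<close> as a \<open>C\<^sup>1\<close> function.\<close>

definition vel :: "real \<Rightarrow> real \<Rightarrow> real"
  where "vel x t = (LINT \<xi>|U. (max 0 (x - \<xi>) - x * (1 - \<xi>)) * h (\<xi>, t))"

lemma h_measurable [measurable]: "h \<in> borel_measurable US"
  using h_L2 by (rule L2D)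

lemma h_integrable: "0 < t \<Longrightarrow> t < 1 \<Longrightarrow> integrable U (\<lambda>\<xi>. h (\<xi>, t))"
  using h_slice by (intro U.L2_integrable)

lemma measurable_vel_x [measurable (raw)]:
  assumes [measurable]: "X \<in> borel_measurable M" "T \<in> measurable M U"
  shows "(\<lambda>p. vel_x (X p) (T p)) \<in> borel_measurable M"
  unfolding vel_x_def by measurable

lemma measurable_vel [measurable (raw)]:
  assumes [measurable]: "X \<in> borel_measurable M" "T \<in> measurable M U"
  shows "(\<lambda>p. vel (X p) (T p)) \<in> borel_measurable M"
  unfolding vel_def by measurable

lemma measurable_lip [measurable]: "lip \<in> borel_measurable U"
  unfolding lip_def[abs_def] by measurable

lemma lip_nonneg: "0 \<le> lip t"
  by (simp add: lip_def)

lemma lip_L2: "lip \<in> L2 U"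
proof (rule L2I[OF measurable_lip], rule Bochner_Integration.integrable_bound)
  show "integrable U (\<lambda>t. LINT \<xi>|U. (h (\<xi>, t))\<^sup>2)" using US_Fubini(3)[OF L2D(2)[OF h_L2]] .
  show "AE t in U. norm ((lip t)\<^sup>2) \<le> norm (LINT \<xi>|U. (h (\<xi>, t))\<^sup>2)"
    using U.L2_integral_square[OF h_slice] by (auto simp: lip_def)
qed measurable

lemma lip_integrable: "integrable U lip"
  using lip_L2 by (rule U.L2_integrable)

lemma kernel_integrable:
  assumes t: "0 < t" "t < 1" and [measurable]: "k \<in> borel_measurable U" and b: "\<And>\<xi>. 0 < \<xi> \<Longrightarrow> \<xi> < 1 \<Longrightarrow> \<bar>k \<xi>\<bar> \<le> C"
  shows "integrable U (\<lambda>\<xi>. k \<xi> * h (\<xi>, t))" "\<bar>LINT \<xi>|U. k \<xi> * h (\<xi>, t)\<bar> \<le> C * lip t"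
proof -
  note h_slice[OF t, THEN L2D(1), measurable]
  show i: "integrable U (\<lambda>\<xi>. k \<xi> * h (\<xi>, t))"
    by (rule U.L2_integrable, rule L2_mult_bdd[OF h_slice[OF t], where C = C]) (use b in auto)
  have "\<bar>LINT \<xi>|U. k \<xi> * h (\<xi>, t)\<bar> \<le> (LINT \<xi>|U. \<bar>k \<xi> * h (\<xi>, t)\<bar>)" by (rule integral_abs_bound)
  also have "\<dots> \<le> (LINT \<xi>|U. C * \<bar>h (\<xi>, t)\<bar>)"
    by (intro integral_mono integrable_abs integrable_mult_right i h_integrable[OF t])
       (use b in \<open>auto simp: abs_mult intro!: mult_right_mono\<close>)
  finally show "\<bar>LINT \<xi>|U. k \<xi> * h (\<xi>, t)\<bar> \<le> C * lip t" by (simp add: lip_def)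
qed

lemma abs_vel_x_le:
  assumes "0 < t" "t < 1" shows "\<bar>vel_x x t\<bar> \<le> lip t"
  using kernel_integrable(2)[OF assms, of "\<lambda>\<xi>. (if \<xi> \<le> x then 1 else 0) - (1 - \<xi>)" 1]
  by (auto simp: vel_x_def)

text \<open>The Green's function is piecewise linear in x with slopes \<xi> - 1 and \<xi>, both at
  most 1 in absolute value.\<close>

lemma vel_kernel_bound:
  fixes x y \<xi> :: real
  shows "0 < \<xi> \<Longrightarrow> \<xi> < 1 \<Longrightarrow> \<bar>(max 0 (x - \<xi>) - x * (1 - \<xi>)) - (max 0 (y - \<xi>) - y * (1 - \<xi>))\<bar> \<le> \<bar>x - y\<bar>"
proof (induction x y rule: linorder_wlog)
  case (le x y)
  have "0 \<le> (y - x) * \<xi>" "0 \<le> (y - x) * (1 - \<xi>)" using le by auto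
  then show ?case by (auto simp: algebra_simps abs_if max_def)
qed (simp add: abs_minus_commute)

lemma vel_int: "0 < t \<Longrightarrow> t < 1 \<Longrightarrow> integrable U (\<lambda>\<xi>. (max 0 (x - \<xi>) - x * (1 - \<xi>)) * h (\<xi>, t))"
  using kernel_integrable(1)[of t "\<lambda>\<xi>. max 0 (x - \<xi>) - x * (1 - \<xi>)" "\<bar>x\<bar>"] vel_kernel_bound[of _ x 0] by simp

lemma vel_x_int: "0 < t \<Longrightarrow> t < 1 \<Longrightarrow> integrable U (\<lambda>\<xi>. ((if \<xi> \<le> x then 1 else 0) - (1 - \<xi>)) * h (\<xi>, t))"
  using kernel_integrable(1)[of t "\<lambda>\<xi>. (if \<xi> \<le> x then 1 else 0) - (1 - \<xi>)" 1] by auto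

lemma vel_lipschitz:
  assumes t: "0 < t" "t < 1" shows "\<bar>vel x t - vel y t\<bar> \<le> lip t * \<bar>x - y\<bar>"
proof -
  have "vel x t - vel y t = (LINT \<xi>|U. ((max 0 (x - \<xi>) - x * (1 - \<xi>)) - (max 0 (y - \<xi>) - y * (1 - \<xi>))) * h (\<xi>, t))"
    unfolding vel_def
    by (subst Bochner_Integration.integral_diff[symmetric, OF vel_int[OF t] vel_int[OF t]])
       (simp add: left_diff_distrib)
  then show ?thesis
    using kernel_integrable(2)[OF t, of "\<lambda>\<xi>. (max 0 (x - \<xi>) - x * (1 - \<xi>)) - (max 0 (y - \<xi>) - y * (1 - \<xi>))" "\<bar>x - y\<bar>"] vel_kernel_bound
    by (simp add: mult.commute)
qed

lemma vel_0: "vel 0 t = 0"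
  unfolding vel_def by (subst Bochner_Integration.integral_cong[where g = "\<lambda>_. 0" and N = U]) auto

lemma vel_1: "vel 1 t = 0"
  unfolding vel_def by (subst Bochner_Integration.integral_cong[where g = "\<lambda>_. 0" and N = U]) auto

lemma abs_vel_le:
  assumes t: "0 < t" "t < 1" shows "\<bar>vel x t\<bar> \<le> lip t * \<bar>x\<bar>" "\<bar>vel x t\<bar> \<le> lip t * \<bar>1 - x\<bar>"
  using vel_lipschitz[OF t, of x 0] vel_lipschitz[OF t, of 1 x] by (simp_all add: vel_0 vel_1)

lemma vel_x_prim:
  assumes t: "0 < t" "t < 1" shows "vel_x x t = vel_x 0 t + prim (\<lambda>\<xi>. h (\<xi>, t)) x"
proof -
  have i: "integrable U (\<lambda>\<xi>. (1 - \<xi>) * h (\<xi>, t))"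
    by (rule kernel_integrable(1)[OF t, where C = 1]) auto
  have "vel_x y t = prim (\<lambda>\<xi>. h (\<xi>, t)) y - (LINT \<xi>|U. (1 - \<xi>) * h (\<xi>, t))" for y
  proof -
    have "vel_x y t = (LINT \<xi>|U. (if \<xi> \<le> y then h (\<xi>, t) else 0) - (1 - \<xi>) * h (\<xi>, t))"
      unfolding vel_x_def by (rule Bochner_Integration.integral_cong) (auto simp: left_diff_distrib)
    then show ?thesis using integrable_prim[OF h_integrable[OF t]] i by (simp add: prim_def)
  qed
  then show ?thesis by (simp add: prim_0)
qed

lemma continuous_vel_x: "0 < t \<Longrightarrow> t < 1 \<Longrightarrow> continuous_on S (\<lambda>x. vel_x x t)"
  by (subst vel_x_prim) (auto intro!: continuous_intros continuous_prim h_integrable)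

text \<open>The kernel of the linearisation error is at most |y - x| and lives between x and y. So
  the error is at most |y - x| times an increment of the primitive of |h(., t)|, which tends to 0 by
  continuity.\<close>

lemma vel_DERIV:
  assumes t: "0 < t" "t < 1" shows "((\<lambda>x. vel x t) has_real_derivative vel_x x t) (at x)"
proof -
  define P where "P = prim (\<lambda>\<xi>. \<bar>h (\<xi>, t)\<bar>)"
  have ah: "integrable U (\<lambda>\<xi>. \<bar>h (\<xi>, t)\<bar>)" using h_integrable[OF t] by simp
  have key: "\<bar>vel y t - vel x t - vel_x x t * (y - x)\<bar> \<le> \<bar>y - x\<bar> * \<bar>P y - P x\<bar>" for y
  proof -
    define k where "k \<xi> = (max 0 (y - \<xi>) - y * (1 - \<xi>)) - (max 0 (x - \<xi>) - x * (1 - \<xi>)) - ((if \<xi> \<le> x then 1 else 0) - (1 - \<xi>)) * (y - x)" for \<xi> :: real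
    define a b where "a = min x y" and "b = max x y"
    have kb: "\<bar>k \<xi>\<bar> \<le> (if a < \<xi> \<and> \<xi> \<le> b then \<bar>y - x\<bar> else 0)" for \<xi>
      unfolding k_def a_def b_def by (auto simp: algebra_simps max_def min_def abs_if)
    have "vel y t - vel x t - vel_x x t * (y - x) = (LINT \<xi>|U. k \<xi> * h (\<xi>, t))"
    proof -
      have "(LINT \<xi>|U. k \<xi> * h (\<xi>, t)) = (LINT \<xi>|U. (max 0 (y - \<xi>) - y * (1 - \<xi>)) * h (\<xi>, t) - (max 0 (x - \<xi>) - x * (1 - \<xi>)) * h (\<xi>, t)
        - ((if \<xi> \<le> x then 1 else 0) - (1 - \<xi>)) * h (\<xi>, t) * (y - x))"
        by (rule Bochner_Integration.integral_cong) (auto simp: k_def algebra_simps)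
      then show ?thesis unfolding vel_def vel_x_def using vel_int[OF t] vel_x_int[OF t]
        by (simp add: Bochner_Integration.integral_diff)
    qed
    also have "\<bar>\<dots>\<bar> \<le> (LINT \<xi>|U. \<bar>k \<xi> * h (\<xi>, t)\<bar>)" by (rule integral_abs_bound)
    also have "\<dots> \<le> (LINT \<xi>|U. \<bar>y - x\<bar> * (if a < \<xi> \<and> \<xi> \<le> b then \<bar>h (\<xi>, t)\<bar> else 0))"
    proof (rule integral_mono)
      have [measurable]: "k \<in> borel_measurable U" unfolding k_def[abs_def] by measurable
      note [measurable] = h_slice[OF t, THEN L2D(1)]
      show "integrable U (\<lambda>\<xi>. \<bar>k \<xi> * h (\<xi>, t)\<bar>)"
        by (intro integrable_abs kernel_integrable(1)[OF t, where C = "\<bar>y - x\<bar>"])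
           (auto intro!: order_trans[OF kb])
      show "integrable U (\<lambda>\<xi>. \<bar>y - x\<bar> * (if a < \<xi> \<and> \<xi> \<le> b then \<bar>h (\<xi>, t)\<bar> else 0))"
        by (intro integrable_mult_right Bochner_Integration.integrable_bound[OF ah]) auto
      show "\<bar>k \<xi> * h (\<xi>, t)\<bar> \<le> \<bar>y - x\<bar> * (if a < \<xi> \<and> \<xi> \<le> b then \<bar>h (\<xi>, t)\<bar> else 0)" for \<xi>
        using mult_right_mono[OF kb[of \<xi>], of "\<bar>h (\<xi>, t)\<bar>"] by (auto simp: abs_mult split: if_splits)
    qed
    also have "\<dots> = \<bar>y - x\<bar> * (P b - P a)"
      unfolding P_def by (subst prim_increment[OF ah]) (auto simp: a_def b_def)
    also have "P b - P a \<le> \<bar>P y - P x\<bar>" unfolding a_def b_def by (auto simp: max_def min_def)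
    finally show ?thesis by (simp add: mult_left_mono)
  qed
  show ?thesis
    unfolding DERIV_def
  proof (rule LIM_zero_cancel, rule Lim_null_comparison)
    show "\<forall>\<^sub>F d in at 0. norm ((vel (x + d) t - vel x t) / d - vel_x x t) \<le> \<bar>P (x + d) - P x\<bar>"
    proof (rule eventually_at_filter[THEN iffD2], rule always_eventually, intro allI impI)
      fix d :: real assume "d \<noteq> 0"
      have "\<bar>vel (x + d) t - vel x t - vel_x x t * d\<bar> \<le> \<bar>d\<bar> * \<bar>P (x + d) - P x\<bar>"
        using key[of "x + d"] by simp
      then have "\<bar>vel (x + d) t - vel x t - vel_x x t * d\<bar> / \<bar>d\<bar> \<le> \<bar>P (x + d) - P x\<bar>"
        using \<open>d \<noteq> 0\<close> by (simp add: pos_divide_le_eq mult.commute)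
      moreover have "(vel (x + d) t - vel x t) / d - vel_x x t = (vel (x + d) t - vel x t - vel_x x t * d) / d"
        using \<open>d \<noteq> 0\<close> by (simp add: field_simps)
      ultimately show "norm ((vel (x + d) t - vel x t) / d - vel_x x t) \<le> \<bar>P (x + d) - P x\<bar>"
        by simp
    qed
    have "isCont P x" using continuous_prim[OF ah, of UNIV] by (simp add: P_def continuous_on_eq_continuous_at)
    then have "((\<lambda>d. \<bar>P (x + d) - P x\<bar>) \<longlongrightarrow> \<bar>P x - P x\<bar>) (at 0)"
      by (intro tendsto_intros) (simp add: isCont_iff)
    then show "((\<lambda>d. \<bar>P (x + d) - P x\<bar>) \<longlongrightarrow> 0) (at 0)" by simp
  qed
qed

lemma vel_prim:
  assumes t: "0 < t" "t < 1" and x: "0 \<le> x" "x \<le> 1" shows "vel x t = prim (\<lambda>\<xi>. vel_x \<xi> t) x"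
  using prim_FTC[OF continuous_vel_x[OF t] x, of "\<lambda>x. vel x t"] vel_DERIV[OF t]
  by (auto simp: vel_0 intro: has_field_derivative_at_within)

subsection \<open>The flow\<close>

definition lip_total :: real where "lip_total = (LINT t|U. lip t)"

lemma vel_curve_integrable:
  assumes X: "continuous_on UNIV X" and C: "\<And>r. 0 < r \<Longrightarrow> r < 1 \<Longrightarrow> \<bar>X r\<bar> \<le> C"
  shows "(\<lambda>r. vel (X r) r) \<in> L2 U" "(\<lambda>r. vel_x (X r) r) \<in> L2 U"
proof -
  have [measurable]: "X \<in> borel_measurable U"
    using measurable_compose[OF borel_ident_U borel_measurable_continuous_onI[OF X]] .
  have "C \<ge> 0" using C[of "1/2"] by simp
  show "(\<lambda>r. vel (X r) r) \<in> L2 U"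
  proof (rule L2_bound)
    show "(\<lambda>r. C * lip r) \<in> L2 U" by (intro L2_cmult lip_L2)
    show "AE r in U. \<bar>vel (X r) r\<bar> \<le> \<bar>C * lip r\<bar>"
    proof (rule AE_I2)
      fix r assume "r \<in> space U"
      then have r: "0 < r" "r < 1" by auto
      have "\<bar>vel (X r) r\<bar> \<le> lip r * \<bar>X r\<bar>" by (rule abs_vel_le[OF r])
      also have "\<dots> \<le> lip r * C" by (intro mult_left_mono C r lip_nonneg)
      finally show "\<bar>vel (X r) r\<bar> \<le> \<bar>C * lip r\<bar>" using \<open>C \<ge> 0\<close> lip_nonneg[of r] by (simp add: mult.commute)
    qed
  qed measurable
  show "(\<lambda>r. vel_x (X r) r) \<in> L2 U"
    by (rule L2_bound[OF _ lip_L2]) (auto intro!: order_trans[OF abs_vel_x_le])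
qed

lemma continuous_bounded_01:
  assumes "continuous_on UNIV (X::real \<Rightarrow> real)"
  obtains C where "\<And>r. 0 \<le> r \<Longrightarrow> r \<le> 1 \<Longrightarrow> \<bar>X r\<bar> \<le> C"
proof -
  have "continuous_on {0..1} X" using assms by (rule continuous_on_subset) simp
  then have "bounded (X ` {0..1})" by (intro compact_imp_bounded compact_continuous_image) auto
  then obtain C where C: "\<forall>x\<in>{0..1}. \<bar>X x\<bar> \<le> C" by (auto simp: bounded_iff)
  show ?thesis by (rule that[of C]) (use C in auto)
qed

text \<open>Banach's fixed point theorem for the integral equation, in a norm with an exponential
  weight, since \<open>lip\<close> is not small.\<close>

lemma flow_exists: "\<exists>X. continuous_on UNIV X \<and> (\<forall>t. X t = y + prim (\<lambda>r. vel (X r) r) t)"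
proof -
  define A where "A = prim lip"
  have A: "0 \<le> A t" "A t \<le> lip_total" for t
    unfolding A_def lip_total_def using abs_prim_le[OF lip_integrable, of t] prim_nonneg[of lip t] lip_nonneg by auto
  have Ac: "continuous_on UNIV A" unfolding A_def by (intro continuous_prim lip_integrable)
  \<comment> \<open>W is (X - y) exp (- 2 A). The Picard operator contracts in the sup norm with
    weight exp (- 2 A), and this substitution makes that norm the plain one of bounded continuous
    functions.\<close>
  define X where "X W r = y + exp (2 * A r) * W r" for W :: "real \<Rightarrow> real" and r
  define op where "op W t = exp (- 2 * A t) * prim (\<lambda>r. vel (X W r) r) t" for W t
  have Xc: "continuous_on UNIV (X W)" if "continuous_on UNIV W" for W
    unfolding X_def using that Ac by (intro continuous_intros)
  have int: "integrable U (\<lambda>r. vel (X W r) r)" if W: "continuous_on UNIV W" for W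
  proof -
    obtain C where "\<And>r. 0 \<le> r \<Longrightarrow> r \<le> 1 \<Longrightarrow> \<bar>X W r\<bar> \<le> C" using continuous_bounded_01[OF Xc[OF W]] by blast
    then show ?thesis by (intro U.L2_integrable vel_curve_integrable(1)[OF Xc[OF W], of C]) auto
  qed
  have opb: "op W \<in> bcontfun" if W: "continuous_on UNIV W" for W
  proof (rule bcontfun_normI)
    show "continuous_on UNIV (op W)" unfolding op_def using Ac W by (intro continuous_intros continuous_prim int)
    fix t
    have "\<bar>op W t\<bar> \<le> 1 * (LINT r|U. \<bar>vel (X W r) r\<bar>)"
      unfolding op_def abs_mult using A[of t] by (intro mult_mono abs_prim_le int W) auto
    then show "norm (op W t) \<le> (LINT r|U. \<bar>vel (X W r) r\<bar>)" by simp
  qed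
  have contr: "\<bar>op W t - op W' t\<bar> \<le> 1/2 * d"
    if W: "continuous_on UNIV W" "continuous_on UNIV W'" and d: "\<And>r. \<bar>W r - W' r\<bar> \<le> d" for W W' t d
  proof -
    have "0 \<le> d" using d[of 0] by simp
    have "op W t - op W' t = exp (- 2 * A t) * prim (\<lambda>r. vel (X W r) r - vel (X W' r) r) t"
      unfolding op_def by (simp add: prim_diff int W right_diff_distrib)
    also have "\<bar>\<dots>\<bar> \<le> exp (- 2 * A t) * prim (\<lambda>r. \<bar>vel (X W r) r - vel (X W' r) r\<bar>) t"
    proof -
      have "\<bar>prim k t\<bar> \<le> prim (\<lambda>r. \<bar>k r\<bar>) t" if "integrable U k" for k
        unfolding prim_def using integral_abs_bound[of U "\<lambda>r. if r \<le> t then k r else 0"]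
        by (simp add: if_distrib[of abs] cong: if_cong)
      then show ?thesis by (simp add: abs_mult int W)
    qed
    \<comment> \<open>The integrand is d / 2 times the derivative of exp (2 A); this is the origin
      of the contraction factor 1 / 2.\<close>
    also have "\<dots> \<le> exp (- 2 * A t) * prim (\<lambda>r. (d / 2) * (2 * exp (2 * A r) * lip r)) t"
    proof (intro mult_left_mono prim_mono)
      show "integrable U (\<lambda>r. \<bar>vel (X W r) r - vel (X W' r) r\<bar>)" using int W by simp
      have "(\<lambda>r. exp (2 * A r)) \<in> borel_measurable U"
        using measurable_compose[OF borel_ident_U borel_measurable_continuous_onI[OF Ac]] by measurable
      then have "(\<lambda>r. exp (2 * A r) * lip r) \<in> L2 U"
        by (rule L2_mult_bdd[OF lip_L2, where C = "exp (2 * lip_total)"]) (use A in auto)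
      then show "integrable U (\<lambda>r. (d / 2) * (2 * exp (2 * A r) * lip r))"
        by (auto simp: mult.assoc intro: U.L2_integrable)
      fix r :: real assume r: "0 < r" "r < 1"
      have "\<bar>vel (X W r) r - vel (X W' r) r\<bar> \<le> lip r * \<bar>X W r - X W' r\<bar>" by (rule vel_lipschitz[OF r])
      also have "\<bar>X W r - X W' r\<bar> = exp (2 * A r) * \<bar>W r - W' r\<bar>"
        by (simp add: X_def abs_mult flip: right_diff_distrib)
      also have "lip r * (exp (2 * A r) * \<bar>W r - W' r\<bar>) \<le> lip r * (exp (2 * A r) * d)"
        by (intro mult_left_mono d lip_nonneg) auto
      finally show "\<bar>vel (X W r) r - vel (X W' r) r\<bar> \<le> (d / 2) * (2 * exp (2 * A r) * lip r)"
        by (simp add: algebra_simps)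
    qed auto
    also have "\<dots> = (d / 2) * (exp (- 2 * A t) * (exp (2 * A t) - 1))"
      unfolding prim_cmult A_def by (subst exp_prim[OF lip_L2]) simp
    also have "\<dots> = (d / 2) * (1 - exp (- 2 * A t))" by (simp add: right_diff_distrib flip: exp_add)
    also have "\<dots> \<le> (d / 2) * 1" using \<open>0 \<le> d\<close> by (intro mult_left_mono) auto
    finally show ?thesis by simp
  qed
  have "\<exists>!W::real \<Rightarrow>\<^sub>C real. Bcontfun (op (apply_bcontfun W)) = W"
  proof (rule banach_fix_type[where c = "1/2"], simp, simp, intro allI)
    fix W W' :: "real \<Rightarrow>\<^sub>C real"
    show "dist (Bcontfun (op W)) (Bcontfun (op W')) \<le> 1/2 * dist W W'"
    proof (rule dist_bound)
      fix t
      have "\<bar>op W t - op W' t\<bar> \<le> 1/2 * dist W W'"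
        by (rule contr) (use dist_bounded[of W _ W'] in \<open>auto simp: dist_real_def\<close>)
      then show "dist (Bcontfun (op W) t) (Bcontfun (op W') t) \<le> 1/2 * dist W W'"
        by (simp add: Bcontfun_inverse opb dist_real_def)
    qed
  qed
  then obtain W :: "real \<Rightarrow>\<^sub>C real" where W: "Bcontfun (op W) = W" by blast
  have fixed: "op W t = W t" for t using arg_cong[OF W, of "\<lambda>F. apply_bcontfun F t"] by (simp add: Bcontfun_inverse opb)
  have "X W t = y + prim (\<lambda>r. vel (X W r) r) t" for t
  proof -
    have "exp (2 * A t) * op W t = prim (\<lambda>r. vel (X W r) r) t"
      unfolding op_def by (simp add: exp_minus)
    then show ?thesis unfolding fixed by (subst X_def) simp
  qed
  moreover have "continuous_on UNIV (X W)" by (rule Xc) simp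
  ultimately show ?thesis by (intro exI[of _ "X W"] conjI allI)
qed

text \<open>The difference q of the curves satisfies q' = m q with m the difference quotient of the
  velocity, and exp (- \<open>prim m\<close>) is an integrating factor. Taking \<open>vel_x\<close>
  where the curves meet keeps m bounded by \<open>lip\<close>. The resulting formula yields
  monotonicity, both Lipschitz bounds and the derivative of the flow.\<close>

lemma curves_difference:
  assumes X: "continuous_on UNIV X" "\<And>t. X t = y + prim (\<lambda>r. vel (X r) r) t"
    and X': "continuous_on UNIV X'" "\<And>t. X' t = y' + prim (\<lambda>r. vel (X' r) r) t"
  defines "m \<equiv> \<lambda>r. if X r = X' r then vel_x (X r) r else (vel (X r) r - vel (X' r) r) / (X r - X' r)"
  shows "X t - X' t = (y - y') * exp (prim m t)" "m \<in> L2 U" "\<And>r. 0 < r \<Longrightarrow> r < 1 \<Longrightarrow> \<bar>m r\<bar> \<le> lip r"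
proof -
  have [measurable]: "X \<in> borel_measurable U" "X' \<in> borel_measurable U"
    using measurable_compose[OF borel_ident_U borel_measurable_continuous_onI[OF X(1)]]
      measurable_compose[OF borel_ident_U borel_measurable_continuous_onI[OF X'(1)]] by simp_all
  show m_le: "\<bar>m r\<bar> \<le> lip r" if "0 < r" "r < 1" for r
    using vel_lipschitz[OF that, of "X r" "X' r"] abs_vel_x_le[OF that] by (auto simp: m_def pos_divide_le_eq)
  have "m \<in> borel_measurable U" unfolding m_def by measurable
  then show mL: "m \<in> L2 U" by (rule L2_bound[OF _ lip_L2]) (rule AE_I2, use m_le abs_ge_self order_trans in fastforce)
  obtain C where C: "\<And>r. 0 \<le> r \<Longrightarrow> r \<le> 1 \<Longrightarrow> \<bar>X r\<bar> \<le> C" using continuous_bounded_01[OF X(1)] by blast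
  obtain C' where C': "\<And>r. 0 \<le> r \<Longrightarrow> r \<le> 1 \<Longrightarrow> \<bar>X' r\<bar> \<le> C'" using continuous_bounded_01[OF X'(1)] by blast
  define q where "q r = X r - X' r" for r
  have vL: "(\<lambda>r. vel (X r) r) \<in> L2 U" "(\<lambda>r. vel (X' r) r) \<in> L2 U"
    using vel_curve_integrable(1)[OF X(1), of C] vel_curve_integrable(1)[OF X'(1), of C'] C C' by auto
  have dq: "m r * q r = vel (X r) r - vel (X' r) r" for r by (auto simp: m_def q_def)
  have q: "q t = (y - y') + prim (\<lambda>r. m r * q r) t" for t
    unfolding dq using U.L2_integrable[OF vL(1)] U.L2_integrable[OF vL(2)] X(2)[of t] X'(2)[of t] by (simp add: prim_diff q_def)
  have mqL: "(\<lambda>r. m r * q r) \<in> L2 U" unfolding dq using vL by auto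
  define E where "E t = exp (- 1 * prim m t)" for t
  have E: "E t = 1 + prim (\<lambda>r. - 1 * E r * m r) t" for t
    unfolding E_def by (rule exp_prim[OF mL])
  have pm: "\<bar>prim m t\<bar> \<le> (LINT r|U. \<bar>m r\<bar>)" for t by (intro abs_prim_le U.L2_integrable mL)
  have EL: "(\<lambda>r. - 1 * E r * m r) \<in> L2 U"
  proof (rule L2_mult_bdd[OF mL])
    show "(\<lambda>r. - 1 * E r) \<in> borel_measurable U" unfolding E_def
      using measurable_compose[OF borel_ident_U measurable_prim[OF U.L2_integrable[OF mL]]] by measurable
    show "\<bar>- 1 * E r\<bar> \<le> exp (LINT r|U. \<bar>m r\<bar>)" for r using pm[of r] by (auto simp: E_def)
  qed
  have "q t * E t = (y - y') * 1 + prim (\<lambda>r. m r * q r * E r + q r * (- 1 * E r * m r)) t"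
    using prim_mult_all[OF mqL EL, of "y - y'" t 1] by (simp only: flip: q E)
  also have "(\<lambda>r. m r * q r * E r + q r * (- 1 * E r * m r)) = (\<lambda>r. 0)" by (simp add: algebra_simps)
  finally have "q t * E t = y - y'" by (simp add: prim_def)
  then show "X t - X' t = (y - y') * exp (prim m t)" by (simp add: q_def E_def exp_minus field_simps)
qed

definition flow :: "real \<Rightarrow> real \<Rightarrow> real"
  where "flow t y = (SOME X. continuous_on UNIV X \<and> (\<forall>t. X t = y + prim (\<lambda>r. vel (X r) r) t)) t"

lemma flow_curve: "continuous_on UNIV (\<lambda>t. flow t y)" "flow t y = y + prim (\<lambda>r. vel (flow r y) r) t"
proof -
  define S where "S = (SOME X. continuous_on UNIV X \<and> (\<forall>t. X t = y + prim (\<lambda>r. vel (X r) r) t))"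
  note S = someI_ex[OF flow_exists[of y], folded S_def]
  have eq: "flow t y = S t" for t unfolding flow_def S_def ..
  show "continuous_on UNIV (\<lambda>t. flow t y)" unfolding eq using S by (rule conjunct1)
  show "flow t y = y + prim (\<lambda>r. vel (flow r y) r) t" unfolding eq by (rule spec[OF conjunct2[OF S]])
qed

definition slope :: "real \<Rightarrow> real \<Rightarrow> real \<Rightarrow> real"
  where "slope y y' r = (if flow r y = flow r y' then vel_x (flow r y) r
    else (vel (flow r y) r - vel (flow r y') r) / (flow r y - flow r y'))"

lemma flow_difference:
  "flow t y - flow t y' = (y - y') * exp (prim (slope y y') t)" "slope y y' \<in> L2 U"
  "0 < r \<Longrightarrow> r < 1 \<Longrightarrow> \<bar>slope y y' r\<bar> \<le> lip r"
  using curves_difference[OF flow_curve(1)[of y] flow_curve(2)[of _ y] flow_curve(1)[of y'] flow_curve(2)[of _ y']] unfolding slope_def[abs_def] by blast+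

lemma abs_prim_slope: "\<bar>prim (slope y y') t\<bar> \<le> lip_total"
proof -
  have "\<bar>prim (slope y y') t\<bar> \<le> (LINT r|U. \<bar>slope y y' r\<bar>)"
    by (intro abs_prim_le U.L2_integrable flow_difference)
  also have "\<dots> \<le> lip_total" unfolding lip_total_def
    by (intro integral_mono lip_integrable integrable_abs U.L2_integrable flow_difference(2)) (auto intro: flow_difference(3))
  finally show ?thesis .
qed

lemma flow_bounds:
  "exp (- lip_total) * \<bar>y - y'\<bar> \<le> \<bar>flow t y - flow t y'\<bar>" "\<bar>flow t y - flow t y'\<bar> \<le> exp lip_total * \<bar>y - y'\<bar>"
proof -
  have e: "exp (- lip_total) \<le> exp (prim (slope y y') t)" "exp (prim (slope y y') t) \<le> exp lip_total"
    using abs_prim_slope[of y y' t] by auto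
  show "exp (- lip_total) * \<bar>y - y'\<bar> \<le> \<bar>flow t y - flow t y'\<bar>" "\<bar>flow t y - flow t y'\<bar> \<le> exp lip_total * \<bar>y - y'\<bar>"
    unfolding flow_difference(1) abs_mult using mult_right_mono[OF e(1), of "\<bar>y - y'\<bar>"] mult_right_mono[OF e(2), of "\<bar>y - y'\<bar>"]
    by (simp_all add: mult.commute)
qed

lemma flow_less_iff: "flow t y < flow t y' \<longleftrightarrow> y < y'"
proof -
  have "flow t y - flow t y' < 0 \<longleftrightarrow> y - y' < 0"
    unfolding flow_difference(1) by (simp add: mult_less_0_iff)
  then show ?thesis by simp
qed

lemma flow_le_iff: "flow t y \<le> flow t y' \<longleftrightarrow> y \<le> y'"
  using flow_less_iff[of t y' y] by auto

lemma flow_eq_iff: "flow t y = flow t y' \<longleftrightarrow> y = y'"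
  using flow_le_iff[of t y y'] flow_le_iff[of t y' y] by auto

lemma flow_0: "flow t 0 = 0"
  using curves_difference(1)[OF flow_curve(1)[of 0] flow_curve(2)[of _ 0], of "\<lambda>_. 0" 0 t] by (simp add: vel_0 prim_def)

lemma flow_1: "flow t 1 = 1"
  using curves_difference(1)[OF flow_curve(1)[of 1] flow_curve(2)[of _ 1], of "\<lambda>_. 1" 1 t] by (simp add: vel_1 prim_def)

lemma flow_in: "0 < flow t y \<longleftrightarrow> 0 < y" "flow t y < 1 \<longleftrightarrow> y < 1" "0 \<le> flow t y \<longleftrightarrow> 0 \<le> y" "flow t y \<le> 1 \<longleftrightarrow> y \<le> 1"
  using flow_less_iff[of t 0 y] flow_less_iff[of t y 1] flow_le_iff[of t 0 y] flow_le_iff[of t y 1] by (auto simp: flow_0 flow_1)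

lemma continuous_flow: "continuous_on UNIV (\<lambda>p. flow (fst p) (snd p))"
  unfolding continuous_on_sequentially
proof (intro ballI allI impI, elim conjE)
  fix p and s :: "nat \<Rightarrow> real \<times> real" assume s: "s \<longlonglongrightarrow> p"
  have "(\<lambda>n. exp lip_total * \<bar>snd (s n) - snd p\<bar> + \<bar>flow (fst (s n)) (snd p) - flow (fst p) (snd p)\<bar>)
      \<longlonglongrightarrow> exp lip_total * \<bar>snd p - snd p\<bar> + \<bar>flow (fst p) (snd p) - flow (fst p) (snd p)\<bar>"
    by (intro tendsto_intros tendsto_snd[OF s] continuous_on_tendsto_compose[OF flow_curve(1) tendsto_fst[OF s]]) auto
  then have lim: "(\<lambda>n. exp lip_total * \<bar>snd (s n) - snd p\<bar> + \<bar>flow (fst (s n)) (snd p) - flow (fst p) (snd p)\<bar>) \<longlonglongrightarrow> 0"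
    by simp
  show "((\<lambda>p. flow (fst p) (snd p)) \<circ> s) \<longlonglongrightarrow> flow (fst p) (snd p)"
  proof (rule LIM_zero_cancel, rule Lim_null_comparison[OF _ lim], rule always_eventually, intro allI)
    fix n
    show "norm (((\<lambda>p. flow (fst p) (snd p)) \<circ> s) n - flow (fst p) (snd p))
        \<le> exp lip_total * \<bar>snd (s n) - snd p\<bar> + \<bar>flow (fst (s n)) (snd p) - flow (fst p) (snd p)\<bar>"
      using flow_bounds(2)[of "fst (s n)" "snd (s n)" "snd p"] by simp
  qed
qed

lemma measurable_flow [measurable (raw)]:
  assumes "T \<in> borel_measurable M" "Y \<in> borel_measurable M"
  shows "(\<lambda>p. flow (T p) (Y p)) \<in> borel_measurable M"
  using assms continuous_flow by (rule borel_measurable_continuous_Pair)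

lemma measurable_flow_U [measurable (raw)]:
  assumes [measurable]: "T \<in> borel_measurable M" "Y \<in> measurable M U"
  shows "(\<lambda>p. flow (T p) (Y p)) \<in> measurable M U"
proof (rule measurable_U_I)
  have [measurable]: "Y \<in> borel_measurable M" using measurable_compose[OF assms(2) borel_ident_U] .
  show "(\<lambda>p. flow (T p) (Y p)) \<in> borel_measurable M" by measurable
qed (use measurable_space[OF assms(2)] in \<open>auto simp: flow_in\<close>)

text \<open>Liouville's formula: along a trajectory the logarithm of the Jacobian grows with rate
  v_x. \<open>flow_DERIV\<close> identifies the exponential of this integral with the y-derivative
  of the flow.\<close>

definition logJ :: "real \<Rightarrow> real \<Rightarrow> real"
  where "logJ t y = prim (\<lambda>r. vel_x (flow r y) r) t"

lemma vel_x_flow_L2: "(\<lambda>r. vel_x (flow r y) r) \<in> L2 U" and vel_flow_L2: "(\<lambda>r. vel (flow r y) r) \<in> L2 U"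
proof -
  obtain C where "\<And>r. 0 \<le> r \<Longrightarrow> r \<le> 1 \<Longrightarrow> \<bar>flow r y\<bar> \<le> C" using continuous_bounded_01[OF flow_curve(1)[of y]] by blast
  then show "(\<lambda>r. vel_x (flow r y) r) \<in> L2 U" "(\<lambda>r. vel (flow r y) r) \<in> L2 U"
    using vel_curve_integrable[OF flow_curve(1), of y C] by auto
qed

lemma abs_logJ: "\<bar>logJ t y\<bar> \<le> lip_total"
proof -
  have "\<bar>logJ t y\<bar> \<le> (LINT r|U. \<bar>vel_x (flow r y) r\<bar>)"
    unfolding logJ_def by (intro abs_prim_le U.L2_integrable vel_x_flow_L2)
  also have "\<dots> \<le> lip_total" unfolding lip_total_def
    by (intro integral_mono lip_integrable integrable_abs U.L2_integrable vel_x_flow_L2) (auto intro: abs_vel_x_le)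
  finally show ?thesis .
qed

lemma continuous_flow_y: "continuous_on S (\<lambda>y. flow t y)"
  by (rule continuous_on_compose2[OF continuous_flow, of S "\<lambda>y. (t, y)", simplified]) (auto intro!: continuous_intros)

lemma continuous_logJ: "continuous_on UNIV (\<lambda>p. logJ (fst p) (snd p))"
  unfolding continuous_on_sequentially
proof (intro ballI allI impI, elim conjE)
  fix p and s :: "nat \<Rightarrow> real \<times> real" assume s: "s \<longlonglongrightarrow> p"
  note st = tendsto_fst[OF s] and sy = tendsto_snd[OF s]
  show "((\<lambda>p. logJ (fst p) (snd p)) \<circ> s) \<longlonglongrightarrow> logJ (fst p) (snd p)"
    unfolding o_def logJ_def prim_def
  proof (rule integral_dominated_convergence[OF _ _ lip_integrable])
    show "AE r in U. (\<lambda>i. if r \<le> fst (s i) then vel_x (flow r (snd (s i))) r else 0) \<longlonglongrightarrow> (if r \<le> fst p then vel_x (flow r (snd p)) r else 0)"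
      using AE_U_neq[of "fst p"] AE_space
    proof eventually_elim
      case (elim r)
      then have r: "0 < r" "r < 1" by auto
      have lim: "(\<lambda>i. vel_x (flow r (snd (s i))) r) \<longlonglongrightarrow> vel_x (flow r (snd p)) r"
        by (rule continuous_on_tendsto_compose[OF continuous_vel_x[OF r, of UNIV]],
            rule continuous_on_tendsto_compose[OF continuous_flow_y[of UNIV]]) (auto intro: sy)
      from elim consider "r < fst p" | "fst p < r" by linarith
      then show ?case
      proof cases
        case 1
        then have "\<forall>\<^sub>F i in sequentially. r < fst (s i)" using st by (auto dest: order_tendstoD)
        then have "\<forall>\<^sub>F i in sequentially. vel_x (flow r (snd (s i))) r = (if r \<le> fst (s i) then vel_x (flow r (snd (s i))) r else 0)"
          by eventually_elim auto
        then show ?thesis using 1 lim by (subst tendsto_cong[symmetric]) auto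
      next
        case 2
        then have "\<forall>\<^sub>F i in sequentially. fst (s i) < r" using st by (auto dest: order_tendstoD)
        then show ?thesis using 2
          by (intro tendsto_eventually) (erule eventually_mono, simp)
      qed
    qed
    show "AE r in U. norm (if r \<le> fst (s i) then vel_x (flow r (snd (s i))) r else 0) \<le> lip r" for i
      using abs_vel_x_le lip_nonneg by (intro AE_I2) auto
  qed measurable
qed

lemma measurable_logJ [measurable (raw)]:
  assumes "T \<in> borel_measurable M" "Y \<in> borel_measurable M"
  shows "(\<lambda>p. logJ (T p) (Y p)) \<in> borel_measurable M"
  using assms continuous_logJ by (rule borel_measurable_continuous_Pair)

text \<open>By \<open>flow_difference\<close> the difference quotient is the exponential of the time
  integral of \<open>slope\<close>, and the slopes tend to \<open>vel_x\<close> on the trajectory,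
  dominated by \<open>lip\<close>.\<close>

lemma flow_DERIV: "((\<lambda>y. flow t y) has_real_derivative exp (logJ t y)) (at y)"
  unfolding has_field_derivative_iff tendsto_at_iff_sequentially
proof (intro allI impI)
  fix s :: "nat \<Rightarrow> real" assume sn: "\<forall>i. s i \<in> UNIV - {y}" and s: "s \<longlonglongrightarrow> y"
  have "(\<lambda>n. prim (slope (s n) y) t) \<longlonglongrightarrow> logJ t y"
    unfolding logJ_def prim_def
  proof (rule integral_dominated_convergence[OF _ _ lip_integrable])
    have [measurable]: "slope a b \<in> borel_measurable U" for a b using flow_difference(2) by (rule L2D)
    show "(\<lambda>r. if r \<le> t then slope (s n) y r else 0) \<in> borel_measurable U" for n by measurable
    show "AE r in U. (\<lambda>n. if r \<le> t then slope (s n) y r else 0) \<longlonglongrightarrow> (if r \<le> t then vel_x (flow r y) r else 0)"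
    proof (rule AE_I2)
      fix r assume "r \<in> space U"
      then have r: "0 < r" "r < 1" by auto
      from vel_DERIV[OF r, of "flow r y"] obtain g where g: "\<And>z. vel z r - vel (flow r y) r = g z * (z - flow r y)"
        "isCont g (flow r y)" "g (flow r y) = vel_x (flow r y) r" unfolding CARAT_DERIV by blast
      have eq: "slope (s n) y r = g (flow r (s n))" for n
        using g(1)[of "flow r (s n)"] sn by (auto simp: slope_def flow_eq_iff)
      have "(\<lambda>n. g (flow r (s n))) \<longlonglongrightarrow> g (flow r y)"
        by (rule isCont_tendsto_compose[OF g(2)], rule continuous_on_tendsto_compose[OF continuous_flow_y[of UNIV] s]) auto
      then show "(\<lambda>n. if r \<le> t then slope (s n) y r else 0) \<longlonglongrightarrow> (if r \<le> t then vel_x (flow r y) r else 0)"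
        by (simp add: eq g(3))
    qed
    show "AE r in U. norm (if r \<le> t then slope (s n) y r else 0) \<le> lip r" for n
      using flow_difference(3) lip_nonneg by (intro AE_I2) auto
  qed measurable
  then have "(\<lambda>n. exp (prim (slope (s n) y) t)) \<longlonglongrightarrow> exp (logJ t y)" by (intro tendsto_intros)
  moreover have "exp (prim (slope (s n) y) t) = (flow t (s n) - flow t y) / (s n - y)" for n
    unfolding flow_difference(1) using sn by auto
  ultimately show "((\<lambda>y'. (flow t y' - flow t y) / (y' - y)) \<circ> s) \<longlonglongrightarrow> exp (logJ t y)"
    by (simp add: o_def)
qed

end

lemma prim_swap:
  assumes "integrable US g"
  shows "prim (\<lambda>r. prim (\<lambda>\<eta>. g (\<eta>, r)) y) t = prim (\<lambda>\<eta>. prim (\<lambda>r. g (\<eta>, r)) t) y"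
proof -
  note [measurable] = borel_measurable_integrable[OF assms]
  let ?f = "\<lambda>p. if fst p \<le> y \<and> snd p \<le> t then g p else 0"
  have i: "integrable US ?f"
    by (rule Bochner_Integration.integrable_bound[OF assms]) auto
  have "prim (\<lambda>r. prim (\<lambda>\<eta>. g (\<eta>, r)) y) t = (LINT r|U. LINT \<eta>|U. ?f (\<eta>, r))"
    unfolding prim_def by (intro Bochner_Integration.integral_cong) (auto intro!: Bochner_Integration.integral_cong)
  also have "\<dots> = (LINT \<eta>|U. LINT r|U. ?f (\<eta>, r))"
    using US_Fubini(2,4)[OF i] by simp
  also have "\<dots> = prim (\<lambda>\<eta>. prim (\<lambda>r. g (\<eta>, r)) t) y"
    unfolding prim_def by (intro Bochner_Integration.integral_cong) (auto intro!: Bochner_Integration.integral_cong)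
  finally show ?thesis .
qed

lemma measurable_prim_param [measurable (raw)]:
  assumes [measurable]: "(\<lambda>p. k (fst p) (snd p)) \<in> borel_measurable (M \<Otimes>\<^sub>M U)" "T \<in> borel_measurable M"
  shows "(\<lambda>p. prim (k p) (T p)) \<in> borel_measurable M"
proof -
  have "(\<lambda>(p, r). if r \<le> T p then k p r else 0) \<in> borel_measurable (M \<Otimes>\<^sub>M U)"
    using assms(1) by (simp add: case_prod_beta') measurable
  then show ?thesis unfolding prim_def by (rule U.borel_measurable_lebesgue_integral)
qed

context velocity
begin

subsection \<open>Change of variables along the flow\<close>

abbreviation jac :: "real \<Rightarrow> real \<Rightarrow> real"
  where "jac t y \<equiv> exp (logJ t y)"

lemma jac_bounds: "exp (- lip_total) \<le> jac t y" "jac t y \<le> exp lip_total"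
  using abs_logJ[of t y] by (auto simp: abs_le_iff)

lemma logJ_le: "logJ t y \<le> lip_total" "- lip_total \<le> logJ t y"
  using abs_logJ[of t y] by auto

lemma continuous_jac_y: "continuous_on S (\<lambda>y. jac t y)"
  by (intro continuous_on_exp continuous_on_compose2[OF continuous_logJ, of S "\<lambda>y. (t, y)", simplified])
     (auto intro!: continuous_intros)

text \<open>Stated as an identity of measures, so that nonnegative integrals, integrals and almost
  everywhere statements all transfer from this one substitution.\<close>

lemma distr_flow: "distr (density U (\<lambda>y. ennreal (jac t y))) U (flow t) = U"
proof (rule measure_eqI)
  fix A assume "A \<in> sets (distr (density U (\<lambda>y. ennreal (jac t y))) U (flow t))"
  then have A: "A \<in> sets U" by simp
  then have Ab [measurable]: "A \<in> sets borel" and A01: "A \<subseteq> {0<..<1}"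
    by (auto simp: sets_U)
  have fm: "flow t \<in> measurable U U" by measurable
  have "emeasure (distr (density U (\<lambda>y. ennreal (jac t y))) U (flow t)) A
      = (\<integral>\<^sup>+y. ennreal (jac t y) * indicator (flow t -` A \<inter> space U) y \<partial>U)"
    using A fm by (subst emeasure_distr) (auto simp: emeasure_density measurable_sets)
  also have "\<dots> = (\<integral>\<^sup>+y. ennreal (jac t y) * indicator (flow t -` A \<inter> space U) y * indicator {0<..<1} y \<partial>lborel)"
    unfolding unit_interval_def by (subst nn_integral_restrict_space) auto
  also have "\<dots> = (\<integral>\<^sup>+y. ennreal (indicator A (flow t y) * jac t y * indicator {0..1} y) \<partial>lborel)"
    using A01 by (intro nn_integral_cong) (auto simp: indicator_def flow_in)
  also have "\<dots> = (\<integral>\<^sup>+x. ennreal (indicator A x * indicator {flow t 0..flow t 1} x) \<partial>lborel)"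
    by (rule nn_integral_substitution[symmetric])
       (auto intro: flow_DERIV continuous_jac_y simp: set_borel_measurable_def)
  also have "\<dots> = (\<integral>\<^sup>+x. indicator A x \<partial>lborel)"
    using A01 by (intro nn_integral_cong) (auto simp: indicator_def flow_0 flow_1)
  also have "\<dots> = emeasure lborel A" by simp
  also have "\<dots> = emeasure U A"
    unfolding unit_interval_def using A01 by (subst emeasure_restrict_space) auto
  finally show "emeasure (distr (density U (\<lambda>y. ennreal (jac t y))) U (flow t)) A = emeasure U A" .
qed simp

lemma flow_t_measurable [measurable]: "flow t \<in> measurable U U"
  by measurable

lemma nn_flow_subst:
  assumes [measurable]: "f \<in> borel_measurable U"
  shows "(\<integral>\<^sup>+x. f x \<partial>U) = (\<integral>\<^sup>+y. ennreal (jac t y) * f (flow t y) \<partial>U)"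
proof -
  have "(\<integral>\<^sup>+x. f x \<partial>U) = (\<integral>\<^sup>+x. f x \<partial>distr (density U (\<lambda>y. ennreal (jac t y))) U (flow t))"
    by (simp add: distr_flow)
  also have "\<dots> = (\<integral>\<^sup>+y. f (flow t y) \<partial>density U (\<lambda>y. ennreal (jac t y)))"
    by (rule nn_integral_distr) (simp_all add: distr_flow)
  also have "\<dots> = (\<integral>\<^sup>+y. ennreal (jac t y) * f (flow t y) \<partial>U)"
    by (rule nn_integral_density) measurable
  finally show ?thesis .
qed

lemma flow_subst:
  fixes f :: "real \<Rightarrow> real"
  assumes [measurable]: "f \<in> borel_measurable U"
  shows "integrable U f \<longleftrightarrow> integrable U (\<lambda>y. jac t y * f (flow t y))"
    "(LINT x|U. f x) = (LINT y|U. jac t y * f (flow t y))"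
proof -
  have fm: "flow t \<in> measurable (density U (\<lambda>y. ennreal (jac t y))) U" by simp
  have "integrable U f \<longleftrightarrow> integrable (distr (density U (\<lambda>y. ennreal (jac t y))) U (flow t)) f"
    by (simp add: distr_flow)
  also have "\<dots> \<longleftrightarrow> integrable (density U (\<lambda>y. ennreal (jac t y))) (\<lambda>y. f (flow t y))"
    by (rule integrable_distr_eq[OF fm assms])
  also have "\<dots> \<longleftrightarrow> integrable U (\<lambda>y. jac t y * f (flow t y))"
    by (subst integrable_density) auto
  finally show "integrable U f \<longleftrightarrow> integrable U (\<lambda>y. jac t y * f (flow t y))" .
  have "(LINT x|U. f x) = (LINT x|distr (density U (\<lambda>y. ennreal (jac t y))) U (flow t). f x)"
    by (simp add: distr_flow)
  also have "\<dots> = (LINT y|density U (\<lambda>y. ennreal (jac t y)). f (flow t y))"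
    by (rule integral_distr[OF fm assms])
  also have "\<dots> = (LINT y|U. jac t y * f (flow t y))"
    by (subst integral_density) auto
  finally show "(LINT x|U. f x) = (LINT y|U. jac t y * f (flow t y))" .
qed

lemma AE_flow:
  assumes "AE x in U. P x" shows "AE y in U. P (flow t y)"
proof -
  have "AE x in distr (density U (\<lambda>y. ennreal (jac t y))) U (flow t). P x" unfolding distr_flow by (rule assms)
  then have "AE y in density U (\<lambda>y. ennreal (jac t y)). P (flow t y)"
    by (rule AE_distrD[rotated]) simp
  then show ?thesis by (subst (asm) AE_density) auto
qed

definition Flow :: "real \<times> real \<Rightarrow> real \<times> real"
  where "Flow p = (flow (snd p) (fst p), snd p)"

lemma Flow_pair [simp]: "Flow (y, t) = (flow t y, t)"
  by (simp add: Flow_def)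

lemma measurable_Flow [measurable]: "Flow \<in> measurable US US"
  unfolding Flow_def[abs_def] by measurable

lemma measurable_jac_US [measurable]: "(\<lambda>p. jac (snd p) (fst p)) \<in> borel_measurable US"
  by measurable

lemma distr_Flow: "distr (density US (\<lambda>p. ennreal (jac (snd p) (fst p)))) US Flow = US"
proof (rule measure_eqI)
  fix A assume "A \<in> sets (distr (density US (\<lambda>p. ennreal (jac (snd p) (fst p)))) US Flow)"
  then have A [measurable]: "A \<in> sets US" by simp
  have "emeasure (distr (density US (\<lambda>p. ennreal (jac (snd p) (fst p)))) US Flow) A
      = (\<integral>\<^sup>+p. ennreal (jac (snd p) (fst p)) * indicator (Flow -` A \<inter> space US) p \<partial>US)"
    using A measurable_Flow by (subst emeasure_distr) (auto simp: emeasure_density measurable_sets)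
  also have "\<dots> = (\<integral>\<^sup>+p. ennreal (jac (snd p) (fst p)) * indicator A (Flow p) \<partial>US)"
    by (intro nn_integral_cong) (auto simp: indicator_def)
  also have "\<dots> = (\<integral>\<^sup>+t. \<integral>\<^sup>+y. ennreal (jac t y) * indicator A (flow t y, t) \<partial>U \<partial>U)"
    by (subst UU.nn_integral_snd[symmetric]) auto
  also have "\<dots> = (\<integral>\<^sup>+t. \<integral>\<^sup>+x. indicator A (x, t) \<partial>U \<partial>U)"
    by (intro nn_integral_cong nn_flow_subst[symmetric]) measurable
  also have "\<dots> = (\<integral>\<^sup>+p. indicator A p \<partial>US)"
    by (rule UU.nn_integral_snd) measurable
  also have "\<dots> = emeasure US A" by simp
  finally show "emeasure (distr (density US (\<lambda>p. ennreal (jac (snd p) (fst p)))) US Flow) A = emeasure US A" .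
qed simp

lemma Flow_subst:
  fixes f :: "real \<times> real \<Rightarrow> real"
  assumes [measurable]: "f \<in> borel_measurable US"
  shows "integrable US f \<longleftrightarrow> integrable US (\<lambda>p. jac (snd p) (fst p) * f (Flow p))"
    "(LINT p|US. f p) = (LINT p|US. jac (snd p) (fst p) * f (Flow p))"
proof -
  have fm: "Flow \<in> measurable (density US (\<lambda>p. ennreal (jac (snd p) (fst p)))) US" by simp
  have "integrable US f \<longleftrightarrow> integrable (distr (density US (\<lambda>p. ennreal (jac (snd p) (fst p)))) US Flow) f"
    by (simp add: distr_Flow)
  also have "\<dots> \<longleftrightarrow> integrable (density US (\<lambda>p. ennreal (jac (snd p) (fst p)))) (\<lambda>p. f (Flow p))"
    by (rule integrable_distr_eq[OF fm assms])
  also have "\<dots> \<longleftrightarrow> integrable US (\<lambda>p. jac (snd p) (fst p) * f (Flow p))"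
    by (subst integrable_density) auto
  finally show "integrable US f \<longleftrightarrow> integrable US (\<lambda>p. jac (snd p) (fst p) * f (Flow p))" .
  have "(LINT x|US. f x) = (LINT x|distr (density US (\<lambda>p. ennreal (jac (snd p) (fst p)))) US Flow. f x)"
    by (simp add: distr_Flow)
  also have "\<dots> = (LINT p|density US (\<lambda>p. ennreal (jac (snd p) (fst p))). f (Flow p))"
    by (rule integral_distr[OF fm assms])
  also have "\<dots> = (LINT p|US. jac (snd p) (fst p) * f (Flow p))"
    by (subst integral_density) auto
  finally show "(LINT p|US. f p) = (LINT p|US. jac (snd p) (fst p) * f (Flow p))" .
qed

lemma AE_Flow:
  assumes "AE p in US. P p" shows "AE p in US. P (Flow p)"
proof -
  have "AE x in distr (density US (\<lambda>p. ennreal (jac (snd p) (fst p)))) US Flow. P x" unfolding distr_Flow by (rule assms)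
  then have "AE y in density US (\<lambda>p. ennreal (jac (snd p) (fst p))). P (Flow y)"
    by (rule AE_distrD[rotated]) simp
  then show ?thesis by (subst (asm) AE_density) auto
qed

lemma inverse_jac_le: "exp (- logJ t y) \<le> exp lip_total"
  using abs_logJ[of t y] by (auto simp: abs_le_iff)

lemma jac_cancel: "exp (- logJ t y) * (jac t y * z) = z"
  by (simp add: exp_minus)

lemma L2_Flow:
  assumes "f \<in> L2 US" shows "(\<lambda>p. f (Flow p)) \<in> L2 US"
proof (rule L2I)
  note [measurable] = L2D(1)[OF assms]
  show "(\<lambda>p. f (Flow p)) \<in> borel_measurable US" by measurable
  have i: "integrable US (\<lambda>p. jac (snd p) (fst p) * (f (Flow p))\<^sup>2)"
    using Flow_subst(1)[of "\<lambda>p. (f p)\<^sup>2"] L2D(2)[OF assms] by simp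
  show "integrable US (\<lambda>p. (f (Flow p))\<^sup>2)"
  proof (rule Bochner_Integration.integrable_bound)
    show "integrable US (\<lambda>p. exp lip_total * (jac (snd p) (fst p) * (f (Flow p))\<^sup>2))" using i by simp
    have "(f (Flow p))\<^sup>2 \<le> exp lip_total * (jac (snd p) (fst p) * (f (Flow p))\<^sup>2)" for p
      using mult_right_mono[OF inverse_jac_le[of "snd p" "fst p"], of "jac (snd p) (fst p) * (f (Flow p))\<^sup>2"]
      by (simp add: jac_cancel)
    then show "AE p in US. norm ((f (Flow p))\<^sup>2) \<le> norm (exp lip_total * (jac (snd p) (fst p) * (f (Flow p))\<^sup>2))"
      by (auto simp: abs_mult)
  qed measurable
qed

subsection \<open>The inverse flow\<close>

definition inv_flow :: "real \<Rightarrow> real \<Rightarrow> real"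
  where "inv_flow t = inv (flow t)"

lemma flow_surj: "\<exists>y. flow t y = x"
proof -
  \<comment> \<open>Since 0 is at rest, \<open>flow_bounds\<close> moves b and -b to distance at
    least |x| from 0, which brackets x for the intermediate value theorem.\<close>
  define b where "b = exp lip_total * \<bar>x\<bar>"
  have b: "0 \<le> b" "exp (- lip_total) * b = \<bar>x\<bar>" by (auto simp: b_def exp_minus)
  have "\<bar>x\<bar> \<le> \<bar>flow t b\<bar>" "\<bar>x\<bar> \<le> \<bar>flow t (- b)\<bar>"
    using flow_bounds(1)[of b 0 t] flow_bounds(1)[of "- b" 0 t] b by (simp_all add: flow_0)
  moreover have "0 \<le> flow t b" "flow t (- b) \<le> 0" using flow_le_iff[of t 0 b] flow_le_iff[of t "- b" 0] b by (simp_all add: flow_0)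
  ultimately have "flow t (- b) \<le> x" "x \<le> flow t b" by linarith+
  then show ?thesis using IVT'[of "flow t" "- b" x b] b continuous_flow_y[of "{- b..b}" t] by auto
qed

lemma flow_inv [simp]: "flow t (inv_flow t x) = x"
  unfolding inv_flow_def using flow_surj[of t x] by (metis f_inv_into_f rangeI)

lemma inv_flow [simp]: "inv_flow t (flow t y) = y"
  using flow_eq_iff[of t] flow_inv by blast

lemma inv_flow_le_iff: "inv_flow t x \<le> y \<longleftrightarrow> x \<le> flow t y" "y \<le> inv_flow t x \<longleftrightarrow> flow t y \<le> x"
  using flow_le_iff[of t "inv_flow t x" y] flow_le_iff[of t y "inv_flow t x"] by auto

lemma inv_flow_in: "0 < inv_flow t x \<longleftrightarrow> 0 < x" "inv_flow t x < 1 \<longleftrightarrow> x < 1" "0 \<le> inv_flow t x \<longleftrightarrow> 0 \<le> x" "inv_flow t x \<le> 1 \<longleftrightarrow> x \<le> 1"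
  using flow_in[of t "inv_flow t x"] by auto

lemma inv_flow_0 [simp]: "inv_flow t 0 = 0" and inv_flow_1 [simp]: "inv_flow t 1 = 1"
  using inv_flow[of t 0] inv_flow[of t 1] by (simp_all add: flow_0 flow_1)

lemma inv_flow_lipschitz: "\<bar>inv_flow t x - inv_flow t x'\<bar> \<le> exp lip_total * \<bar>x - x'\<bar>"
  using flow_bounds(1)[of "inv_flow t x" "inv_flow t x'" t] by (simp add: exp_minus field_simps)

text \<open>The inverse maps have a Lipschitz constant independent of t. So it suffices to compare
  with the trajectory of the one point y that is the limit of the preimages.\<close>

lemma continuous_inv_flow: "continuous_on UNIV (\<lambda>p. inv_flow (fst p) (snd p))"
  unfolding continuous_on_sequentially
proof (intro ballI allI impI, elim conjE)
  fix p and s :: "nat \<Rightarrow> real \<times> real" assume s: "s \<longlonglongrightarrow> p"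
  define y where "y = inv_flow (fst p) (snd p)"
  have "(\<lambda>n. exp lip_total * (\<bar>snd (s n) - snd p\<bar> + \<bar>flow (fst p) y - flow (fst (s n)) y\<bar>))
      \<longlonglongrightarrow> exp lip_total * (\<bar>snd p - snd p\<bar> + \<bar>flow (fst p) y - flow (fst p) y\<bar>)"
    by (intro tendsto_intros tendsto_snd[OF s] continuous_on_tendsto_compose[OF flow_curve(1) tendsto_fst[OF s]]) auto
  then have lim: "(\<lambda>n. exp lip_total * (\<bar>snd (s n) - snd p\<bar> + \<bar>flow (fst p) y - flow (fst (s n)) y\<bar>)) \<longlonglongrightarrow> 0"
    by simp
  show "((\<lambda>p. inv_flow (fst p) (snd p)) \<circ> s) \<longlonglongrightarrow> inv_flow (fst p) (snd p)"
  proof (rule LIM_zero_cancel, rule Lim_null_comparison[OF _ lim], rule always_eventually, intro allI)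
    fix n
    have "\<bar>inv_flow (fst (s n)) (snd (s n)) - inv_flow (fst (s n)) (flow (fst (s n)) y)\<bar>
        \<le> exp lip_total * \<bar>snd (s n) - flow (fst (s n)) y\<bar>" by (rule inv_flow_lipschitz)
    also have "\<bar>snd (s n) - flow (fst (s n)) y\<bar> \<le> \<bar>snd (s n) - snd p\<bar> + \<bar>flow (fst p) y - flow (fst (s n)) y\<bar>"
      by (simp add: y_def)
    finally show "norm (((\<lambda>p. inv_flow (fst p) (snd p)) \<circ> s) n - inv_flow (fst p) (snd p))
        \<le> exp lip_total * (\<bar>snd (s n) - snd p\<bar> + \<bar>flow (fst p) y - flow (fst (s n)) y\<bar>)"
      by (simp add: y_def mult_left_mono)
  qed
qed

lemma measurable_inv_flow [measurable (raw)]: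
  assumes "T \<in> borel_measurable M" "Y \<in> borel_measurable M"
  shows "(\<lambda>p. inv_flow (T p) (Y p)) \<in> borel_measurable M"
  using assms continuous_inv_flow by (rule borel_measurable_continuous_Pair)

lemma measurable_inv_flow_U [measurable (raw)]:
  assumes [measurable]: "T \<in> borel_measurable M" "Y \<in> measurable M U"
  shows "(\<lambda>p. inv_flow (T p) (Y p)) \<in> measurable M U"
proof (rule measurable_U_I)
  have [measurable]: "Y \<in> borel_measurable M" using measurable_compose[OF assms(2) borel_ident_U] .
  show "(\<lambda>p. inv_flow (T p) (Y p)) \<in> borel_measurable M" by measurable
qed (use measurable_space[OF assms(2)] in \<open>auto simp: inv_flow_in\<close>)

lemma L2_inv_flow_US:
  assumes "g \<in> L2 US" shows "(\<lambda>p. g (inv_flow (snd p) (fst p), snd p)) \<in> L2 US"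
proof (rule L2I)
  note [measurable] = L2D(1)[OF assms]
  show "(\<lambda>p. g (inv_flow (snd p) (fst p), snd p)) \<in> borel_measurable US" by measurable
  have "(\<lambda>p. jac (snd p) (fst p) * (g p)\<^sup>2) \<in> borel_measurable US" by measurable
  then have "integrable US (\<lambda>p. jac (snd p) (fst p) * (g p)\<^sup>2)"
    by (rule Bochner_Integration.integrable_bound[OF integrable_mult_right[OF L2D(2)[OF assms], of "exp lip_total"]])
       (auto intro!: AE_I2 mult_right_mono jac_bounds)
  then show "integrable US (\<lambda>p. (g (inv_flow (snd p) (fst p), snd p))\<^sup>2)"
    by (subst Flow_subst(1)) (auto simp: Flow_def)
qed

lemma integral_inv_flow:
  fixes w :: "real \<Rightarrow> real"
  assumes [measurable]: "w \<in> borel_measurable U" "g \<in> borel_measurable U"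
  shows "(LINT x|U. w x * (g (inv_flow t x) * exp (- logJ t (inv_flow t x)))) = (LINT y|U. w (flow t y) * g y)"
    "integrable U (\<lambda>x. w x * (g (inv_flow t x) * exp (- logJ t (inv_flow t x)))) \<longleftrightarrow> integrable U (\<lambda>y. w (flow t y) * g y)"
proof -
  have m: "(\<lambda>x. w x * (g (inv_flow t x) * exp (- logJ t (inv_flow t x)))) \<in> borel_measurable U" by measurable
  show "(LINT x|U. w x * (g (inv_flow t x) * exp (- logJ t (inv_flow t x)))) = (LINT y|U. w (flow t y) * g y)"
    "integrable U (\<lambda>x. w x * (g (inv_flow t x) * exp (- logJ t (inv_flow t x)))) \<longleftrightarrow> integrable U (\<lambda>y. w (flow t y) * g y)"
    by (subst flow_subst[OF m, of t]; simp add: exp_minus field_simps)+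
qed

text \<open>The chain rule for the composition of \<open>prim g\<close> with the inverse flow,
  obtained by substitution in an integral instead of differentiation.\<close>

lemma prim_inv_flow:
  assumes [measurable]: "g \<in> borel_measurable U"
  shows "prim (\<lambda>\<xi>. g (inv_flow t \<xi>) * exp (- logJ t (inv_flow t \<xi>))) x = prim g (inv_flow t x)"
proof -
  have "prim (\<lambda>\<xi>. g (inv_flow t \<xi>) * exp (- logJ t (inv_flow t \<xi>))) x =
      (LINT \<xi>|U. (if \<xi> \<le> x then 1 else 0) * (g (inv_flow t \<xi>) * exp (- logJ t (inv_flow t \<xi>))))"
    unfolding prim_def by (intro Bochner_Integration.integral_cong) auto
  also have "\<dots> = (LINT y|U. (if flow t y \<le> x then 1 else 0) * g y)"
    by (rule integral_inv_flow) measurable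
  also have "\<dots> = prim g (inv_flow t x)"
    unfolding prim_def by (intro Bochner_Integration.integral_cong) (auto simp: inv_flow_le_iff)
  finally show ?thesis .
qed

lemma L2_inv_flow_deriv:
  assumes "g \<in> L2 U"
  shows "(\<lambda>\<xi>. g (inv_flow t \<xi>) * exp (- logJ t (inv_flow t \<xi>))) \<in> L2 U"
    "(LINT \<xi>|U. (g (inv_flow t \<xi>) * exp (- logJ t (inv_flow t \<xi>)))\<^sup>2) \<le> exp lip_total * (LINT y|U. (g y)\<^sup>2)"
proof -
  note [measurable] = L2D(1)[OF assms]
  have m: "(\<lambda>y. exp (- logJ t y) * (g y)\<^sup>2) \<in> borel_measurable U" by measurable
  have i: "integrable U (\<lambda>y. exp (- logJ t y) * (g y)\<^sup>2)"
    by (rule Bochner_Integration.integrable_bound[OF integrable_mult_right[OF L2D(2)[OF assms], of "exp lip_total"] m])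
       (auto intro!: AE_I2 mult_right_mono inverse_jac_le)
  have m2: "(\<lambda>\<xi>. (g (inv_flow t \<xi>) * exp (- logJ t (inv_flow t \<xi>)))\<^sup>2) \<in> borel_measurable U" by measurable
  have eq: "jac t y * (g y * exp (- logJ t y))\<^sup>2 = exp (- logJ t y) * (g y)\<^sup>2" for y
    by (simp add: power2_eq_square exp_minus field_simps)
  show "(\<lambda>\<xi>. g (inv_flow t \<xi>) * exp (- logJ t (inv_flow t \<xi>))) \<in> L2 U"
    using flow_subst(1)[OF m2, of t] i by (intro L2I) (simp_all add: eq)
  have "(LINT \<xi>|U. (g (inv_flow t \<xi>) * exp (- logJ t (inv_flow t \<xi>)))\<^sup>2) = (LINT y|U. exp (- logJ t y) * (g y)\<^sup>2)"
    using flow_subst(2)[OF m2, of t] by (simp add: eq)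
  also have "\<dots> \<le> (LINT y|U. exp lip_total * (g y)\<^sup>2)"
    by (intro integral_mono i integrable_mult_right L2D(2) assms mult_right_mono inverse_jac_le) auto
  finally show "(LINT \<xi>|U. (g (inv_flow t \<xi>) * exp (- logJ t (inv_flow t \<xi>)))\<^sup>2) \<le> exp lip_total * (LINT y|U. (g y)\<^sup>2)" by simp
qed

subsection \<open>The logarithm of the Jacobian as a Sobolev function\<close>

text \<open>v_xx along the flow times the Jacobian, that is the y-derivative of v_x(X(y, t), t). Its
  time integral \<open>dlogJ\<close> is the y-derivative of \<open>logJ\<close>.\<close>

definition hJ :: "real \<times> real \<Rightarrow> real"
  where "hJ p = jac (snd p) (fst p) * h (Flow p)"

definition dlogJ :: "real \<Rightarrow> real \<Rightarrow> real"
  where "dlogJ t \<eta> = prim (\<lambda>r. hJ (\<eta>, r)) t"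

text \<open>A majorant of \<open>dlogJ\<close> for all times at once; it makes later bounds uniform
  in time.\<close>

definition dlogJ_bound :: "real \<Rightarrow> real"
  where "dlogJ_bound \<eta> = (LINT r|U. \<bar>hJ (\<eta>, r)\<bar>)"

lemma hJ_L2: "hJ \<in> L2 US"
  unfolding hJ_def[abs_def]
  by (rule L2_mult_bdd[OF L2_Flow[OF h_L2], where C = "exp lip_total"]) (auto simp: logJ_le)

lemma measurable_hJ [measurable]: "hJ \<in> borel_measurable US"
  using hJ_L2 by (rule L2D)

lemma dlogJ_bound_L2: "dlogJ_bound \<in> L2 U"
proof (rule L2I)
  show m: "dlogJ_bound \<in> borel_measurable U" unfolding dlogJ_bound_def[abs_def] by measurable
  show "integrable U (\<lambda>p. (dlogJ_bound p)\<^sup>2)"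
  proof (rule Bochner_Integration.integrable_bound)
    show "integrable U (\<lambda>\<eta>. LINT r|U. (hJ (\<eta>, r))\<^sup>2)" using US_Fubini(1)[OF L2D(2)[OF hJ_L2]] .
    show "AE \<eta> in U. norm ((dlogJ_bound \<eta>)\<^sup>2) \<le> norm (LINT r|U. (hJ (\<eta>, r))\<^sup>2)"
      using L2_slices(2)[OF hJ_L2] by eventually_elim (auto dest: U.L2_integral_square simp: dlogJ_bound_def)
  qed (use m in measurable)
qed

lemma measurable_dlogJ [measurable (raw)]:
  assumes [measurable]: "T \<in> borel_measurable M" "Y \<in> measurable M U"
  shows "(\<lambda>p. dlogJ (T p) (Y p)) \<in> borel_measurable M"
  unfolding dlogJ_def by measurable

lemma abs_dlogJ: "AE \<eta> in U. \<forall>t. \<bar>dlogJ t \<eta>\<bar> \<le> dlogJ_bound \<eta>"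
  using L2_slices(2)[OF hJ_L2]
  by eventually_elim (auto simp: dlogJ_def dlogJ_bound_def intro!: abs_prim_le U.L2_integrable)

lemma dlogJ_L2: "dlogJ t \<in> L2 U"
proof (rule L2_bound[OF _ dlogJ_bound_L2])
  show "dlogJ t \<in> borel_measurable U" by measurable
  show "AE \<eta> in U. \<bar>dlogJ t \<eta>\<bar> \<le> \<bar>dlogJ_bound \<eta>\<bar>"
    using abs_dlogJ by eventually_elim (metis abs_ge_self order_trans)
qed

text \<open>Substitution along the flow writes \<open>vel_x\<close> at the moving point as a
  primitive in y; then the integrals over time and over y are exchanged.\<close>

lemma logJ_prim: "logJ t y = logJ t 0 + prim (dlogJ t) y"
proof -
  have I: "integrable US hJ" using hJ_L2 by (rule US.L2_integrable)
  have "vel_x (flow r y) r = vel_x (flow r 0) r + prim (\<lambda>\<eta>. hJ (\<eta>, r)) y" if r: "0 < r" "r < 1" for r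
  proof -
    have [measurable]: "(\<lambda>\<xi>. h (\<xi>, r)) \<in> borel_measurable U" using h_slice[OF r] by (rule L2D)
    have "prim (\<lambda>\<xi>. h (\<xi>, r)) (flow r y) = (LINT \<eta>|U. jac r \<eta> * (if flow r \<eta> \<le> flow r y then h (flow r \<eta>, r) else 0))"
      unfolding prim_def by (rule flow_subst(2)) measurable
    also have "\<dots> = prim (\<lambda>\<eta>. hJ (\<eta>, r)) y"
      unfolding prim_def by (intro Bochner_Integration.integral_cong) (auto simp: hJ_def flow_le_iff)
    finally show ?thesis by (subst vel_x_prim[OF r]) (simp add: flow_0)
  qed
  then have "logJ t y = prim (\<lambda>r. vel_x (flow r 0) r + prim (\<lambda>\<eta>. hJ (\<eta>, r)) y) t"
    unfolding logJ_def by (rule prim_cong)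
  also have "\<dots> = logJ t 0 + prim (\<lambda>r. prim (\<lambda>\<eta>. hJ (\<eta>, r)) y) t"
  proof -
    have "integrable US (\<lambda>p. if fst p \<le> y then hJ p else 0)"
      by (rule Bochner_Integration.integrable_bound[OF I]) auto
    from US_Fubini(3)[OF this] have "integrable U (\<lambda>r. prim (\<lambda>\<eta>. hJ (\<eta>, r)) y)"
      by (simp add: prim_def)
    then show ?thesis unfolding logJ_def by (rule prim_add[OF U.L2_integrable[OF vel_x_flow_L2]])
  qed
  also have "prim (\<lambda>r. prim (\<lambda>\<eta>. hJ (\<eta>, r)) y) t = prim (dlogJ t) y"
    unfolding dlogJ_def[abs_def] by (rule prim_swap[OF I])
  finally show ?thesis .
qed

end

section \<open>The weak transport equation in Lagrangian coordinates\<close>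

subsection \<open>Smooth test functions on the square\<close>

lemma Ck_continuous: "Ck k \<phi> \<Longrightarrow> continuous_on S \<phi>"
  by (cases k) (auto intro: continuous_on_subset differentiable_imp_continuous_on)

lemma smooth_fun_partial:
  assumes "\<phi> \<in> smooth_fun"
  shows "partial_x \<phi> \<in> smooth_fun" "partial_t \<phi> \<in> smooth_fun"
proof -
  have "Ck (Suc k) \<phi>" for k using assms unfolding smooth_fun_def by blast
  then show "partial_x \<phi> \<in> smooth_fun" "partial_t \<phi> \<in> smooth_fun" unfolding smooth_fun_def by auto
qed

lemma smooth_fun_continuous: "\<phi> \<in> smooth_fun \<Longrightarrow> continuous_on S \<phi>"
  using Ck_continuous unfolding smooth_fun_def by blast

lemma smooth_fun_has_derivative:
  assumes "\<phi> \<in> smooth_fun"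
  shows "(\<phi> has_derivative (\<lambda>(a, b). partial_x \<phi> p * a + partial_t \<phi> p * b)) (at p)"
proof -
  have "Ck (Suc 0) \<phi>" using assms unfolding smooth_fun_def by blast
  then have "\<phi> differentiable (at p)" by (cases p) (simp add: differentiable_on_def)
  then obtain D where D: "(\<phi> has_derivative D) (at p)" by (auto simp: differentiable_def)
  obtain x t where p: "p = (x, t)" by (cases p)
  interpret D: bounded_linear D using D by (rule has_derivative_bounded_linear)
  have "((\<lambda>y. (y, t)) has_derivative (\<lambda>h. (h, 0))) (at x)" by (auto intro!: derivative_eq_intros)
  from has_derivative_compose[OF this D[unfolded p]]
  have "((\<lambda>y. \<phi> (y, t)) has_derivative (\<lambda>h. D (h, 0))) (at x)" .
  moreover have "(\<lambda>h. D (h, 0)) = (*) (D (1, 0))"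
  proof
    fix h :: real
    have "D (h, 0) = D (h *\<^sub>R (1, 0))" by simp
    then show "D (h, 0) = D (1, 0) * h" unfolding D.scaleR by simp
  qed
  ultimately have px: "partial_x \<phi> p = D (1, 0)"
    by (auto simp: partial_x_def p has_field_derivative_def intro!: DERIV_imp_deriv)
  have "((\<lambda>s. (x, s)) has_derivative (\<lambda>h. (0, h))) (at t)" by (auto intro!: derivative_eq_intros)
  from has_derivative_compose[OF this D[unfolded p]]
  have "((\<lambda>s. \<phi> (x, s)) has_derivative (\<lambda>h. D (0, h))) (at t)" .
  moreover have "(\<lambda>h. D (0, h)) = (*) (D (0, 1))"
  proof
    fix h :: real
    have "D (0, h) = D (h *\<^sub>R (0, 1))" by simp
    then show "D (0, h) = D (0, 1) * h" unfolding D.scaleR by simp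
  qed
  ultimately have pt: "partial_t \<phi> p = D (0, 1)"
    by (auto simp: partial_t_def p has_field_derivative_def intro!: DERIV_imp_deriv)
  have "D (a, b) = partial_x \<phi> p * a + partial_t \<phi> p * b" for a b
  proof -
    have "D (a, b) = D (a *\<^sub>R (1, 0) + b *\<^sub>R (0, 1))" by simp
    then show ?thesis unfolding D.add D.scaleR px pt by simp
  qed
  then have "D = (\<lambda>(a, b). partial_x \<phi> p * a + partial_t \<phi> p * b)" by auto
  then show ?thesis using D by simp
qed

lemma partial_monomial:
  "partial_x (\<lambda>p. c * fst p ^ k * snd p ^ j) = (\<lambda>p. (c * real k) * fst p ^ (k - 1) * snd p ^ j)"
  "partial_t (\<lambda>p. c * fst p ^ k * snd p ^ j) = (\<lambda>p. (c * real j) * fst p ^ k * snd p ^ (j - 1))"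
  unfolding partial_x_def partial_t_def
  by (auto intro!: ext DERIV_imp_deriv derivative_eq_intros)

text \<open>Through these test functions the transport equation yields statements about
  moments.\<close>

lemma smooth_monomial: "(\<lambda>p. c * fst p ^ k * snd p ^ j) \<in> smooth_fun"
proof -
  have "Ck n (\<lambda>p. c * fst p ^ k * snd p ^ j)" for n
  proof (induction n arbitrary: c k j)
    case 0 then show ?case by (auto intro!: continuous_intros)
  next
    case (Suc n)
    have "(\<lambda>p::real\<times>real. c * fst p ^ k * snd p ^ j) differentiable_on UNIV"
      unfolding differentiable_on_def
      by (intro ballI differentiable_mult[OF differentiable_mult[OF differentiable_const
            differentiable_power[OF bounded_linear_imp_differentiable[OF bounded_linear_fst]]]
            differentiable_power[OF bounded_linear_imp_differentiable[OF bounded_linear_snd]]])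
    then show ?case using Suc by (simp add: partial_monomial)
  qed
  then show ?thesis by (auto simp: smooth_fun_def)
qed

lemma smooth_fun_bounded:
  assumes "\<phi> \<in> smooth_fun"
  obtains C where "0 \<le> C" "\<And>p. p \<in> {0..1} \<times> {0..1} \<Longrightarrow> \<bar>\<phi> p\<bar> \<le> C"
    "\<And>p. p \<in> {0..1} \<times> {0..1} \<Longrightarrow> \<bar>partial_x \<phi> p\<bar> \<le> C" "\<And>p. p \<in> {0..1} \<times> {0..1} \<Longrightarrow> \<bar>partial_t \<phi> p\<bar> \<le> C"
proof -
  have "\<exists>C. \<forall>p\<in>{0..1} \<times> {0..1}. \<bar>\<psi> p\<bar> \<le> C" if "\<psi> \<in> smooth_fun" for \<psi> :: "real \<times> real \<Rightarrow> real"
  proof -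
    have "bounded (\<psi> ` ({0..1} \<times> {0..1}))"
      by (intro compact_imp_bounded compact_continuous_image smooth_fun_continuous that compact_Times) auto
    then show ?thesis by (auto simp: bounded_iff)
  qed
  note bd = this
  obtain C1 where C1: "\<forall>p\<in>{0..1} \<times> {0..1}. \<bar>\<phi> p\<bar> \<le> C1" using bd[OF assms] by blast
  obtain C2 where C2: "\<forall>p\<in>{0..1} \<times> {0..1}. \<bar>partial_x \<phi> p\<bar> \<le> C2" using bd[OF smooth_fun_partial(1)[OF assms]] by blast
  obtain C3 where C3: "\<forall>p\<in>{0..1} \<times> {0..1}. \<bar>partial_t \<phi> p\<bar> \<le> C3" using bd[OF smooth_fun_partial(2)[OF assms]] by blast
  note C = C1[rule_format] C2[rule_format] C3[rule_format]
  have "((0::real), (0::real)) \<in> {0..1} \<times> {0..1}" by auto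
  from C[OF this] have pos: "0 \<le> C1" "0 \<le> C2" "0 \<le> C3" by linarith+
  show ?thesis
  proof (rule that[of "C1 + C2 + C3"])
    fix p :: "real \<times> real" assume p: "p \<in> {0..1} \<times> {0..1}"
    show "\<bar>\<phi> p\<bar> \<le> C1 + C2 + C3" "\<bar>partial_x \<phi> p\<bar> \<le> C1 + C2 + C3" "\<bar>partial_t \<phi> p\<bar> \<le> C1 + C2 + C3"
      using C[OF p] pos by linarith+
  qed (use pos in linarith)
qed

lemma smooth_fun_measurable:
  assumes "\<phi> \<in> smooth_fun" shows "\<phi> \<in> borel_measurable borel" "\<phi> \<in> borel_measurable US"
proof -
  show *: "\<phi> \<in> borel_measurable borel"
    by (intro borel_measurable_continuous_onI smooth_fun_continuous assms)
  show "\<phi> \<in> borel_measurable US"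
    using measurable_compose[OF borel_ident_US *] .
qed

lemma smooth_fun_slice:
  assumes "\<phi> \<in> smooth_fun" shows "(\<lambda>x. \<phi> (x, t)) \<in> L2 U"
  by (intro continuous_L2 continuous_on_compose2[OF smooth_fun_continuous[OF assms, of UNIV]] continuous_intros) auto

subsection \<open>Time integrals of square integrable functions\<close>

lemma L2_time_integral:
  assumes "W \<in> L2 US"
  shows "(\<lambda>y. LINT r|U. \<bar>W (y, r)\<bar>) \<in> L2 U" "(\<lambda>p. prim (\<lambda>r. W (fst p, r)) (snd p)) \<in> L2 US"
    "(\<lambda>y. prim (\<lambda>r. W (y, r)) t) \<in> L2 U"
proof -
  note [measurable] = L2D(1)[OF assms]
  show L: "(\<lambda>y. LINT r|U. \<bar>W (y, r)\<bar>) \<in> L2 U"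
  proof (rule L2I)
    show "integrable U (\<lambda>y. (LINT r|U. \<bar>W (y, r)\<bar>)\<^sup>2)"
    proof (rule Bochner_Integration.integrable_bound)
      show "integrable U (\<lambda>y. LINT r|U. (W (y, r))\<^sup>2)" using US_Fubini(1)[OF L2D(2)[OF assms]] .
      show "AE y in U. norm ((LINT r|U. \<bar>W (y, r)\<bar>)\<^sup>2) \<le> norm (LINT r|U. (W (y, r))\<^sup>2)"
        using L2_slices(2)[OF assms] by eventually_elim (auto dest: U.L2_integral_square)
    qed measurable
  qed measurable
  have b: "AE y in U. \<forall>t. \<bar>prim (\<lambda>r. W (y, r)) t\<bar> \<le> (LINT r|U. \<bar>W (y, r)\<bar>)"
    using L2_slices(2)[OF assms] by eventually_elim (auto intro!: abs_prim_le U.L2_integrable)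
  show "(\<lambda>y. prim (\<lambda>r. W (y, r)) t) \<in> L2 U"
  proof (rule L2_bound[OF _ L])
    show "AE y in U. \<bar>prim (\<lambda>r. W (y, r)) t\<bar> \<le> \<bar>LINT r|U. \<bar>W (y, r)\<bar>\<bar>"
      using b by eventually_elim (auto intro: order_trans)
  qed measurable
  have m: "(\<lambda>p. prim (\<lambda>r. W (fst p, r)) (snd p)) \<in> borel_measurable US" by measurable
  show "(\<lambda>p. prim (\<lambda>r. W (fst p, r)) (snd p)) \<in> L2 US"
  proof (rule L2_bound[OF m L2_US_fst[OF L]])
    have m2: "{p \<in> space US. \<bar>prim (\<lambda>r. W (fst p, r)) (snd p)\<bar> \<le> \<bar>LINT r|U. \<bar>W (fst p, r)\<bar>\<bar>} \<in> sets US"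
      by measurable
    show "AE p in US. \<bar>prim (\<lambda>r. W (fst p, r)) (snd p)\<bar> \<le> \<bar>LINT r|U. \<bar>W (fst p, r)\<bar>\<bar>"
      by (rule AE_US_I[OF m2], rule AE_I2) (use b in \<open>simp, eventually_elim, auto intro: order_trans\<close>)
  qed
qed

context velocity
begin

lemma velocity_L2: "(\<lambda>p. vel (fst p) (snd p)) \<in> L2 US" "(\<lambda>p. vel_x (fst p) (snd p)) \<in> L2 US"
proof -
  note L = L2_US_snd[OF lip_L2]
  show "(\<lambda>p. vel (fst p) (snd p)) \<in> L2 US"
  proof (rule L2_bound[OF _ L])
    show "AE p in US. \<bar>vel (fst p) (snd p)\<bar> \<le> \<bar>lip (snd p)\<bar>"
    proof (rule AE_I2)
      fix p assume "p \<in> space US"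
      then have p: "0 < snd p" "snd p < 1" "\<bar>fst p\<bar> \<le> 1" by (auto simp: space_US)
      show "\<bar>vel (fst p) (snd p)\<bar> \<le> \<bar>lip (snd p)\<bar>"
        using abs_vel_le(1)[OF p(1,2), of "fst p"] mult_left_le[OF p(3) lip_nonneg[of "snd p"]] by linarith
    qed
  qed measurable
  show "(\<lambda>p. vel_x (fst p) (snd p)) \<in> L2 US"
    by (rule L2_bound[OF _ L]) (auto simp: space_US intro!: order_trans[OF abs_vel_x_le])
qed

lemma abs_vel_01: "0 < t \<Longrightarrow> t < 1 \<Longrightarrow> 0 \<le> x \<Longrightarrow> x \<le> 1 \<Longrightarrow> \<bar>vel x t\<bar> \<le> lip t"
  using abs_vel_le(1)[of t x] mult_left_le[of "\<bar>x\<bar>" "lip t"] lip_nonneg[of t] by force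

text \<open>\<phi>_t + (\<phi> v)_x, up to the sign the formal adjoint of the transport
  operator.\<close>

definition transport_op :: "(real \<times> real \<Rightarrow> real) \<Rightarrow> real \<times> real \<Rightarrow> real"
  where "transport_op \<phi> p = partial_t \<phi> p + partial_x \<phi> p * vel (fst p) (snd p) + \<phi> p * vel_x (fst p) (snd p)"

text \<open>\<open>vel\<close> and \<open>vel_x\<close> are defined at every point, in contrast to v
  and the choice \<open>weak_dx v\<close>.\<close>

definition weak_transport :: "(real \<Rightarrow> real) \<Rightarrow> (real \<Rightarrow> real) \<Rightarrow> (real \<times> real \<Rightarrow> real) \<Rightarrow> (real \<times> real \<Rightarrow> real) \<Rightarrow> bool"
  where "weak_transport f0 f1 f z \<longleftrightarrow> (\<forall>\<phi>\<in>smooth_fun.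
    (LINT p|US. f p * transport_op \<phi> p) + (LINT p|US. \<phi> p * z p) =
    (LINT x|U. f1 x * \<phi> (x, 1)) - (LINT x|U. f0 x * \<phi> (x, 0)))"

lemma smooth_fun_US:
  assumes "\<phi> \<in> smooth_fun" "f \<in> L2 US" shows "(\<lambda>p. \<phi> p * f p) \<in> L2 US"
proof -
  obtain C where C: "\<And>p. p \<in> {0..1} \<times> {0..1} \<Longrightarrow> \<bar>\<phi> p\<bar> \<le> C" using smooth_fun_bounded[OF assms(1)] by metis
  show ?thesis
  proof (rule L2_mult_bdd[OF assms(2) smooth_fun_measurable(2)[OF assms(1)]])
    show "\<bar>\<phi> p\<bar> \<le> C" if "p \<in> space US" for p using C[of p] that by (auto simp: space_US)
  qed
qed

lemma smooth_fun_L2_US: "\<phi> \<in> smooth_fun \<Longrightarrow> \<phi> \<in> L2 US"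
  using smooth_fun_US[OF _ US.L2_const[of 1], of \<phi>] by simp

lemma transport_op_L2: "\<phi> \<in> smooth_fun \<Longrightarrow> transport_op \<phi> \<in> L2 US"
  unfolding transport_op_def[abs_def]
  by (intro L2_add smooth_fun_L2_US smooth_fun_US smooth_fun_partial velocity_L2)

lemma transport_equation_iff:
  assumes v: "v \<in> borel_measurable US" "AE p in US. v p = vel (fst p) (snd p)"
    and dv: "weak_dx v \<in> borel_measurable US" "AE p in US. weak_dx v p = vel_x (fst p) (snd p)"
    and f: "f \<in> L2 US"
  shows "transport_equation f0 f1 f v z \<longleftrightarrow> weak_transport f0 f1 f z"
proof -
  note [measurable] = v(1) dv(1) L2D(1)[OF f]
  have "(LINT p|US. f p * transport_op \<phi> p) = (LINT p|US. f p * partial_t \<phi> p)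
      + (LINT p|US. f p * partial_x \<phi> p * v p) + (LINT p|US. f p * \<phi> p * weak_dx v p)" if \<phi>: "\<phi> \<in> smooth_fun" for \<phi>
  proof -
    note [measurable] = smooth_fun_measurable(2)[OF \<phi>] smooth_fun_measurable(2)[OF smooth_fun_partial(1)[OF \<phi>]]
    have 1: "(LINT p|US. f p * partial_x \<phi> p * v p) = (LINT p|US. f p * (partial_x \<phi> p * vel (fst p) (snd p)))"
      by (rule integral_cong_AE) (measurable, use v(2) in \<open>auto elim!: eventually_mono\<close>)
    have 2: "(LINT p|US. f p * \<phi> p * weak_dx v p) = (LINT p|US. f p * (\<phi> p * vel_x (fst p) (snd p)))"
      by (rule integral_cong_AE) (measurable, use dv(2) in \<open>auto elim!: eventually_mono\<close>)
    have i: "integrable US (\<lambda>p. f p * partial_t \<phi> p)" "integrable US (\<lambda>p. f p * (partial_x \<phi> p * vel (fst p) (snd p)))"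
      "integrable US (\<lambda>p. f p * (\<phi> p * vel_x (fst p) (snd p)))"
      by (intro integrable_mult_L2 f smooth_fun_L2_US smooth_fun_US smooth_fun_partial velocity_L2 \<phi>)+
    show ?thesis unfolding 1 2 transport_op_def using i by (simp add: distrib_left)
  qed
  then show ?thesis unfolding transport_equation_def weak_transport_def unit_square_def
    by (intro ball_cong refl) auto
qed

subsection \<open>From Lagrangian to Eulerian coordinates\<close>

text \<open>Along a trajectory \<phi> changes with rate \<phi>_t + v \<phi>_x and the Jacobian J
  with rate v_x J, so \<phi> J changes with rate \<open>transport_op \<phi>\<close> times J.\<close>

lemma flow_along:
  assumes "\<phi> \<in> smooth_fun" "0 \<le> t" "t \<le> 1"
  shows "\<phi> (flow t y, t) * jac t y = \<phi> (y, 0) + prim (\<lambda>r. transport_op \<phi> (flow r y, r) * jac r y) t"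
    "(\<lambda>r. transport_op \<phi> (flow r y, r) * jac r y) \<in> L2 U"
    "\<phi> (flow t y, t) = \<phi> (y, 0) + prim (\<lambda>r. partial_x \<phi> (flow r y, r) * vel (flow r y) r + partial_t \<phi> (flow r y, r)) t"
proof -
  obtain C0 where C0: "\<And>r. 0 \<le> r \<Longrightarrow> r \<le> 1 \<Longrightarrow> \<bar>flow r y\<bar> \<le> C0" using continuous_bounded_01[OF flow_curve(1)[of y]] by blast
  define k where "k r = partial_x \<phi> (flow r y, r) * vel (flow r y) r + partial_t \<phi> (flow r y, r)" for r
  have fl: "flow t y = y + prim (\<lambda>r. vel (flow r y) r) t" for t by (rule flow_curve)
  have one: "(\<lambda>_. 1) \<in> L2 U" by (rule U.L2_const)
  \<comment> \<open>Time is the primitive of 1, so that \<open>prim_chain2\<close> applies to the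
    pair of position and time.\<close>
  have p1: "prim (\<lambda>_. 1) t = t" if "0 \<le> t" "t \<le> 1" for t
    using prim_FTC[of "\<lambda>_. 1" t "\<lambda>x. x"] that by simp
  have cc: "continuous_on UNIV (\<lambda>r. \<psi> (flow r y, r))" if "\<psi> \<in> smooth_fun" for \<psi>
    by (rule continuous_on_compose2[OF smooth_fun_continuous[OF that, of UNIV]]) (auto intro!: continuous_intros flow_curve)
  have bd: "\<exists>C. \<forall>r. 0 \<le> r \<longrightarrow> r \<le> 1 \<longrightarrow> \<bar>u r\<bar> \<le> C" if "continuous_on UNIV u" for u :: "real \<Rightarrow> real"
    using continuous_bounded_01[OF that] by metis
  have mult: "(\<lambda>r. u r * w r) \<in> L2 U" if u: "continuous_on UNIV u" and w: "w \<in> L2 U" for u w :: "real \<Rightarrow> real"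
  proof -
    obtain C where "\<forall>r. 0 \<le> r \<longrightarrow> r \<le> 1 \<longrightarrow> \<bar>u r\<bar> \<le> C" using bd[OF u] by blast
    then show ?thesis by (intro L2_mult_bdd[OF w L2D(1)[OF continuous_L2[OF u]], of C]) auto
  qed
  have kL: "k \<in> L2 U" unfolding k_def[abs_def]
    by (intro L2_add mult cc smooth_fun_partial assms(1) vel_flow_L2 continuous_L2)
  have \<phi>k: "\<phi> (flow t y, t) = \<phi> (y, 0) + prim k t" if t: "0 \<le> t" "t \<le> 1" for t
  proof -
    have "\<phi> (y + prim (\<lambda>r. vel (flow r y) r) t, 0 + prim (\<lambda>_. 1) t) = \<phi> (y, 0) + prim (\<lambda>r.
        partial_x \<phi> (y + prim (\<lambda>r. vel (flow r y) r) r, 0 + prim (\<lambda>_. 1) r) * vel (flow r y) r +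
        partial_t \<phi> (y + prim (\<lambda>r. vel (flow r y) r) r, 0 + prim (\<lambda>_. 1) r) * 1) t"
      by (rule prim_chain2[OF smooth_fun_has_derivative[OF assms(1)]])
         (use t assms(1) in \<open>auto intro!: smooth_fun_continuous smooth_fun_partial vel_flow_L2 one\<close>)
    also have "prim (\<lambda>r.
        partial_x \<phi> (y + prim (\<lambda>r. vel (flow r y) r) r, 0 + prim (\<lambda>_. 1) r) * vel (flow r y) r +
        partial_t \<phi> (y + prim (\<lambda>r. vel (flow r y) r) r, 0 + prim (\<lambda>_. 1) r) * 1) t = prim k t"
      by (rule prim_cong) (simp add: k_def p1 flip: fl)
    finally show ?thesis using t by (simp add: p1 flip: fl)
  qed
  then show "\<phi> (flow t y, t) = \<phi> (y, 0) + prim (\<lambda>r. partial_x \<phi> (flow r y, r) * vel (flow r y) r + partial_t \<phi> (flow r y, r)) t"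
    using assms(2,3) by (simp add: k_def[abs_def])
  define j where "j r = 1 * exp (1 * prim (\<lambda>r. vel_x (flow r y) r) r) * vel_x (flow r y) r" for r
  have jj: "jac t y = 1 + prim j t" for t
    using exp_prim[OF vel_x_flow_L2, of 1 y t] by (simp add: logJ_def j_def[abs_def])
  have cj: "continuous_on UNIV (\<lambda>r. jac r y)"
    by (intro continuous_on_exp continuous_on_compose2[OF continuous_logJ, of UNIV "\<lambda>r. (r, y)", simplified])
       (auto intro!: continuous_intros)
  have jL: "j \<in> L2 U"
    using mult[OF cj vel_x_flow_L2[of y]] by (simp add: j_def[abs_def] logJ_def)
  have "(\<phi> (y, 0) + prim k t) * (1 + prim j t) = \<phi> (y, 0) * 1 + prim (\<lambda>r. k r * (1 + prim j r) + (\<phi> (y, 0) + prim k r) * j r) t"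
    by (rule prim_mult_all[OF kL jL])
  also have "prim (\<lambda>r. k r * (1 + prim j r) + (\<phi> (y, 0) + prim k r) * j r) t = prim (\<lambda>r. transport_op \<phi> (flow r y, r) * jac r y) t"
  proof (rule prim_cong)
    fix r :: real assume r: "0 < r" "r < 1"
    have e1: "1 + prim j r = jac r y" using jj[of r] by simp
    have e2: "\<phi> (y, 0) + prim k r = \<phi> (flow r y, r)" using \<phi>k[of r] r by simp
    show "k r * (1 + prim j r) + (\<phi> (y, 0) + prim k r) * j r = transport_op \<phi> (flow r y, r) * jac r y"
      unfolding e1 e2 by (simp add: k_def j_def transport_op_def algebra_simps logJ_def)
  qed
  finally show "\<phi> (flow t y, t) * jac t y = \<phi> (y, 0) + prim (\<lambda>r. transport_op \<phi> (flow r y, r) * jac r y) t"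
    using assms by (simp add: \<phi>k jj)
  have "(\<lambda>r. k r + \<phi> (flow r y, r) * vel_x (flow r y) r) \<in> L2 U"
    by (intro L2_add kL mult cc assms(1) vel_x_flow_L2)
  from mult[OF cj this] show "(\<lambda>r. transport_op \<phi> (flow r y, r) * jac r y) \<in> L2 U"
    by (simp add: k_def transport_op_def algebra_simps)
qed

text \<open>In Lagrangian coordinates the transport equation reads G_t = W; this is its solution
  with initial value G0.\<close>

definition lagrange :: "(real \<Rightarrow> real) \<Rightarrow> (real \<times> real \<Rightarrow> real) \<Rightarrow> real \<times> real \<Rightarrow> real"
  where "lagrange G0 W p = G0 (fst p) + prim (\<lambda>r. W (fst p, r)) (snd p)"

definition euler :: "(real \<times> real \<Rightarrow> real) \<Rightarrow> real \<times> real \<Rightarrow> real"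
  where "euler G p = G (inv_flow (snd p) (fst p), snd p)"

lemma euler_Flow [simp]: "euler G (Flow p) = G p"
  by (simp add: euler_def Flow_def)

lemma lagrange_L2: "G0 \<in> L2 U \<Longrightarrow> W \<in> L2 US \<Longrightarrow> lagrange G0 W \<in> L2 US"
  unfolding lagrange_def[abs_def] by (intro L2_add L2_US_fst L2_time_integral)

lemma euler_L2: "G \<in> L2 US \<Longrightarrow> euler G \<in> L2 US"
  unfolding euler_def[abs_def] by (rule L2_inv_flow_US)

lemma lagrange_1_L2: "G0 \<in> L2 U \<Longrightarrow> W \<in> L2 US \<Longrightarrow> (\<lambda>y. lagrange G0 W (y, t)) \<in> L2 U"
  unfolding lagrange_def fst_conv snd_conv by (intro L2_add L2_time_integral)

text \<open>After substitution along the flow the integrand for fixed y is the time derivative of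
  the product of G with \<phi> times the Jacobian. Only the end terms remain, and the one at time 1
  is transformed back to x.\<close>

lemma lagrange_weak_transport:
  assumes G0: "G0 \<in> L2 U" and W: "W \<in> L2 US"
  shows "weak_transport G0 (\<lambda>x. lagrange G0 W (inv_flow 1 x, 1)) (euler (lagrange G0 W)) (euler W)"
  unfolding weak_transport_def
proof
  fix \<phi> assume \<phi>: "\<phi> \<in> smooth_fun"
  let ?G = "lagrange G0 W"
  note GL = lagrange_L2[OF G0 W]
  note [measurable] = L2D(1)[OF G0] L2D(1)[OF W] L2D(1)[OF GL] L2D(1)[OF euler_L2[OF GL]] L2D(1)[OF euler_L2[OF W]]
    L2D(1)[OF transport_op_L2[OF \<phi>]] smooth_fun_measurable[OF \<phi>] L2D(1)[OF lagrange_1_L2[OF G0 W]]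
  have i1: "integrable US (\<lambda>p. euler ?G p * transport_op \<phi> p)" by (intro integrable_mult_L2 euler_L2 GL transport_op_L2 \<phi>)
  have i2: "integrable US (\<lambda>p. \<phi> p * euler W p)" by (intro integrable_mult_L2 euler_L2 W smooth_fun_L2_US \<phi>)
  have j1: "integrable US (\<lambda>p. ?G p * (transport_op \<phi> (Flow p) * jac (snd p) (fst p)))"
    using Flow_subst(1)[of "\<lambda>p. euler ?G p * transport_op \<phi> p"] i1 by (simp add: mult_ac)
  have j2: "integrable US (\<lambda>p. W p * (\<phi> (Flow p) * jac (snd p) (fst p)))"
    using Flow_subst(1)[of "\<lambda>p. \<phi> p * euler W p"] i2 by (simp add: mult_ac)
  have m0: "(\<lambda>x. G0 x * \<phi> (x, 0)) \<in> borel_measurable U"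
    by (intro borel_measurable_times L2D(1)[OF G0] L2D(1)[OF smooth_fun_slice[OF \<phi>]])
  have m1: "(\<lambda>x. ?G (inv_flow 1 x, 1) * \<phi> (x, 1)) \<in> borel_measurable U"
    using measurable_compose[of "inv_flow 1" U U, OF _ L2D(1)[OF lagrange_1_L2[OF G0 W, of 1]]] L2D(1)[OF smooth_fun_slice[OF \<phi>, of 1]]
    by (intro borel_measurable_times) (auto simp: measurable_inv_flow_U)
  have "(LINT p|US. euler ?G p * transport_op \<phi> p) + (LINT p|US. \<phi> p * euler W p)
      = (LINT p|US. ?G p * (transport_op \<phi> (Flow p) * jac (snd p) (fst p))) + (LINT p|US. W p * (\<phi> (Flow p) * jac (snd p) (fst p)))"
    using Flow_subst(2)[of "\<lambda>p. euler ?G p * transport_op \<phi> p"] Flow_subst(2)[of "\<lambda>p. \<phi> p * euler W p"]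
    by (simp add: mult_ac)
  also have "\<dots> = (LINT p|US. W p * (\<phi> (Flow p) * jac (snd p) (fst p)) + ?G p * (transport_op \<phi> (Flow p) * jac (snd p) (fst p)))"
    using j1 j2 by simp
  also have "\<dots> = (LINT y|U. LINT t|U. W (y, t) * (\<phi> (flow t y, t) * jac t y) + ?G (y, t) * (transport_op \<phi> (flow t y, t) * jac t y))"
    by (subst US_Fubini(2)[symmetric]) (use j1 j2 in auto)
  also have "\<dots> = (LINT y|U. jac 1 y * (?G (inv_flow 1 (flow 1 y), 1) * \<phi> (flow 1 y, 1)) - G0 y * \<phi> (y, 0))"
  proof (rule integral_cong_AE)
    show "AE y in U. (LINT t|U. W (y, t) * (\<phi> (flow t y, t) * jac t y) + ?G (y, t) * (transport_op \<phi> (flow t y, t) * jac t y))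
        = jac 1 y * (?G (inv_flow 1 (flow 1 y), 1) * \<phi> (flow 1 y, 1)) - G0 y * \<phi> (y, 0)"
      using L2_slices(2)[OF W]
    proof eventually_elim
      case (elim y)
      have "(G0 y + prim (\<lambda>r. W (y, r)) 1) * (\<phi> (y, 0) + prim (\<lambda>r. transport_op \<phi> (flow r y, r) * jac r y) 1)
        = G0 y * \<phi> (y, 0) + prim (\<lambda>t. W (y, t) * (\<phi> (y, 0) + prim (\<lambda>r. transport_op \<phi> (flow r y, r) * jac r y) t)
          + (G0 y + prim (\<lambda>r. W (y, r)) t) * (transport_op \<phi> (flow t y, t) * jac t y)) 1"
        by (rule prim_mult[OF elim flow_along(2)[OF \<phi>, of 0]]) auto
      also have "prim (\<lambda>t. W (y, t) * (\<phi> (y, 0) + prim (\<lambda>r. transport_op \<phi> (flow r y, r) * jac r y) t)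
          + (G0 y + prim (\<lambda>r. W (y, r)) t) * (transport_op \<phi> (flow t y, t) * jac t y)) 1
          = prim (\<lambda>t. W (y, t) * (\<phi> (flow t y, t) * jac t y) + ?G (y, t) * (transport_op \<phi> (flow t y, t) * jac t y)) 1"
        by (rule prim_cong) (simp add: lagrange_def flow_along(1)[OF \<phi>])
      finally have "(G0 y + prim (\<lambda>r. W (y, r)) 1) * (\<phi> (flow 1 y, 1) * jac 1 y) = G0 y * \<phi> (y, 0) +
          (LINT t|U. W (y, t) * (\<phi> (flow t y, t) * jac t y) + ?G (y, t) * (transport_op \<phi> (flow t y, t) * jac t y))"
        unfolding flow_along(1)[OF \<phi> zero_le_one order_refl, symmetric] by (simp only: prim_1[OF order_refl])
      then show ?case by (simp add: lagrange_def[of G0 W "(y, 1)"] mult_ac)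
    qed
    have "(\<lambda>x. jac 1 x * (?G (inv_flow 1 (flow 1 x), 1) * \<phi> (flow 1 x, 1))) \<in> borel_measurable U"
      using measurable_compose[OF flow_t_measurable[of 1] m1] by measurable
    then show "(\<lambda>y. jac 1 y * (?G (inv_flow 1 (flow 1 y), 1) * \<phi> (flow 1 y, 1)) - G0 y * \<phi> (y, 0)) \<in> borel_measurable U"
      using m0 by (rule borel_measurable_diff)
    have "(\<lambda>p. W p * (\<phi> (Flow p) * jac (snd p) (fst p)) + ?G p * (transport_op \<phi> (Flow p) * jac (snd p) (fst p))) \<in> borel_measurable US"
      by measurable
    then have "(\<lambda>(y, t). W (y, t) * (\<phi> (flow t y, t) * jac t y) + ?G (y, t) * (transport_op \<phi> (flow t y, t) * jac t y)) \<in> borel_measurable US"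
      by (rule measurable_cong[THEN iffD1, rotated]) (simp add: case_prod_beta' Flow_def)
    then show "(\<lambda>y. LINT t|U. W (y, t) * (\<phi> (flow t y, t) * jac t y) + ?G (y, t) * (transport_op \<phi> (flow t y, t) * jac t y)) \<in> borel_measurable U"
      by (rule U.borel_measurable_lebesgue_integral)
  qed
  also have "\<dots> = (LINT y|U. jac 1 y * (?G (inv_flow 1 (flow 1 y), 1) * \<phi> (flow 1 y, 1))) - (LINT y|U. G0 y * \<phi> (y, 0))"
  proof (rule Bochner_Integration.integral_diff)
    show "integrable U (\<lambda>y. G0 y * \<phi> (y, 0))" by (intro integrable_mult_L2 G0 smooth_fun_slice \<phi>)
    have "continuous_on UNIV (\<lambda>y. jac 1 y * \<phi> (flow 1 y, 1))"
      by (intro continuous_on_mult continuous_jac_y continuous_on_compose2[OF smooth_fun_continuous[OF \<phi>, of UNIV]])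
         (auto intro!: continuous_intros continuous_flow_y)
    from integrable_mult_L2[OF continuous_L2[OF this] lagrange_1_L2[OF G0 W, of 1]]
    show "integrable U (\<lambda>y. jac 1 y * (?G (inv_flow 1 (flow 1 y), 1) * \<phi> (flow 1 y, 1)))" by (simp add: mult_ac)
  qed
  also have "(LINT y|U. jac 1 y * (?G (inv_flow 1 (flow 1 y), 1) * \<phi> (flow 1 y, 1))) = (LINT x|U. ?G (inv_flow 1 x, 1) * \<phi> (x, 1))"
    by (rule flow_subst(2)[OF m1, symmetric])
  finally show "(LINT p|US. euler ?G p * transport_op \<phi> p) + (LINT p|US. \<phi> p * euler W p) =
    (LINT x|U. ?G (inv_flow 1 x, 1) * \<phi> (x, 1)) - (LINT x|U. G0 x * \<phi> (x, 0))" .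
qed

end

section \<open>Uniqueness of weak solutions of the transport equation\<close>

lemma prim_sum:
  fixes f :: "nat \<Rightarrow> real \<Rightarrow> real"
  assumes "\<And>k. integrable U (f k)"
  shows "prim (\<lambda>r. \<Sum>k\<le>m. b k * f k r) t = (\<Sum>k\<le>m. b k * prim (f k) t)"
  by (induction m) (simp_all add: prim_cmult prim_add assms)

text \<open>In contrast to \<open>prim_mult\<close> the density a is merely integrable, like the
  rates below, which are products of two L2 functions of time. The proof is Fubini's theorem on a
  triangle.\<close>

lemma integral_prim_by_parts:
  assumes a: "integrable U a" and q': "q' \<in> borel_measurable U" "\<And>r. 0 < r \<Longrightarrow> r < 1 \<Longrightarrow> \<bar>q' r\<bar> \<le> C"
  shows "(LINT r|U. a r * (c + prim q' r)) = prim a 1 * (c + prim q' 1) - (LINT s|U. prim a s * q' s)"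
proof -
  note [measurable] = q'(1) borel_measurable_integrable[OF a]
  have q'i: "integrable U q'" by (rule U.L2_integrable, rule U.L2_bdd[of _ C]) (use q' in auto)
  let ?k = "\<lambda>p. a (fst p) * (if snd p \<le> fst p then q' (snd p) else 0)"
  have ki: "integrable US ?k"
  proof (rule Bochner_Integration.integrable_bound)
    show "integrable US (\<lambda>p. C * a (fst p))" using integral_US_fst(2)[OF a] by simp
    show "AE p in US. norm (?k p) \<le> norm (C * a (fst p))"
    proof (rule AE_I2)
      fix p assume "p \<in> space US"
      then have "\<bar>if snd p \<le> fst p then q' (snd p) else 0\<bar> \<le> \<bar>C\<bar>" using q'(2)[of "snd p"] by (auto simp: space_US)
      from mult_left_mono[OF this, of "\<bar>a (fst p)\<bar>"] show "norm (?k p) \<le> norm (C * a (fst p))"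
        by (simp add: abs_mult mult.commute)
    qed
  qed measurable
  have "(LINT r|U. a r * prim q' r) = (LINT r|U. LINT s|U. ?k (r, s))"
    unfolding prim_def by (intro Bochner_Integration.integral_cong refl) (simp cong: if_cong flip: integral_mult_right_zero)
  also have "\<dots> = (LINT s|U. LINT r|U. ?k (r, s))" using US_Fubini(2,4)[OF ki] by simp
  also have "\<dots> = (LINT s|U. q' s * (prim a 1 - prim a s))"
  proof (rule Bochner_Integration.integral_cong[OF refl])
    fix s assume "s \<in> space U"
    have "(LINT r|U. ?k (r, s)) = (LINT r|U. q' s * (a r - (if r \<le> s then a r else 0)))"
    proof (rule integral_cong_AE)
      show "(\<lambda>r. ?k (r, s)) \<in> borel_measurable U" by (simp cong: if_cong) measurable
      show "AE r in U. ?k (r, s) = q' s * (a r - (if r \<le> s then a r else 0))"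
        using AE_U_neq[of s] by eventually_elim auto
    qed measurable
    also have "\<dots> = q' s * (prim a 1 - prim a s)"
      using a integrable_prim[OF a] by (simp add: prim_1) (simp add: prim_def)
    finally show "(LINT r|U. ?k (r, s)) = q' s * (prim a 1 - prim a s)" .
  qed
  also have "\<dots> = prim a 1 * prim q' 1 - (LINT s|U. prim a s * q' s)"
  proof -
    have "integrable U (\<lambda>s. prim a s * q' s)"
      using integrable_mult_L2[OF L2_prim[OF a, of 0] U.L2_bdd[of q' C]] q' by simp
    then show ?thesis using q'i by (simp add: right_diff_distrib prim_1 mult.commute)
  qed
  finally have "(LINT r|U. a r * prim q' r) = prim a 1 * prim q' 1 - (LINT s|U. prim a s * q' s)" .
  moreover have "integrable U (\<lambda>r. a r * prim q' r)"
    using US_Fubini(1)[OF ki] by (simp add: prim_def cong: if_cong)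
  ultimately show ?thesis using a by (simp add: distrib_left prim_1 mult.commute)
qed

lemma L2_US_slicesI:
  assumes [measurable]: "F \<in> borel_measurable US" and F: "AE t in U. (\<lambda>x. F (x, t)) \<in> L2 U"
    "AE t in U. (LINT x|U. (F (x, t))\<^sup>2) \<le> B t" and B: "integrable U B"
  shows "F \<in> L2 US"
proof (rule L2I[OF assms(1)])
  have "integrable US (\<lambda>p. (F (snd p, fst p))\<^sup>2)"
  proof (rule UU.Fubini_integrable)
    show "integrable U (\<lambda>x. LINT y|U. norm ((F (snd (x, y), fst (x, y)))\<^sup>2))"
    proof (rule Bochner_Integration.integrable_bound[OF B])
      show "AE x in U. norm (LINT y|U. norm ((F (snd (x, y), fst (x, y)))\<^sup>2)) \<le> norm (B x)"
        using F(2) by (rule eventually_mono) simp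
    qed measurable
    show "AE x in U. integrable U (\<lambda>y. (F (snd (x, y), fst (x, y)))\<^sup>2)"
      using F(1) by (rule eventually_mono) (simp add: L2D(2))
  qed measurable
  from US_swap(1)[OF this] show "integrable US (\<lambda>p. (F p)\<^sup>2)" by simp
qed

lemma integral_prim_swap:
  assumes "integrable US g"
  shows "(LINT x|U. prim (\<lambda>r. g (x, r)) s) = prim (\<lambda>r. LINT x|U. g (x, r)) s"
  using prim_swap[OF assms, of 1 s] by (simp add: prim_1)

definition slice_norm :: "(real \<times> real \<Rightarrow> real) \<Rightarrow> real \<Rightarrow> real"
  where "slice_norm d t = sqrt (LINT x|U. (d (x, t))\<^sup>2)"

lemma slice_norm_L2:
  assumes "d \<in> L2 US" shows "slice_norm d \<in> L2 U" "(LINT t|U. (slice_norm d t)\<^sup>2) = (LINT p|US. (d p)\<^sup>2)"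
proof -
  note [measurable] = L2D(1)[OF assms]
  show "slice_norm d \<in> L2 U" using US_Fubini(3)[OF L2D(2)[OF assms]]
    by (intro L2I) (simp_all add: slice_norm_def[abs_def])
  show "(LINT t|U. (slice_norm d t)\<^sup>2) = (LINT p|US. (d p)\<^sup>2)"
    using US_Fubini(4)[OF L2D(2)[OF assms]] by (simp add: slice_norm_def)
qed

lemma slice_pairing:
  assumes "(\<lambda>x. d (x, t)) \<in> L2 U" "w \<in> L2 U"
  shows "\<bar>LINT x|U. d (x, t) * w x\<bar> \<le> slice_norm d t * sqrt (LINT x|U. (w x)\<^sup>2)"
  unfolding slice_norm_def
  by (rule order_trans[OF integral_abs_bound L2_Cauchy_Schwarz_abs[OF assms]])

lemma slice_pairing_L2:
  assumes d: "d \<in> L2 US" and w: "w \<in> L2 U"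
  shows "(\<lambda>t. LINT x|U. d (x, t) * w x) \<in> L2 U"
proof (rule L2_bound)
  note [measurable] = L2D(1)[OF d] L2D(1)[OF w]
  show "(\<lambda>t. LINT x|U. d (x, t) * w x) \<in> borel_measurable U" by measurable
  show "(\<lambda>t. sqrt (LINT x|U. (w x)\<^sup>2) * slice_norm d t) \<in> L2 U" by (intro L2_cmult slice_norm_L2 d)
  show "AE t in U. \<bar>LINT x|U. d (x, t) * w x\<bar> \<le> \<bar>sqrt (LINT x|U. (w x)\<^sup>2) * slice_norm d t\<bar>"
    using L2_slices(1)[OF d]
  proof eventually_elim
    case (elim t)
    have "\<bar>LINT x|U. d (x, t) * w x\<bar> \<le> sqrt (LINT x|U. (w x)\<^sup>2) * slice_norm d t"
      using slice_pairing[of d t, OF elim w] by (simp add: mult.commute)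
    then show ?case using abs_ge_self order_trans by blast
  qed
qed

context velocity
begin

subsection \<open>The transport equation tested with a fixed function of space\<close>

text \<open>The derivative in time of \<open>\<integral> d(x,t) p(x) dx\<close> if \<open>d\<close> solves \<open>\<partial>\<^sub>t d + v \<partial>\<^sub>x d = 0\<close>.\<close>

definition pairing_rate :: "(real \<times> real \<Rightarrow> real) \<Rightarrow> (real \<Rightarrow> real) \<Rightarrow> (real \<Rightarrow> real) \<Rightarrow> real \<Rightarrow> real \<Rightarrow> real"
  where "pairing_rate d p p' r t = (LINT x|U. d (x, t) * (p' x * vel x r + p x * vel_x x r))"

lemma velocity_slice_measurable:
  assumes "0 < t" "t < 1"
  shows "(\<lambda>x. vel x t) \<in> borel_measurable U" "(\<lambda>x. vel_x x t) \<in> borel_measurable U"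
  using assms by (auto intro!: measurable_vel measurable_vel_x)

lemma rate_kernel:
  assumes r: "0 < r" "r < 1" and p': "p' \<in> L2 U" and p: "p \<in> borel_measurable U" "\<And>x. 0 < x \<Longrightarrow> x < 1 \<Longrightarrow> \<bar>p x\<bar> \<le> C"
  shows "(\<lambda>x. p' x * vel x r) \<in> L2 U" "(\<lambda>x. p x * vel_x x r) \<in> L2 U"
proof -
  note [measurable] = L2D(1)[OF p'] p(1)
  have m: "(\<lambda>x. vel x r) \<in> borel_measurable U" "(\<lambda>x. vel_x x r) \<in> borel_measurable U"
    using velocity_slice_measurable[OF r] .
  show "(\<lambda>x. p' x * vel x r) \<in> L2 U"
    using L2_mult_bdd[OF p' m(1), of "lip r"] abs_vel_01[OF r] by (simp add: mult.commute)
  have "\<bar>p x * vel_x x r\<bar> \<le> C * lip r" if "0 < x" "x < 1" for x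
    unfolding abs_mult using p(2)[OF that] abs_vel_x_le[OF r, of x] by (intro mult_mono) auto
  then show "(\<lambda>x. p x * vel_x x r) \<in> L2 U"
    using m p(1) by (intro U.L2_bdd[where C = "C * lip r"]) auto
qed

lemma abs_pairing_rate:
  assumes r: "0 < r" "r < 1" and p': "p' \<in> L2 U" and p: "p \<in> borel_measurable U" "\<And>x. 0 < x \<Longrightarrow> x < 1 \<Longrightarrow> \<bar>p x\<bar> \<le> C"
    and d: "(\<lambda>x. d (x, t)) \<in> L2 U"
  shows "\<bar>pairing_rate d p p' r t\<bar> \<le> slice_norm d t * lip r * (sqrt (LINT x|U. (p' x)\<^sup>2) + C)"
proof -
  note k = rate_kernel[OF r p' p]
  have C: "0 \<le> C" using p(2)[of "1/2"] by simp
  have N: "0 \<le> slice_norm d t" by (simp add: slice_norm_def)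
  have "pairing_rate d p p' r t = (LINT x|U. d (x, t) * (p' x * vel x r)) + (LINT x|U. d (x, t) * (p x * vel_x x r))"
    unfolding pairing_rate_def distrib_left by (intro Bochner_Integration.integral_add integrable_mult_L2 d k)
  moreover have "\<bar>LINT x|U. d (x, t) * (p' x * vel x r)\<bar> \<le> slice_norm d t * (lip r * sqrt (LINT x|U. (p' x)\<^sup>2))"
  proof (rule order_trans[OF slice_pairing[OF d k(1)] mult_left_mono[OF _ N]])
    have "(LINT x|U. (p' x * vel x r)\<^sup>2) \<le> (LINT x|U. (lip r)\<^sup>2 * (p' x)\<^sup>2)"
    proof (intro integral_mono L2D(2) k integrable_mult_right p')
      fix x assume "x \<in> space U"
      then have "(vel x r)\<^sup>2 \<le> (lip r)\<^sup>2" using abs_vel_01[OF r, of x] lip_nonneg[of r]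
        by (simp flip: abs_le_square_iff)
      then show "(p' x * vel x r)\<^sup>2 \<le> (lip r)\<^sup>2 * (p' x)\<^sup>2"
        by (simp add: power_mult_distrib mult.commute mult_left_mono)
    qed
    then show "sqrt (LINT x|U. (p' x * vel x r)\<^sup>2) \<le> lip r * sqrt (LINT x|U. (p' x)\<^sup>2)"
      using lip_nonneg[of r] real_sqrt_le_mono by (fastforce simp: real_sqrt_mult)
  qed
  moreover have "\<bar>LINT x|U. d (x, t) * (p x * vel_x x r)\<bar> \<le> slice_norm d t * (lip r * C)"
  proof (rule order_trans[OF slice_pairing[OF d k(2)] mult_left_mono[OF _ N]])
    have "(LINT x|U. (p x * vel_x x r)\<^sup>2) \<le> (LINT x|U. (lip r * C)\<^sup>2)"
    proof (intro integral_mono L2D(2) k U.L2_const)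
      fix x assume x: "x \<in> space U"
      have "\<bar>p x * vel_x x r\<bar> \<le> C * lip r"
        unfolding abs_mult using p(2)[of x] x abs_vel_x_le[OF r, of x] C by (intro mult_mono) auto
      then show "(p x * vel_x x r)\<^sup>2 \<le> (lip r * C)\<^sup>2"
        using C lip_nonneg[of r] by (simp add: mult.commute flip: abs_le_square_iff)
    qed
    then show "sqrt (LINT x|U. (p x * vel_x x r)\<^sup>2) \<le> lip r * C"
      using C lip_nonneg[of r] by (intro real_le_lsqrt) auto
  qed
  ultimately show ?thesis by (simp add: algebra_simps)
qed

lemma rate_kernel_US:
  assumes p': "p' \<in> L2 U" and p: "p \<in> borel_measurable U" "\<And>x. 0 < x \<Longrightarrow> x < 1 \<Longrightarrow> \<bar>p x\<bar> \<le> C"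
  shows "(\<lambda>y. p' (fst y) * vel (fst y) (snd y) + p (fst y) * vel_x (fst y) (snd y)) \<in> L2 US"
proof (rule L2_add)
  note [measurable] = L2D(1)[OF p'] p(1)
  show "(\<lambda>y. p' (fst y) * vel (fst y) (snd y)) \<in> L2 US"
    by (rule L2_bound[OF _ L2_tensor[OF p' lip_L2]])
       (measurable, auto intro!: AE_I2 mult_left_mono order_trans[OF abs_vel_01] simp: abs_mult space_US)
  show "(\<lambda>y. p (fst y) * vel_x (fst y) (snd y)) \<in> L2 US"
    by (rule L2_mult_bdd[OF velocity_L2(2), where C = C]) (measurable, use p(2) in \<open>auto simp: space_US\<close>)
qed

lemma pairing_rate_integrable:
  assumes d: "d \<in> L2 US" and p: "p' \<in> L2 U" "p \<in> borel_measurable U" "\<And>x. 0 < x \<Longrightarrow> x < 1 \<Longrightarrow> \<bar>p x\<bar> \<le> C"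
  shows "integrable U (\<lambda>r. pairing_rate d p p' r r)"
  using US_Fubini(3)[OF integrable_mult_L2[OF d rate_kernel_US[OF p]]] by (simp add: pairing_rate_def)

abbreviation solves_homogeneous :: "(real \<times> real \<Rightarrow> real) \<Rightarrow> (real \<Rightarrow> real) \<Rightarrow> bool"
  where "solves_homogeneous d d1 \<equiv> weak_transport (\<lambda>_. 0) d1 d (\<lambda>_. 0)"

text \<open>Testing with \<open>x ^ k * t ^ j\<close> for all j relates all moments in t of the
  pairing D to its rate a, and hence D = \<open>prim a\<close> almost everywhere. The case j = 0
  evaluates the term with d1, which then drops out.\<close>

lemma pairing_monomial:
  assumes d: "d \<in> L2 US" and hom: "solves_homogeneous d d1"
  shows "AE t in U. (LINT x|U. d (x, t) * x ^ k) = prim (\<lambda>r. pairing_rate d (\<lambda>x. x ^ k) (\<lambda>x. real k * x ^ (k - 1)) r r) t"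
proof -
  note [measurable] = L2D(1)[OF d]
  define D where "D t = (LINT x|U. d (x, t) * x ^ k)" for t
  define a where "a r = pairing_rate d (\<lambda>x. x ^ k) (\<lambda>x. real k * x ^ (k - 1)) r r" for r
  have dp: "(\<lambda>x. real k * x ^ (k - 1)) \<in> L2 U" by (intro L2_cmult L2_monomial)
  have ai: "integrable U a" unfolding a_def
    by (rule pairing_rate_integrable[OF d dp, of _ 1]) (auto simp: power_le_one)
  have DL: "D \<in> L2 U" unfolding D_def[abs_def] by (intro slice_pairing_L2 d L2_monomial)
  have eq: "(LINT t|U. (real j * t ^ (j - 1)) * D t) + (LINT t|U. t ^ j * a t) = (LINT x|U. d1 x * x ^ k)" for j
  proof -
    have 1: "integrable US (\<lambda>p. d p * (fst p ^ k * (real j * snd p ^ (j - 1))))"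
      by (intro integrable_mult_L2 d L2_tensor L2_cmult L2_monomial)
    have 2: "integrable US (\<lambda>p. d p * (snd p ^ j * ((real k * fst p ^ (k - 1)) * vel (fst p) (snd p) + fst p ^ k * vel_x (fst p) (snd p))))"
      by (intro integrable_mult_L2 d L2_mult_bdd[OF rate_kernel_US[OF dp], of _ 1, where C = 1])
         (auto simp: power_le_one space_US)
    have "transport_op (\<lambda>p. 1 * fst p ^ k * snd p ^ j) p = fst p ^ k * (real j * snd p ^ (j - 1)) +
        snd p ^ j * ((real k * fst p ^ (k - 1)) * vel (fst p) (snd p) + fst p ^ k * vel_x (fst p) (snd p))" for p
      unfolding transport_op_def partial_monomial by (simp add: algebra_simps)
    then have "(LINT p|US. d p * transport_op (\<lambda>p. 1 * fst p ^ k * snd p ^ j) p) =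
        (LINT p|US. d p * (fst p ^ k * (real j * snd p ^ (j - 1)))) +
        (LINT p|US. d p * (snd p ^ j * ((real k * fst p ^ (k - 1)) * vel (fst p) (snd p) + fst p ^ k * vel_x (fst p) (snd p))))"
      using 1 2 by (simp add: distrib_left)
    also have "(LINT p|US. d p * (fst p ^ k * (real j * snd p ^ (j - 1)))) = (LINT t|U. LINT x|U. (real j * t ^ (j - 1)) * (d (x, t) * x ^ k))"
      unfolding US_Fubini(4)[OF 1, symmetric] fst_conv snd_conv
      by (intro Bochner_Integration.integral_cong refl) (simp add: mult_ac)
    also have "\<dots> = (LINT t|U. (real j * t ^ (j - 1)) * D t)" by (simp add: D_def)
    also have "(LINT p|US. d p * (snd p ^ j * ((real k * fst p ^ (k - 1)) * vel (fst p) (snd p) + fst p ^ k * vel_x (fst p) (snd p))))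
        = (LINT t|U. LINT x|U. t ^ j * (d (x, t) * ((real k * x ^ (k - 1)) * vel x t + x ^ k * vel_x x t)))"
      unfolding US_Fubini(4)[OF 2, symmetric] fst_conv snd_conv
      by (intro Bochner_Integration.integral_cong refl) (simp only: mult.left_commute)
    also have "\<dots> = (LINT t|U. t ^ j * a t)" by (simp add: a_def pairing_rate_def)
    finally show ?thesis
      using bspec[OF hom[unfolded weak_transport_def] smooth_monomial[of 1 k j]] by simp
  qed
  have A1: "prim a 1 = (LINT x|U. d1 x * x ^ k)" using eq[of 0] by (simp add: prim_1)
  have pL: "prim a \<in> L2 U" using L2_prim[OF ai, of 0] by simp
  have "AE t in U. D t - prim a t = 0"
  proof (rule L2_moments_zero)
    show "(\<lambda>t. D t - prim a t) \<in> L2 U" by (intro L2_diff DL pL)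
    fix i
    \<comment> \<open>The derivative of \<open>t ^ j\<close> has to be a multiple of
      \<open>t ^ i\<close>, the moment in question.\<close>
    define j where "j = Suc i"
    have p: "t ^ j = 0 + prim (\<lambda>x. real j * x ^ (j - 1)) t" if "0 \<le> t" "t \<le> 1" for t :: real
    proof -
      have "t ^ j = 0 ^ j + prim (\<lambda>x. real j * x ^ (j - 1)) t"
        by (rule prim_FTC[OF _ that]) (auto intro!: continuous_intros derivative_eq_intros)
      then show ?thesis by (simp add: j_def)
    qed
    have "(LINT t|U. t ^ j * a t) = (LINT t|U. a t * (0 + prim (\<lambda>x. real j * x ^ (j - 1)) t))"
    proof (rule Bochner_Integration.integral_cong[OF refl])
      fix t assume "t \<in> space U"
      then have "t ^ j = 0 + prim (\<lambda>x. real j * x ^ (j - 1)) t" by (intro p) auto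
      then show "t ^ j * a t = a t * (0 + prim (\<lambda>x. real j * x ^ (j - 1)) t)" by (simp only: mult.commute)
    qed
    also have "\<dots> = prim a 1 * (0 + prim (\<lambda>x. real j * x ^ (j - 1)) 1) - (LINT s|U. prim a s * (real j * s ^ (j - 1)))"
      by (rule integral_prim_by_parts[OF ai, where C = "real j"]) (auto simp: abs_mult intro!: mult_left_le power_le_one)
    also have "0 + prim (\<lambda>x. real j * x ^ (j - 1)) 1 = 1" using p[of 1] by simp
    finally have "(LINT t|U. (real j * t ^ (j - 1)) * D t) = (LINT s|U. prim a s * (real j * s ^ (j - 1)))"
      using eq[of j] A1 by simp
    moreover have "integrable U (\<lambda>t. D t * (real j * t ^ (j - 1)))" "integrable U (\<lambda>t. prim a t * (real j * t ^ (j - 1)))"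
      by (intro integrable_mult_L2 DL pL L2_cmult L2_monomial)+
    ultimately have "(LINT t|U. (D t - prim a t) * (real j * t ^ (j - 1))) = 0"
      by (simp add: left_diff_distrib mult.commute[of _ "D _"])
    then have "real j * (LINT t|U. (D t - prim a t) * t ^ i) = 0"
      by (simp add: j_def mult.left_commute)
    then show "(LINT t|U. (D t - prim a t) * t ^ i) = 0" by (simp add: j_def)
  qed
  then show ?thesis by (simp add: D_def a_def[abs_def])
qed

text \<open>The null set of times must not depend on the test function, as the identity is applied
  to the uncountable family \<open>tst k s\<close>. Outside one null set it holds for all monomials;
  both sides are controlled by the L2 norm of p', in which polynomials are dense.\<close>

lemma pairing_H1:
  assumes d: "d \<in> L2 US" and hom: "solves_homogeneous d d1"
  shows "AE t in U. \<forall>c. \<forall>p'\<in>L2 U. (LINT x|U. d (x, t) * (c + prim p' x)) =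
    prim (\<lambda>r. pairing_rate d (\<lambda>x. c + prim p' x) p' r r) t"
proof -
  note [measurable] = L2D(1)[OF d]
  define N where "N = slice_norm d"
  define B where "B = (LINT r|U. N r * lip r)"
  have NL: "integrable U (\<lambda>r. N r * lip r)" unfolding N_def by (intro integrable_mult_L2 slice_norm_L2 d lip_L2)
  have N0: "0 \<le> N r" for r by (simp add: N_def slice_norm_def)
  have B0: "0 \<le> B" unfolding B_def by (intro integral_nonneg_AE AE_I2 mult_nonneg_nonneg N0 lip_nonneg)
  have "AE t in U. \<forall>k. (LINT x|U. d (x, t) * x ^ k) = prim (\<lambda>r. pairing_rate d (\<lambda>x. x ^ k) (\<lambda>x. real k * x ^ (k - 1)) r r) t"
    using pairing_monomial[OF d hom] by (simp add: AE_all_countable)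
  then show ?thesis using L2_slices(1)[OF d]
  proof eventually_elim
    case (elim t)
    show ?case
    proof (intro allI ballI)
      fix c p' assume p': "p' \<in> L2 U"
      define E where "E = (LINT x|U. d (x, t) * (c + prim p' x)) - prim (\<lambda>r. pairing_rate d (\<lambda>x. c + prim p' x) p' r r) t"
      have "\<bar>E\<bar> \<le> (N t + 2 * B) * \<delta>" if "\<delta> > 0" for \<delta>
      proof -
        obtain b n where b: "(LINT x|U. (p' x - (\<Sum>i\<le>n. b i * x ^ i))\<^sup>2) < \<delta>\<^sup>2"
          using L2_poly_approx[OF p', of "\<delta>\<^sup>2"] \<open>\<delta> > 0\<close> by auto
        define q' where "q' x = (\<Sum>i\<le>n. b i * x ^ i)" for x :: real
        \<comment> \<open>The coefficients of the primitive of q' with value c at 0.\<close>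
        define \<beta> where "\<beta> k = (if k = 0 then c else b (k - 1) / real k)" for k
        define q where "q x = (\<Sum>k\<le>Suc n. \<beta> k * x ^ k)" for x :: real
        have q'eq: "q' x = (\<Sum>k\<le>Suc n. \<beta> k * (real k * x ^ (k - 1)))" for x
          unfolding sum.atMost_Suc_shift by (simp add: \<beta>_def q'_def)
        have q'L: "q' \<in> L2 U" unfolding q'_def[abs_def] by (rule L2_poly)
        have qq: "q x = c + prim q' x" if "0 \<le> x" "x \<le> 1" for x
        proof -
          have "q x = q 0 + prim q' x"
          proof (rule prim_FTC[OF _ that])
            show "continuous_on {0..1} q'" unfolding q'_def by (intro continuous_intros)
            show "(q has_real_derivative q' r) (at r within {0..1})" for r
              unfolding q_def[abs_def] q'eq
              by (intro DERIV_sum DERIV_cmult) (auto intro!: derivative_eq_intros)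
          qed
          also have "q 0 = c" unfolding q_def sum.atMost_Suc_shift by (simp add: \<beta>_def)
          finally show ?thesis .
        qed
        define u where "u x = p' x - q' x" for x
        have uL: "u \<in> L2 U" unfolding u_def[abs_def] by (intro L2_diff p' q'L)
        have uS: "sqrt (LINT x|U. (u x)\<^sup>2) \<le> \<delta>" using b \<open>\<delta> > 0\<close> unfolding u_def q'_def
          by (intro real_le_lsqrt) auto
        have pu: "\<bar>prim u x\<bar> \<le> \<delta>" for x using abs_prim_L2[OF uL, of x] uS by linarith
        have pI: "integrable U p'" "integrable U q'" "integrable U u" using p' q'L uL by (auto intro: U.L2_integrable)
        have cq: "c + prim p' x = q x + prim u x" if "0 < x" "x < 1" for x
          unfolding u_def[abs_def] using pI(1,2) that by (simp add: prim_diff qq)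
        have qm: "q \<in> borel_measurable U" unfolding q_def[abs_def] by measurable
        obtain Cq where Cq: "\<And>x. 0 \<le> x \<Longrightarrow> x \<le> 1 \<Longrightarrow> \<bar>q x\<bar> \<le> Cq"
        proof -
          have "continuous_on UNIV q" unfolding q_def[abs_def] by (intro continuous_intros)
          from continuous_bounded_01[OF this] that show ?thesis by blast
        qed
        have qL: "q \<in> L2 U" using qm Cq by (intro U.L2_bdd[where C = Cq]) auto
        have um: "prim u \<in> borel_measurable U" by (rule measurable_compose[OF borel_ident_U measurable_prim[OF pI(3)]])
        have puL: "prim u \<in> L2 U" using um pu by (intro U.L2_bdd[where C = \<delta>]) auto
        have monoi: "integrable U (\<lambda>r. pairing_rate d (\<lambda>x. x ^ k) (\<lambda>x. real k * x ^ (k - 1)) r r)" for k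
          by (rule pairing_rate_integrable[OF d, where C = 1]) (auto simp: power_le_one intro: L2_monomial)
        have poly: "(LINT x|U. d (x, t) * q x) = prim (\<lambda>r. pairing_rate d q q' r r) t"
        proof -
          have "(LINT x|U. d (x, t) * q x) = (LINT x|U. (\<Sum>k\<le>Suc n. \<beta> k * (d (x, t) * x ^ k)))"
            unfolding q_def sum_distrib_left by (intro Bochner_Integration.integral_cong sum.cong refl) simp
          also have "\<dots> = (\<Sum>k\<le>Suc n. \<beta> k * (LINT x|U. d (x, t) * x ^ k))"
            by (subst Bochner_Integration.integral_sum) (auto intro!: integrable_mult_right integrable_mult_L2 elim L2_monomial)
          also have "\<dots> = (\<Sum>k\<le>Suc n. \<beta> k * prim (\<lambda>r. pairing_rate d (\<lambda>x. x ^ k) (\<lambda>x. real k * x ^ (k - 1)) r r) t)"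
            using elim(1) by simp
          also have "\<dots> = prim (\<lambda>r. \<Sum>k\<le>Suc n. \<beta> k * pairing_rate d (\<lambda>x. x ^ k) (\<lambda>x. real k * x ^ (k - 1)) r r) t"
            by (rule prim_sum[OF monoi, symmetric])
          also have "\<dots> = prim (\<lambda>r. pairing_rate d q q' r r) t"
          proof (rule prim_cong_AE)
            show "(\<lambda>r. \<Sum>k\<le>Suc n. \<beta> k * pairing_rate d (\<lambda>x. x ^ k) (\<lambda>x. real k * x ^ (k - 1)) r r) \<in> borel_measurable U"
              using monoi by (intro borel_measurable_sum borel_measurable_times) (auto dest: borel_measurable_integrable)
            show "(\<lambda>r. pairing_rate d q q' r r) \<in> borel_measurable U"
              by (intro borel_measurable_integrable pairing_rate_integrable[OF d q'L qm, where C = Cq] Cq) auto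
            show "AE r in U. (\<Sum>k\<le>Suc n. \<beta> k * pairing_rate d (\<lambda>x. x ^ k) (\<lambda>x. real k * x ^ (k - 1)) r r) = pairing_rate d q q' r r"
              using L2_slices(1)[OF d] AE_space
            proof eventually_elim
              case (elim r)
              then have r: "0 < r" "r < 1" by auto
              have ki: "integrable U (\<lambda>x. d (x, r) * (real k * x ^ (k - 1) * vel x r + x ^ k * vel_x x r))" for k
                by (intro integrable_mult_L2 elim L2_add rate_kernel[OF r, where C = 1 and p = "\<lambda>x. x ^ k"] L2_cmult L2_monomial)
                   (auto simp: power_le_one)
              have "pairing_rate d q q' r r = (LINT x|U. (\<Sum>k\<le>Suc n. \<beta> k * (d (x, r) * (real k * x ^ (k - 1) * vel x r + x ^ k * vel_x x r))))"
              proof -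
                have "d (x, r) * (q' x * vel x r + q x * vel_x x r) =
                    (\<Sum>k\<le>Suc n. \<beta> k * (d (x, r) * (real k * x ^ (k - 1) * vel x r + x ^ k * vel_x x r)))" for x
                  unfolding q_def q'eq sum_distrib_right sum.distrib[symmetric] sum_distrib_left
                  by (intro sum.cong refl) (simp only: algebra_simps)
                then show ?thesis unfolding pairing_rate_def by (simp only:)
              qed
              also have "\<dots> = (\<Sum>k\<le>Suc n. \<beta> k * pairing_rate d (\<lambda>x. x ^ k) (\<lambda>x. real k * x ^ (k - 1)) r r)"
                unfolding pairing_rate_def integral_mult_right_zero[symmetric]
                by (rule Bochner_Integration.integral_sum) (rule integrable_mult_right[OF ki])
              finally show ?case by simp
            qed
          qed
          finally show ?thesis .
        qed
        have D1: "(LINT x|U. d (x, t) * (c + prim p' x)) = (LINT x|U. d (x, t) * q x) + (LINT x|U. d (x, t) * prim u x)"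
        proof -
          have "(LINT x|U. d (x, t) * (c + prim p' x)) = (LINT x|U. d (x, t) * q x + d (x, t) * prim u x)"
            by (intro Bochner_Integration.integral_cong) (simp_all add: cq distrib_left)
          then show ?thesis by (simp add: integrable_mult_L2[OF elim(2)] qL puL)
        qed
        have ui: "integrable U (\<lambda>r. pairing_rate d (prim u) u r r)"
          by (rule pairing_rate_integrable[OF d uL um pu])
        have qi: "integrable U (\<lambda>r. pairing_rate d q q' r r)"
          by (rule pairing_rate_integrable[OF d q'L qm, where C = Cq]) (simp add: Cq)
        have pm: "(\<lambda>x. c + prim p' x) \<in> borel_measurable U"
          using measurable_compose[OF borel_ident_U measurable_prim[OF pI(1)]] by simp
        have D2: "prim (\<lambda>r. pairing_rate d (\<lambda>x. c + prim p' x) p' r r) t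
            = prim (\<lambda>r. pairing_rate d q q' r r) t + prim (\<lambda>r. pairing_rate d (prim u) u r r) t"
        proof -
          have "prim (\<lambda>r. pairing_rate d (\<lambda>x. c + prim p' x) p' r r) t = prim (\<lambda>r. pairing_rate d q q' r r + pairing_rate d (prim u) u r r) t"
          proof (rule prim_cong_AE)
            have "\<bar>c + prim p' x\<bar> \<le> Cq + \<delta>" if "0 < x" "x < 1" for x
              using cq[OF that] Cq[of x] pu[of x] that by auto
            then show "(\<lambda>r. pairing_rate d (\<lambda>x. c + prim p' x) p' r r) \<in> borel_measurable U"
              by (intro borel_measurable_integrable pairing_rate_integrable[OF d p' pm])
            show "(\<lambda>r. pairing_rate d q q' r r + pairing_rate d (prim u) u r r) \<in> borel_measurable U"
              using ui qi by auto
            show "AE r in U. pairing_rate d (\<lambda>x. c + prim p' x) p' r r = pairing_rate d q q' r r + pairing_rate d (prim u) u r r"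
              using L2_slices(1)[OF d] AE_space
            proof eventually_elim
              case (elim r)
              then have r: "0 < r" "r < 1" by auto
              have "pairing_rate d (\<lambda>x. c + prim p' x) p' r r =
                  (LINT x|U. d (x, r) * (q' x * vel x r + q x * vel_x x r) + d (x, r) * (u x * vel x r + prim u x * vel_x x r))"
                unfolding pairing_rate_def
                by (intro Bochner_Integration.integral_cong) (auto simp: cq u_def algebra_simps)
              also have "\<dots> = pairing_rate d q q' r r + pairing_rate d (prim u) u r r"
                unfolding pairing_rate_def
                by (intro Bochner_Integration.integral_add integrable_mult_L2 elim L2_add
                    rate_kernel[OF r q'L qm, where C = Cq] rate_kernel[OF r uL um, where C = \<delta>] Cq pu) auto
              finally show ?case .
            qed
          qed
          then show ?thesis using ui qi by (simp add: prim_add)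
        qed
        have E: "E = (LINT x|U. d (x, t) * prim u x) - prim (\<lambda>r. pairing_rate d (prim u) u r r) t"
          unfolding E_def D1 D2 poly by simp
        have "\<bar>LINT x|U. d (x, t) * prim u x\<bar> \<le> N t * \<delta>"
        proof -
          have "(LINT x|U. (prim u x)\<^sup>2) \<le> (LINT x|U. \<delta>\<^sup>2)"
            using pu \<open>\<delta> > 0\<close> by (intro integral_mono L2D(2) puL U.L2_const) (simp flip: abs_le_square_iff)
          then have "sqrt (LINT x|U. (prim u x)\<^sup>2) \<le> \<delta>" using \<open>\<delta> > 0\<close> by (intro real_le_lsqrt) auto
          then show ?thesis using slice_pairing[of d t, OF elim(2) puL] mult_left_mono[OF _ N0[of t]]
            unfolding N_def by (meson order_trans)
        qed
        moreover have "\<bar>prim (\<lambda>r. pairing_rate d (prim u) u r r) t\<bar> \<le> 2 * B * \<delta>"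
        proof -
          have "\<bar>prim (\<lambda>r. pairing_rate d (prim u) u r r) t\<bar> \<le> (LINT r|U. \<bar>pairing_rate d (prim u) u r r\<bar>)"
            by (rule abs_prim_le[OF ui])
          also have "\<dots> \<le> (LINT r|U. (N r * lip r) * (\<delta> + \<delta>))"
          proof (rule integral_mono_AE)
            show "AE r in U. \<bar>pairing_rate d (prim u) u r r\<bar> \<le> (N r * lip r) * (\<delta> + \<delta>)"
              using L2_slices(1)[OF d] AE_space
            proof eventually_elim
              case (elim r)
              then have r: "0 < r" "r < 1" by auto
              have "\<bar>pairing_rate d (prim u) u r r\<bar> \<le> slice_norm d r * lip r * (sqrt (LINT x|U. (u x)\<^sup>2) + \<delta>)"
                by (rule abs_pairing_rate[OF r uL um pu elim(1)])
              also have "\<dots> \<le> (N r * lip r) * (\<delta> + \<delta>)"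
                unfolding N_def[symmetric] using uS by (intro mult_left_mono mult_nonneg_nonneg N0 lip_nonneg) auto
              finally show ?case .
            qed
          qed (use ui NL in auto)
          also have "\<dots> = 2 * B * \<delta>" using NL by (simp add: B_def)
          finally show ?thesis .
        qed
        ultimately show ?thesis unfolding E by (simp add: algebra_simps)
      qed
      then have "E = 0"
      proof -
        assume *: "\<And>\<delta>. \<delta> > 0 \<Longrightarrow> \<bar>E\<bar> \<le> (N t + 2 * B) * \<delta>"
        show ?thesis
        proof (rule ccontr)
          assume "E \<noteq> 0"
          define K where "K = N t + 2 * B + 1"
          have "K > 0" using N0[of t] B0 by (simp add: K_def)
          have "\<bar>E\<bar> \<le> (N t + 2 * B) * (\<bar>E\<bar> / (2 * K))" by (rule *) (use \<open>K > 0\<close> \<open>E \<noteq> 0\<close> in simp)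
          also have "\<dots> \<le> K * (\<bar>E\<bar> / (2 * K))" using \<open>K > 0\<close> by (intro mult_right_mono) (auto simp: K_def)
          finally show False using \<open>K > 0\<close> \<open>E \<noteq> 0\<close> by simp
        qed
      qed
      then show "(LINT x|U. d (x, t) * (c + prim p' x)) = prim (\<lambda>r. pairing_rate d (\<lambda>x. c + prim p' x) p' r r) t"
        by (simp add: E_def)
    qed
  qed
qed

subsection \<open>Test functions transported by the flow\<close>

text \<open>\<open>tst k s\<close> is the solution at time \<open>s\<close> of the continuity equation with initial value \<open>x ^ k\<close>.\<close>

definition tst :: "nat \<Rightarrow> real \<Rightarrow> real \<Rightarrow> real"
  where "tst k s x = inv_flow s x ^ k * exp (- logJ s (inv_flow s x))"

text \<open>The y-derivative of \<open>y ^ k * exp (- logJ s y)\<close>, which is \<open>tst\<close>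
  in Lagrangian coordinates. Passing to x, as in \<open>dtst\<close>, costs another reciprocal
  Jacobian.\<close>

definition tst_dy :: "nat \<Rightarrow> real \<Rightarrow> real \<Rightarrow> real"
  where "tst_dy k s y = real k * y ^ (k - 1) * exp (- logJ s y) - y ^ k * exp (- logJ s y) * dlogJ s y"

definition dtst :: "nat \<Rightarrow> real \<Rightarrow> real \<Rightarrow> real"
  where "dtst k s x = tst_dy k s (inv_flow s x) * exp (- logJ s (inv_flow s x))"

text \<open>The x-derivative of \<open>tst\<close> times \<open>vel\<close>, hence minus the time
  derivative of \<open>tst\<close>.\<close>

definition tst_rate :: "nat \<Rightarrow> real \<times> real \<Rightarrow> real"
  where "tst_rate k p = dtst k (snd p) (fst p) * vel (fst p) (snd p) + tst k (snd p) (fst p) * vel_x (fst p) (snd p)"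

text \<open>Bounds the squared L2 norm of \<open>dtst\<close> at all times. The single factor
  \<open>exp lip_total\<close> comes from the substitution, the squared one from the reciprocal
  Jacobian in \<open>tst_dy\<close>.\<close>

definition tst_const :: "nat \<Rightarrow> real"
  where "tst_const k = exp lip_total * (exp lip_total)\<^sup>2 * (LINT y|U. (real k + dlogJ_bound y)\<^sup>2)"

lemma measurable_tst [measurable (raw)]:
  assumes [measurable]: "T \<in> borel_measurable M" "X \<in> borel_measurable M"
  shows "(\<lambda>p. tst k (T p) (X p)) \<in> borel_measurable M"
  unfolding tst_def by measurable

lemma measurable_tst_dy [measurable (raw)]:
  assumes [measurable]: "T \<in> borel_measurable M" "X \<in> measurable M U"
  shows "(\<lambda>p. tst_dy k (T p) (X p)) \<in> borel_measurable M"
proof -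
  have [measurable]: "X \<in> borel_measurable M" using measurable_compose[OF assms(2) borel_ident_U] .
  show ?thesis unfolding tst_dy_def by measurable
qed

lemma measurable_dtst [measurable (raw)]:
  assumes [measurable]: "T \<in> borel_measurable M" "X \<in> measurable M U"
  shows "(\<lambda>p. dtst k (T p) (X p)) \<in> borel_measurable M"
proof -
  have [measurable]: "X \<in> borel_measurable M" using measurable_compose[OF assms(2) borel_ident_U] .
  show ?thesis unfolding dtst_def by measurable
qed

lemma tst_dy_L2: "tst_dy k s \<in> L2 U" "(LINT y|U. (tst_dy k s y)\<^sup>2) \<le> (exp lip_total)\<^sup>2 * (LINT y|U. (real k + dlogJ_bound y)\<^sup>2)"
proof -
  have b: "AE y in U. \<bar>tst_dy k s y\<bar> \<le> exp lip_total * (real k + dlogJ_bound y)"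
    using abs_dlogJ AE_space
  proof eventually_elim
    case (elim y)
    then have y: "0 < y" "y < 1" and dl: "\<bar>dlogJ s y\<bar> \<le> dlogJ_bound y" by auto
    have "\<bar>tst_dy k s y\<bar> = exp (- logJ s y) * \<bar>real k * y ^ (k - 1) - y ^ k * dlogJ s y\<bar>"
      unfolding tst_dy_def by (subst abs_exp_cancel[symmetric], subst abs_mult[symmetric]) (simp add: algebra_simps)
    also have "\<dots> \<le> exp lip_total * (real k + dlogJ_bound y)"
    proof (intro mult_mono inverse_jac_le)
      have "\<bar>real k * y ^ (k - 1) - y ^ k * dlogJ s y\<bar> \<le> \<bar>real k * y ^ (k - 1)\<bar> + \<bar>y ^ k * dlogJ s y\<bar>" by (rule abs_triangle_ineq4)
      also have "\<bar>real k * y ^ (k - 1)\<bar> \<le> real k" using y by (auto simp: abs_mult intro!: mult_left_le power_le_one)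
      also have "\<bar>y ^ k * dlogJ s y\<bar> \<le> \<bar>dlogJ s y\<bar>" using y by (auto simp: abs_mult power_le_one intro!: mult_left_le_one_le)
      finally show "\<bar>real k * y ^ (k - 1) - y ^ k * dlogJ s y\<bar> \<le> real k + dlogJ_bound y" using dl by linarith
    qed auto
    finally show ?case .
  qed
  have BL: "(\<lambda>y. real k + dlogJ_bound y) \<in> L2 U" by (intro L2_add U.L2_const dlogJ_bound_L2)
  show L: "tst_dy k s \<in> L2 U"
    by (rule L2_bound[OF _ L2_cmult[OF BL, of "exp lip_total"]]) (measurable, use b in \<open>auto elim!: eventually_mono\<close>)
  have "(LINT y|U. (tst_dy k s y)\<^sup>2) \<le> (LINT y|U. (exp lip_total * (real k + dlogJ_bound y))\<^sup>2)"
  proof (rule integral_mono_AE)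
    show "AE y in U. (tst_dy k s y)\<^sup>2 \<le> (exp lip_total * (real k + dlogJ_bound y))\<^sup>2"
      using b by eventually_elim (meson abs_ge_self abs_le_square_iff order_trans)
  qed (intro L2D(2) L L2_cmult BL)+
  then show "(LINT y|U. (tst_dy k s y)\<^sup>2) \<le> (exp lip_total)\<^sup>2 * (LINT y|U. (real k + dlogJ_bound y)\<^sup>2)"
    by (simp add: power_mult_distrib)
qed

lemma dtst_L2: "dtst k s \<in> L2 U" "(LINT x|U. (dtst k s x)\<^sup>2) \<le> tst_const k"
proof -
  show "dtst k s \<in> L2 U" unfolding dtst_def[abs_def] by (rule L2_inv_flow_deriv(1)[OF tst_dy_L2(1)])
  have "(LINT x|U. (dtst k s x)\<^sup>2) \<le> exp lip_total * (LINT y|U. (tst_dy k s y)\<^sup>2)"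
    unfolding dtst_def by (rule L2_inv_flow_deriv(2)[OF tst_dy_L2(1)])
  also have "\<dots> \<le> tst_const k" unfolding tst_const_def mult.assoc by (intro mult_left_mono tst_dy_L2) auto
  finally show "(LINT x|U. (dtst k s x)\<^sup>2) \<le> tst_const k" .
qed

lemma abs_tst_le: "0 \<le> x \<Longrightarrow> x \<le> 1 \<Longrightarrow> \<bar>tst k s x\<bar> \<le> exp lip_total"
proof -
  assume "0 \<le> x" "x \<le> 1"
  then have y: "0 \<le> inv_flow s x" "inv_flow s x \<le> 1" by (auto simp: inv_flow_in)
  have "\<bar>tst k s x\<bar> = inv_flow s x ^ k * exp (- logJ s (inv_flow s x))" using y by (simp add: tst_def abs_mult)
  also have "\<dots> \<le> 1 * exp lip_total" using y by (intro mult_mono power_le_one inverse_jac_le) auto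
  finally show ?thesis by simp
qed

lemma tst_L2: "tst k s \<in> L2 U"
  by (rule U.L2_bdd[where C = "exp lip_total"]) (measurable, auto intro: abs_tst_le)

text \<open>\<open>tst\<close> in Lagrangian coordinates is a smooth function of y and
  \<open>logJ\<close>, which are both primitives, so \<open>prim_chain2\<close> applies;
  \<open>prim_inv_flow\<close> moves the result to x.\<close>

lemma tst_prim:
  assumes "0 \<le> x" "x \<le> 1" shows "tst k s x = tst k s 0 + prim (dtst k s) x"
proof -
  define y where "y = inv_flow s x"
  have y: "0 \<le> y" "y \<le> 1" using assms by (auto simp: y_def inv_flow_in)
  have p1: "prim (\<lambda>_. 1) t = t" if "0 \<le> t" "t \<le> 1" for t
    using prim_FTC[of "\<lambda>_. 1" t "\<lambda>x. x"] that by simp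
  have D: "((\<lambda>p::real\<times>real. fst p ^ k * exp (- snd p)) has_derivative
      (\<lambda>(a, b). (real k * fst p ^ (k - 1) * exp (- snd p)) * a + (- (fst p ^ k * exp (- snd p))) * b)) (at p)" for p
    by (auto intro!: derivative_eq_intros simp: case_prod_beta' algebra_simps)
  have "(0 + prim (\<lambda>_. 1) y) ^ k * exp (- (logJ s 0 + prim (dlogJ s) y)) = 0 ^ k * exp (- logJ s 0) +
      prim (\<lambda>r. (real k * (0 + prim (\<lambda>_. 1) r) ^ (k - 1) * exp (- (logJ s 0 + prim (dlogJ s) r))) * 1
        + (- ((0 + prim (\<lambda>_. 1) r) ^ k * exp (- (logJ s 0 + prim (dlogJ s) r)))) * dlogJ s r) y"
  proof -
    have c: "continuous_on UNIV (\<lambda>p::real\<times>real. real k * fst p ^ (k - 1) * exp (- snd p))"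
      "continuous_on UNIV (\<lambda>p::real\<times>real. - (fst p ^ k * exp (- snd p)))" by (intro continuous_intros)+
    show ?thesis
      using prim_chain2[OF D c U.L2_const[of 1] dlogJ_L2[of s] y, of 0 "logJ s 0"] unfolding fst_conv snd_conv .
  qed
  also have "prim (\<lambda>r. (real k * (0 + prim (\<lambda>_. 1) r) ^ (k - 1) * exp (- (logJ s 0 + prim (dlogJ s) r))) * 1
        + (- ((0 + prim (\<lambda>_. 1) r) ^ k * exp (- (logJ s 0 + prim (dlogJ s) r)))) * dlogJ s r) y = prim (tst_dy k s) y"
    by (rule prim_cong) (simp add: tst_dy_def p1 flip: logJ_prim)
  also have "(0 + prim (\<lambda>_. 1) y) ^ k * exp (- (logJ s 0 + prim (dlogJ s) y)) = tst k s x"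
    using y by (simp add: p1 tst_def flip: logJ_prim y_def)
  also have "0 ^ k * exp (- logJ s 0) = tst k s 0" by (simp add: tst_def)
  also have "prim (tst_dy k s) y = prim (dtst k s) x"
    unfolding dtst_def[abs_def] y_def by (rule prim_inv_flow[symmetric]) measurable
  finally show ?thesis .
qed

lemma tst_rate_L2: "tst_rate k \<in> L2 US"
  unfolding tst_rate_def[abs_def]
proof (rule L2_add)
  show "(\<lambda>p. dtst k (snd p) (fst p) * vel (fst p) (snd p)) \<in> L2 US"
  proof (rule L2_US_slicesI[where B = "\<lambda>t. tst_const k * (lip t)\<^sup>2", OF _ AE_I2 AE_I2])
    fix t assume "t \<in> space U"
    then have t: "0 < t" "t < 1" by auto
    note m = velocity_slice_measurable(1)[OF t]
    show L: "(\<lambda>x. dtst k (snd (x, t)) (fst (x, t)) * vel (fst (x, t)) (snd (x, t))) \<in> L2 U"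
      using L2_mult_bdd[OF dtst_L2(1) m, of "lip t" k t] abs_vel_01[OF t] by (simp add: mult.commute)
    have "(LINT x|U. (dtst k t x * vel x t)\<^sup>2) \<le> (LINT x|U. (lip t)\<^sup>2 * (dtst k t x)\<^sup>2)"
    proof (intro integral_mono L2D(2) integrable_mult_right dtst_L2)
      show "(\<lambda>x. dtst k t x * vel x t) \<in> L2 U" using L by simp
      fix x assume "x \<in> space U"
      then have "(vel x t)\<^sup>2 \<le> (lip t)\<^sup>2" using abs_vel_01[OF t, of x] lip_nonneg[of t] by (simp flip: abs_le_square_iff)
      then show "(dtst k t x * vel x t)\<^sup>2 \<le> (lip t)\<^sup>2 * (dtst k t x)\<^sup>2"
        by (simp add: power_mult_distrib mult.commute mult_right_mono)
    qed
    also have "\<dots> \<le> tst_const k * (lip t)\<^sup>2" using mult_right_mono[OF dtst_L2(2)[of k t], of "(lip t)\<^sup>2"] by (simp add: mult.commute)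
    finally show "(LINT x|U. (dtst k (snd (x, t)) (fst (x, t)) * vel (fst (x, t)) (snd (x, t)))\<^sup>2) \<le> tst_const k * (lip t)\<^sup>2"
      by simp
  next
    show "integrable U (\<lambda>t. tst_const k * (lip t)\<^sup>2)" by (intro integrable_mult_right L2D(2) lip_L2)
  qed measurable
  show "(\<lambda>p. tst k (snd p) (fst p) * vel_x (fst p) (snd p)) \<in> L2 US"
    by (rule L2_mult_bdd[OF velocity_L2(2), where C = "exp lip_total"]) (measurable, auto simp: space_US intro: abs_tst_le)
qed

text \<open>\<open>tst k s\<close> is the density of the image of y^k dy under the flow, so its j-th
  moment is the integral of X(y, s)^j y^k. The flow is absolutely continuous in s, hence so is this
  moment. Integration by parts in x, without boundary terms as \<open>vel\<close> vanishes at 0 and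
  1, turns its rate into minus the moment of \<open>tst_rate\<close>.\<close>

lemma tst_evolution:
  assumes s: "0 \<le> s" "s \<le> 1"
  shows "AE x in U. tst k s x = x ^ k - prim (\<lambda>r. tst_rate k (x, r)) s"
proof -
  have "AE x in U. tst k s x - x ^ k + prim (\<lambda>r. tst_rate k (x, r)) s = 0"
  proof (rule L2_moments_zero)
    show "(\<lambda>x. tst k s x - x ^ k + prim (\<lambda>r. tst_rate k (x, r)) s) \<in> L2 U"
      by (intro L2_add L2_diff tst_L2 L2_monomial L2_time_integral tst_rate_L2)
    fix j
    have xj: "x ^ j = 0 ^ j + prim (\<lambda>x. real j * x ^ (j - 1)) x" if "0 \<le> x" "x \<le> 1" for x :: real
      by (rule prim_FTC[OF _ that]) (auto intro!: continuous_intros derivative_eq_intros)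
    have byparts: "(LINT x|U. x ^ j * tst_rate k (x, r)) = - (LINT y|U. real j * flow r y ^ (j - 1) * vel (flow r y) r * y ^ k)"
      if r: "0 < r" "r < 1" for r
    proof -
      have vL: "(\<lambda>x. vel_x x r) \<in> L2 U" by (rule continuous_L2[OF continuous_vel_x[OF r]])
      have rL: "(\<lambda>x. tst_rate k (x, r)) \<in> L2 U"
        unfolding tst_rate_def fst_conv snd_conv
        by (intro L2_add rate_kernel[OF r dtst_L2(1), where C = "exp lip_total"]) (measurable, auto intro: abs_tst_le)
      have jL: "(\<lambda>x. real j * x ^ (j - 1)) \<in> L2 U" by (intro L2_cmult L2_monomial)
      have e: "0 + prim (\<lambda>x. vel_x x r) x = vel x r" "tst k r 0 + prim (dtst k r) x = tst k r x"
        if "0 \<le> x" "x \<le> 1" for x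
        using vel_prim[OF r that] tst_prim[OF that, of k r] by simp_all
      have tv: "tst k r x * vel x r = 0 + prim (\<lambda>x. tst_rate k (x, r)) x" if x: "0 \<le> x" "x \<le> 1" for x
      proof -
        have "(tst k r 0 + prim (dtst k r) x) * (0 + prim (\<lambda>x. vel_x x r) x) = tst k r 0 * 0 +
            prim (\<lambda>x. dtst k r x * (0 + prim (\<lambda>x. vel_x x r) x) + (tst k r 0 + prim (dtst k r) x) * vel_x x r) x"
          by (rule prim_mult_all[OF dtst_L2(1) vL])
        also have "prim (\<lambda>x. dtst k r x * (0 + prim (\<lambda>x. vel_x x r) x) + (tst k r 0 + prim (dtst k r) x) * vel_x x r) x
            = prim (\<lambda>x. tst_rate k (x, r)) x"
        proof (rule prim_cong)
          fix z :: real assume "0 < z" "z < 1"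
          then have z: "0 \<le> z" "z \<le> 1" by simp_all
          show "dtst k r z * (0 + prim (\<lambda>x. vel_x x r) z) + (tst k r 0 + prim (dtst k r) z) * vel_x z r = tst_rate k (z, r)"
            unfolding e[OF z] by (simp add: tst_rate_def)
        qed
        finally show ?thesis unfolding e[OF x] by simp
      qed
      have "(0 + prim (\<lambda>x. tst_rate k (x, r)) 1) * (0 ^ j + prim (\<lambda>x. real j * x ^ (j - 1)) 1) = 0 * 0 ^ j +
          prim (\<lambda>x. tst_rate k (x, r) * (0 ^ j + prim (\<lambda>x. real j * x ^ (j - 1)) x) + (0 + prim (\<lambda>x. tst_rate k (x, r)) x) * (real j * x ^ (j - 1))) 1"
        by (rule prim_mult_all[OF rL jL])
      moreover have "0 + prim (\<lambda>x. tst_rate k (x, r)) 1 = 0" using tv[of 1] by (simp add: vel_1)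
      ultimately have "0 = prim (\<lambda>x. tst_rate k (x, r) * (0 ^ j + prim (\<lambda>x. real j * x ^ (j - 1)) x) + (0 + prim (\<lambda>x. tst_rate k (x, r)) x) * (real j * x ^ (j - 1))) 1"
        by simp
      also have "\<dots> = prim (\<lambda>x. x ^ j * tst_rate k (x, r) + (real j * x ^ (j - 1) * vel x r) * tst k r x) 1"
      proof (rule prim_cong)
        fix z :: real assume "0 < z" "z < 1"
        then have z: "0 \<le> z" "z \<le> 1" by simp_all
        show "tst_rate k (z, r) * (0 ^ j + prim (\<lambda>x. real j * x ^ (j - 1)) z) + (0 + prim (\<lambda>x. tst_rate k (x, r)) z) * (real j * z ^ (j - 1))
            = z ^ j * tst_rate k (z, r) + (real j * z ^ (j - 1) * vel z r) * tst k r z"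
          unfolding xj[OF z, symmetric] tv[OF z, symmetric] by (simp add: mult_ac)
      qed
      also have "\<dots> = (LINT x|U. x ^ j * tst_rate k (x, r)) + (LINT x|U. (real j * x ^ (j - 1) * vel x r) * tst k r x)"
      proof -
        have "(\<lambda>x. real j * x ^ (j - 1) * vel x r) \<in> L2 U"
          by (rule rate_kernel(1)[OF r jL, of "\<lambda>_. 0" 0]) auto
        then show ?thesis
          by (simp add: prim_1 integrable_mult_L2 L2_monomial rL tst_L2)
      qed
      also have "(LINT x|U. (real j * x ^ (j - 1) * vel x r) * tst k r x) = (LINT y|U. real j * flow r y ^ (j - 1) * vel (flow r y) r * y ^ k)"
        unfolding tst_def using velocity_slice_measurable(1)[OF r] by (intro integral_inv_flow(1)) auto
      finally show ?thesis by simp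
    qed
    have fj: "flow s y ^ j = y ^ j + prim (\<lambda>r. real j * flow r y ^ (j - 1) * vel (flow r y) r) s" for y
    proof -
      have "(y + prim (\<lambda>r. vel (flow r y) r) s) ^ j = y ^ j + prim (\<lambda>r. real j * (y + prim (\<lambda>r. vel (flow r y) r) r) ^ (j - 1) * vel (flow r y) r) s"
        by (rule prim_chain_all[OF _ _ vel_flow_L2]) (auto intro!: derivative_eq_intros continuous_intros)
      then show ?thesis by (simp flip: flow_curve(2))
    qed
    have gI: "integrable US (\<lambda>p. y_k p * (real j * flow (snd p) (fst p) ^ (j - 1) * vel (flow (snd p) (fst p)) (snd p)))"
      if y_k: "y_k = (\<lambda>p. fst p ^ k)" for y_k
    proof (rule US.L2_integrable, rule L2_mult_bdd[where C = 1], rule L2_mult_bdd[where C = "real j"])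
      show "(\<lambda>p. vel (flow (snd p) (fst p)) (snd p)) \<in> L2 US"
        using L2_Flow[OF velocity_L2(1)] by (simp add: Flow_def)
      show "\<bar>real j * flow (snd p) (fst p) ^ (j - 1)\<bar> \<le> real j" if "p \<in> space US" for p
        using that by (auto simp: abs_mult space_US flow_in intro!: mult_left_le power_le_one)
      show "\<bar>y_k p\<bar> \<le> 1" if "p \<in> space US" for p using that by (auto simp: y_k space_US power_le_one)
    qed (unfold y_k, measurable)
    have "(LINT x|U. tst k s x * x ^ j) = (LINT y|U. flow s y ^ j * y ^ k)"
      unfolding tst_def using integral_inv_flow(1)[of "\<lambda>x. x ^ j" "\<lambda>y. y ^ k" s] by (simp add: mult.commute)
    also have "\<dots> = (LINT y|U. y ^ j * y ^ k + prim (\<lambda>r. y ^ k * (real j * flow r y ^ (j - 1) * vel (flow r y) r)) s)"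
      unfolding fj by (simp add: algebra_simps prim_cmult)
    also have "\<dots> = (LINT y|U. y ^ j * y ^ k) + (LINT y|U. prim (\<lambda>r. y ^ k * (real j * flow r y ^ (j - 1) * vel (flow r y) r)) s)"
    proof (rule Bochner_Integration.integral_add)
      show "integrable U (\<lambda>y. y ^ j * y ^ k)" by (intro integrable_mult_L2 L2_monomial)
      have "integrable US (\<lambda>p. if snd p \<le> s then fst p ^ k * (real j * flow (snd p) (fst p) ^ (j - 1) * vel (flow (snd p) (fst p)) (snd p)) else 0)"
        by (rule Bochner_Integration.integrable_bound[OF gI[OF refl]]) auto
      from US_Fubini(1)[OF this] show "integrable U (\<lambda>y. prim (\<lambda>r. y ^ k * (real j * flow r y ^ (j - 1) * vel (flow r y) r)) s)"
        by (simp add: prim_def cong: if_cong)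
    qed
    also have "(LINT y|U. prim (\<lambda>r. y ^ k * (real j * flow r y ^ (j - 1) * vel (flow r y) r)) s)
        = prim (\<lambda>r. LINT y|U. y ^ k * (real j * flow r y ^ (j - 1) * vel (flow r y) r)) s"
      using integral_prim_swap[OF gI[OF refl], of s] by simp
    also have "\<dots> = prim (\<lambda>r. - (LINT x|U. x ^ j * tst_rate k (x, r))) s"
      by (rule prim_cong) (simp add: byparts mult_ac)
    also have "\<dots> = - prim (\<lambda>r. LINT x|U. x ^ j * tst_rate k (x, r)) s"
      using prim_cmult[of "-1"] by simp
    also have "prim (\<lambda>r. LINT x|U. x ^ j * tst_rate k (x, r)) s = (LINT x|U. prim (\<lambda>r. x ^ j * tst_rate k (x, r)) s)"
    proof -
      have "integrable US (\<lambda>p. fst p ^ j * tst_rate k p)"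
        by (intro integrable_mult_L2 L2_US_fst[OF L2_monomial] tst_rate_L2)
      from integral_prim_swap[OF this, of s] show ?thesis by simp
    qed
    also have "\<dots> = (LINT x|U. prim (\<lambda>r. tst_rate k (x, r)) s * x ^ j)" by (simp add: prim_cmult mult.commute)
    finally have eq: "(LINT x|U. tst k s x * x ^ j) = (LINT y|U. y ^ j * y ^ k) + - (LINT x|U. prim (\<lambda>r. tst_rate k (x, r)) s * x ^ j)" .
    show "(LINT x|U. (tst k s x - x ^ k + prim (\<lambda>r. tst_rate k (x, r)) s) * x ^ j) = 0"
    proof -
      have i: "integrable U (\<lambda>x. tst k s x * x ^ j)" "integrable U (\<lambda>x. x ^ j * x ^ k)" "integrable U (\<lambda>x. prim (\<lambda>r. tst_rate k (x, r)) s * x ^ j)"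
        by (intro integrable_mult_L2 tst_L2 L2_monomial L2_time_integral tst_rate_L2)+
      have "(LINT x|U. (tst k s x - x ^ k + prim (\<lambda>r. tst_rate k (x, r)) s) * x ^ j)
          = (LINT x|U. tst k s x * x ^ j - x ^ j * x ^ k + prim (\<lambda>r. tst_rate k (x, r)) s * x ^ j)"
        by (intro Bochner_Integration.integral_cong) (auto simp: algebra_simps)
      also have "\<dots> = 0" using eq i by simp
      finally show ?thesis .
    qed
  qed
  then show ?thesis by (auto elim!: eventually_mono)
qed

end

subsection \<open>Integration near the diagonal of the time square\<close>

text \<open>Passes from the variable t to s on the edge s = t + e of the strip; the cut-offs keep
  both intervals inside (0, 1).\<close>

lemma U_shift:
  fixes f :: "real \<Rightarrow> real"
  assumes f: "integrable U f" and e: "0 < e" "T + e < 1" "0 < T"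
  shows "integrable U (\<lambda>s. if e < s \<and> s \<le> T + e then f (s - e) else 0)"
    "(LINT s|U. (if e < s \<and> s \<le> T + e then f (s - e) else 0)) = prim f T"
proof -
  define F where "F t = (if 0 < t \<and> t \<le> T then f t else 0)" for t
  have "integrable lborel (\<lambda>x. indicator {0<..<1} x *\<^sub>R (if x \<le> T then f x else 0))"
    using integrable_prim[OF f, of T] unfolding unit_interval_def
    by (subst (asm) integrable_restrict_space) auto
  then have Fi: "integrable lborel F"
    by (rule Bochner_Integration.integrable_cong[THEN iffD1, rotated -1])
       (use e in \<open>auto simp: F_def indicator_def\<close>)
  have FT: "prim f T = (LINT t|lborel. F t)"
    unfolding prim_def unit_interval_def
    by (subst integral_restrict_space) (auto intro!: Bochner_Integration.integral_cong simp: F_def indicator_def, use e in auto)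
  have sh: "indicator {0<..<1} s *\<^sub>R (if e < s \<and> s \<le> T + e then f (s - e) else 0) = F (- e + 1 * s)" for s
    using e by (auto simp: F_def indicator_def)
  show "integrable U (\<lambda>s. if e < s \<and> s \<le> T + e then f (s - e) else 0)"
    unfolding unit_interval_def
    by (subst integrable_restrict_space) (auto simp only: sh intro!: lborel_integrable_real_affine[OF Fi], auto)
  show "(LINT s|U. (if e < s \<and> s \<le> T + e then f (s - e) else 0)) = prim f T"
    unfolding FT using lborel_integral_real_affine[of 1 F "- e"] unfolding unit_interval_def
    by (subst integral_restrict_space) (simp_all only: sh, auto)
qed

lemma AE_U_shift:
  assumes "AE t in U. P t"
  shows "AE s in U. \<forall>x. x = s - e \<longrightarrow> 0 < x \<longrightarrow> x < 1 \<longrightarrow> P x"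
proof -
  have 1: "AE t in lborel. t \<in> {0<..<1} \<longrightarrow> P t"
    using assms unfolding unit_interval_def by (subst (asm) AE_restrict_space_iff) auto
  have "AE t in distr lborel borel ((+) (- e)). t \<in> {0<..<1} \<longrightarrow> P t"
    using 1 by (simp only: lborel_distr_plus)
  then have "AE s in lborel. - e + s \<in> {0<..<1} \<longrightarrow> P (- e + s)"
    by (rule AE_distrD[rotated]) simp
  then show ?thesis
    unfolding unit_interval_def by (subst AE_restrict_space_iff) (auto elim!: eventually_mono)
qed

lemma prim_interval:
  assumes "integrable U k" "s \<le> t" and P: "\<And>r. r \<noteq> s \<Longrightarrow> r \<noteq> t \<Longrightarrow> P r \<longleftrightarrow> s < r \<and> r \<le> t"
    and m: "Measurable.pred U P"
  shows "(LINT r|U. (if P r then k r else 0)) = prim k t - prim k s"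
proof -
  note [measurable] = borel_measurable_integrable[OF assms(1)] m
  have "(LINT r|U. (if P r then k r else 0)) = (LINT r|U. (if s < r \<and> r \<le> t then k r else 0))"
  proof (rule integral_cong_AE)
    show "AE r in U. (if P r then k r else 0) = (if s < r \<and> r \<le> t then k r else 0)"
      using AE_U_neq[of s] AE_U_neq[of t] by eventually_elim (simp add: P)
  qed measurable
  then show ?thesis using prim_increment[OF assms(1,2)] by simp
qed

definition diag_strip :: "real \<Rightarrow> real \<Rightarrow> real \<times> real \<Rightarrow> bool"
  where "diag_strip T e p \<longleftrightarrow> fst p \<le> T \<and> fst p < snd p \<and> snd p \<le> fst p + e"

lemma measurable_diag_strip [measurable]: "Measurable.pred US (diag_strip T e)"
  unfolding diag_strip_def[abs_def] by measurable

text \<open>All sections of the strip, in either direction, have length at most e.\<close>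

lemma diag_strip_integral_le:
  assumes u: "integrable U u" "\<And>t. 0 < t \<Longrightarrow> t < 1 \<Longrightarrow> 0 \<le> u t" and e: "0 < e"
  shows "(LINT p|US. (if diag_strip T e p then u (fst p) else 0)) \<le> e * (LINT t|U. u t)"
    "(LINT p|US. (if diag_strip T e p then u (snd p) else 0)) \<le> e * (LINT t|U. u t)"
proof -
  note [measurable] = borel_measurable_integrable[OF u(1)]
  have i1: "integrable US (\<lambda>p. if diag_strip T e p then u (fst p) else 0)"
    by (rule Bochner_Integration.integrable_bound[OF integral_US_fst(2)[OF u(1)]]) auto
  have i2: "integrable US (\<lambda>p. if diag_strip T e p then u (snd p) else 0)"
    by (rule Bochner_Integration.integrable_bound[OF integral_US_snd(2)[OF u(1)]]) auto
  have len: "(LINT s|U. (if a < s \<and> s \<le> b then c else 0)) \<le> (b - a) * c" if "0 \<le> c" "a \<le> b" for a b c :: real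
  proof -
    have "(LINT s|U. (if a < s \<and> s \<le> b then c else 0)) = prim (\<lambda>_. c) b - prim (\<lambda>_. c) a"
      by (rule prim_increment[symmetric]) (use that in auto)
    also have "\<dots> \<le> (b - a) * c"
    proof -
      have p: "prim (\<lambda>_. c) t = c * max 0 (min 1 t)" for t
        by (subst prim_clamp, subst prim_FTC[of "\<lambda>_. c" _ "\<lambda>x. c * x", simplified, symmetric])
           (auto intro!: derivative_eq_intros)
      have "max 0 (min 1 b) - max 0 (min 1 a) \<le> b - a" using that by auto
      from mult_left_mono[OF this that(1)] show ?thesis unfolding p by (simp add: algebra_simps)
    qed
    finally show ?thesis .
  qed
  have "(LINT p|US. (if diag_strip T e p then u (fst p) else 0)) = (LINT t|U. LINT s|U. (if diag_strip T e (t, s) then u t else 0))"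
    using US_Fubini(2)[OF i1] by (simp cong: if_cong)
  also have "\<dots> \<le> (LINT t|U. e * u t)"
  proof (rule integral_mono)
    show "integrable U (\<lambda>t. LINT s|U. (if diag_strip T e (t, s) then u t else 0))" using US_Fubini(1)[OF i1] by (simp cong: if_cong)
    fix t assume t: "t \<in> space U"
    have "(LINT s|U. (if diag_strip T e (t, s) then u t else 0)) = (LINT s|U. (if t < s \<and> s \<le> t + e then (if t \<le> T then u t else 0) else 0))"
      by (rule Bochner_Integration.integral_cong) (auto simp: diag_strip_def)
    also have "\<dots> \<le> (t + e - t) * (if t \<le> T then u t else 0)" by (rule len) (use u(2)[of t] t e in auto)
    also have "\<dots> \<le> e * u t" using u(2)[of t] t e by auto
    finally show "(LINT s|U. (if diag_strip T e (t, s) then u t else 0)) \<le> e * u t" .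
  qed (use u in auto)
  finally show "(LINT p|US. (if diag_strip T e p then u (fst p) else 0)) \<le> e * (LINT t|U. u t)" by simp
  have "(LINT p|US. (if diag_strip T e p then u (snd p) else 0)) = (LINT s|U. LINT t|U. (if diag_strip T e (t, s) then u s else 0))"
    using US_Fubini(4)[OF i2] by (simp cong: if_cong)
  also have "\<dots> \<le> (LINT s|U. e * u s)"
  proof (rule integral_mono)
    show "integrable U (\<lambda>s. LINT t|U. (if diag_strip T e (t, s) then u s else 0))" using US_Fubini(3)[OF i2] by (simp cong: if_cong)
    fix s assume s: "s \<in> space U"
    have "(LINT t|U. (if diag_strip T e (t, s) then u s else 0)) \<le> (LINT t|U. (if s - e < t \<and> t \<le> s then u s else 0))"
    proof (rule integral_mono_AE)
      show "integrable U (\<lambda>t. if diag_strip T e (t, s) then u s else 0)"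
        by (rule U.L2_integrable, rule U.L2_bdd[where C = "u s"]) (use u(2)[of s] s in \<open>auto simp: diag_strip_def\<close>)
      show "integrable U (\<lambda>t. if s - e < t \<and> t \<le> s then u s else 0)"
        by (rule U.L2_integrable, rule U.L2_bdd[where C = "u s"]) (use u(2)[of s] s in auto)
      show "AE t in U. (if diag_strip T e (t, s) then u s else 0) \<le> (if s - e < t \<and> t \<le> s then u s else 0)"
        using AE_U_neq[of "s - e"] by eventually_elim (use u(2)[of s] s in \<open>auto simp: diag_strip_def\<close>)
    qed
    also have "\<dots> \<le> (s - (s - e)) * u s" by (rule len) (use u(2)[of s] s e in auto)
    finally show "(LINT t|U. (if diag_strip T e (t, s) then u s else 0)) \<le> e * u s" by simp
  qed (use u in auto)
  finally show "(LINT p|US. (if diag_strip T e p then u (snd p) else 0)) \<le> e * (LINT t|U. u t)" by simp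
qed

text \<open>The divergence theorem on the strip \<open>t \<le> T, t < s \<le> t + e\<close> for the field \<open>(D, D)\<close>, which is
  tangential to the edges \<open>s = t\<close> and \<open>s = t + e\<close>; here \<open>\<partial>\<^sub>t D = a\<close>, \<open>\<partial>\<^sub>s D = - b\<close> and \<open>D = 0\<close> for \<open>t = 0\<close>.\<close>

lemma diag_strip_divergence:
  fixes a b D :: "real \<Rightarrow> real \<Rightarrow> real"
  assumes a: "integrable US (\<lambda>p. a (fst p) (snd p))" and b: "integrable US (\<lambda>p. b (fst p) (snd p))"
    and Dm: "(\<lambda>p. D (fst p) (snd p)) \<in> borel_measurable US"
    and DM: "AE t in U. \<forall>s. 0 < s \<longrightarrow> s < 1 \<longrightarrow> \<bar>D t s\<bar> \<le> M t" "integrable U M"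
    and Da: "AE t in U. \<forall>s. 0 < s \<longrightarrow> s < 1 \<longrightarrow> D t s = prim (\<lambda>r. a r s) t"
    and Db: "AE t in U. \<forall>s. 0 < s \<longrightarrow> s < 1 \<longrightarrow> D t s = c t - prim (b t) s"
    and T: "0 < T" "\<And>s. 0 < s \<Longrightarrow> s < 1 \<Longrightarrow> D T s = prim (\<lambda>r. a r s) T"
      "\<And>s. 0 < s \<Longrightarrow> s < 1 \<Longrightarrow> \<bar>D T s\<bar> \<le> M T" and e: "0 < e" "T + e < 1"
  shows "(LINT s|U. (if T < s \<and> s \<le> T + e then D T s else 0)) =
    (LINT p|US. (if diag_strip T e p then a (fst p) (snd p) - b (fst p) (snd p) else 0))"
proof -
  note [measurable] = borel_measurable_integrable[OF a] borel_measurable_integrable[OF b] Dm borel_measurable_integrable[OF DM(2)]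
  let ?S = "diag_strip T e"
  have T1: "T < 1" using e by simp
  have ai: "integrable US (\<lambda>p. if ?S p then a (fst p) (snd p) else 0)"
    by (rule Bochner_Integration.integrable_bound[OF a]) auto
  have bi: "integrable US (\<lambda>p. if ?S p then b (fst p) (snd p) else 0)"
    by (rule Bochner_Integration.integrable_bound[OF b]) auto
  have curve [measurable]: "(\<lambda>s. D (f s) (g s)) \<in> borel_measurable U"
    if "f \<in> measurable U U" "g \<in> measurable U U" for f g
    using measurable_compose[OF measurable_Pair[OF that] Dm] by simp
  have curveT: "(\<lambda>s. D T s) \<in> borel_measurable U"
    by (rule curve[of "\<lambda>_. T" "\<lambda>x. x"]) (use T T1 in auto)
  \<comment> \<open>The boundary terms: \<open>H1\<close> belongs to the diagonal, \<open>H2\<close>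
    to the edge t = T, \<open>K\<close> to the edge s = t + e in the variable t, and
    \<open>H3\<close> is \<open>K\<close> in the variable s.\<close>
  define H1 where "H1 s = (if s \<le> T then D s s else 0)" for s
  define H2 where "H2 s = (if T < s \<and> s \<le> T + e then D T s else 0)" for s
  define K where "K t = (if t \<le> T then D t (t + e) else 0)" for t
  define H3 where "H3 s = (if e < s \<and> s \<le> T + e then K (s - e) else 0)" for s
  have H1i: "integrable U H1"
  proof (rule Bochner_Integration.integrable_bound[OF DM(2)])
    show "H1 \<in> borel_measurable U" unfolding H1_def[abs_def] using curve[of "\<lambda>x. x" "\<lambda>x. x"] by measurable
    show "AE s in U. norm (H1 s) \<le> norm (M s)"
      using DM(1) AE_space by eventually_elim (fastforce simp: H1_def)
  qed
  have H2i: "integrable U H2"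
  proof (rule U.L2_integrable, rule U.L2_bdd[where C = "M T"])
    show "H2 \<in> borel_measurable U" unfolding H2_def[abs_def] using curveT by measurable
    have "0 \<le> M T" using T(3)[of T] T(1) T1 by linarith
    then show "\<bar>H2 s\<bar> \<le> M T" if "s \<in> space U" for s using T(3)[of s] that by (auto simp: H2_def)
  qed
  have Ki: "integrable U K"
  proof (rule Bochner_Integration.integrable_bound[OF DM(2)])
    \<comment> \<open>The minimum keeps the second argument of D inside (0, 1) also for t > T, where
      the value is discarded.\<close>
    have "(\<lambda>t. D t (min (t + e) (T + e))) \<in> borel_measurable U"
      by (rule curve) (use e T in \<open>auto intro!: measurable_U_I\<close>)
    then have "(\<lambda>t. if t \<le> T then D t (min (t + e) (T + e)) else 0) \<in> borel_measurable U" by measurable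
    moreover have "(\<lambda>t. if t \<le> T then D t (min (t + e) (T + e)) else 0) = K" by (auto simp: K_def min_def fun_eq_iff)
    ultimately show "K \<in> borel_measurable U" by simp
    show "AE t in U. norm (K t) \<le> norm (M t)"
      using DM(1) AE_space
    proof eventually_elim
      case (elim t)
      show "norm (K t) \<le> norm (M t)"
      proof (cases "t \<le> T")
        case True
        then have "0 < t + e" "t + e < 1" using elim(2) e by auto
        then have "\<bar>D t (t + e)\<bar> \<le> M t" using elim(1) by blast
        then show ?thesis using True by (simp add: K_def)
      qed (simp add: K_def)
    qed
  qed
  have H3i: "integrable U H3" unfolding H3_def[abs_def] by (rule U_shift(1)[OF Ki]) (use e T in auto)
  have H3v: "(LINT s|U. H3 s) = (LINT t|U. K t)"
  proof -
    have "(LINT s|U. H3 s) = prim K T" unfolding H3_def by (rule U_shift(2)[OF Ki]) (use e T in auto)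
    also have "\<dots> = (LINT t|U. K t)" unfolding prim_def by (rule Bochner_Integration.integral_cong) (auto simp: K_def)
    finally show ?thesis .
  qed
  have "(LINT p|US. (if ?S p then a (fst p) (snd p) else 0)) = (LINT s|U. LINT t|U. (if ?S (t, s) then a t s else 0))"
    using US_Fubini(4)[OF ai] by (simp cong: if_cong)
  also have "\<dots> = (LINT s|U. H1 s + H2 s - H3 s)"
  proof (rule integral_cong_AE)
    show "(\<lambda>s. LINT t|U. (if ?S (t, s) then a t s else 0)) \<in> borel_measurable U"
      using borel_measurable_integrable[OF US_Fubini(3)[OF ai]] by (simp cong: if_cong)
    show "(\<lambda>s. H1 s + H2 s - H3 s) \<in> borel_measurable U" using H1i H2i H3i by auto
    show "AE s in U. (LINT t|U. (if ?S (t, s) then a t s else 0)) = H1 s + H2 s - H3 s"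
      using Da AE_U_shift[OF Da, of e] US_Fubini(6)[OF a] AE_space
    proof eventually_elim
      case (elim s)
      then have s: "0 < s" "s < 1" and ai: "integrable U (\<lambda>r. a r s)" by auto
      let ?A = "prim (\<lambda>r. a r s)"
      have "(LINT t|U. (if ?S (t, s) then a t s else 0)) = ?A (min T s) - ?A (min T (s - e))"
        by (rule prim_interval[OF ai]) (use e in \<open>auto simp: diag_strip_def min_def\<close>)
      also have "?A (min T s) = (if s \<le> T then D s s else D T s)"
        using elim(1) s T by (auto simp: min_def)
      also have "?A (min T (s - e)) = (if s \<le> e then 0 else if s - e \<le> T then D (s - e) s else D T s)"
        using elim(2) s T e by (auto simp: min_def prim_0)
      also have "(if s \<le> T then D s s else D T s) - (if s \<le> e then 0 else if s - e \<le> T then D (s - e) s else D T s) = H1 s + H2 s - H3 s"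
        using T e s by (auto simp: H1_def H2_def H3_def K_def)
      finally show ?case .
    qed
  qed
  also have "\<dots> = (LINT s|U. H1 s) + (LINT s|U. H2 s) - (LINT t|U. K t)" using H1i H2i H3i by (simp add: H3v)
  finally have A: "(LINT p|US. (if ?S p then a (fst p) (snd p) else 0)) = (LINT s|U. H1 s) + (LINT s|U. H2 s) - (LINT t|U. K t)" .
  have "(LINT p|US. (if ?S p then b (fst p) (snd p) else 0)) = (LINT t|U. LINT s|U. (if ?S (t, s) then b t s else 0))"
    using US_Fubini(2)[OF bi] by (simp cong: if_cong)
  also have "\<dots> = (LINT t|U. H1 t - K t)"
  proof (rule integral_cong_AE)
    show "(\<lambda>t. LINT s|U. (if ?S (t, s) then b t s else 0)) \<in> borel_measurable U"
      using borel_measurable_integrable[OF US_Fubini(1)[OF bi]] by (simp cong: if_cong)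
    show "(\<lambda>s. H1 s - K s) \<in> borel_measurable U" using H1i Ki by auto
    show "AE t in U. (LINT s|U. (if ?S (t, s) then b t s else 0)) = H1 t - K t"
      using Db US_Fubini(5)[OF b] AE_space
    proof eventually_elim
      case (elim t)
      then have t: "0 < t" "t < 1" and bi: "integrable U (b t)" by auto
      show ?case
      proof (cases "t \<le> T")
        case True
        have "(LINT s|U. (if ?S (t, s) then b t s else 0)) = prim (b t) (t + e) - prim (b t) t"
          by (rule prim_interval[OF bi]) (use e True in \<open>auto simp: diag_strip_def\<close>)
        also have "\<dots> = D t t - D t (t + e)" using elim(1) t e True by simp
        finally show ?thesis using True by (simp add: H1_def K_def)
      next
        case False
        then have "(LINT s|U. (if ?S (t, s) then b t s else 0)) = 0" by (simp add: diag_strip_def)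
        then show ?thesis using False by (simp add: H1_def K_def)
      qed
    qed
  qed
  also have "\<dots> = (LINT t|U. H1 t) - (LINT t|U. K t)" using H1i Ki by simp
  finally have B: "(LINT p|US. (if ?S p then b (fst p) (snd p) else 0)) = (LINT t|U. H1 t) - (LINT t|U. K t)" .
  have "(LINT p|US. (if ?S p then a (fst p) (snd p) - b (fst p) (snd p) else 0))
      = (LINT p|US. (if ?S p then a (fst p) (snd p) else 0) - (if ?S p then b (fst p) (snd p) else 0))"
    by (rule Bochner_Integration.integral_cong) auto
  also have "\<dots> = (LINT s|U. H2 s)" using ai bi A B by simp
  finally show ?thesis by (simp add: H2_def)
qed

text \<open>Continuity of time translations in the mean: the squared distance of two slices,
  integrated over the strip, is o(e). A continuous function close to g is uniformly continuous, and
  what g and it differ by contributes at most in proportion to e.\<close>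

lemma L2_time_continuity:
  assumes g: "g \<in> L2 US" and \<eta>: "\<eta> > 0"
  obtains e0 where "e0 > 0" "\<And>T e. 0 < e \<Longrightarrow> e < e0 \<Longrightarrow>
    integrable US (\<lambda>p. if diag_strip T e p then (LINT x|U. (g (x, fst p) - g (x, snd p))\<^sup>2) else 0) \<and>
    (LINT p|US. (if diag_strip T e p then (LINT x|U. (g (x, fst p) - g (x, snd p))\<^sup>2) else 0)) \<le> \<eta> * e"
proof -
  interpret C: continuous_density US by standard (rule borel_ident_US)
  obtain c where c: "c \<in> bounded_continuous" "(LINT p|US. (g p - c p)\<^sup>2) < \<eta> / 16"
    using approx_US[OF g] \<eta> by (auto simp: continuous_approx_def dest: spec[of _ "\<eta> / 16"])
  have cL: "c \<in> L2 US" using c(1) by (rule C.bc_L2)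
  note [measurable] = L2D(1)[OF g] L2D(1)[OF cL]
  have gc: "(\<lambda>p. g p - c p) \<in> L2 US" by (intro L2_diff g cL)
  define u where "u t = (LINT x|U. (g (x, t) - c (x, t))\<^sup>2)" for t
  have ui: "integrable U u" "(LINT t|U. u t) < \<eta> / 16"
    using US_Fubini(3,4)[OF L2D(2)[OF gc]] c(2) by (simp_all add: u_def[abs_def])
  have u0: "0 \<le> u t" for t by (simp add: u_def)
  have "uniformly_continuous_on ({0..1} \<times> {0..1}) c"
    using c(1) by (intro compact_uniformly_continuous compact_Times) (auto simp: bounded_continuous_def intro: continuous_on_subset)
  then obtain e0 where e0: "e0 > 0" "\<And>p q. p \<in> {0..1} \<times> {0..1} \<Longrightarrow> q \<in> {0..1} \<times> {0..1} \<Longrightarrow> dist q p < e0 \<Longrightarrow> dist (c q) (c p) < sqrt (\<eta> / 8)"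
    using \<eta> unfolding uniformly_continuous_on_def by (metis divide_pos_pos real_sqrt_gt_zero zero_less_numeral)
  show ?thesis
  proof (rule that[OF e0(1)])
    fix T e :: real assume e: "0 < e" "e < e0"
    let ?S = "diag_strip T e"
    let ?g = "\<lambda>p. LINT x|U. (g (x, fst p) - g (x, snd p))\<^sup>2"
    \<comment> \<open>The weights 4, 4, 2 come from splitting squares of sums twice. With the
      thresholds \<eta> / 16 and \<eta> / 8 they add up to at most 3/4 \<eta> e.\<close>
    let ?B = "\<lambda>p. 4 * (if ?S p then u (fst p) else 0) + (4 * (if ?S p then u (snd p) else 0) + 2 * (if ?S p then \<eta> / 8 else 0))"
    have i1: "integrable US (\<lambda>p. if ?S p then u (fst p) else 0)"
      by (rule Bochner_Integration.integrable_bound[OF integral_US_fst(2)[OF ui(1)]]) (use ui in auto)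
    have i2: "integrable US (\<lambda>p. if ?S p then u (snd p) else 0)"
      by (rule Bochner_Integration.integrable_bound[OF integral_US_snd(2)[OF ui(1)]]) (use ui in auto)
    have i3: "integrable US (\<lambda>p. if ?S p then \<eta> / 8 else 0)"
      by (rule Bochner_Integration.integrable_bound[OF US.integrable_const[of "\<eta> / 8"]]) auto
    have gm: "(\<lambda>p. if ?S p then ?g p else 0) \<in> borel_measurable US" by measurable
    have le: "AE p in US. (if ?S p then ?g p else 0) \<le> ?B p"
    proof (rule UU.AE_pair_measure)
      show "{p \<in> space US. (if ?S p then ?g p else 0) \<le> ?B p} \<in> sets US"
        using borel_measurable_integrable[OF i1] borel_measurable_integrable[OF i2] borel_measurable_integrable[OF i3] gm by measurable
      have good: "AE t in U. (\<lambda>x. g (x, t)) \<in> L2 U \<and> (\<lambda>x. c (x, t)) \<in> L2 U"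
        using L2_slices(1)[OF g] L2_slices(1)[OF cL] by eventually_elim auto
      show "AE t in U. AE s in U. (if ?S (t, s) then ?g (t, s) else 0) \<le> ?B (t, s)"
        using good AE_space
      proof eventually_elim
        case (elim t)
        note t = elim
        show ?case using good AE_space
        proof eventually_elim
          case (elim s)
          show ?case
          proof (cases "?S (t, s)")
            case True
            have ts: "0 < t" "t < 1" "0 < s" "s < 1" using t elim by auto
            let ?v = "\<lambda>t x. g (x, t) - c (x, t)"
            have vL: "?v t \<in> L2 U" "(\<lambda>x. - ?v s x) \<in> L2 U" "(\<lambda>x. c (x, t) - c (x, s)) \<in> L2 U"
              using t elim by auto
            have "?g (t, s) = (LINT x|U. ((?v t x + - ?v s x) + (c (x, t) - c (x, s)))\<^sup>2)" by simp
            also have "\<dots> \<le> 2 * (LINT x|U. (?v t x + - ?v s x)\<^sup>2) + 2 * (LINT x|U. (c (x, t) - c (x, s))\<^sup>2)"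
              by (intro integral_square_add_le L2_add vL)
            also have "(LINT x|U. (?v t x + - ?v s x)\<^sup>2) \<le> 2 * u t + 2 * u s"
              using integral_square_add_le[OF vL(1,2)] unfolding u_def power2_minus .
            also have "(LINT x|U. (c (x, t) - c (x, s))\<^sup>2) \<le> (LINT x|U. \<eta> / 8)"
            proof (intro integral_mono L2D(2) vL)
              fix x assume "x \<in> space U"
              then have "dist (c (x, t)) (c (x, s)) < sqrt (\<eta> / 8)"
                using ts e True by (intro e0(2)) (auto simp: dist_Pair_Pair dist_real_def diag_strip_def)
              then show "(c (x, t) - c (x, s))\<^sup>2 \<le> \<eta> / 8"
                using power_mono[of "\<bar>c (x, t) - c (x, s)\<bar>" "sqrt (\<eta> / 8)" 2] \<eta> by (simp add: dist_real_def)
            qed auto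
            finally show ?thesis using True by simp
          qed simp
        qed
      qed
    qed
    have Bi: "integrable US ?B" using i1 i2 i3 by auto
    have gi: "integrable US (\<lambda>p. if ?S p then ?g p else 0)"
      by (rule Bochner_Integration.integrable_bound[OF Bi gm]) (use le in \<open>auto elim!: eventually_mono\<close>)
    have "(LINT p|US. (if ?S p then ?g p else 0)) \<le> (LINT p|US. ?B p)"
      by (rule integral_mono_AE[OF gi Bi le])
    also have "\<dots> = 4 * (LINT p|US. (if ?S p then u (fst p) else 0)) + (4 * (LINT p|US. (if ?S p then u (snd p) else 0)) + 2 * (LINT p|US. (if ?S p then \<eta> / 8 else 0)))"
      using i1 i2 i3 by simp
    also have "\<dots> \<le> 4 * (e * (LINT t|U. u t)) + (4 * (e * (LINT t|U. u t)) + 2 * (e * (LINT t|U. \<eta> / 8)))"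
      using diag_strip_integral_le(1)[OF ui(1) u0 e(1), of T] diag_strip_integral_le(2)[OF ui(1) u0 e(1), of T]
        diag_strip_integral_le(1)[of "\<lambda>_. \<eta> / 8" e T] e \<eta>
      by (intro add_mono mult_left_mono) auto
    also have "\<dots> \<le> \<eta> * e"
    proof -
      have "e * (LINT t|U. u t) \<le> e * (\<eta> / 16)" using ui(2) e by (intro mult_left_mono) auto
      moreover have "0 \<le> \<eta> * e" using \<eta> e by simp
      ultimately show ?thesis by (simp add: algebra_simps)
    qed
    finally show "integrable US (\<lambda>p. if ?S p then ?g p else 0) \<and> (LINT p|US. (if ?S p then ?g p else 0)) \<le> \<eta> * e"
      using gi by simp
  qed
qed

lemma AE_US_fst:
  assumes "AE t in U. P t" shows "AE p in US. P (fst p)"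
proof -
  have "distr US U fst = U"
  proof (rule measure_eqI)
    fix A assume "A \<in> sets (distr US U fst)"
    then have A: "A \<in> sets U" by simp
    have "fst -` A \<inter> space US = A \<times> {0<..<1}" using sets.sets_into_space[OF A] by (auto simp: space_US)
    then show "emeasure (distr US U fst) A = emeasure U A"
      using A sets.top[of U] by (simp add: emeasure_distr U.emeasure_pair_measure_Times emeasure_U)
  qed simp
  then have "AE t in distr US U fst. P t" using assms by (simp only:)
  then show ?thesis by (rule AE_distrD[rotated]) simp
qed

lemma kernel_pairing_bound:
  assumes d: "(\<lambda>x. d (x, t)) \<in> L2 U" and p': "p' \<in> L2 U" "sqrt (LINT x|U. (p' x)\<^sup>2) \<le> S"
    and p: "p \<in> borel_measurable U" "\<And>x. 0 < x \<Longrightarrow> x < 1 \<Longrightarrow> \<bar>p x\<bar> \<le> C"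
    and w1: "w1 \<in> borel_measurable U" "\<And>x. 0 < x \<Longrightarrow> x < 1 \<Longrightarrow> \<bar>w1 x\<bar> \<le> \<gamma>"
    and w2: "w2 \<in> L2 U" "sqrt (LINT x|U. (w2 x)\<^sup>2) \<le> \<gamma>"
  shows "\<bar>LINT x|U. d (x, t) * (p' x * w1 x + p x * w2 x)\<bar> \<le> slice_norm d t * ((S + C) * \<gamma>)"
proof -
  have C: "0 \<le> C" using p(2)[of "1/2"] by simp
  have \<gamma>: "0 \<le> \<gamma>" using w1(2)[of "1/2"] by simp
  have N: "0 \<le> slice_norm d t" by (simp add: slice_norm_def)
  have L1: "(\<lambda>x. p' x * w1 x) \<in> L2 U" using L2_mult_bdd[OF p'(1) w1(1), of \<gamma>] w1(2) by (simp add: mult.commute)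
  have L2: "(\<lambda>x. p x * w2 x) \<in> L2 U" by (rule L2_mult_bdd[OF w2(1) p(1), of C]) (use p(2) in simp)
  have "(LINT x|U. (p' x * w1 x)\<^sup>2) \<le> (LINT x|U. \<gamma>\<^sup>2 * (p' x)\<^sup>2)"
  proof (intro integral_mono L2D(2) L1 integrable_mult_right p')
    fix x assume "x \<in> space U"
    then have "(w1 x)\<^sup>2 \<le> \<gamma>\<^sup>2" using w1(2)[of x] \<gamma> by (simp flip: abs_le_square_iff)
    from mult_right_mono[OF this, of "(p' x)\<^sup>2"] show "(p' x * w1 x)\<^sup>2 \<le> \<gamma>\<^sup>2 * (p' x)\<^sup>2"
      by (simp add: power_mult_distrib mult.commute)
  qed
  from real_sqrt_le_mono[OF this] have 1: "sqrt (LINT x|U. (p' x * w1 x)\<^sup>2) \<le> \<gamma> * S"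
    using \<gamma> mult_left_mono[OF p'(2) \<gamma>] by (simp add: real_sqrt_mult)
  have "(LINT x|U. (p x * w2 x)\<^sup>2) \<le> (LINT x|U. C\<^sup>2 * (w2 x)\<^sup>2)"
  proof (intro integral_mono L2D(2) L2 integrable_mult_right w2)
    fix x assume "x \<in> space U"
    then have "(p x)\<^sup>2 \<le> C\<^sup>2" using p(2)[of x] C by (simp flip: abs_le_square_iff)
    from mult_right_mono[OF this, of "(w2 x)\<^sup>2"] show "(p x * w2 x)\<^sup>2 \<le> C\<^sup>2 * (w2 x)\<^sup>2"
      by (simp add: power_mult_distrib)
  qed
  from real_sqrt_le_mono[OF this] have 2: "sqrt (LINT x|U. (p x * w2 x)\<^sup>2) \<le> C * \<gamma>"
    using C mult_left_mono[OF w2(2) C] by (simp add: real_sqrt_mult)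
  have "(LINT x|U. d (x, t) * (p' x * w1 x + p x * w2 x)) = (LINT x|U. d (x, t) * (p' x * w1 x)) + (LINT x|U. d (x, t) * (p x * w2 x))"
    unfolding distrib_left by (intro Bochner_Integration.integral_add integrable_mult_L2 d L1 L2)
  moreover have "\<bar>LINT x|U. d (x, t) * (p' x * w1 x)\<bar> \<le> slice_norm d t * (\<gamma> * S)"
    by (rule order_trans[OF slice_pairing[OF d L1] mult_left_mono[OF 1 N]])
  moreover have "\<bar>LINT x|U. d (x, t) * (p x * w2 x)\<bar> \<le> slice_norm d t * (C * \<gamma>)"
    by (rule order_trans[OF slice_pairing[OF d L2] mult_left_mono[OF 2 N]])
  ultimately show ?thesis by (simp add: algebra_simps)
qed

context velocity
begin

subsection \<open>Uniqueness for the transport equation\<close>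

context
  fixes d :: "real \<times> real \<Rightarrow> real" and d1 :: "real \<Rightarrow> real" and k :: nat
  assumes d: "d \<in> L2 US" and hom: "solves_homogeneous d d1"
begin

definition tpair :: "real \<Rightarrow> real \<Rightarrow> real"
  where "tpair t s = (LINT x|U. d (x, t) * tst k s x)"

text \<open>\<open>tpair_t\<close> is the rate of \<open>tpair\<close> in t and takes the velocity
  at time t; \<open>tpair_s\<close> is minus the rate in s and takes it at time s. Apart from that
  the two coincide.\<close>

definition tpair_t :: "real \<Rightarrow> real \<Rightarrow> real"
  where "tpair_t t s = pairing_rate d (tst k s) (dtst k s) t t"

definition tpair_s :: "real \<Rightarrow> real \<Rightarrow> real"
  where "tpair_s t s = pairing_rate d (tst k s) (dtst k s) s t"

lemma d_measurable: "d \<in> borel_measurable US"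
  using d by (rule L2D)

lemma tst_measurable_U: "tst k s \<in> borel_measurable U"
  using tst_L2 by (rule L2D)

lemma sqrt_dtst: "sqrt (LINT x|U. (dtst k s x)\<^sup>2) \<le> sqrt (tst_const k)"
  by (intro real_sqrt_le_mono dtst_L2)

text \<open>\<open>pairing_H1\<close> for \<open>tst k s\<close>, which is absolutely continuous in
  x; its exceptional times do not depend on s.\<close>

lemma tpair_alpha: "AE t in U. \<forall>s. tpair t s = prim (\<lambda>r. tpair_t r s) t"
  using pairing_H1[OF d hom]
proof eventually_elim
  case (elim t)
  show ?case
  proof
    fix s
    have e: "tst k s 0 + prim (dtst k s) x = tst k s x" if "0 < x" "x < 1" for x
      using tst_prim[of x k s] that by simp
    have "tpair t s = (LINT x|U. d (x, t) * (tst k s 0 + prim (dtst k s) x))"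
      unfolding tpair_def by (intro Bochner_Integration.integral_cong) (auto simp: e)
    also have "\<dots> = prim (\<lambda>r. pairing_rate d (\<lambda>x. tst k s 0 + prim (dtst k s) x) (dtst k s) r r) t"
      using elim dtst_L2(1) by blast
    also have "\<dots> = prim (\<lambda>r. tpair_t r s) t"
      unfolding tpair_t_def pairing_rate_def by (intro prim_cong Bochner_Integration.integral_cong) (auto simp: e)
    finally show "tpair t s = prim (\<lambda>r. tpair_t r s) t" .
  qed
qed

lemma tpair_beta: "AE t in U. \<forall>s. 0 < s \<longrightarrow> s < 1 \<longrightarrow> tpair t s = (LINT x|U. d (x, t) * x ^ k) - prim (tpair_s t) s"
  using L2_slices(1)[OF d]
proof eventually_elim
  case (elim t)
  note [measurable] = L2D(1)[OF elim] L2D(1)[OF tst_L2] L2D(1)[OF L2_time_integral(3)[OF tst_rate_L2]]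
  show ?case
  proof (intro allI impI)
    fix s :: real assume s: "0 < s" "s < 1"
    have pL: "(\<lambda>x. prim (\<lambda>r. tst_rate k (x, r)) s) \<in> L2 U" by (intro L2_time_integral tst_rate_L2)
    have gi: "integrable US (\<lambda>p. d (fst p, t) * tst_rate k p)"
      by (intro integrable_mult_L2 L2_US_fst[OF elim] tst_rate_L2)
    have "tpair t s = (LINT x|U. d (x, t) * x ^ k - d (x, t) * prim (\<lambda>r. tst_rate k (x, r)) s)"
      unfolding tpair_def
    proof (rule integral_cong_AE)
      show "AE x in U. d (x, t) * tst k s x = d (x, t) * x ^ k - d (x, t) * prim (\<lambda>r. tst_rate k (x, r)) s"
        using tst_evolution[of s k] s by (auto elim!: eventually_mono simp: right_diff_distrib)
    qed measurable
    also have "\<dots> = (LINT x|U. d (x, t) * x ^ k) - (LINT x|U. d (x, t) * prim (\<lambda>r. tst_rate k (x, r)) s)"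
      by (intro Bochner_Integration.integral_diff integrable_mult_L2 elim L2_monomial pL)
    also have "(LINT x|U. d (x, t) * prim (\<lambda>r. tst_rate k (x, r)) s) = (LINT x|U. prim (\<lambda>r. d (x, t) * tst_rate k (x, r)) s)"
      by (simp add: prim_cmult)
    also have "\<dots> = prim (\<lambda>r. LINT x|U. d (x, t) * tst_rate k (x, r)) s"
      using integral_prim_swap[OF gi, of s] by simp
    also have "\<dots> = prim (tpair_s t) s" by (simp add: tpair_s_def[abs_def] pairing_rate_def tst_rate_def)
    finally show "tpair t s = (LINT x|U. d (x, t) * x ^ k) - prim (tpair_s t) s" .
  qed
qed

lemma tpair_measurable: "(\<lambda>p. tpair (fst p) (snd p)) \<in> borel_measurable US"
  "(\<lambda>p. tpair_t (fst p) (snd p)) \<in> borel_measurable US" "(\<lambda>p. tpair_s (fst p) (snd p)) \<in> borel_measurable US"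
proof -
  note [measurable] = d_measurable
  show "(\<lambda>p. tpair (fst p) (snd p)) \<in> borel_measurable US" unfolding tpair_def by measurable
  show "(\<lambda>p. tpair_t (fst p) (snd p)) \<in> borel_measurable US" unfolding tpair_t_def pairing_rate_def by measurable
  show "(\<lambda>p. tpair_s (fst p) (snd p)) \<in> borel_measurable US" unfolding tpair_s_def pairing_rate_def by measurable
qed

definition tpair_bound :: real
  where "tpair_bound = sqrt (tst_const k) + exp lip_total"

lemma abs_tpair_rate:
  assumes "0 < r" "r < 1" "(\<lambda>x. d (x, t)) \<in> L2 U"
  shows "\<bar>pairing_rate d (tst k s) (dtst k s) r t\<bar> \<le> tpair_bound * (slice_norm d t * lip r)"
proof -
  have "\<bar>pairing_rate d (tst k s) (dtst k s) r t\<bar> \<le> slice_norm d t * lip r * (sqrt (LINT x|U. (dtst k s x)\<^sup>2) + exp lip_total)"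
    by (rule abs_pairing_rate[OF assms(1,2) dtst_L2(1) tst_measurable_U _ assms(3)]) (simp add: abs_tst_le)
  also have "\<dots> \<le> slice_norm d t * lip r * tpair_bound"
    unfolding tpair_bound_def using sqrt_dtst[of s] lip_nonneg[of r]
    by (intro mult_left_mono) (auto simp: slice_norm_def)
  finally show ?thesis by (simp add: mult_ac)
qed

lemma tpair_integrable: "integrable US (\<lambda>p. tpair_t (fst p) (snd p))" "integrable US (\<lambda>p. tpair_s (fst p) (snd p))"
proof -
  have g: "AE p in US. (\<lambda>x. d (x, fst p)) \<in> L2 U" by (rule AE_US_fst[OF L2_slices(1)[OF d]])
  have i: "integrable US (\<lambda>p. tpair_bound * (slice_norm d (fst p) * lip (fst p)))"
    using integral_US_fst(2)[OF integrable_mult_L2[OF slice_norm_L2(1)[OF d] lip_L2]] by simp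
  have i': "integrable US (\<lambda>p. tpair_bound * (slice_norm d (fst p) * lip (snd p)))"
    using integrable_mult_L2[OF L2_US_fst[OF slice_norm_L2(1)[OF d]] L2_US_snd[OF lip_L2]] by simp
  show "integrable US (\<lambda>p. tpair_t (fst p) (snd p))"
  proof (rule Bochner_Integration.integrable_bound[OF i tpair_measurable(2)])
    show "AE p in US. norm (tpair_t (fst p) (snd p)) \<le> norm (tpair_bound * (slice_norm d (fst p) * lip (fst p)))"
      using g AE_space unfolding tpair_t_def
      by eventually_elim (auto simp: space_US intro!: order_trans[OF abs_tpair_rate])
  qed
  show "integrable US (\<lambda>p. tpair_s (fst p) (snd p))"
  proof (rule Bochner_Integration.integrable_bound[OF i' tpair_measurable(3)])
    show "AE p in US. norm (tpair_s (fst p) (snd p)) \<le> norm (tpair_bound * (slice_norm d (fst p) * lip (snd p)))"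
      using g AE_space unfolding tpair_s_def
      by eventually_elim (auto simp: space_US intro!: order_trans[OF abs_tpair_rate])
  qed
qed

text \<open>Only the velocities at times t and s differ. The L2 distance of \<open>vel_x\<close> at
  these times bounds the sup distance of \<open>vel\<close> as well, because \<open>vel\<close>
  vanishes at x = 0.\<close>

lemma abs_tpair_difference:
  assumes t: "0 < t" "t < 1" "0 < s" "s < 1" and dt: "(\<lambda>x. d (x, t)) \<in> L2 U"
  shows "\<bar>tpair_t t s - tpair_s t s\<bar> \<le> slice_norm d t * (tpair_bound * sqrt (LINT x|U. (vel_x x t - vel_x x s)\<^sup>2))"
proof -
  have vL: "(\<lambda>x. vel_x x r) \<in> L2 U" if "0 < r" "r < 1" for r
    by (rule continuous_L2[OF continuous_vel_x[OF that]])
  have wL: "(\<lambda>x. vel_x x t - vel_x x s) \<in> L2 U" using t by (intro L2_diff vL)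
  have "\<bar>vel x t - vel x s\<bar> \<le> sqrt (LINT x|U. (vel_x x t - vel_x x s)\<^sup>2)" if "0 < x" "x < 1" for x
  proof -
    have "vel x t - vel x s = prim (\<lambda>x. vel_x x t - vel_x x s) x"
      using t that by (simp add: vel_prim prim_diff U.L2_integrable vL)
    then show ?thesis using abs_prim_L2[OF wL, of x] by simp
  qed
  then have "\<bar>LINT x|U. d (x, t) * (dtst k s x * (vel x t - vel x s) + tst k s x * (vel_x x t - vel_x x s))\<bar>
      \<le> slice_norm d t * ((sqrt (tst_const k) + exp lip_total) * sqrt (LINT x|U. (vel_x x t - vel_x x s)\<^sup>2))"
    by (intro kernel_pairing_bound[where C = "exp lip_total"] dt dtst_L2 sqrt_dtst tst_measurable_U wL
        borel_measurable_diff velocity_slice_measurable t order_refl) (auto intro: abs_tst_le)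
  moreover have "tpair_t t s - tpair_s t s = (LINT x|U. d (x, t) * (dtst k s x * (vel x t - vel x s) + tst k s x * (vel_x x t - vel_x x s)))"
  proof -
    have i: "integrable U (\<lambda>x. d (x, t) * (dtst k s x * vel x r + tst k s x * vel_x x r))" if "0 < r" "r < 1" for r
      by (intro integrable_mult_L2 dt L2_add rate_kernel[OF that dtst_L2(1) tst_measurable_U, where C = "exp lip_total"])
         (auto intro: abs_tst_le)
    show ?thesis unfolding tpair_t_def tpair_s_def pairing_rate_def
      by (subst Bochner_Integration.integral_diff[symmetric, OF i i])
         (use t in \<open>auto intro!: Bochner_Integration.integral_cong simp: algebra_simps\<close>)
  qed
  ultimately show ?thesis by (simp add: tpair_bound_def)
qed

text \<open>By \<open>diag_strip_divergence\<close> the integral of D(T, .) over (T, T + e] is the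
  strip integral of \<open>tpair_t\<close> minus \<open>tpair_s\<close>. This is o(e): the integrand
  is at most the norm of d at time t times the distance of \<open>vel_x\<close> at nearby times,
  Young's inequality separates the two factors, and \<open>L2_time_continuity\<close> handles the
  second. Division by e and continuity of D(T, .) give the claim.\<close>

lemma tpair_diagonal: "AE t in U. tpair t t = 0"
proof -
  let ?N = "slice_norm d"
  define W where "W = (LINT p|US. (d p)\<^sup>2)"
  have W0: "0 \<le> W" by (simp add: W_def)
  have Ni: "integrable U (\<lambda>t. (?N t)\<^sup>2)" by (intro L2D(2) slice_norm_L2 d)
  have strip: "\<exists>e0>0. \<forall>e T. 0 < e \<longrightarrow> e < e0 \<longrightarrow>
      \<bar>LINT p|US. (if diag_strip T e p then tpair_t (fst p) (snd p) - tpair_s (fst p) (snd p) else 0)\<bar> \<le> \<theta> * e"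
    if "\<theta> > 0" for \<theta>
  proof -
    \<comment> \<open>\<delta> weighs the part with the squared norm of d, whose strip integral is
      at most e W; \<eta>, chosen after it, weighs the part with factor
      \<open>tpair_bound\<^sup>2 / \<delta>\<close>. Each part gets \<theta> / 2.\<close>
    define \<delta> where "\<delta> = \<theta> / (2 * (W + 1))"
    have \<delta>: "\<delta> > 0" "\<delta> * W \<le> \<theta> / 2" using \<open>\<theta> > 0\<close> W0 by (auto simp: \<delta>_def field_simps)
    define \<eta> where "\<eta> = \<theta> * \<delta> / (2 * (tpair_bound\<^sup>2 + 1))"
    have \<eta>: "\<eta> > 0" "tpair_bound\<^sup>2 / \<delta> * \<eta> \<le> \<theta> / 2"
      using \<open>\<theta> > 0\<close> \<delta>(1) by (auto simp: \<eta>_def field_simps add_pos_nonneg)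
    obtain e0 where e0: "e0 > 0" "\<And>T e. 0 < e \<Longrightarrow> e < e0 \<Longrightarrow>
      integrable US (\<lambda>p. if diag_strip T e p then (LINT x|U. (vel_x x (fst p) - vel_x x (snd p))\<^sup>2) else 0) \<and>
      (LINT p|US. (if diag_strip T e p then (LINT x|U. (vel_x x (fst p) - vel_x x (snd p))\<^sup>2) else 0)) \<le> \<eta> * e"
      using L2_time_continuity[OF velocity_L2(2) \<eta>(1)] unfolding fst_conv snd_conv by blast
    show ?thesis
    proof (intro exI[of _ e0] conjI e0(1) allI impI)
      fix e T :: real assume e: "0 < e" "e < e0"
      let ?S = "diag_strip T e"
      let ?g = "\<lambda>p. LINT x|U. (vel_x x (fst p) - vel_x x (snd p))\<^sup>2"
      let ?ab = "\<lambda>p. if ?S p then tpair_t (fst p) (snd p) - tpair_s (fst p) (snd p) else 0"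
      have i1: "integrable US (\<lambda>p. if ?S p then (?N (fst p))\<^sup>2 else 0)"
        by (rule Bochner_Integration.integrable_bound[OF integral_US_fst(2)[OF Ni]])
           (use L2D(1)[OF slice_norm_L2(1)[OF d]] in auto)
      have abi: "integrable US ?ab"
        by (rule Bochner_Integration.integrable_bound[OF Bochner_Integration.integrable_diff[OF tpair_integrable]])
           (use tpair_measurable in auto)
      have "\<bar>LINT p|US. ?ab p\<bar> \<le> (LINT p|US. \<bar>?ab p\<bar>)" by (rule integral_abs_bound)
      also have "\<dots> \<le> (LINT p|US. \<delta> * (if ?S p then (?N (fst p))\<^sup>2 else 0) + tpair_bound\<^sup>2 / \<delta> * (if ?S p then ?g p else 0))"
      proof (rule integral_mono_AE)
        show "integrable US (\<lambda>p. \<delta> * (if ?S p then (?N (fst p))\<^sup>2 else 0) + tpair_bound\<^sup>2 / \<delta> * (if ?S p then ?g p else 0))"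
          using i1 e0(2)[OF e, of T] by (intro Bochner_Integration.integrable_add integrable_mult_right) auto
        show "AE p in US. \<bar>?ab p\<bar> \<le> \<delta> * (if ?S p then (?N (fst p))\<^sup>2 else 0) + tpair_bound\<^sup>2 / \<delta> * (if ?S p then ?g p else 0)"
          using AE_US_fst[OF L2_slices(1)[OF d]] AE_space
        proof eventually_elim
          case (elim p)
          have "\<bar>tpair_t (fst p) (snd p) - tpair_s (fst p) (snd p)\<bar> \<le> ?N (fst p) * (tpair_bound * sqrt (?g p))"
            using elim by (intro abs_tpair_difference) (auto simp: space_US)
          also have "\<dots> \<le> \<delta> * (?N (fst p))\<^sup>2 + tpair_bound\<^sup>2 / \<delta> * ?g p"
          proof -
            have "\<bar>(sqrt \<delta> * ?N (fst p)) * (tpair_bound * sqrt (?g p) / sqrt \<delta>)\<bar>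
                \<le> (sqrt \<delta> * ?N (fst p))\<^sup>2 + (tpair_bound * sqrt (?g p) / sqrt \<delta>)\<^sup>2"
              by (rule two_mult_le)
            then show ?thesis using \<delta>(1) by (simp add: power_mult_distrib power_divide)
          qed
          finally show ?case by simp
        qed
      qed (use abi in simp)
      also have "\<dots> = \<delta> * (LINT p|US. (if ?S p then (?N (fst p))\<^sup>2 else 0)) + tpair_bound\<^sup>2 / \<delta> * (LINT p|US. (if ?S p then ?g p else 0))"
        using i1 e0(2)[OF e, of T] by (subst Bochner_Integration.integral_add) auto
      also have "\<dots> \<le> \<delta> * (e * (LINT t|U. (?N t)\<^sup>2)) + tpair_bound\<^sup>2 / \<delta> * (\<eta> * e)"
        using \<delta>(1) e0(2)[OF e, of T] diag_strip_integral_le(1)[OF Ni _ e(1), of T]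
        by (intro add_mono mult_left_mono) auto
      also have "\<dots> = (\<delta> * W + tpair_bound\<^sup>2 / \<delta> * \<eta>) * e"
        unfolding slice_norm_L2(2)[OF d] W_def by (simp add: algebra_simps)
      also have "\<dots> \<le> (\<theta> / 2 + \<theta> / 2) * e" using \<delta>(2) \<eta>(2) e by (intro mult_right_mono add_mono) auto
      finally show "\<bar>LINT p|US. ?ab p\<bar> \<le> \<theta> * e" by simp
    qed
  qed
  have Mi: "integrable U (\<lambda>t. exp lip_total * ?N t)" by (intro integrable_mult_right U.L2_integrable slice_norm_L2 d)
  have M: "\<bar>tpair t s\<bar> \<le> exp lip_total * ?N t" if dt: "(\<lambda>x. d (x, t)) \<in> L2 U" for t s
  proof -
    have "(LINT x|U. (tst k s x)\<^sup>2) \<le> (LINT x|U. (exp lip_total)\<^sup>2)"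
      by (intro integral_mono L2D(2) tst_L2 U.L2_const) (use abs_tst_le in \<open>auto simp flip: abs_le_square_iff\<close>)
    then have "sqrt (LINT x|U. (tst k s x)\<^sup>2) \<le> exp lip_total" by (intro real_le_lsqrt) auto
    from order_trans[OF slice_pairing[OF dt tst_L2] mult_left_mono[OF this]] show ?thesis
      unfolding tpair_def by (simp add: slice_norm_def mult.commute)
  qed
  have MA: "AE t in U. \<forall>s. \<bar>tpair t s\<bar> \<le> exp lip_total * ?N t"
    using L2_slices(1)[OF d] by eventually_elim (simp add: M)
  show ?thesis
    using tpair_alpha tpair_beta L2_slices(1)[OF d] US_Fubini(5)[OF tpair_integrable(2)] AE_space
  proof eventually_elim
    case (elim T)
    then have T: "0 < T" "T < 1" and bi: "integrable U (tpair_s T)" by auto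
    show ?case
    proof (rule ccontr)
      assume nz: "tpair T T \<noteq> 0"
      \<comment> \<open>The strip integral and the oscillation of D(T, .) contribute \<theta> each,
        so |D(T, T)| would be at most half of itself.\<close>
      define \<theta> where "\<theta> = \<bar>tpair T T\<bar> / 4"
      have \<theta>: "\<theta> > 0" using nz by (simp add: \<theta>_def)
      obtain e0 where e0: "e0 > 0" "\<And>e T. 0 < e \<Longrightarrow> e < e0 \<Longrightarrow>
          \<bar>LINT p|US. (if diag_strip T e p then tpair_t (fst p) (snd p) - tpair_s (fst p) (snd p) else 0)\<bar> \<le> \<theta> * e"
        using strip[OF \<theta>] by blast
      have "isCont (prim (tpair_s T)) T"
        using continuous_prim[OF bi, of UNIV] by (simp add: continuous_on_eq_continuous_at)
      then obtain e1 where e1: "e1 > 0" "\<And>s. \<bar>s - T\<bar> < e1 \<Longrightarrow> \<bar>prim (tpair_s T) s - prim (tpair_s T) T\<bar> < \<theta>"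
        using \<theta> unfolding continuous_at_eps_delta by (auto simp: dist_real_def)
      define e where "e = min (e0 / 2) (min (e1 / 2) ((1 - T) / 2))"
      have e: "0 < e" "e < e0" "e < e1" "T + e < 1" using e0(1) e1(1) T by (auto simp: e_def min_def field_simps)
      have "(LINT s|U. (if T < s \<and> s \<le> T + e then tpair T s else 0)) =
          (LINT p|US. (if diag_strip T e p then tpair_t (fst p) (snd p) - tpair_s (fst p) (snd p) else 0))"
      proof (rule diag_strip_divergence[OF tpair_integrable tpair_measurable(1) _ Mi _ tpair_beta T(1)])
        show "AE t in U. \<forall>s. 0 < s \<longrightarrow> s < 1 \<longrightarrow> \<bar>tpair t s\<bar> \<le> exp lip_total * ?N t"
          using MA by (rule eventually_mono) blast
        show "AE t in U. \<forall>s. 0 < s \<longrightarrow> s < 1 \<longrightarrow> tpair t s = prim (\<lambda>r. tpair_t r s) t"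
          using tpair_alpha by (rule eventually_mono) blast
        show "tpair T s = prim (\<lambda>r. tpair_t r s) T" for s using elim(1) by blast
        show "\<bar>tpair T s\<bar> \<le> exp lip_total * ?N T" for s by (rule M[OF elim(3)])
      qed (use e in auto)
      then have small: "\<bar>LINT s|U. (if T < s \<and> s \<le> T + e then tpair T s else 0)\<bar> \<le> \<theta> * e"
        using e0(2)[OF e(1,2), of T] by simp
      have near: "\<bar>tpair T s - tpair T T\<bar> \<le> \<theta>" if "T < s" "s \<le> T + e" for s
        using elim(2) T that e e1(2)[of s] by (auto simp: abs_minus_commute)
      have len: "(LINT s|U. (if T < s \<and> s \<le> T + e then c else 0)) = e * c" for c :: real
      proof -
        have "(LINT s|U. (if T < s \<and> s \<le> T + e then c else 0)) = prim (\<lambda>_. c) (T + e) - prim (\<lambda>_. c) T"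
          by (rule prim_increment[symmetric]) (use e in auto)
        also have "\<dots> = c * (T + e) - c * T"
          using prim_FTC[of "\<lambda>_. c" "T + e" "\<lambda>x. c * x"] prim_FTC[of "\<lambda>_. c" T "\<lambda>x. c * x"] T e
          by (auto intro!: derivative_eq_intros)
        finally show ?thesis by (simp add: algebra_simps)
      qed
      have Tm: "(\<lambda>s. tpair T s) \<in> borel_measurable U"
      proof -
        have "(\<lambda>s. (T, s)) \<in> measurable U US" using T by (intro measurable_Pair) auto
        from measurable_compose[OF this tpair_measurable(1)] show ?thesis by simp
      qed
      have ii: "integrable U (\<lambda>s. if T < s \<and> s \<le> T + e then tpair T s - tpair T T else 0)"
        by (rule U.L2_integrable, rule U.L2_bdd[where C = \<theta>]) (use Tm near \<theta> in auto)
      have ic: "integrable U (\<lambda>s. if T < s \<and> s \<le> T + e then c else 0)" for c :: real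
        by (rule U.L2_integrable, rule U.L2_bdd[where C = "\<bar>c\<bar>"]) auto
      have "(LINT s|U. (if T < s \<and> s \<le> T + e then tpair T s else 0))
          = (LINT s|U. (if T < s \<and> s \<le> T + e then tpair T s - tpair T T else 0) + (if T < s \<and> s \<le> T + e then tpair T T else 0))"
        by (rule Bochner_Integration.integral_cong) auto
      also have "\<dots> = (LINT s|U. (if T < s \<and> s \<le> T + e then tpair T s - tpair T T else 0)) + e * tpair T T"
        using ii ic by (simp add: len)
      finally have "\<bar>e * tpair T T\<bar> \<le> \<theta> * e + \<bar>LINT s|U. (if T < s \<and> s \<le> T + e then tpair T s - tpair T T else 0)\<bar>"
        using small by linarith
      also have "\<bar>LINT s|U. (if T < s \<and> s \<le> T + e then tpair T s - tpair T T else 0)\<bar>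
          \<le> (LINT s|U. (if T < s \<and> s \<le> T + e then \<theta> else 0))"
        by (rule order_trans[OF integral_abs_bound integral_mono[OF integrable_abs[OF ii] ic]]) (use near in auto)
      also have "\<dots> = e * \<theta>" by (rule len)
      finally have "e * \<bar>tpair T T\<bar> \<le> e * (2 * \<theta>)" using e by (simp add: abs_mult algebra_simps)
      then have "\<bar>tpair T T\<bar> \<le> 2 * \<theta>" using e by simp
      then show False using nz by (simp add: \<theta>_def)
    qed
  qed
qed

end

lemma AE_zero_along_Flow:
  assumes d: "d \<in> L2 US" and z: "AE p in US. d (Flow p) = 0"
  shows "AE p in US. d p = 0"
proof -
  note [measurable] = L2D(1)[OF d]
  have "(LINT p|US. jac (snd p) (fst p) * (d (Flow p))\<^sup>2) = (LINT p|US. 0)"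
  proof (rule integral_cong_AE)
    show "AE p in US. jac (snd p) (fst p) * (d (Flow p))\<^sup>2 = 0" using z by (rule eventually_mono) simp
  qed measurable
  then have "(LINT p|US. (d p)\<^sup>2) = 0" using Flow_subst(2)[of "\<lambda>p. (d p)\<^sup>2"] by simp
  then show ?thesis using integral_nonneg_eq_0_iff_AE[OF L2D(2)[OF d]] by simp
qed

text \<open>On the diagonal \<open>tpair\<close> is the k-th moment of d(X(., t), t), so d vanishes
  along the flow. Then monomials in x alone show that the moments of d1 vanish.\<close>

lemma homogeneous_zero:
  assumes d: "d \<in> L2 US" and d1: "d1 \<in> L2 U" and hom: "solves_homogeneous d d1"
  shows "AE p in US. d p = 0" "AE x in U. d1 x = 0"
proof -
  note [measurable] = L2D(1)[OF d]
  have "AE t in U. \<forall>k. (LINT x|U. d (x, t) * tst k t x) = 0"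
    using tpair_diagonal[OF d hom] by (simp add: AE_all_countable tpair_def[OF d hom])
  then have "AE t in U. AE y in U. d (Flow (y, t)) = 0"
    using L2_slices(1)[OF d] L2_slices(1)[OF L2_Flow[OF d]]
  proof eventually_elim
    case (elim t)
    note [measurable] = L2D(1)[OF elim(2)]
    show ?case
    proof (rule L2_moments_zero[OF elim(3)])
      fix k
      have "(LINT y|U. d (Flow (y, t)) * y ^ k) = (LINT x|U. d (x, t) * tst k t x)"
        unfolding tst_def using integral_inv_flow(1)[of "\<lambda>x. d (x, t)" "\<lambda>y. y ^ k" t] by simp
      then show "(LINT y|U. d (Flow (y, t)) * y ^ k) = 0" using elim(1) by simp
    qed
  qed
  then have "AE p in US. d (Flow p) = 0"
    by (intro AE_US_eqI[where g = "\<lambda>_. 0"]) measurable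
  then show z: "AE p in US. d p = 0" by (rule AE_zero_along_Flow[OF d])
  show "AE x in U. d1 x = 0"
  proof (rule L2_moments_zero[OF d1])
    fix j
    have "(LINT p|US. d p * transport_op (\<lambda>p. 1 * fst p ^ j * snd p ^ 0) p) = (LINT p|US. 0)"
    proof (rule integral_cong_AE)
      note [measurable] = L2D(1)[OF transport_op_L2[OF smooth_monomial[of 1 j 0]]]
      show "(\<lambda>p. d p * transport_op (\<lambda>p. 1 * fst p ^ j * snd p ^ 0) p) \<in> borel_measurable US" by measurable
      show "AE p in US. d p * transport_op (\<lambda>p. 1 * fst p ^ j * snd p ^ 0) p = 0"
        using z by (rule eventually_mono) simp
    qed simp
    then show "(LINT x|U. d1 x * x ^ j) = 0"
      using bspec[OF hom[unfolded weak_transport_def] smooth_monomial[of 1 j 0]] by simp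
  qed
qed

text \<open>The explicit solution has the same initial value and source as f, so their difference
  solves the homogeneous equation.\<close>

lemma weak_transport_representation:
  assumes f: "f \<in> L2 US" and z: "z \<in> L2 US" and f0: "f0 \<in> L2 U" and f1: "f1 \<in> L2 U"
    and wt: "weak_transport f0 f1 f z"
  defines "G \<equiv> lagrange f0 (\<lambda>p. z (Flow p))"
  shows "AE p in US. f p = euler G p" "AE x in U. f1 x = G (inv_flow 1 x, 1)"
proof -
  have ZL: "(\<lambda>p. z (Flow p)) \<in> L2 US" by (rule L2_Flow[OF z])
  have GL: "G \<in> L2 US" unfolding G_def by (rule lagrange_L2[OF f0 ZL])
  have ez: "euler (\<lambda>p. z (Flow p)) p = z p" for p by (simp add: euler_def Flow_def)
  have w2: "weak_transport f0 (\<lambda>x. G (inv_flow 1 x, 1)) (euler G) z"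
    using lagrange_weak_transport[OF f0 ZL] unfolding G_def ez .
  have G1: "(\<lambda>x. G (inv_flow 1 x, 1)) \<in> L2 U"
  proof (rule L2I)
    note [measurable] = L2D(1)[OF lagrange_1_L2[OF f0 ZL, of 1], folded G_def]
    show m: "(\<lambda>x. G (inv_flow 1 x, 1)) \<in> borel_measurable U"
      by (rule measurable_compose[of "inv_flow 1" U U "\<lambda>y. G (y, 1)"]) (auto intro!: measurable_inv_flow_U)
    have "integrable U (\<lambda>y. jac 1 y * (G (y, 1))\<^sup>2)"
      by (rule Bochner_Integration.integrable_bound[OF integrable_mult_right[OF L2D(2)[OF lagrange_1_L2[OF f0 ZL, of 1, folded G_def]], of "exp lip_total"]])
         (measurable, auto intro!: AE_I2 mult_right_mono jac_bounds simp: logJ_le)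
    then show "integrable U (\<lambda>x. (G (inv_flow 1 x, 1))\<^sup>2)"
      by (subst flow_subst(1)[of _ 1]) (use m in auto)
  qed
  have "solves_homogeneous (\<lambda>p. f p - euler G p) (\<lambda>x. f1 x - G (inv_flow 1 x, 1))"
    unfolding weak_transport_def
  proof
    fix \<phi> assume \<phi>: "\<phi> \<in> smooth_fun"
    have i: "integrable US (\<lambda>p. f p * transport_op \<phi> p)" "integrable US (\<lambda>p. euler G p * transport_op \<phi> p)"
      by (intro integrable_mult_L2 f euler_L2 GL transport_op_L2 \<phi>)+
    have j: "integrable U (\<lambda>x. f1 x * \<phi> (x, 1))" "integrable U (\<lambda>x. G (inv_flow 1 x, 1) * \<phi> (x, 1))"
      by (intro integrable_mult_L2 f1 G1 smooth_fun_slice \<phi>)+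
    show "(LINT p|US. (f p - euler G p) * transport_op \<phi> p) + (LINT p|US. \<phi> p * 0) =
        (LINT x|U. (f1 x - G (inv_flow 1 x, 1)) * \<phi> (x, 1)) - (LINT x|U. 0 * \<phi> (x, 0))"
      using bspec[OF wt[unfolded weak_transport_def] \<phi>] bspec[OF w2[unfolded weak_transport_def] \<phi>] i j
      by (simp add: left_diff_distrib)
  qed
  from homogeneous_zero[OF L2_diff[OF f euler_L2[OF GL]] L2_diff[OF f1 G1] this]
  show "AE p in US. f p = euler G p" "AE x in U. f1 x = G (inv_flow 1 x, 1)" by auto
qed

lemma euler_slice:
  assumes G: "G \<in> borel_measurable US" and t: "0 < t" "t < 1"
    and B: "B \<in> L2 U" "AE y in U. \<bar>G (y, t)\<bar> \<le> B y"
  shows "(\<lambda>x. euler G (x, t)) \<in> L2 U" "(LINT x|U. (euler G (x, t))\<^sup>2) \<le> exp lip_total * (LINT y|U. (B y)\<^sup>2)"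
proof -
  have "(\<lambda>y. (y, t)) \<in> measurable U US" using t by (intro measurable_Pair) auto
  from measurable_compose[OF this G] have Gt [measurable]: "(\<lambda>y. G (y, t)) \<in> borel_measurable U" .
  have GtL: "(\<lambda>y. G (y, t)) \<in> L2 U"
    by (rule L2_bound[OF Gt B(1)]) (use B(2) in \<open>auto elim!: eventually_mono\<close>)
  have m: "(\<lambda>x. euler G (x, t)) \<in> borel_measurable U"
    unfolding euler_def fst_conv snd_conv
    by (rule measurable_compose[of "inv_flow t" U U "\<lambda>y. G (y, t)"]) (auto intro!: measurable_inv_flow_U)
  have eq: "euler G (flow t y, t) = G (y, t)" for y by (simp add: euler_def)
  have i: "integrable U (\<lambda>y. jac t y * (G (y, t))\<^sup>2)"
    by (rule Bochner_Integration.integrable_bound[OF integrable_mult_right[OF L2D(2)[OF GtL], of "exp lip_total"]])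
       (measurable, auto intro!: AE_I2 mult_right_mono jac_bounds simp: logJ_le)
  have m2: "(\<lambda>x. (euler G (x, t))\<^sup>2) \<in> borel_measurable U" using m by measurable
  show "(\<lambda>x. euler G (x, t)) \<in> L2 U"
    using flow_subst(1)[OF m2, of t] i by (intro L2I m) (simp add: eq)
  have "(LINT x|U. (euler G (x, t))\<^sup>2) = (LINT y|U. jac t y * (G (y, t))\<^sup>2)"
    using flow_subst(2)[OF m2, of t] by (simp add: eq)
  also have "\<dots> \<le> (LINT y|U. exp lip_total * (B y)\<^sup>2)"
  proof (rule integral_mono_AE[OF i])
    show "AE y in U. jac t y * (G (y, t))\<^sup>2 \<le> exp lip_total * (B y)\<^sup>2"
      using B(2)
    proof eventually_elim
      case (elim y)
      then have "(G (y, t))\<^sup>2 \<le> (B y)\<^sup>2" by (meson abs_le_square_iff abs_ge_self order_trans)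
      then show ?case by (intro mult_mono jac_bounds) auto
    qed
  qed (intro integrable_mult_right L2D(2) B)
  finally show "(LINT x|U. (euler G (x, t))\<^sup>2) \<le> exp lip_total * (LINT y|U. (B y)\<^sup>2)" by simp
qed

text \<open>Along a trajectory the density is at most |f0| plus the time integral of |z|, an L2
  function of y that does not depend on time; returning to x costs the factor
  \<open>exp lip_total\<close>.\<close>

lemma weak_transport_bounded:
  assumes f: "f \<in> L2 US" and z: "z \<in> L2 US" and f0: "f0 \<in> L2 U" and f1: "f1 \<in> L2 U"
    and wt: "weak_transport f0 f1 f z"
  obtains C where "AE t in U. (LINT x|U. (f (x, t))\<^sup>2) \<le> C"
proof -
  define G where "G = lagrange f0 (\<lambda>p. z (Flow p))"
  have ZL: "(\<lambda>p. z (Flow p)) \<in> L2 US" by (rule L2_Flow[OF z])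
  have GL: "G \<in> L2 US" unfolding G_def by (rule lagrange_L2[OF f0 ZL])
  define B where "B y = \<bar>f0 y\<bar> + (LINT r|U. \<bar>z (Flow (y, r))\<bar>)" for y
  have BL: "B \<in> L2 U" unfolding B_def[abs_def] by (intro L2_add L2_abs f0 L2_time_integral(1)[OF ZL])
  have b: "AE y in U. \<forall>t. \<bar>G (y, t)\<bar> \<le> B y"
    using L2_slices(2)[OF ZL]
  proof eventually_elim
    case (elim y)
    show ?case
    proof
      fix t
      have "\<bar>prim (\<lambda>r. z (Flow (y, r))) t\<bar> \<le> (LINT r|U. \<bar>z (Flow (y, r))\<bar>)"
        by (intro abs_prim_le U.L2_integrable elim)
      then show "\<bar>G (y, t)\<bar> \<le> B y" unfolding G_def lagrange_def B_def fst_conv snd_conv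
        using abs_triangle_ineq[of "f0 y" "prim (\<lambda>r. z (Flow (y, r))) t"] by linarith
    qed
  qed
  have "AE t in U. (LINT x|U. (f (x, t))\<^sup>2) \<le> exp lip_total * (LINT y|U. (B y)\<^sup>2)"
    using AE_US_D(2)[OF weak_transport_representation(1)[OF f z f0 f1 wt]] L2_slices(1)[OF f] AE_space
  proof eventually_elim
    case (elim t)
    then have t: "0 < t" "t < 1" by auto
    have bt: "AE y in U. \<bar>G (y, t)\<bar> \<le> B y" using b by (rule eventually_mono) blast
    note es = euler_slice[OF L2D(1)[OF GL] t BL bt]
    note [measurable] = L2D(1)[OF elim(2)] L2D(1)[OF es(1)]
    have "(LINT x|U. (f (x, t))\<^sup>2) = (LINT x|U. (euler G (x, t))\<^sup>2)"
      by (rule integral_cong_AE, measurable) (use elim(1) in \<open>auto elim!: eventually_mono simp: G_def\<close>)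
    then show ?case using es(2) by simp
  qed
  then show ?thesis using that by blast
qed

end

section \<open>Admissible variations and the optimality conditions\<close>

subsection \<open>Velocities in the space of admissible paths\<close>

lemma prim_cong_AE_L2:
  assumes "g \<in> L2 U" "k \<in> L2 U" "AE x in U. g x = k x" shows "prim g = prim k"
  by (intro ext prim_cong_AE) (use assms in \<open>auto dest: L2D\<close>)

text \<open>The two zero traces fix both constants of integration, so v is the Green's function
  representation of its second derivative, and the theory of the flow applies to it.\<close>

lemma V_space_velocity:
  assumes "v \<in> V_space"
  obtains h where "velocity h" "AE p in US. weak_dx (weak_dx v) p = h p"
    "AE p in US. weak_dx v p = velocity.vel_x h (fst p) (snd p)"
    "AE p in US. v p = velocity.vel h (fst p) (snd p)"
proof -
  define g h0 where "g = weak_dx v" and "h0 = weak_dx (weak_dx v)"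
  have vg: "has_weak_dx v g" and gh: "has_weak_dx g h0" and v0: "AE t in U. (\<lambda>x. v (x, t)) \<in> H10"
    using V_spaceD[OF assms] by (simp_all add: g_def h0_def)
  have L: "v \<in> L2 US" "g \<in> L2 US" "h0 \<in> L2 US" using has_weak_dxD[OF vg] has_weak_dxD[OF gh] by auto
  note [measurable] = L2D(1)[OF L(1)] L2D(1)[OF L(2)] L2D(1)[OF L(3)]
  \<comment> \<open>Slices of v_xx outside L2 are replaced by 0. Finiteness of a nonnegative
    integral is a measurable condition on the time.\<close>
  define h where "h p = (if (\<integral>\<^sup>+\<xi>. ennreal ((h0 (\<xi>, snd p))\<^sup>2) \<partial>U) < top then h0 p else 0)" for p
  have fin: "(\<integral>\<^sup>+\<xi>. ennreal ((h0 (\<xi>, t))\<^sup>2) \<partial>U) < top \<longleftrightarrow> (\<lambda>\<xi>. h0 (\<xi>, t)) \<in> L2 U" if "0 < t" "t < 1" for t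
  proof -
    have "(\<lambda>\<xi>. h0 (\<xi>, t)) \<in> borel_measurable U"
      by (rule measurable_compose[OF measurable_Pair2' L2D(1)[OF L(3)]]) (use that in simp)
    then show ?thesis by (auto simp: L2_def integrable_iff_bounded)
  qed
  have hm: "h \<in> borel_measurable US" unfolding h_def[abs_def] by measurable
  have hslice: "AE t in U. \<forall>\<xi>. h (\<xi>, t) = h0 (\<xi>, t)"
    using L2_slices(1)[OF L(3)] AE_space by eventually_elim (auto simp: h_def fin)
  have heq: "AE p in US. h p = h0 p"
    by (rule AE_US_eqI[OF hm]) (measurable, use hslice in \<open>auto elim!: eventually_mono\<close>)
  have vel: "velocity h"
  proof
    show "h \<in> L2 US" by (rule L2_cong_AE[OF hm L(3) heq])
    show "(\<lambda>\<xi>. h (\<xi>, t)) \<in> L2 U" if "0 < t" "t < 1" for t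
      using fin[OF that] by (cases "(\<lambda>\<xi>. h0 (\<xi>, t)) \<in> L2 U") (auto simp: h_def U.L2_const)
  qed
  interpret velocity h by (rule vel)
  have "AE t in U. (AE x in U. g (x, t) = vel_x x t) \<and> (AE x in U. v (x, t) = vel x t)"
    using v0 has_weak_dxD(3)[OF vg] has_weak_dxD(3)[OF gh] hslice AE_space
  proof eventually_elim
    case (elim t)
    then have t: "0 < t" "t < 1" by auto
    obtain c where c: "AE x in U. g (x, t) = c + prim (\<lambda>x. h (x, t)) x" and gL: "(\<lambda>x. g (x, t)) \<in> L2 U"
      using elim(3,4) by (auto simp: has_weak_deriv_iff)
    have vL: "(\<lambda>x. vel_x x t) \<in> L2 U" by (rule continuous_L2[OF continuous_vel_x[OF t]])
    note [measurable] = L2D(1)[OF gL] L2D(1)[OF vL]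
    have "AE x in U. g (x, t) - vel_x x t = c - vel_x 0 t"
      using c by eventually_elim (subst vel_x_prim[OF t], simp)
    then have "(LINT x|U. g (x, t) - vel_x x t) = (LINT x|U. c - vel_x 0 t)"
      by (intro integral_cong_AE) measurable
    moreover have "(LINT x|U. vel_x x t) = 0" using vel_prim[OF t, of 1] by (simp add: prim_1 vel_1)
    moreover have "(LINT x|U. g (x, t)) = 0" by (rule H10_traces(2)[OF elim(1,2)])
    \<comment> \<open>\<open>g\<close> and \<open>vel_x\<close> differ by a constant and both have
      mean zero, \<open>g\<close> because of the traces of v.\<close>
    ultimately have ceq: "c = vel_x 0 t" using gL vL by (simp add: U.L2_integrable)
    have 1: "AE x in U. g (x, t) = vel_x x t"
      using c by eventually_elim (subst vel_x_prim[OF t], simp add: ceq)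
    have 2: "AE x in U. v (x, t) = vel x t"
      using H10_traces(1)[OF elim(1,2)] AE_space
      by eventually_elim (simp add: prim_cong_AE_L2[OF gL vL 1] vel_prim[OF t])
    with 1 show ?case by simp
  qed
  then have "AE t in U. AE x in U. g (x, t) = vel_x (fst (x, t)) (snd (x, t))"
    "AE t in U. AE x in U. v (x, t) = vel (fst (x, t)) (snd (x, t))" by (auto elim!: eventually_mono)
  then have "AE p in US. g p = vel_x (fst p) (snd p)" "AE p in US. v p = vel (fst p) (snd p)"
    by (intro AE_US_eqI; measurable)+
  moreover have "AE p in US. h0 p = h p" using heq by (rule eventually_mono) simp
  ultimately show ?thesis using that[OF vel] by (simp add: g_def h0_def)
qed

subsection \<open>Traces of products\<close>

text \<open>The pointwise bound is averaged over (l, r]; the factor r - l in front of |F| cancels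
  the length of the interval.\<close>

lemma trace_le_increment:
  assumes F: "integrable U F" and b: "AE x in U. l < x \<longrightarrow> x \<le> r \<longrightarrow> \<bar>e\<bar> \<le> (r - l) * (a * \<bar>F x\<bar>) + \<eta>"
    and lr: "0 \<le> l" "l < r" "r \<le> 1"
  shows "\<bar>e\<bar> \<le> a * (prim (\<lambda>x. \<bar>F x\<bar>) r - prim (\<lambda>x. \<bar>F x\<bar>) l) + \<eta>"
proof -
  have Fi: "integrable U (\<lambda>x. \<bar>F x\<bar>)" using F by simp
  have len: "prim (\<lambda>_. c) r - prim (\<lambda>_. c) l = c * (r - l)" for c
  proof -
    have "c * s = c * 0 + prim (\<lambda>_. c) s" if "0 \<le> s" "s \<le> 1" for s
      by (rule prim_FTC[OF _ that]) (auto intro!: derivative_eq_intros)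
    from this[of l] this[of r] show ?thesis using lr by (simp add: algebra_simps)
  qed
  have "\<bar>e\<bar> * (r - l) = (LINT x|U. (if l < x \<and> x \<le> r then \<bar>e\<bar> else 0))"
    unfolding len[symmetric] by (rule prim_increment) (use lr in auto)
  also have "\<dots> \<le> (LINT x|U. (if l < x \<and> x \<le> r then (r - l) * a * \<bar>F x\<bar> + \<eta> else 0))"
  proof (rule integral_mono_AE)
    show "integrable U (\<lambda>x. if l < x \<and> x \<le> r then \<bar>e\<bar> else 0)"
      by (rule U.L2_integrable, rule U.L2_bdd[where C = "\<bar>e\<bar>"]) auto
    have "integrable U (\<lambda>x. (r - l) * a * \<bar>F x\<bar> + \<eta>)" using Fi by auto
    then show "integrable U (\<lambda>x. if l < x \<and> x \<le> r then (r - l) * a * \<bar>F x\<bar> + \<eta> else 0)"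
      by (rule Bochner_Integration.integrable_bound) (use borel_measurable_integrable[OF F] in auto)
    show "AE x in U. (if l < x \<and> x \<le> r then \<bar>e\<bar> else 0) \<le> (if l < x \<and> x \<le> r then (r - l) * a * \<bar>F x\<bar> + \<eta> else 0)"
      using b by eventually_elim (auto simp: mult.assoc)
  qed
  also have "\<dots> = prim (\<lambda>x. (r - l) * a * \<bar>F x\<bar> + \<eta>) r - prim (\<lambda>x. (r - l) * a * \<bar>F x\<bar> + \<eta>) l"
    by (rule prim_increment[symmetric]) (use Fi lr in auto)
  also have "\<dots> = (r - l) * a * (prim (\<lambda>x. \<bar>F x\<bar>) r - prim (\<lambda>x. \<bar>F x\<bar>) l) + \<eta> * (r - l)"
    using len[of \<eta>] by (subst (1 2) prim_add) (use Fi in \<open>auto simp: prim_cmult right_diff_distrib\<close>)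
  finally have "\<bar>e\<bar> * (r - l) \<le> (a * (prim (\<lambda>x. \<bar>F x\<bar>) r - prim (\<lambda>x. \<bar>F x\<bar>) l) + \<eta>) * (r - l)" by (simp add: algebra_simps)
  then show ?thesis using lr by (simp add: mult_le_cancel_right)
qed

text \<open>If \<open>w\<close> vanishes at least linearly at \<open>0\<close> and \<open>1\<close> and \<open>w F\<close> is in \<open>H\<^sup>1\<close> for some \<open>F \<in> L\<^sup>2\<close>, then
  \<open>w F\<close> has zero traces, since otherwise \<open>F\<close> would dominate a multiple of \<open>1/x\<close>.\<close>

lemma product_traces:
  assumes F: "F \<in> L2 U" and g: "g \<in> L2 U" and c: "AE x in U. w x * F x = c + prim g x"
    and w: "\<And>x. 0 < x \<Longrightarrow> x < 1 \<Longrightarrow> \<bar>w x\<bar> \<le> a * x" "\<And>x. 0 < x \<Longrightarrow> x < 1 \<Longrightarrow> \<bar>w x\<bar> \<le> a * (1 - x)"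
  shows "c = 0" "prim g 1 = 0"
proof -
  have Fi: "integrable U F" and gi: "integrable U g" using F g by (auto intro: U.L2_integrable)
  have Fa: "integrable U (\<lambda>x. \<bar>F x\<bar>)" and ga: "integrable U (\<lambda>x. \<bar>g x\<bar>)" using Fi gi by auto
  have a: "0 \<le> a" using w(1)[of "1/2"] by (simp add: order_trans[OF abs_ge_zero])
  define PF PG where "PF = prim (\<lambda>x. \<bar>F x\<bar>)" and "PG = prim (\<lambda>x. \<bar>g x\<bar>)"
  have inc: "\<bar>prim g r - prim g l\<bar> \<le> PG r - PG l" if "l \<le> r" for l r
    unfolding PG_def prim_increment[OF gi that] prim_increment[OF ga that]
  proof (rule order_trans[OF integral_abs_bound integral_mono])
    show "integrable U (\<lambda>x. \<bar>if l < x \<and> x \<le> r then g x else 0\<bar>)" "integrable U (\<lambda>x. if l < x \<and> x \<le> r then \<bar>g x\<bar> else 0)"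
      by (rule Bochner_Integration.integrable_bound[OF ga]; use borel_measurable_integrable[OF gi] in auto)+
  qed auto
  have mono: "PG l \<le> PG r" if "l \<le> r" for l r using inc[OF that] by linarith
  have cont: "continuous_on UNIV PF" "continuous_on UNIV PG" unfolding PF_def PG_def by (intro continuous_prim Fa ga)+
  have e0: "\<bar>c\<bar> \<le> a * (PF \<delta> - PF 0) + (PG \<delta> - PG 0)" if d: "0 < \<delta>" "\<delta> < 1" for \<delta>
    unfolding PF_def
  proof (rule trace_le_increment[OF Fi])
    show "AE x in U. 0 < x \<longrightarrow> x \<le> \<delta> \<longrightarrow> \<bar>c\<bar> \<le> (\<delta> - 0) * (a * \<bar>F x\<bar>) + (PG \<delta> - PG 0)"
      using c AE_space
    proof eventually_elim
      case (elim x)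
      show ?case
      proof (intro impI)
        assume x: "0 < x" "x \<le> \<delta>"
        have "\<bar>w x * F x\<bar> \<le> (a * x) * \<bar>F x\<bar>" unfolding abs_mult by (intro mult_right_mono w) (use x d in auto)
        also have "\<dots> \<le> \<delta> * (a * \<bar>F x\<bar>)" using mult_right_mono[OF x(2), of "a * \<bar>F x\<bar>"] a by (simp add: mult_ac)
        finally have "\<bar>c + prim g x\<bar> \<le> \<delta> * (a * \<bar>F x\<bar>)" using elim by simp
        moreover have "\<bar>prim g x\<bar> \<le> PG \<delta> - PG 0" using inc[of 0 x] mono[of x \<delta>] x by (simp add: prim_0)
        ultimately show "\<bar>c\<bar> \<le> (\<delta> - 0) * (a * \<bar>F x\<bar>) + (PG \<delta> - PG 0)" unfolding diff_zero by linarith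
      qed
    qed
  qed (use d in auto)
  have e1: "\<bar>c + prim g 1\<bar> \<le> a * (PF 1 - PF (1 - \<delta>)) + (PG 1 - PG (1 - \<delta>))" if d: "0 < \<delta>" "\<delta> < 1" for \<delta>
    unfolding PF_def
  proof (rule trace_le_increment[OF Fi])
    show "AE x in U. 1 - \<delta> < x \<longrightarrow> x \<le> 1 \<longrightarrow> \<bar>c + prim g 1\<bar> \<le> (1 - (1 - \<delta>)) * (a * \<bar>F x\<bar>) + (PG 1 - PG (1 - \<delta>))"
      using c AE_space
    proof eventually_elim
      case (elim x)
      show ?case
      proof (intro impI)
        assume x: "1 - \<delta> < x" "x \<le> 1"
        then have x': "0 < x" "x < 1" using elim by auto
        have "\<bar>w x * F x\<bar> \<le> (a * (1 - x)) * \<bar>F x\<bar>" unfolding abs_mult by (intro mult_right_mono w x') auto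
        also have "\<dots> = (1 - x) * (a * \<bar>F x\<bar>)" by simp
        also have "\<dots> \<le> \<delta> * (a * \<bar>F x\<bar>)" using x a by (intro mult_right_mono) auto
        finally have "\<bar>c + prim g x\<bar> \<le> \<delta> * (a * \<bar>F x\<bar>)" using elim by simp
        moreover have "\<bar>prim g 1 - prim g x\<bar> \<le> PG 1 - PG (1 - \<delta>)" using inc[of x 1] mono[of "1 - \<delta>" x] x by linarith
        ultimately show "\<bar>c + prim g 1\<bar> \<le> (1 - (1 - \<delta>)) * (a * \<bar>F x\<bar>) + (PG 1 - PG (1 - \<delta>))" by (simp add: abs_if split: if_splits)
      qed
    qed
  qed (use d in auto)
  \<comment> \<open>The width 1 / (n + 2) is less than 1 already for n = 0, as \<open>e0\<close>
    demands.\<close>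
  have "(\<lambda>n. a * (PF (1 / (real n + 2)) - PF 0) + (PG (1 / (real n + 2)) - PG 0)) \<longlonglongrightarrow> a * (PF 0 - PF 0) + (PG 0 - PG 0)"
  proof -
    have l: "(\<lambda>n. 1 / (real n + 2)) \<longlonglongrightarrow> 0" by real_asymp
    show ?thesis by (intro tendsto_intros continuous_on_tendsto_compose[OF cont(1) l] continuous_on_tendsto_compose[OF cont(2) l]) auto
  qed
  then have "\<bar>c\<bar> \<le> a * (PF 0 - PF 0) + (PG 0 - PG 0)"
    by (rule tendsto_lowerbound[where F = sequentially, OF _ always_eventually]) (auto intro!: e0)
  then show c0: "c = 0" by simp
  have "(\<lambda>n. a * (PF 1 - PF (1 - 1 / (real n + 2))) + (PG 1 - PG (1 - 1 / (real n + 2)))) \<longlonglongrightarrow> a * (PF 1 - PF 1) + (PG 1 - PG 1)"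
  proof -
    have l: "(\<lambda>n. 1 - 1 / (real n + 2)) \<longlonglongrightarrow> 1" by real_asymp
    show ?thesis by (intro tendsto_intros continuous_on_tendsto_compose[OF cont(1) l] continuous_on_tendsto_compose[OF cont(2) l]) auto
  qed
  then have "\<bar>c + prim g 1\<bar> \<le> a * (PF 1 - PF 1) + (PG 1 - PG 1)"
    by (rule tendsto_lowerbound[where F = sequentially, OF _ always_eventually]) (auto intro!: e1)
  then show "prim g 1 = 0" using c0 by simp
qed

subsection \<open>Variations of admissible paths\<close>

lemma quadratic_min_linear:
  fixes B C :: real
  assumes "\<And>s. 0 \<le> s * B + s\<^sup>2 * C" shows "B = 0"
proof (rule ccontr)
  assume "B \<noteq> 0"
  \<comment> \<open>M is positive even for C = 0. At s = - B / (2 M) the linear term is - B^2 / (2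
    M), and half of it remains after the quadratic one.\<close>
  define M where "M = \<bar>C\<bar> + 1"
  have M: "M > 0" "C \<le> M" by (auto simp: M_def)
  have "0 \<le> (- B / (2 * M)) * B + (- B / (2 * M))\<^sup>2 * C" by (rule assms)
  also have "\<dots> \<le> (- B / (2 * M)) * B + (- B / (2 * M))\<^sup>2 * M" using M by (intro add_left_mono mult_left_mono) auto
  also have "\<dots> = - B\<^sup>2 / (4 * M)" using M by (simp add: power2_eq_square field_simps)
  also have "\<dots> < 0" using M \<open>B \<noteq> 0\<close> by (simp add: divide_neg_pos)
  finally show False by simp
qed

lemma L2_abs_le_H1_norm:
  assumes "w \<in> H10" shows "w \<in> L2 U" "(LINT x|U. \<bar>w x\<bar>) \<le> H1_norm w"
proof -
  have H: "w \<in> H1" using assms by (simp add: H10_def)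
  then show L: "w \<in> L2 U" by (auto simp: H1_def has_weak_deriv_def)
  have "(LINT x|U. \<bar>w x\<bar>) \<le> sqrt (LINT x|U. (w x)\<^sup>2)"
    by (rule real_le_rsqrt) (use U.L2_integral_square[OF L] in simp)
  then show "(LINT x|U. \<bar>w x\<bar>) \<le> H1_norm w" using L2_le_H1_norm[OF H] by simp
qed

text \<open>On the closed square h is uniformly continuous, so its slices depend continuously on
  time in the sup norm, which dominates the norm of the dual space. Where h vanishes, at times 0 and
  1, the end point conditions are preserved.\<close>

lemma Hm1_curve_perturb:
  assumes f: "Hm1_curve_between f f0 f1" "f \<in> L2 US"
    and h: "continuous_on UNIV h" "\<And>x. h (x, 0) = 0" "\<And>x. h (x, 1) = 0"
  shows "Hm1_curve_between (\<lambda>p. f p + s * h p) f0 f1"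
proof -
  obtain F where F: "continuous_Hm1 F" "AE t in U. represents_Hm1 (F t) (\<lambda>x. f (x, t))"
    "represents_Hm1 (F 0) f0" "represents_Hm1 (F 1) f1" using f(1) by (auto simp: Hm1_curve_between_def)
  have ch: "continuous_on ({0..1} \<times> {0..1}) h" using h(1) by (rule continuous_on_subset) simp
  have uc: "uniformly_continuous_on ({0..1} \<times> {0..1}) h"
    by (intro compact_uniformly_continuous ch compact_Times) auto
  have "bounded (h ` ({0..1} \<times> {0..1}))" by (intro compact_imp_bounded compact_continuous_image ch compact_Times) auto
  then obtain B where B: "\<forall>p\<in>{0..1} \<times> {0..1}. \<bar>h p\<bar> \<le> B" by (auto simp: bounded_iff)
  have hL: "(\<lambda>x. h (x, t)) \<in> L2 U" for t
    by (intro continuous_L2 continuous_on_compose2[OF h(1)] continuous_intros) auto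
  have hw: "integrable U (\<lambda>x. h (x, t) * w x)" if "w \<in> H10" for t w
    by (intro integrable_mult_L2 hL L2_abs_le_H1_norm that)
  have est: "\<bar>LINT x|U. k x * w x\<bar> \<le> C * H1_norm w"
    if w: "w \<in> H10" and k: "k \<in> L2 U" "\<And>x. 0 < x \<Longrightarrow> x < 1 \<Longrightarrow> \<bar>k x\<bar> \<le> C" for k w C
  proof -
    have "0 \<le> C" using k(2)[of "1/2"] by simp
    have "\<bar>LINT x|U. k x * w x\<bar> \<le> (LINT x|U. \<bar>k x * w x\<bar>)" by (rule integral_abs_bound)
    also have "\<dots> \<le> (LINT x|U. C * \<bar>w x\<bar>)"
      by (intro integral_mono integrable_abs integrable_mult_right integrable_mult_L2 k U.L2_integrable L2_abs_le_H1_norm w)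
         (auto simp: abs_mult intro!: mult_right_mono k)
    also have "\<dots> \<le> C * H1_norm w" using L2_abs_le_H1_norm(2)[OF w] \<open>0 \<le> C\<close> by (simp add: mult_left_mono)
    finally show ?thesis .
  qed
  define G where "G t w = F t w + s * (LINT x|U. h (x, t) * w x)" for t w
  show ?thesis unfolding Hm1_curve_between_def
  proof (intro exI[of _ G] conjI)
    show "continuous_Hm1 G" unfolding continuous_Hm1_def
    proof (intro conjI ballI allI impI)
      fix t :: real assume t: "t \<in> {0..1}"
      then have Ft: "F t \<in> Hm1" using F(1) by (auto simp: continuous_Hm1_def)
      then obtain C where C: "\<And>w. w \<in> H10 \<Longrightarrow> \<bar>F t w\<bar> \<le> C * H1_norm w" unfolding Hm1_def by blast
      show "G t \<in> Hm1" unfolding Hm1_def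
      proof (intro CollectI conjI ballI allI exI[of _ "C + \<bar>s\<bar> * B"])
        show "G t (\<lambda>x. w x + w' x) = G t w + G t w'" if "w \<in> H10" "w' \<in> H10" for w w'
          using Ft that hw[of w t] hw[of w' t] by (simp add: Hm1_def G_def distrib_left)
        show "G t (\<lambda>x. c * w x) = c * G t w" if "w \<in> H10" for w c
          using Ft that by (simp add: Hm1_def G_def distrib_left mult.left_commute)
        fix w assume w: "w \<in> H10"
        have "\<bar>LINT x|U. h (x, t) * w x\<bar> \<le> B * H1_norm w" by (rule est[OF w hL]) (use B t in auto)
        then have "\<bar>s * (LINT x|U. h (x, t) * w x)\<bar> \<le> \<bar>s\<bar> * (B * H1_norm w)" by (simp add: abs_mult mult_left_mono)
        then show "\<bar>G t w\<bar> \<le> (C + \<bar>s\<bar> * B) * H1_norm w"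
          using C[OF w] abs_triangle_ineq[of "F t w" "s * (LINT x|U. h (x, t) * w x)"]
          by (simp add: G_def distrib_right mult.assoc)
      qed
    next
      fix t e :: real assume t: "t \<in> {0..1}" and e: "e > 0"
      obtain d1 where d1: "d1 > 0" "\<And>r w. r \<in> {0..1} \<Longrightarrow> \<bar>r - t\<bar> < d1 \<Longrightarrow> w \<in> H10 \<Longrightarrow> \<bar>F r w - F t w\<bar> \<le> e / 2 * H1_norm w"
        using F(1) t e unfolding continuous_Hm1_def by (meson half_gt_zero)
      define e' where "e' = e / (2 * (\<bar>s\<bar> + 1))"
      have e': "e' > 0" "\<bar>s\<bar> * e' \<le> e / 2" using e by (auto simp: e'_def field_simps)
      obtain d2 where d2: "d2 > 0" "\<And>p q. p \<in> {0..1} \<times> {0..1} \<Longrightarrow> q \<in> {0..1} \<times> {0..1} \<Longrightarrow> dist q p < d2 \<Longrightarrow> dist (h q) (h p) < e'"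
        using uc e'(1) unfolding uniformly_continuous_on_def by metis
      show "\<exists>d>0. \<forall>r\<in>{0..1}. \<bar>r - t\<bar> < d \<longrightarrow> (\<forall>w\<in>H10. \<bar>G r w - G t w\<bar> \<le> e * H1_norm w)"
      proof (intro exI[of _ "min d1 d2"] conjI ballI impI)
        show "min d1 d2 > 0" using d1 d2 by simp
        fix r w assume r: "r \<in> {0..1}" "\<bar>r - t\<bar> < min d1 d2" and w: "w \<in> H10"
        have "\<bar>LINT x|U. (h (x, r) - h (x, t)) * w x\<bar> \<le> e' * H1_norm w"
        proof (rule est[OF w L2_diff[OF hL hL]])
          fix x :: real assume "0 < x" "x < 1"
          then have "dist (h (x, r)) (h (x, t)) < e'" using r t by (intro d2(2)) (auto simp: dist_Pair_Pair dist_real_def)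
          then show "\<bar>h (x, r) - h (x, t)\<bar> \<le> e'" by (simp add: dist_real_def)
        qed
        then have "\<bar>s * (LINT x|U. (h (x, r) - h (x, t)) * w x)\<bar> \<le> \<bar>s\<bar> * (e' * H1_norm w)" by (simp add: abs_mult mult_left_mono)
        also have "\<dots> \<le> e / 2 * H1_norm w"
          using mult_right_mono[OF e'(2) H1_norm_nonneg[of w]] by (simp add: mult.assoc)
        finally have 1: "\<bar>s * (LINT x|U. (h (x, r) - h (x, t)) * w x)\<bar> \<le> e / 2 * H1_norm w" .
        have "G r w - G t w = (F r w - F t w) + s * (LINT x|U. (h (x, r) - h (x, t)) * w x)"
          using hw[OF w] by (simp add: G_def left_diff_distrib right_diff_distrib)
        moreover have "\<bar>F r w - F t w\<bar> \<le> e / 2 * H1_norm w" using d1(2)[of r w] r w by auto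
        moreover have "e / 2 * H1_norm w + e / 2 * H1_norm w = e * H1_norm w" by simp
        ultimately show "\<bar>G r w - G t w\<bar> \<le> e * H1_norm w" using 1 by linarith
      qed
    qed
    show "AE t in U. represents_Hm1 (G t) (\<lambda>x. f (x, t) + s * h (x, t))"
      using F(2) L2_slices(1)[OF f(2)]
    proof eventually_elim
      case (elim t)
      show ?case unfolding represents_Hm1_def
      proof
        fix w assume w: "w \<in> H10"
        have "integrable U (\<lambda>x. f (x, t) * w x)" by (intro integrable_mult_L2 elim L2_abs_le_H1_norm w)
        then show "G t w = (LINT x|U. (f (x, t) + s * h (x, t)) * w x)"
          using elim(1) w hw[OF w, of t] by (simp add: represents_Hm1_def G_def distrib_right mult.assoc)
      qed
    qed
    show "represents_Hm1 (G 0) f0" "represents_Hm1 (G 1) f1"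
      using F(3,4) by (simp_all add: represents_Hm1_def G_def h)
  qed
qed

locale minimizer =
  fixes \<kappa> lam \<epsilon> :: real and f0 f1 :: "real \<Rightarrow> real" and f v z :: "real \<times> real \<Rightarrow> real"
  assumes f0: "f0 \<in> L2 unit_interval" and f1: "f1 \<in> L2 unit_interval"
    and adm: "(f, v, z) \<in> admissible f0 f1"
    and minimal: "\<forall>q\<in>admissible f0 f1. action \<kappa> lam \<epsilon> (f, v, z) \<le> action \<kappa> lam \<epsilon> q"
begin

lemma admD: "f \<in> L2 US" "v \<in> V_space" "z \<in> L2 US" "Hm1_curve_between f f0 f1" "transport_equation f0 f1 f v z"
  using adm by (auto simp: admissible_def unit_square_def)

lemma V_L2:
  assumes "u \<in> V_space"
  shows "u \<in> L2 US" "weak_dx u \<in> L2 US" "weak_dx (weak_dx u) \<in> L2 US"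
  using has_weak_dxD[OF V_spaceD(1)[OF assms]] has_weak_dxD[OF V_spaceD(2)[OF assms]] by auto

lemma action_expand:
  assumes u: "u \<in> V_space" and \<tau>: "\<tau> \<in> L2 US"
  shows "action \<kappa> lam \<epsilon> (f', \<lambda>p. v p + s * u p, \<lambda>p. z p + s * \<tau> p) = action \<kappa> lam \<epsilon> (f, v, z)
    + s * (LINT p|US. \<kappa> * v p * u p + lam * weak_dx v p * weak_dx u p
             + \<epsilon> * weak_dx (weak_dx v) p * weak_dx (weak_dx u) p + z p * \<tau> p)
    + s\<^sup>2 * (1/2 * (LINT p|US. \<kappa> * (u p)\<^sup>2 + lam * (weak_dx u p)\<^sup>2 + \<epsilon> * (weak_dx (weak_dx u) p)\<^sup>2 + (\<tau> p)\<^sup>2))"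
proof -
  note vL = V_L2[OF admD(2)] and uL = V_L2[OF u] and e = V_space_add[OF admD(2) u, of s]
  note sL = V_L2[OF e(1)]
  let ?A = "\<lambda>p. \<kappa> * (v p)\<^sup>2 + lam * (weak_dx v p)\<^sup>2 + \<epsilon> * (weak_dx (weak_dx v) p)\<^sup>2 + (z p)\<^sup>2"
  let ?B = "\<lambda>p. \<kappa> * v p * u p + lam * weak_dx v p * weak_dx u p + \<epsilon> * weak_dx (weak_dx v) p * weak_dx (weak_dx u) p + z p * \<tau> p"
  let ?C = "\<lambda>p. \<kappa> * (u p)\<^sup>2 + lam * (weak_dx u p)\<^sup>2 + \<epsilon> * (weak_dx (weak_dx u) p)\<^sup>2 + (\<tau> p)\<^sup>2"
  have iA: "integrable US ?A"
    by (intro Bochner_Integration.integrable_add integrable_mult_right L2D(2) vL admD(3))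
  have iB: "integrable US ?B"
    unfolding mult.assoc by (intro Bochner_Integration.integrable_add integrable_mult_right integrable_mult_L2 vL uL admD(3) \<tau>)
  have iC: "integrable US ?C"
    by (intro Bochner_Integration.integrable_add integrable_mult_right L2D(2) uL \<tau>)
  note [measurable] = L2D(1)[OF vL(1)] L2D(1)[OF vL(2)] L2D(1)[OF vL(3)] L2D(1)[OF uL(1)] L2D(1)[OF uL(2)] L2D(1)[OF uL(3)]
    L2D(1)[OF sL(2)] L2D(1)[OF sL(3)] L2D(1)[OF \<tau>] L2D(1)[OF admD(3)]
  have "(LINT p|US. \<kappa> * (v p + s * u p)\<^sup>2 + lam * (weak_dx (\<lambda>p. v p + s * u p) p)\<^sup>2
      + \<epsilon> * (weak_dx (weak_dx (\<lambda>p. v p + s * u p)) p)\<^sup>2 + (z p + s * \<tau> p)\<^sup>2)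
      = (LINT p|US. ?A p + ((2 * s) * ?B p + s\<^sup>2 * ?C p))"
  proof (rule integral_cong_AE)
    show "AE p in US. \<kappa> * (v p + s * u p)\<^sup>2 + lam * (weak_dx (\<lambda>p. v p + s * u p) p)\<^sup>2
      + \<epsilon> * (weak_dx (weak_dx (\<lambda>p. v p + s * u p)) p)\<^sup>2 + (z p + s * \<tau> p)\<^sup>2 = ?A p + ((2 * s) * ?B p + s\<^sup>2 * ?C p)"
      using e(2,3) by eventually_elim (simp add: power2_eq_square algebra_simps)
  qed measurable
  also have "\<dots> = (LINT p|US. ?A p) + ((2 * s) * (LINT p|US. ?B p) + s\<^sup>2 * (LINT p|US. ?C p))"
    by (subst Bochner_Integration.integral_add[OF iA Bochner_Integration.integrable_add[OF integrable_mult_right[OF iB] integrable_mult_right[OF iC]]],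
        subst Bochner_Integration.integral_add[OF integrable_mult_right[OF iB] integrable_mult_right[OF iC]]) simp
  finally show ?thesis unfolding action_def unit_square_def prod.case by (simp add: algebra_simps)
qed

text \<open>f' may depend on s in any way, because the action contains only v and z. Along the
  family the action is a quadratic polynomial in s with its minimum at 0.\<close>

lemma first_variation:
  assumes u: "u \<in> V_space" and \<tau>: "\<tau> \<in> L2 US"
    and q: "\<And>s. \<exists>f'. (f', \<lambda>p. v p + s * u p, \<lambda>p. z p + s * \<tau> p) \<in> admissible f0 f1"
  shows "(LINT p|US. \<kappa> * v p * u p + lam * weak_dx v p * weak_dx u p
             + \<epsilon> * weak_dx (weak_dx v) p * weak_dx (weak_dx u) p + z p * \<tau> p) = 0"
proof (rule quadratic_min_linear)
  fix s :: real
  obtain f' where "(f', \<lambda>p. v p + s * u p, \<lambda>p. z p + s * \<tau> p) \<in> admissible f0 f1" using q by blast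
  then have "action \<kappa> lam \<epsilon> (f, v, z) \<le> action \<kappa> lam \<epsilon> (f', \<lambda>p. v p + s * u p, \<lambda>p. z p + s * \<tau> p)"
    using minimal by blast
  then show "0 \<le> s * (LINT p|US. \<kappa> * v p * u p + lam * weak_dx v p * weak_dx u p
             + \<epsilon> * weak_dx (weak_dx v) p * weak_dx (weak_dx u) p + z p * \<tau> p)
      + s\<^sup>2 * (1/2 * (LINT p|US. \<kappa> * (u p)\<^sup>2 + lam * (weak_dx u p)\<^sup>2 + \<epsilon> * (weak_dx (weak_dx u) p)\<^sup>2 + (\<tau> p)\<^sup>2))"
    unfolding action_expand[OF u \<tau>] by simp
qed

end

locale minimizer_velocity = minimizer \<kappa> lam \<epsilon> f0 f1 f v z + velocity h
  for \<kappa> lam \<epsilon> :: real and f0 f1 :: "real \<Rightarrow> real" and f v z h :: "real \<times> real \<Rightarrow> real" +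
  assumes dv_vel: "AE p in US. weak_dx v p = vel_x (fst p) (snd p)"
    and v_vel: "AE p in US. v p = vel (fst p) (snd p)"
begin

lemma transport_iff: "f' \<in> L2 US \<Longrightarrow> transport_equation g0 g1 f' v z' \<longleftrightarrow> weak_transport g0 g1 f' z'"
  by (rule transport_equation_iff[OF L2D(1)[OF V_L2(1)] v_vel L2D(1)[OF V_L2(2)] dv_vel]) (rule admD(2))+

lemma f_transport: "weak_transport f0 f1 f z"
  using transport_iff[OF admD(1)] admD(5) by simp

lemma zero_V_space: "(\<lambda>_. 0) \<in> V_space" "AE p in US. weak_dx (\<lambda>_. 0) p = 0" "AE p in US. weak_dx (weak_dx (\<lambda>_. 0)) p = 0"
proof -
  \<comment> \<open>The zero field is written as v - v, so that \<open>V_space_add\<close> gives its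
    \<open>weak_dx\<close>, a choice known only almost everywhere.\<close>
  have V: "(\<lambda>p. v p + (-1) * v p) \<in> V_space" "AE p in US. weak_dx (\<lambda>p. v p + (-1) * v p) p = weak_dx v p + (-1) * weak_dx v p"
    "AE p in US. weak_dx (weak_dx (\<lambda>p. v p + (-1) * v p)) p = weak_dx (weak_dx v) p + (-1) * weak_dx (weak_dx v) p"
    by (rule V_space_add[OF admD(2) admD(2)])+
  then show "(\<lambda>_. 0) \<in> V_space" "AE p in US. weak_dx (\<lambda>_. 0) p = 0" "AE p in US. weak_dx (weak_dx (\<lambda>_. 0)) p = 0" by simp_all
qed

text \<open>With v kept, z is orthogonal to every source that leads from zero initial to zero final
  density. Both the continuity equation for z and its form along the flow rest on this.\<close>

lemma vary_f:
  assumes g: "continuous_on UNIV g" "\<And>x. g (x, 0) = 0" "\<And>x. g (x, 1) = 0" "g \<in> L2 US"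
    and \<tau>: "\<tau> \<in> L2 US" and tr: "weak_transport (\<lambda>_. 0) (\<lambda>_. 0) g \<tau>"
  shows "(LINT p|US. z p * \<tau> p) = 0"
proof -
  have "(LINT p|US. \<kappa> * v p * 0 + lam * weak_dx v p * weak_dx (\<lambda>_. 0) p
             + \<epsilon> * weak_dx (weak_dx v) p * weak_dx (weak_dx (\<lambda>_. 0)) p + z p * \<tau> p) = 0"
  proof (rule first_variation[OF zero_V_space(1) \<tau>])
    fix s :: real
    have fg: "(\<lambda>p. f p + s * g p) \<in> L2 US" by (intro L2_add L2_cmult admD g)
    have "weak_transport f0 f1 (\<lambda>p. f p + s * g p) (\<lambda>p. z p + s * \<tau> p)"
      unfolding weak_transport_def
    proof
      fix \<phi> assume \<phi>: "\<phi> \<in> smooth_fun"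
      have i: "integrable US (\<lambda>p. f p * transport_op \<phi> p)" "integrable US (\<lambda>p. g p * transport_op \<phi> p)"
        "integrable US (\<lambda>p. \<phi> p * z p)" "integrable US (\<lambda>p. \<phi> p * \<tau> p)"
        by (intro integrable_mult_L2 admD g transport_op_L2 smooth_fun_L2_US \<tau> \<phi>)+
      have "(LINT p|US. g p * transport_op \<phi> p) + (LINT p|US. \<phi> p * \<tau> p) = 0"
        using bspec[OF tr[unfolded weak_transport_def] \<phi>] by simp
      moreover have "(LINT p|US. (f p + s * g p) * transport_op \<phi> p) = (LINT p|US. f p * transport_op \<phi> p) + s * (LINT p|US. g p * transport_op \<phi> p)"
        using i by (simp add: distrib_right mult.assoc)
      moreover have "(LINT p|US. \<phi> p * (z p + s * \<tau> p)) = (LINT p|US. \<phi> p * z p) + s * (LINT p|US. \<phi> p * \<tau> p)"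
        using i by (simp add: distrib_left mult.left_commute)
      ultimately show "(LINT p|US. (f p + s * g p) * transport_op \<phi> p) + (LINT p|US. \<phi> p * (z p + s * \<tau> p))
          = (LINT x|U. f1 x * \<phi> (x, 1)) - (LINT x|U. f0 x * \<phi> (x, 0))"
        using bspec[OF f_transport[unfolded weak_transport_def] \<phi>]
        by (simp add: algebra_simps flip: distrib_left)
    qed
    then have "(\<lambda>p. f p + s * g p, v, \<lambda>p. z p + s * \<tau> p) \<in> admissible f0 f1"
      unfolding admissible_def unit_square_def using transport_iff[OF fg] fg admD
      by (auto intro!: L2_add L2_cmult \<tau> Hm1_curve_perturb g)
    then show "\<exists>f'. (f', \<lambda>p. v p + s * 0, \<lambda>p. z p + s * \<tau> p) \<in> admissible f0 f1" by auto
  qed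
  moreover have "(LINT p|US. \<kappa> * v p * 0 + lam * weak_dx v p * weak_dx (\<lambda>_. 0) p
             + \<epsilon> * weak_dx (weak_dx v) p * weak_dx (weak_dx (\<lambda>_. 0)) p + z p * \<tau> p) = (LINT p|US. z p * \<tau> p)"
  proof (rule integral_cong_AE)
    note [measurable] = L2D(1)[OF V_L2(1)[OF admD(2)]] L2D(1)[OF V_L2(2)[OF admD(2)]] L2D(1)[OF V_L2(3)[OF admD(2)]]
      L2D(1)[OF V_L2(2)[OF zero_V_space(1)]] L2D(1)[OF V_L2(3)[OF zero_V_space(1)]] L2D(1)[OF \<tau>] L2D(1)[OF admD(3)]
    show "(\<lambda>p. \<kappa> * v p * 0 + lam * weak_dx v p * weak_dx (\<lambda>_. 0) p
             + \<epsilon> * weak_dx (weak_dx v) p * weak_dx (weak_dx (\<lambda>_. 0)) p + z p * \<tau> p) \<in> borel_measurable US" by measurable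
    show "(\<lambda>p. z p * \<tau> p) \<in> borel_measurable US" by measurable
    show "AE p in US. \<kappa> * v p * 0 + lam * weak_dx v p * weak_dx (\<lambda>_. 0) p
             + \<epsilon> * weak_dx (weak_dx v) p * weak_dx (weak_dx (\<lambda>_. 0)) p + z p * \<tau> p = z p * \<tau> p"
      using zero_V_space(2,3) by eventually_elim simp
  qed
  ultimately show ?thesis by simp
qed

text \<open>The variation is \<phi> itself, with the source \<phi>_t + v \<phi>_x. That the two
  solve the transport equation follows from the explicit solution, as \<phi> along a trajectory is
  the time integral of this source.\<close>

lemma z_continuity_equation: "weak_continuity_equation z v"
  unfolding weak_continuity_equation_def unit_square_def
proof
  fix \<phi> assume "\<phi> \<in> smooth_compact_fun"
  then obtain K where \<phi>: "\<phi> \<in> smooth_fun" and K: "K \<subseteq> {0<..<1} \<times> {0<..<1}" "\<And>p. p \<notin> K \<Longrightarrow> \<phi> p = 0"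
    by (auto simp: smooth_compact_fun_def)
  define \<tau> where "\<tau> p = partial_x \<phi> p * vel (fst p) (snd p) + partial_t \<phi> p" for p
  have \<tau>L: "\<tau> \<in> L2 US" unfolding \<tau>_def[abs_def]
    by (intro L2_add smooth_fun_US velocity_L2 smooth_fun_partial smooth_fun_L2_US \<phi>)
  have b: "\<phi> (x, 0) = 0" "\<phi> (x, 1) = 0" for x using K(1) by (auto intro!: K(2))
  have lag: "lagrange (\<lambda>_. 0) (\<lambda>p. \<tau> (Flow p)) (y, t) = \<phi> (flow t y, t)" if "0 \<le> t" "t \<le> 1" for y t
    using flow_along(3)[OF \<phi> that, of y] by (simp add: lagrange_def \<tau>_def b)
  have wt: "weak_transport (\<lambda>_. 0) (\<lambda>x. lagrange (\<lambda>_. 0) (\<lambda>p. \<tau> (Flow p)) (inv_flow 1 x, 1))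
      (euler (lagrange (\<lambda>_. 0) (\<lambda>p. \<tau> (Flow p)))) (euler (\<lambda>p. \<tau> (Flow p)))"
    by (intro lagrange_weak_transport U.L2_const L2_Flow \<tau>L)
  have e1: "euler (\<lambda>p. \<tau> (Flow p)) = \<tau>" by (auto simp: euler_def fun_eq_iff)
  have e2: "lagrange (\<lambda>_. 0) (\<lambda>p. \<tau> (Flow p)) (inv_flow 1 x, 1) = 0" for x
    using lag[of 1 "inv_flow 1 x"] by (simp add: b)
  have e3: "euler (lagrange (\<lambda>_. 0) (\<lambda>p. \<tau> (Flow p))) p = \<phi> p" if "p \<in> space US" for p
    using that lag[of "snd p" "inv_flow (snd p) (fst p)"] by (cases p) (auto simp: euler_def space_US)
  have "weak_transport (\<lambda>_. 0) (\<lambda>_. 0) \<phi> \<tau>"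
    unfolding weak_transport_def
  proof
    fix \<psi> assume \<psi>: "\<psi> \<in> smooth_fun"
    have "(LINT p|US. euler (lagrange (\<lambda>_. 0) (\<lambda>p. \<tau> (Flow p))) p * transport_op \<psi> p) = (LINT p|US. \<phi> p * transport_op \<psi> p)"
      by (intro Bochner_Integration.integral_cong refl) (simp add: e3)
    then show "(LINT p|US. \<phi> p * transport_op \<psi> p) + (LINT p|US. \<psi> p * \<tau> p) =
        (LINT x|U. 0 * \<psi> (x, 1)) - (LINT x|U. 0 * \<psi> (x, 0))"
      using bspec[OF wt[unfolded weak_transport_def e1 e2] \<psi>] by simp
  qed
  from vary_f[OF smooth_fun_continuous[OF \<phi>] b smooth_fun_L2_US[OF \<phi>] \<tau>L this]
  have "(LINT p|US. z p * \<tau> p) = 0" .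
  moreover have "(LINT p|US. z p * partial_t \<phi> p + z p * v p * partial_x \<phi> p) = (LINT p|US. z p * \<tau> p)"
  proof (rule integral_cong_AE)
    note [measurable] = L2D(1)[OF V_L2(1)[OF admD(2)]] L2D(1)[OF \<tau>L] L2D(1)[OF admD(3)]
      smooth_fun_measurable(2)[OF smooth_fun_partial(1)[OF \<phi>]] smooth_fun_measurable(2)[OF smooth_fun_partial(2)[OF \<phi>]]
    show "(\<lambda>p. z p * partial_t \<phi> p + z p * v p * partial_x \<phi> p) \<in> borel_measurable US" by measurable
    show "(\<lambda>p. z p * \<tau> p) \<in> borel_measurable US" by measurable
    show "AE p in US. z p * partial_t \<phi> p + z p * v p * partial_x \<phi> p = z p * \<tau> p"
      using v_vel by eventually_elim (simp add: \<tau>_def algebra_simps)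
  qed
  ultimately show "(LINT p|US. z p * partial_t \<phi> p + z p * v p * partial_x \<phi> p) = 0" by simp
qed

lemma f_bounded: obtains C where "AE t in U. (LINT x|U. (f (x, t))\<^sup>2) \<le> C"
  using weak_transport_bounded[OF admD(1,3) f0 f1 f_transport] by blast

text \<open>Hoelder's inequality in mixed norms: w is bounded in time with values in L2, u is square
  integrable in time with values in the bounded functions.\<close>

lemma product_L2:
  assumes w: "AE t in U. (\<lambda>x. w (x, t)) \<in> L2 U" "AE t in U. (LINT x|U. (w (x, t))\<^sup>2) \<le> C" "w \<in> borel_measurable US"
    and u: "u \<in> borel_measurable US" "AE t in U. AE x in U. \<bar>u (x, t)\<bar> \<le> a t" and a: "a \<in> L2 U" "\<And>t. 0 \<le> a t"
  shows "(\<lambda>p. u p * w p) \<in> L2 US"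
proof (rule L2_US_slicesI[where B = "\<lambda>t. C * (a t)\<^sup>2"])
  note [measurable] = w(3) u(1)
  show "(\<lambda>p. u p * w p) \<in> borel_measurable US" by measurable
  show "integrable U (\<lambda>t. C * (a t)\<^sup>2)" by (intro integrable_mult_right L2D(2) a)
  have *: "AE t in U. (\<lambda>x. u (x, t) * w (x, t)) \<in> L2 U \<and> (LINT x|U. (u (x, t) * w (x, t))\<^sup>2) \<le> C * (a t)\<^sup>2"
    using w(1,2) u(2) AE_space
  proof eventually_elim
    case (elim t)
    have m: "(\<lambda>x. u (x, t) * w (x, t)) \<in> borel_measurable U" using elim(4) by measurable
    have b: "AE x in U. \<bar>u (x, t) * w (x, t)\<bar> \<le> \<bar>a t * w (x, t)\<bar>"
      using elim(3) by eventually_elim (simp add: abs_mult mult_right_mono a)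
    have L: "(\<lambda>x. u (x, t) * w (x, t)) \<in> L2 U" by (rule L2_bound[OF m L2_cmult[OF elim(1)] b])
    have "(LINT x|U. (u (x, t) * w (x, t))\<^sup>2) \<le> (LINT x|U. (a t * w (x, t))\<^sup>2)"
      by (rule integral_mono_AE[OF L2D(2)[OF L] L2D(2)[OF L2_cmult[OF elim(1)]]])
         (use b in \<open>eventually_elim, simp add: abs_le_square_iff\<close>)
    also have "\<dots> \<le> C * (a t)\<^sup>2" using mult_right_mono[OF elim(2), of "(a t)\<^sup>2"] by (simp add: power_mult_distrib mult.commute)
    finally show ?case using L by simp
  qed
  show "AE t in U. (\<lambda>x. u (x, t) * w (x, t)) \<in> L2 U" using * by (rule eventually_mono) simp
  show "AE t in U. (LINT x|U. (u (x, t) * w (x, t))\<^sup>2) \<le> C * (a t)\<^sup>2" using * by (rule eventually_mono) simp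
qed

text \<open>a is the Lipschitz constant of the slices. The last bound is the linear decay at both
  ends that \<open>product_traces\<close> asks for.\<close>

lemma V_space_slices:
  assumes "u \<in> V_space"
  obtains a where "a \<in> L2 U" "\<And>t. 0 \<le> a t" "AE t in U. AE x in U. \<bar>u (x, t)\<bar> \<le> a t"
    "AE t in U. AE x in U. \<bar>weak_dx u (x, t)\<bar> \<le> a t"
    "AE t in U. AE x in U. \<bar>u (x, t)\<bar> \<le> a t * x \<and> \<bar>u (x, t)\<bar> \<le> a t * (1 - x)"
proof -
  obtain k where k: "velocity k" "AE p in US. weak_dx u p = velocity.vel_x k (fst p) (snd p)" "AE p in US. u p = velocity.vel k (fst p) (snd p)"
    using V_space_velocity[OF assms] by blast
  interpret K: velocity k by (rule k(1))
  have u: "AE t in U. AE x in U. u (x, t) = K.vel x t" "AE t in U. AE x in U. weak_dx u (x, t) = K.vel_x x t"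
    using AE_US_D(2)[OF k(3)] AE_US_D(2)[OF k(2)] by simp_all
  show ?thesis
  proof (rule that[OF K.lip_L2 K.lip_nonneg])
    show "AE t in U. AE x in U. \<bar>u (x, t)\<bar> \<le> K.lip t"
      using u(1) AE_space
    proof eventually_elim
      case (elim t)
      show ?case using elim(1) AE_space by eventually_elim (use elim K.abs_vel_01[of t] in auto)
    qed
    show "AE t in U. AE x in U. \<bar>weak_dx u (x, t)\<bar> \<le> K.lip t"
      using u(2) AE_space
    proof eventually_elim
      case (elim t)
      show ?case using elim(1) AE_space by eventually_elim (use elim K.abs_vel_x_le[of t] in auto)
    qed
    show "AE t in U. AE x in U. \<bar>u (x, t)\<bar> \<le> K.lip t * x \<and> \<bar>u (x, t)\<bar> \<le> K.lip t * (1 - x)"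
      using u(1) AE_space
    proof eventually_elim
      case (elim t)
      then have t: "0 < t" "t < 1" by auto
      show ?case using elim(1) AE_space
      proof eventually_elim
        case (elim x)
        then show ?case using K.abs_vel_le[OF t, of x] by auto
      qed
    qed
  qed
qed

text \<open>This is where the time bound of f enters: u_x is only square integrable in time.\<close>

lemma times_dx_L2:
  assumes u: "u \<in> R_T f" shows "times_dx u f \<in> L2 US"
proof -
  have uV: "u \<in> V_space" and "(\<lambda>p. u p * f p) \<in> L2_H1" using u by (auto simp: R_T_def)
  then obtain G where "has_weak_dx (\<lambda>p. u p * f p) G" by (auto simp: L2_H1_def)
  then have GL: "weak_dx (\<lambda>q. u q * f q) \<in> L2 US" using has_weak_dxD(2)[OF has_weak_dx_weak_dx] by blast
  obtain C where C: "AE t in U. (LINT x|U. (f (x, t))\<^sup>2) \<le> C" using f_bounded by blast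
  obtain a where a: "a \<in> L2 U" "\<And>t. 0 \<le> a t" "AE t in U. AE x in U. \<bar>u (x, t)\<bar> \<le> a t"
    "AE t in U. AE x in U. \<bar>weak_dx u (x, t)\<bar> \<le> a t"
    "AE t in U. AE x in U. \<bar>u (x, t)\<bar> \<le> a t * x \<and> \<bar>u (x, t)\<bar> \<le> a t * (1 - x)"
    by (rule V_space_slices[OF uV], rule that)
  have "(\<lambda>p. weak_dx u p * f p) \<in> L2 US"
    by (rule product_L2[OF L2_slices(1)[OF admD(1)] C _ _ a(4) a(1,2)]) (use admD(1) V_L2[OF uV] in \<open>auto dest: L2D\<close>)
  then show ?thesis unfolding times_dx_def[abs_def] by (intro L2_diff GL)
qed

text \<open>On almost every slice the integrals combine to that of (\<phi> u f)_x, and u f has zero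
  traces.\<close>

lemma times_dx_transport:
  assumes u: "u \<in> R_T f" and \<phi>: "\<phi> \<in> smooth_fun"
  shows "(LINT p|US. f p * \<phi> p * weak_dx u p) + (LINT p|US. f p * partial_x \<phi> p * u p) + (LINT p|US. \<phi> p * times_dx u f p) = 0"
proof -
  have uV: "u \<in> V_space" and "(\<lambda>p. u p * f p) \<in> L2_H1" using u by (auto simp: R_T_def)
  define G where "G = weak_dx (\<lambda>q. u q * f q)"
  have uf: "has_weak_dx (\<lambda>p. u p * f p) G"
    using \<open>_ \<in> L2_H1\<close> has_weak_dx_weak_dx by (auto simp: L2_H1_def G_def)
  obtain a where a: "a \<in> L2 U" "\<And>t. 0 \<le> a t" "AE t in U. AE x in U. \<bar>u (x, t)\<bar> \<le> a t"
    "AE t in U. AE x in U. \<bar>weak_dx u (x, t)\<bar> \<le> a t"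
    "AE t in U. AE x in U. \<bar>u (x, t)\<bar> \<le> a t * x \<and> \<bar>u (x, t)\<bar> \<le> a t * (1 - x)"
    by (rule V_space_slices[OF uV], rule that)
  have ufL: "(\<lambda>p. u p * f p) \<in> L2 US" and GL: "G \<in> L2 US" using has_weak_dxD[OF uf] by auto
  have i: "integrable US (\<lambda>p. f p * \<phi> p * weak_dx u p)" "integrable US (\<lambda>p. f p * partial_x \<phi> p * u p)"
    "integrable US (\<lambda>p. \<phi> p * times_dx u f p)"
    unfolding mult.assoc
    by (intro integrable_mult_L2 admD smooth_fun_US V_L2[OF uV] smooth_fun_partial \<phi> smooth_fun_L2_US times_dx_L2 u)+
  have j: "integrable US (\<lambda>p. partial_x \<phi> p * (u p * f p) + \<phi> p * G p)"
    by (intro Bochner_Integration.integrable_add integrable_mult_L2 ufL GL smooth_fun_partial smooth_fun_L2_US \<phi>)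
  have "(LINT p|US. f p * \<phi> p * weak_dx u p) + (LINT p|US. f p * partial_x \<phi> p * u p) + (LINT p|US. \<phi> p * times_dx u f p)
      = (LINT p|US. partial_x \<phi> p * (u p * f p) + \<phi> p * G p)"
    using i by (simp add: times_dx_def G_def algebra_simps flip: Bochner_Integration.integral_add)
  also have "\<dots> = (LINT t|U. LINT x|U. partial_x \<phi> (x, t) * (u (x, t) * f (x, t)) + \<phi> (x, t) * G (x, t))"
    using US_Fubini(4)[OF j] by simp
  also have "\<dots> = (LINT t|U. 0)"
  proof (rule integral_cong_AE)
    show "(\<lambda>t. LINT x|U. partial_x \<phi> (x, t) * (u (x, t) * f (x, t)) + \<phi> (x, t) * G (x, t)) \<in> borel_measurable U"
      using borel_measurable_integrable[OF US_Fubini(3)[OF j]] .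
    show "AE t in U. (LINT x|U. partial_x \<phi> (x, t) * (u (x, t) * f (x, t)) + \<phi> (x, t) * G (x, t)) = 0"
      using has_weak_dxD(3)[OF uf] L2_slices(1)[OF admD(1)] a(5) L2_slices(1)[OF V_L2(1)[OF uV]]
    proof eventually_elim
      case (elim t)
      then obtain c where c: "AE x in U. u (x, t) * f (x, t) = c + prim (\<lambda>x. G (x, t)) x"
        and L: "(\<lambda>x. u (x, t) * f (x, t)) \<in> L2 U" "(\<lambda>x. G (x, t)) \<in> L2 U" by (auto simp: has_weak_deriv_iff)
      \<comment> \<open>\<open>product_traces\<close> needs its bounds at every x; w is u(., t), set
        to 0 where they fail, which is a null set.\<close>
      define w where "w x = (if \<bar>u (x, t)\<bar> \<le> a t * x \<and> \<bar>u (x, t)\<bar> \<le> a t * (1 - x) then u (x, t) else 0)" for x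
      have "AE x in U. w x * f (x, t) = c + prim (\<lambda>x. G (x, t)) x"
        using c elim(3) by eventually_elim (simp add: w_def)
      from product_traces[OF elim(2) L(2) this, of "a t"] have c0: "c = 0" and P1: "prim (\<lambda>x. G (x, t)) 1 = 0"
        using a(2)[of t] by (auto simp: w_def)
      have \<phi>L: "(\<lambda>x. partial_x \<phi> (x, t)) \<in> L2 U" by (rule smooth_fun_slice[OF smooth_fun_partial(1)[OF \<phi>]])
      have \<phi>p: "\<phi> (x, t) = \<phi> (0, t) + prim (\<lambda>x. partial_x \<phi> (x, t)) x" if x: "0 \<le> x" "x \<le> 1" for x
      proof (rule prim_FTC[OF _ x])
        show "continuous_on {0..1} (\<lambda>x. partial_x \<phi> (x, t))"
          by (intro continuous_on_compose2[OF smooth_fun_continuous[OF smooth_fun_partial(1)[OF \<phi>], of UNIV]] continuous_intros) auto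
        fix x :: real
        have "((\<lambda>x. (x, t)) has_derivative (\<lambda>h. (h, 0))) (at x)" by (auto intro!: derivative_eq_intros)
        from has_derivative_compose[OF this smooth_fun_has_derivative[OF \<phi>]]
        have "((\<lambda>x. \<phi> (x, t)) has_real_derivative partial_x \<phi> (x, t)) (at x)"
          by (simp add: has_field_derivative_def)
        then show "((\<lambda>x. \<phi> (x, t)) has_real_derivative partial_x \<phi> (x, t)) (at x within {0..1})"
          by (rule has_field_derivative_at_within)
      qed
      have "(\<phi> (0, t) + prim (\<lambda>x. partial_x \<phi> (x, t)) 1) * (0 + prim (\<lambda>x. G (x, t)) 1) = \<phi> (0, t) * 0 +
          prim (\<lambda>x. partial_x \<phi> (x, t) * (0 + prim (\<lambda>x. G (x, t)) x) + (\<phi> (0, t) + prim (\<lambda>x. partial_x \<phi> (x, t)) x) * G (x, t)) 1"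
        by (rule prim_mult_all[OF \<phi>L L(2)])
      then have "0 = prim (\<lambda>x. partial_x \<phi> (x, t) * (0 + prim (\<lambda>x. G (x, t)) x) + (\<phi> (0, t) + prim (\<lambda>x. partial_x \<phi> (x, t)) x) * G (x, t)) 1"
        by (simp add: P1)
      also have "\<dots> = prim (\<lambda>x. partial_x \<phi> (x, t) * prim (\<lambda>x. G (x, t)) x + \<phi> (x, t) * G (x, t)) 1"
        by (rule prim_cong) (simp flip: \<phi>p)
      also have "\<dots> = (LINT x|U. partial_x \<phi> (x, t) * prim (\<lambda>x. G (x, t)) x + \<phi> (x, t) * G (x, t))" by (simp add: prim_1)
      also have "\<dots> = (LINT x|U. partial_x \<phi> (x, t) * (u (x, t) * f (x, t)) + \<phi> (x, t) * G (x, t))"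
      proof (rule integral_cong_AE)
        note [measurable] = L2D(1)[OF L(1)] L2D(1)[OF L(2)] L2D(1)[OF \<phi>L] L2D(1)[OF smooth_fun_slice[OF \<phi>, of t]]
          measurable_compose[OF borel_ident_U measurable_prim[OF U.L2_integrable[OF L(2)]]]
        show "(\<lambda>x. partial_x \<phi> (x, t) * prim (\<lambda>x. G (x, t)) x + \<phi> (x, t) * G (x, t)) \<in> borel_measurable U" by measurable
        show "(\<lambda>x. partial_x \<phi> (x, t) * (u (x, t) * f (x, t)) + \<phi> (x, t) * G (x, t)) \<in> borel_measurable U"
          by (intro borel_measurable_add borel_measurable_times) (use L \<phi>L smooth_fun_slice[OF \<phi>, of t] elim(2,4) in \<open>auto dest: L2D\<close>)
        show "AE x in U. partial_x \<phi> (x, t) * prim (\<lambda>x. G (x, t)) x + \<phi> (x, t) * G (x, t)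
            = partial_x \<phi> (x, t) * (u (x, t) * f (x, t)) + \<phi> (x, t) * G (x, t)"
          using c by eventually_elim (simp add: c0)
      qed
      finally show ?case by simp
    qed
  qed simp
  finally show ?thesis by simp
qed

lemma euler_lagrange:
  assumes u: "u \<in> R_T f"
  shows "(LINT p|US. \<kappa> * v p * u p + lam * weak_dx v p * weak_dx u p
             + \<epsilon> * weak_dx (weak_dx v) p * weak_dx (weak_dx u) p + z p * times_dx u f p) = 0"
proof (rule first_variation[OF _ times_dx_L2[OF u]])
  show uV: "u \<in> V_space" using u by (simp add: R_T_def)
  fix s :: real
  note e = V_space_add[OF admD(2) uV, of s]
  have "transport_equation f0 f1 f (\<lambda>p. v p + s * u p) (\<lambda>p. z p + s * times_dx u f p)"
    unfolding transport_equation_def unit_square_def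
  proof
    fix \<phi> assume \<phi>: "\<phi> \<in> smooth_fun"
    note [measurable] = L2D(1)[OF admD(1)] smooth_fun_measurable(2)[OF \<phi>] L2D(1)[OF V_L2(2)[OF admD(2)]] L2D(1)[OF V_L2(2)[OF uV]]
      L2D(1)[OF V_L2(2)[OF e(1)]]
    have i: "integrable US (\<lambda>p. f p * \<phi> p * weak_dx w p)" "integrable US (\<lambda>p. f p * partial_x \<phi> p * w p)" if "w \<in> V_space" for w
      unfolding mult.assoc by (intro integrable_mult_L2 admD smooth_fun_US V_L2 that smooth_fun_partial \<phi>)+
    have j: "integrable US (\<lambda>p. \<phi> p * z p)" "integrable US (\<lambda>p. \<phi> p * times_dx u f p)"
      by (intro integrable_mult_L2 admD smooth_fun_L2_US \<phi> times_dx_L2 u)+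
    have "(LINT p|US. f p * \<phi> p * weak_dx (\<lambda>p. v p + s * u p) p) = (LINT p|US. f p * \<phi> p * weak_dx v p + s * (f p * \<phi> p * weak_dx u p))"
    proof (rule integral_cong_AE)
      show "AE p in US. f p * \<phi> p * weak_dx (\<lambda>p. v p + s * u p) p = f p * \<phi> p * weak_dx v p + s * (f p * \<phi> p * weak_dx u p)"
        using e(2) by eventually_elim (simp add: algebra_simps)
    qed measurable
    also have "\<dots> = (LINT p|US. f p * \<phi> p * weak_dx v p) + s * (LINT p|US. f p * \<phi> p * weak_dx u p)"
      using i(1)[OF admD(2)] i(1)[OF uV] by simp
    finally have 1: "(LINT p|US. f p * \<phi> p * weak_dx (\<lambda>p. v p + s * u p) p) = (LINT p|US. f p * \<phi> p * weak_dx v p) + s * (LINT p|US. f p * \<phi> p * weak_dx u p)" .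
    have 2: "(LINT p|US. f p * partial_x \<phi> p * (v p + s * u p)) = (LINT p|US. f p * partial_x \<phi> p * v p) + s * (LINT p|US. f p * partial_x \<phi> p * u p)"
      using i(2)[OF admD(2)] i(2)[OF uV] by (simp add: distrib_left mult.left_commute[of _ s])
    have 3: "(LINT p|US. \<phi> p * (z p + s * times_dx u f p)) = (LINT p|US. \<phi> p * z p) + s * (LINT p|US. \<phi> p * times_dx u f p)"
      using j by (simp add: distrib_left mult.left_commute[of _ s])
    have 4: "s * ((LINT p|US. f p * \<phi> p * weak_dx u p) + (LINT p|US. f p * partial_x \<phi> p * u p) + (LINT p|US. \<phi> p * times_dx u f p)) = 0"
      unfolding times_dx_transport[OF u \<phi>] by simp
    show "- (LINT p|US. f p * partial_t \<phi> p) + (LINT x|U. f1 x * \<phi> (x, 1)) - (LINT x|U. f0 x * \<phi> (x, 0)) =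
      (LINT p|US. f p * \<phi> p * weak_dx (\<lambda>p. v p + s * u p) p) + (LINT p|US. f p * partial_x \<phi> p * (v p + s * u p))
      + (LINT p|US. \<phi> p * (z p + s * times_dx u f p))"
      unfolding 1 2 3 using 4 bspec[OF admD(5)[unfolded transport_equation_def unit_square_def] \<phi>] by (simp add: algebra_simps)
  qed
  then have "(f, \<lambda>p. v p + s * u p, \<lambda>p. z p + s * times_dx u f p) \<in> admissible f0 f1"
    using admD e(1) times_dx_L2[OF u] by (auto simp: admissible_def unit_square_def)
  then show "\<exists>f'. (f', \<lambda>p. v p + s * u p, \<lambda>p. z p + s * times_dx u f p) \<in> admissible f0 f1" by blast
qed

end

section \<open>Regularity for boundary data in H1\<close>

subsection \<open>Absolutely continuous functions with square integrable derivative\<close>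

text \<open>H1 functions given by their continuous representative, extended by constants. Equality
  at every y allows products, reciprocals and compositions with the flow to be formed
  pointwise.\<close>

definition AC2 :: "(real \<Rightarrow> real) \<Rightarrow> bool"
  where "AC2 F \<longleftrightarrow> (\<exists>c. \<exists>g\<in>L2 U. \<forall>y. F y = c + prim g y)"

lemma AC2I: "g \<in> L2 U \<Longrightarrow> (\<And>y. F y = c + prim g y) \<Longrightarrow> AC2 F"
  by (auto simp: AC2_def)

lemma L2_mult_AC:
  assumes "k \<in> L2 U" "g \<in> L2 U" shows "(\<lambda>y. k y * (c + prim g y)) \<in> L2 U" "(\<lambda>y. (c + prim g y) * k y) \<in> L2 U"
proof -
  have gi: "integrable U g" using assms(2) by (rule U.L2_integrable)
  note [measurable] = L2D(1)[OF L2_prim[OF gi, of c]]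
  have "(\<lambda>y. (c + prim g y) * k y) \<in> L2 U"
    by (rule L2_mult_bdd[OF assms(1), where C = "\<bar>c\<bar> + (LINT r|U. \<bar>g r\<bar>)"])
       (auto intro!: order_trans[OF abs_triangle_ineq] abs_prim_le gi L2D(1)[OF L2_prim[OF gi]])
  then show "(\<lambda>y. (c + prim g y) * k y) \<in> L2 U" "(\<lambda>y. k y * (c + prim g y)) \<in> L2 U" by (simp_all add: mult.commute)
qed

lemma AC2_mult:
  assumes "AC2 F" "AC2 G" shows "AC2 (\<lambda>y. F y * G y)"
proof -
  obtain c g d k where F: "g \<in> L2 U" "\<And>y. F y = c + prim g y" and G: "k \<in> L2 U" "\<And>y. G y = d + prim k y"
    using assms by (auto simp: AC2_def)
  show ?thesis
    by (rule AC2I[of "\<lambda>r. g r * (d + prim k r) + (c + prim g r) * k r" _ "c * d"])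
       (auto simp: F(2) G(2) intro!: L2_add L2_mult_AC F G prim_mult_all)
qed

lemma AC2_diff:
  assumes "AC2 F" "AC2 G" shows "AC2 (\<lambda>y. F y - G y)"
proof -
  obtain c g d k where F: "g \<in> L2 U" "\<And>y. F y = c + prim g y" and G: "k \<in> L2 U" "\<And>y. G y = d + prim k y"
    using assms by (auto simp: AC2_def)
  show ?thesis
    by (rule AC2I[of "\<lambda>r. g r - k r" _ "c - d"]) (auto simp: F(2) G(2) intro!: L2_diff F G simp: prim_diff U.L2_integrable F G)
qed

text \<open>w satisfies w' = m w with initial value 0, and exp (- \<open>prim m\<close>) is an
  integrating factor.\<close>

lemma prim_ODE_unique:
  assumes m: "m \<in> L2 U" and w: "\<And>y. w y = prim (\<lambda>r. m r * w r) y" and L: "(\<lambda>r. m r * w r) \<in> L2 U"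
  shows "w y = 0"
proof -
  define E where "E y = exp ((-1) * prim m y)" for y
  define k where "k r = (-1) * E r * m r" for r
  have E: "E y = 1 + prim k y" for y unfolding E_def k_def by (rule exp_prim[OF m])
  have "E \<in> borel_measurable U"
    unfolding E_def[abs_def]
    using measurable_compose[OF borel_ident_U measurable_prim[OF U.L2_integrable[OF m]]] by measurable
  moreover have "\<bar>E y\<bar> \<le> exp (LINT r|U. \<bar>m r\<bar>)" for y
    using abs_prim_le[OF U.L2_integrable[OF m], of y] by (simp add: E_def)
  ultimately have k: "k \<in> L2 U"
    unfolding k_def[abs_def] by (intro L2_mult_bdd[OF m, where C = "exp (LINT r|U. \<bar>m r\<bar>)"]) auto
  have "(0 + prim (\<lambda>r. m r * w r) y) * (1 + prim k y)
      = 0 * 1 + prim (\<lambda>r. m r * w r * (1 + prim k r) + (0 + prim (\<lambda>r. m r * w r) r) * k r) y"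
    by (rule prim_mult_all[OF L k])
  also have "prim (\<lambda>r. m r * w r * (1 + prim k r) + (0 + prim (\<lambda>r. m r * w r) r) * k r) y = prim (\<lambda>r. 0) y"
    unfolding w[symmetric] E[symmetric] add_0 by (rule prim_cong) (simp add: k_def)
  finally have "w y * E y = 0" unfolding w[symmetric] E[symmetric] add_0 by (simp add: prim_def)
  then show ?thesis by (simp add: E_def)
qed

text \<open>The candidate \<open>r\<close> for \<open>1 / F\<close> is the primitive of \<open>- F' / F\<^sup>2\<close>; then \<open>r F - 1\<close> solves a homogeneous
  linear differential equation.\<close>

lemma AC2_inverse:
  assumes F: "AC2 F" and b: "b > 0" "\<And>y. b \<le> F y" shows "AC2 (\<lambda>y. inverse (F y))"
proof -
  obtain c g where g: "g \<in> L2 U" and Fg: "\<And>y. F y = c + prim g y" using F by (auto simp: AC2_def)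
  have [measurable]: "F \<in> borel_measurable U" "g \<in> borel_measurable U"
    using L2D(1)[OF L2_prim[OF U.L2_integrable[OF g], of c]] L2D(1)[OF g] by (simp_all add: Fg[abs_def])
  have pos: "0 < F y" for y using b(2)[of y] b(1) by linarith
  have iF: "\<bar>inverse (F y)\<bar> \<le> inverse b" for y using pos[of y] b by (simp add: le_imp_inverse_le)
  define m where "m y = inverse (F y) * g y" for y
  define k where "k y = - (inverse (F y) * m y)" for y
  have m: "m \<in> L2 U" unfolding m_def[abs_def] by (rule L2_mult_bdd[OF g _ iF]) measurable
  have k: "k \<in> L2 U" unfolding k_def[abs_def] by (intro L2_minus L2_mult_bdd[OF m _ iF]) measurable
  have c: "c > 0" using pos[of 0] by (simp add: Fg prim_0)
  define r where "r y = inverse c + prim k y" for y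
  define w where "w y = r y * F y - 1" for y
  have gr: "(\<lambda>y. r y * g y) \<in> L2 U" unfolding r_def by (rule L2_mult_AC[OF g k])
  have "m y * w y = r y * g y - m y" for y
    using pos[of y] by (simp add: w_def m_def field_simps)
  then have mw: "(\<lambda>y. m y * w y) = (\<lambda>y. r y * g y - m y)" by auto
  have "w y = prim (\<lambda>y. m y * w y) y" for y
  proof -
    have "r y * F y = inverse c * c + prim (\<lambda>y. k y * (c + prim g y) + (inverse c + prim k y) * g y) y"
      unfolding r_def Fg by (rule prim_mult_all[OF k g])
    also have "prim (\<lambda>y. k y * (c + prim g y) + (inverse c + prim k y) * g y) y = prim (\<lambda>y. m y * w y) y"
    proof (rule prim_cong)
      fix y show "k y * (c + prim g y) + (inverse c + prim k y) * g y = m y * w y"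
        unfolding Fg[symmetric] r_def[symmetric] using pos[of y] by (simp add: k_def m_def w_def field_simps)
    qed
    finally show ?thesis using c by (simp add: w_def)
  qed
  note wp = this
  have mwL: "(\<lambda>y. m y * w y) \<in> L2 U" unfolding mw using gr m by (rule L2_diff)
  have "w y = 0" for y by (rule prim_ODE_unique[OF m wp mwL])
  then have "inverse (F y) = r y" for y using pos[of y] by (simp add: w_def field_simps)
  then show ?thesis by (intro AC2I[OF k]) (simp add: r_def)
qed

context velocity
begin

text \<open>Substitution replaces the chain rule: the density \<open>jac t y * g (flow t y)\<close>
  is the one that \<open>prim_inv_flow\<close> turns back into g.\<close>

lemma AC2_flow:
  assumes "AC2 F" shows "AC2 (\<lambda>y. F (flow t y))"
proof -
  obtain c g where g: "g \<in> L2 U" and Fg: "\<And>y. F y = c + prim g y" using assms by (auto simp: AC2_def)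
  note [measurable] = L2D(1)[OF g]
  define k where "k y = jac t y * g (flow t y)" for y
  have km [measurable]: "k \<in> borel_measurable U" unfolding k_def[abs_def] by measurable
  have i: "integrable U (\<lambda>y. jac t y * (g (flow t y))\<^sup>2)"
    using flow_subst(1)[of "\<lambda>x. (g x)\<^sup>2" t] L2D(2)[OF g] by simp
  have k: "k \<in> L2 U"
  proof (rule L2I[OF km])
    show "integrable U (\<lambda>y. (k y)\<^sup>2)"
      by (rule Bochner_Integration.integrable_bound[OF integrable_mult_right[OF i, of "exp lip_total"]])
         (auto simp: k_def power_mult_distrib power2_eq_square[of "exp _"] mult.assoc intro!: mult_right_mono logJ_le)
  qed
  have e: "k (inv_flow t \<xi>) * exp (- logJ t (inv_flow t \<xi>)) = g \<xi>" for \<xi> by (simp add: k_def exp_minus)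
  have "prim g (flow t y) = prim k y" for y
    using prim_inv_flow[OF km, of t "flow t y"] unfolding e by simp
  then show ?thesis by (intro AC2I[OF k, of _ c]) (simp add: Fg)
qed

subsection \<open>Time integrals of the reciprocal Jacobian\<close>

text \<open>Once z times the Jacobian is a function z0 of y alone, the source collected along a
  trajectory up to time t is z0(y) times this integral.\<close>

definition elapsed :: "real \<Rightarrow> real \<Rightarrow> real"
  where "elapsed t y = prim (\<lambda>r. exp (- logJ r y)) t"

definition delapsed :: "real \<Rightarrow> real \<Rightarrow> real"
  where "delapsed t \<eta> = prim (\<lambda>r. - (exp (- logJ r \<eta>) * dlogJ r \<eta>)) t"

lemma minus_logJ_le: "- logJ t y \<le> lip_total"
  using logJ_le(2)[of t y] by linarith

lemma inverse_jac_L2: "(\<lambda>r. exp (- logJ r y)) \<in> L2 U"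
  by (rule U.L2_bdd[where C = "exp lip_total"]) (auto simp: minus_logJ_le)

lemma abs_elapsed: "\<bar>elapsed t y\<bar> \<le> exp lip_total"
proof -
  have "\<bar>elapsed t y\<bar> \<le> (LINT r|U. \<bar>exp (- logJ r y)\<bar>)"
    unfolding elapsed_def by (rule abs_prim_le[OF U.L2_integrable[OF inverse_jac_L2]])
  also have "\<dots> \<le> (LINT r|U. exp lip_total)"
    by (rule integral_mono) (use U.L2_integrable[OF inverse_jac_L2] inverse_jac_le in auto)
  finally show ?thesis by simp
qed

text \<open>Allows the relation between the densities at times 0 and 1 to be solved for z0.\<close>

lemma elapsed_1_ge: "exp (- lip_total) \<le> elapsed 1 y"
proof -
  have "(LINT r|U. exp (- lip_total)) \<le> (LINT r|U. exp (- logJ r y))"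
    by (rule integral_mono) (use U.L2_integrable[OF inverse_jac_L2] logJ_le in auto)
  then show ?thesis by (simp add: elapsed_def prim_1)
qed

lemma measurable_elapsed [measurable (raw)]:
  assumes [measurable]: "T \<in> borel_measurable M" "Y \<in> borel_measurable M"
  shows "(\<lambda>p. elapsed (T p) (Y p)) \<in> borel_measurable M"
proof -
  have [measurable]: "(\<lambda>x. snd x) \<in> borel_measurable (M \<Otimes>\<^sub>M U)"
    using measurable_compose[OF measurable_snd borel_ident_U] .
  show ?thesis unfolding elapsed_def by measurable
qed

lemma measurable_delapsed [measurable (raw)]:
  assumes [measurable]: "T \<in> borel_measurable M" "Y \<in> measurable M U"
  shows "(\<lambda>p. delapsed (T p) (Y p)) \<in> borel_measurable M"
proof -
  have [measurable]: "(\<lambda>x. snd x) \<in> borel_measurable (M \<Otimes>\<^sub>M U)"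
    using measurable_compose[OF measurable_snd borel_ident_U] .
  have [measurable]: "Y \<in> borel_measurable M" using measurable_compose[OF assms(2) borel_ident_U] .
  show ?thesis unfolding delapsed_def by measurable
qed

lemma elapsed_rate_L2: "(\<lambda>p. - (exp (- logJ (snd p) (fst p)) * dlogJ (snd p) (fst p))) \<in> L2 US"
proof (rule L2_bound[OF _ L2_US_fst[OF L2_cmult[OF dlogJ_bound_L2, of "exp lip_total"]]])
  show "AE p in US. \<bar>- (exp (- logJ (snd p) (fst p)) * dlogJ (snd p) (fst p))\<bar> \<le> \<bar>exp lip_total * dlogJ_bound (fst p)\<bar>"
    using AE_US_fst[OF abs_dlogJ]
  proof eventually_elim
    case (elim p)
    have "\<bar>dlogJ (snd p) (fst p)\<bar> \<le> \<bar>dlogJ_bound (fst p)\<bar>" using elim by (metis abs_ge_self order_trans)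
    then show ?case unfolding abs_minus abs_mult by (intro mult_mono) (auto simp: minus_logJ_le)
  qed
qed measurable

lemma abs_delapsed: "AE \<eta> in U. \<forall>t. \<bar>delapsed t \<eta>\<bar> \<le> exp lip_total * dlogJ_bound \<eta>"
  using abs_dlogJ L2_slices(2)[OF elapsed_rate_L2]
proof eventually_elim
  case (elim \<eta>)
  then have i: "integrable U (\<lambda>r. - (exp (- logJ r \<eta>) * dlogJ r \<eta>))" by (auto dest: U.L2_integrable)
  show ?case
  proof
    fix t
    have "\<bar>delapsed t \<eta>\<bar> \<le> (LINT r|U. \<bar>- (exp (- logJ r \<eta>) * dlogJ r \<eta>)\<bar>)"
      unfolding delapsed_def by (rule abs_prim_le[OF i])
    also have "\<dots> \<le> (LINT r|U. exp lip_total * dlogJ_bound \<eta>)"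
      by (rule integral_mono[OF integrable_abs[OF i]]) (use elim(1) in \<open>auto simp: abs_mult minus_logJ_le intro!: mult_mono\<close>)
    finally show "\<bar>delapsed t \<eta>\<bar> \<le> exp lip_total * dlogJ_bound \<eta>" by simp
  qed
qed

lemma delapsed_L2: "delapsed t \<in> L2 U"
proof (rule L2_bound[OF _ L2_cmult[OF dlogJ_bound_L2, of "exp lip_total"]])
  show "delapsed t \<in> borel_measurable U" by measurable
  show "AE \<eta> in U. \<bar>delapsed t \<eta>\<bar> \<le> \<bar>exp lip_total * dlogJ_bound \<eta>\<bar>"
    using abs_delapsed by eventually_elim (metis abs_ge_self order_trans)
qed

text \<open>At each time the reciprocal Jacobian is absolutely continuous in y, by
  \<open>logJ_prim\<close> and the chain rule for exp; then the integrals over time and over y are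
  exchanged.\<close>

lemma elapsed_prim: "elapsed t y = elapsed t 0 + prim (delapsed t) y"
proof -
  let ?g = "\<lambda>p. - (exp (- logJ (snd p) (fst p)) * dlogJ (snd p) (fst p))"
  have I: "integrable US ?g" using elapsed_rate_L2 by (rule US.L2_integrable)
  have "exp (- logJ r y) = exp (- logJ r 0) + prim (\<lambda>\<eta>. ?g (\<eta>, r)) y" for r
  proof -
    have e: "exp (- logJ r 0) * exp ((-1) * prim (dlogJ r) y) = exp (- logJ r y)" for y
      unfolding exp_add[symmetric] by (subst (2) logJ_prim) simp
    have "exp (- logJ r y) = exp (- logJ r 0) * (1 + prim (\<lambda>\<eta>. (-1) * exp ((-1) * prim (dlogJ r) \<eta>) * dlogJ r \<eta>) y)"
      unfolding exp_prim[OF dlogJ_L2, symmetric] e ..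
    also have "\<dots> = exp (- logJ r 0) + prim (\<lambda>\<eta>. exp (- logJ r 0) * ((-1) * exp ((-1) * prim (dlogJ r) \<eta>) * dlogJ r \<eta>)) y"
      by (simp only: distrib_left mult_1_right prim_cmult)
    also have "prim (\<lambda>\<eta>. exp (- logJ r 0) * ((-1) * exp ((-1) * prim (dlogJ r) \<eta>) * dlogJ r \<eta>)) y = prim (\<lambda>\<eta>. ?g (\<eta>, r)) y"
    proof (rule prim_cong)
      fix \<eta>
      show "exp (- logJ r 0) * ((-1) * exp ((-1) * prim (dlogJ r) \<eta>) * dlogJ r \<eta>) = ?g (\<eta>, r)"
        unfolding fst_conv snd_conv e[of \<eta>, symmetric] by algebra
    qed
    finally show ?thesis .
  qed
  then have "elapsed t y = prim (\<lambda>r. exp (- logJ r 0) + prim (\<lambda>\<eta>. ?g (\<eta>, r)) y) t"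
    unfolding elapsed_def by (rule prim_cong)
  also have "\<dots> = elapsed t 0 + prim (\<lambda>r. prim (\<lambda>\<eta>. ?g (\<eta>, r)) y) t"
  proof -
    have "integrable US (\<lambda>p. if fst p \<le> y then ?g p else 0)"
      by (rule Bochner_Integration.integrable_bound[OF I]) auto
    from US_Fubini(3)[OF this] have "integrable U (\<lambda>r. prim (\<lambda>\<eta>. ?g (\<eta>, r)) y)" by (simp add: prim_def cong: if_cong)
    then show ?thesis unfolding elapsed_def by (rule prim_add[OF U.L2_integrable[OF inverse_jac_L2]])
  qed
  also have "prim (\<lambda>r. prim (\<lambda>\<eta>. ?g (\<eta>, r)) y) t = prim (delapsed t) y"
    unfolding delapsed_def[abs_def] using prim_swap[OF I] by simp
  finally show ?thesis .
qed

lemma AC2_elapsed: "AC2 (elapsed t)"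
  by (rule AC2I[OF delapsed_L2 elapsed_prim])

end

context minimizer_velocity
begin

subsection \<open>The source term along the flow\<close>

text \<open>Perturbing \<open>f\<close> along the flow by \<open>y\<^sup>k\<close> times a function of time that vanishes at both ends shows
  that all moments of \<open>z\<close> times the Jacobian agree with those of its time average.\<close>

lemma z_along_flow:
  obtains z0 where "z0 \<in> L2 U" "AE y in U. AE t in U. z (flow t y, t) = z0 y * exp (- logJ t y)"
proof -
  define N where "N p = jac (snd p) (fst p) * z (Flow p)" for p
  have zL: "z \<in> L2 US" by (rule admD(3))
  note [measurable] = L2D(1)[OF zL]
  have N: "N \<in> L2 US" unfolding N_def[abs_def]
    by (rule L2_mult_bdd[OF L2_Flow[OF zL], where C = "exp lip_total"]) (auto simp: logJ_le)
  define z0 where "z0 y = (LINT t|U. N (y, t))" for y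
  have z0: "z0 \<in> L2 U" using L2_time_integral(3)[OF N, of 1] by (simp add: z0_def[abs_def] prim_1)
  define D where "D p = N p - z0 (fst p)" for p
  have D: "D \<in> L2 US" unfolding D_def[abs_def] by (intro L2_diff N L2_US_fst z0)
  have tj: "(\<lambda>p. fst p ^ k * snd p ^ j) \<in> L2 US" for k j by (rule L2_tensor[OF L2_monomial L2_monomial])
  have mom: "(LINT p|US. D p * (fst p ^ k * snd p ^ j)) = 0" for k j
  proof -
    \<comment> \<open>With the mean of \<open>t ^ j\<close> subtracted, the primitive q vanishes at
      time 1 as well as at time 0, as a variation of f must.\<close>
    define c where "c = (LINT t|U. t ^ j)"
    define W where "W p = fst p ^ k * (snd p ^ j - c)" for p :: "real \<times> real"
    define q where "q t = prim (\<lambda>t. t ^ j - c) t" for t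
    have W: "W \<in> L2 US" unfolding W_def by (rule L2_tensor[OF L2_monomial L2_diff[OF L2_monomial U.L2_const]])
    have q1: "q 1 = 0"
      using U.L2_integrable[OF L2_monomial[of j]] by (simp add: q_def prim_1 c_def)
    have q0: "q 0 = 0" by (simp add: q_def prim_0)
    have lag: "lagrange (\<lambda>_. 0) W (y, t) = y ^ k * q t" for y t
      by (simp add: lagrange_def W_def q_def prim_cmult)
    have eul: "euler (lagrange (\<lambda>_. 0) W) = (\<lambda>p. inv_flow (snd p) (fst p) ^ k * q (snd p))"
      by (simp add: euler_def lag fun_eq_iff)
    have "(LINT p|US. z p * euler W p) = 0"
    proof (rule vary_f[of "euler (lagrange (\<lambda>_. 0) W)"])
      show "continuous_on UNIV (euler (lagrange (\<lambda>_. 0) W))"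
        unfolding eul q_def
        by (intro continuous_on_mult continuous_on_power
              continuous_on_compose2[OF continuous_inv_flow, of UNIV "\<lambda>p. (snd p, fst p)", simplified]
              continuous_on_compose2[OF continuous_prim, of _ UNIV snd] continuous_intros
              U.L2_integrable L2_diff L2_monomial U.L2_const) auto
      show "euler (lagrange (\<lambda>_. 0) W) (x, 0) = 0" "euler (lagrange (\<lambda>_. 0) W) (x, 1) = 0" for x
        by (simp_all add: eul q0 q1)
      show "euler (lagrange (\<lambda>_. 0) W) \<in> L2 US" by (intro euler_L2 lagrange_L2 U.L2_const W)
      show "euler W \<in> L2 US" by (intro euler_L2 W)
      show "weak_transport (\<lambda>_. 0) (\<lambda>_. 0) (euler (lagrange (\<lambda>_. 0) W)) (euler W)"
        using lagrange_weak_transport[OF U.L2_const W, of 0] by (simp add: lag q1)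
    qed
    moreover have "(LINT p|US. z p * euler W p) = (LINT p|US. N p * W p)"
    proof -
      note [measurable] = L2D(1)[OF euler_L2[OF W]]
      have "(\<lambda>p. z p * euler W p) \<in> borel_measurable US" by measurable
      from Flow_subst(2)[OF this] show ?thesis by (simp add: N_def mult.assoc)
    qed
    ultimately have NW: "(LINT p|US. N p * W p) = 0" by simp
    have i: "integrable US (\<lambda>p. N p * (fst p ^ k * snd p ^ j))" "integrable US (\<lambda>p. N p * (fst p ^ k * snd p ^ 0))"
      "integrable US (\<lambda>p. z0 (fst p) * (fst p ^ k * snd p ^ j))"
      by (intro integrable_mult_L2 N tj L2_US_fst z0)+
    have "(LINT p|US. N p * W p) = (LINT p|US. N p * (fst p ^ k * snd p ^ j) - c * (N p * (fst p ^ k * snd p ^ 0)))"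
      by (simp add: W_def algebra_simps)
    also have "\<dots> = (LINT p|US. N p * (fst p ^ k * snd p ^ j)) - c * (LINT p|US. N p * (fst p ^ k * snd p ^ 0))"
      using i by simp
    also have "(LINT p|US. N p * (fst p ^ k * snd p ^ 0)) = (LINT y|U. z0 y * y ^ k)"
      using US_Fubini(2)[OF i(2)] by (simp add: z0_def)
    also have "c * (LINT y|U. z0 y * y ^ k) = (LINT y|U. LINT t|U. z0 y * (y ^ k * t ^ j))"
    proof -
      have "(LINT t|U. z0 y * (y ^ k * t ^ j)) = c * (z0 y * y ^ k)" for y
        by (simp add: c_def flip: mult.assoc)
      then show ?thesis by (simp only: integral_mult_right_zero)
    qed
    also have "\<dots> = (LINT p|US. z0 (fst p) * (fst p ^ k * snd p ^ j))" using US_Fubini(2)[OF i(3)] by simp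
    finally show ?thesis using i NW by (simp add: D_def left_diff_distrib)
  qed
  have Dj: "(\<lambda>p. D p * snd p ^ j) \<in> L2 US" for j
    by (rule L2_bound[OF _ D])
       (use L2D(1)[OF D] in \<open>auto simp: abs_mult space_US power_le_one intro!: AE_I2 mult_right_le_one_le\<close>)
  \<comment> \<open>Mixed moments are used in two rounds: those in y show that each moment in t
    vanishes for almost every y, and those in t then show that D(y, .) vanishes.\<close>
  have "AE y in U. (LINT t|U. D (y, t) * t ^ j) = 0" for j
  proof (rule L2_moments_zero)
    show "(\<lambda>y. LINT t|U. D (y, t) * t ^ j) \<in> L2 U"
      using L2_time_integral(3)[OF Dj[of j], of 1] by (simp add: prim_1)
    fix k
    have "(LINT y|U. (LINT t|U. D (y, t) * t ^ j) * y ^ k) = (LINT y|U. LINT t|U. D (y, t) * (y ^ k * t ^ j))"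
      by (simp add: mult_ac flip: integral_mult_right_zero)
    also have "\<dots> = 0"
      using US_Fubini(2)[OF integrable_mult_L2[OF D tj[of k j]]] mom[of k j] by simp
    finally show "(LINT y|U. (LINT t|U. D (y, t) * t ^ j) * y ^ k) = 0" .
  qed
  then have "AE y in U. \<forall>j. (LINT t|U. D (y, t) * t ^ j) = 0" by (simp add: AE_all_countable)
  then have "AE y in U. AE t in U. z (flow t y, t) = z0 y * exp (- logJ t y)"
    using L2_slices(2)[OF D]
  proof eventually_elim
    case (elim y)
    from L2_moments_zero[OF elim(2)] elim(1) have "AE t in U. D (y, t) = 0" by simp
    then show ?case by (rule eventually_mono) (simp add: D_def N_def exp_minus field_simps)
  qed
  then show ?thesis using z0 that by blast
qed

lemma lagrangian_density:
  assumes z0: "AE y in U. AE t in U. z (flow t y, t) = z0 y * exp (- logJ t y)"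
  shows "AE y in U. \<forall>t. lagrange f0 (\<lambda>p. z (Flow p)) (y, t) = f0 y + z0 y * elapsed t y"
    "AE y in U. f1 (flow 1 y) = f0 y + z0 y * elapsed 1 y"
proof -
  show 1: "AE y in U. \<forall>t. lagrange f0 (\<lambda>p. z (Flow p)) (y, t) = f0 y + z0 y * elapsed t y"
    using z0 L2_slices(2)[OF L2_Flow[OF admD(3)]]
  proof eventually_elim
    case (elim y)
    have "prim (\<lambda>r. z (Flow (y, r))) t = prim (\<lambda>r. z0 y * exp (- logJ r y)) t" for t
      by (rule prim_cong_AE) (use elim in \<open>auto dest: L2D\<close>)
    then show ?case by (simp add: lagrange_def prim_cmult elapsed_def)
  qed
  have "AE y in U. f1 (flow 1 y) = lagrange f0 (\<lambda>p. z (Flow p)) (inv_flow 1 (flow 1 y), 1)"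
    by (rule AE_flow[OF weak_transport_representation(2)[OF admD(1,3) f0 f1 f_transport]])
  then show "AE y in U. f1 (flow 1 y) = f0 y + z0 y * elapsed 1 y"
    using 1 by eventually_elim simp
qed

subsection \<open>Boundary data in \<open>H\<^sup>1\<close>\<close>

lemma H1_AC2:
  assumes "w \<in> H1" obtains w' where "AC2 w'" "AE x in U. w x = w' x"
proof -
  from assms obtain g c where g: "g \<in> L2 U" "AE x in U. w x = c + prim g x"
    by (auto simp: H1_def has_weak_deriv_iff)
  show ?thesis by (rule that[of "\<lambda>x. c + prim g x"]) (use g in \<open>auto intro: AC2I\<close>)
qed

text \<open>In Lagrangian coordinates f is w0(y) + z0(y) times \<open>elapsed t y\<close>, with all
  three functions absolutely continuous in y and majorants of the derivatives that are independent
  of time. The inverse flow carries this over to x.\<close>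

lemma f_weak_dx:
  assumes H1: "f0 \<in> H1" "f1 \<in> H1"
  obtains fx C where "has_weak_dx f fx" "AE t in U. (LINT x|U. (fx (x, t))\<^sup>2) \<le> C"
proof -
  obtain z0 where z0: "AE y in U. AE t in U. z (flow t y, t) = z0 y * exp (- logJ t y)"
    using z_along_flow by blast
  note L = lagrangian_density[OF z0]
  obtain w0 where w0: "AC2 w0" "AE x in U. f0 x = w0 x" using H1_AC2[OF H1(1)] by blast
  obtain w1 where w1: "AC2 w1" "AE x in U. f1 x = w1 x" using H1_AC2[OF H1(2)] by blast
  \<comment> \<open>z0 is known only almost everywhere. Solving the relation at time 1 with the
    continuous representatives of f0 and f1 yields an absolutely continuous version of it.\<close>
  define \<zeta> where "\<zeta> y = (w1 (flow 1 y) - w0 y) * inverse (elapsed 1 y)" for y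
  have "AC2 \<zeta>" unfolding \<zeta>_def
    by (intro AC2_mult AC2_diff AC2_flow w0 w1 AC2_inverse[OF AC2_elapsed _ elapsed_1_ge]) simp
  then obtain c dz where dz: "dz \<in> L2 U" "\<And>y. \<zeta> y = c + prim dz y" by (auto simp: AC2_def)
  obtain c0 g0 where g0: "g0 \<in> L2 U" "\<And>y. w0 y = c0 + prim g0 y" using w0(1) by (auto simp: AC2_def)
  have \<zeta>m [measurable]: "\<zeta> \<in> borel_measurable U" and w0m [measurable]: "w0 \<in> borel_measurable U"
    using L2D(1)[OF L2_prim[OF U.L2_integrable[OF dz(1)], of c]] L2D(1)[OF L2_prim[OF U.L2_integrable[OF g0(1)], of c0]]
    by (simp_all add: dz(2)[abs_def] g0(2)[abs_def])
  note [measurable] = L2D(1)[OF dz(1)] L2D(1)[OF g0(1)]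
  define F where "F p = w0 (fst p) + \<zeta> (fst p) * elapsed (snd p) (fst p)" for p
  define dF where "dF p = g0 (fst p) + (dz (fst p) * elapsed (snd p) (fst p) + \<zeta> (fst p) * delapsed (snd p) (fst p))" for p
  define Z where "Z = \<bar>c\<bar> + (LINT r|U. \<bar>dz r\<bar>)"
  define B where "B y = \<bar>g0 y\<bar> + (\<bar>dz y\<bar> * exp lip_total + Z * (exp lip_total * dlogJ_bound y))" for y
  have Z: "\<bar>\<zeta> y\<bar> \<le> Z" for y
    unfolding Z_def dz(2) using abs_prim_le[OF U.L2_integrable[OF dz(1)], of y] by linarith
  have B: "B \<in> L2 U" unfolding B_def[abs_def]
    using L2_cmult[OF L2_abs[OF dz(1)], of "exp lip_total"]
    by (intro L2_add L2_abs g0 L2_cmult dlogJ_bound_L2) (simp_all add: mult.commute)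
  have dFB: "AE y in U. \<forall>t. \<bar>dF (y, t)\<bar> \<le> B y"
    using abs_delapsed
  proof eventually_elim
    case (elim y)
    show ?case
    proof
      fix t
      have "\<bar>dz y * elapsed t y\<bar> \<le> \<bar>dz y\<bar> * exp lip_total"
        unfolding abs_mult by (intro mult_left_mono abs_elapsed) simp
      moreover have "\<bar>\<zeta> y * delapsed t y\<bar> \<le> Z * (exp lip_total * dlogJ_bound y)"
        unfolding abs_mult using elim Z[of y] by (intro mult_mono) auto
      ultimately show "\<bar>dF (y, t)\<bar> \<le> B y" unfolding dF_def B_def fst_conv snd_conv by linarith
    qed
  qed
  have dz_e: "(\<lambda>y. dz y * elapsed t y) \<in> L2 U" for t
    using L2_mult_bdd[OF dz(1), of "elapsed t" "exp lip_total"] abs_elapsed by (simp add: mult.commute)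
  have \<zeta>_d: "(\<lambda>y. \<zeta> y * delapsed t y) \<in> L2 U" for t
    using L2_mult_bdd[OF delapsed_L2[of t], of \<zeta> Z] Z by simp
  have Fp: "F (y, t) = F (0, t) + prim (\<lambda>y. dF (y, t)) y" for y t
  proof -
    have "\<zeta> y * elapsed t y = (c + prim dz y) * (elapsed t 0 + prim (delapsed t) y)"
      unfolding dz(2) elapsed_prim[symmetric] ..
    also have "\<dots> = c * elapsed t 0 + prim (\<lambda>y. dz y * (elapsed t 0 + prim (delapsed t) y) + (c + prim dz y) * delapsed t y) y"
      by (rule prim_mult_all[OF dz(1) delapsed_L2])
    finally have "\<zeta> y * elapsed t y = c * elapsed t 0 + prim (\<lambda>y. dz y * elapsed t y + \<zeta> y * delapsed t y) y"
      unfolding dz(2)[symmetric] elapsed_prim[symmetric] .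
    moreover have "prim (\<lambda>y. dF (y, t)) y = prim g0 y + prim (\<lambda>y. dz y * elapsed t y + \<zeta> y * delapsed t y) y"
      unfolding dF_def fst_conv snd_conv by (intro prim_add U.L2_integrable g0 L2_add dz_e \<zeta>_d)
    ultimately show ?thesis by (simp add: F_def g0(2) dz(2)[of 0] prim_0)
  qed
  have Fm [measurable]: "F \<in> borel_measurable US" and dFm [measurable]: "dF \<in> borel_measurable US"
    unfolding F_def[abs_def] dF_def[abs_def] by measurable
  \<comment> \<open>The y-derivative of F divided by the Jacobian; in Eulerian coordinates it is the
    x-derivative of f.\<close>
  define H where "H p = dF p * exp (- logJ (snd p) (fst p))" for p
  have HB: "AE y in U. \<forall>t. \<bar>H (y, t)\<bar> \<le> exp lip_total * B y"
    using dFB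
  proof eventually_elim
    case (elim y)
    have "\<bar>H (y, t)\<bar> \<le> exp lip_total * B y" for t
      unfolding H_def fst_conv snd_conv abs_mult mult.commute[of "exp lip_total"]
      using elim by (intro mult_mono) (auto simp: minus_logJ_le intro: order_trans[OF abs_ge_zero])
    then show ?case by simp
  qed
  have HBL: "(\<lambda>y. exp lip_total * B y) \<in> L2 U" by (rule L2_cmult[OF B])
  have Hm [measurable]: "H \<in> borel_measurable US" unfolding H_def[abs_def] by measurable
  have "H \<in> L2 US"
    by (rule L2_bound[OF Hm L2_US_fst[OF HBL]])
       (use AE_US_fst[OF HB] in \<open>eventually_elim, metis abs_ge_self order_trans prod.collapse\<close>)
  then have HL: "euler H \<in> L2 US" by (rule euler_L2)
  have GL: "lagrange f0 (\<lambda>p. z (Flow p)) \<in> L2 US" by (intro lagrange_L2 f0 L2_Flow admD(3))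
  have "AE y in U. \<forall>t. lagrange f0 (\<lambda>p. z (Flow p)) (y, t) = F (y, t)"
    using L(1) L(2) w0(2) AE_flow[OF w1(2), of 1]
  proof eventually_elim
    case (elim y)
    have "elapsed 1 y \<noteq> 0" using elapsed_1_ge[of y] by (smt (verit) exp_gt_zero)
    moreover have "w1 (flow 1 y) = w0 y + z0 y * elapsed 1 y" using elim(2,3,4) by simp
    ultimately have "\<zeta> y = z0 y" by (simp add: \<zeta>_def)
    then show ?case using elim(1,3) by (simp add: F_def)
  qed
  from AE_US_fst[OF this] have GF: "AE p in US. lagrange f0 (\<lambda>p. z (Flow p)) p = F p"
    by (rule eventually_mono) (metis prod.collapse)
  have FL: "F \<in> L2 US" by (rule L2_cong_AE[OF Fm GL]) (use GF in \<open>auto elim!: eventually_mono\<close>)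
  have "AE p in US. f p - euler F p = 0"
  proof (rule AE_zero_along_Flow)
    show "(\<lambda>p. f p - euler F p) \<in> L2 US" by (intro L2_diff admD(1) euler_L2 FL)
    show "AE p in US. f (Flow p) - euler F (Flow p) = 0"
      using AE_Flow[OF weak_transport_representation(1)[OF admD(1,3) f0 f1 f_transport]] GF
      by eventually_elim simp
  qed
  then have fF: "AE p in US. f p = euler F p" by (rule eventually_mono) simp
  have wd: "AE t in U. has_weak_deriv (\<lambda>x. f (x, t)) (\<lambda>x. euler H (x, t))"
    using AE_US_D(2)[OF fF] L2_slices(1)[OF admD(1)] L2_slices(1)[OF HL] AE_space
  proof eventually_elim
    case (elim t)
    have m: "(\<lambda>y. dF (y, t)) \<in> borel_measurable U"
      by (rule measurable_compose[OF measurable_Pair2' dFm]) (use elim in simp)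
    have "euler F (x, t) = F (0, t) + prim (\<lambda>x. euler H (x, t)) x" for x
      using prim_inv_flow[OF m, of t x] Fp[of "inv_flow t x" t] by (simp add: euler_def H_def)
    then show ?case using elim(1,2,3) by (auto simp: has_weak_deriv_iff intro!: exI[of _ "F (0, t)"])
  qed
  have "has_weak_dx f (euler H)" using wd admD(1) HL by (simp add: has_weak_dx_def unit_square_def)
  moreover have "AE t in U. (LINT x|U. (euler H (x, t))\<^sup>2) \<le> exp lip_total * (LINT y|U. (exp lip_total * B y)\<^sup>2)"
    using AE_space
  proof eventually_elim
    case (elim t)
    then show ?case by (intro euler_slice(2)[OF Hm _ _ HBL]) (use HB in \<open>auto elim!: eventually_mono\<close>)
  qed
  ultimately show ?thesis by (rule that)
qed

lemma f_Linf_H1: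
  assumes H1: "f0 \<in> H1" "f1 \<in> H1" shows "f \<in> Linf_H1"
proof -
  obtain fx C where fx: "has_weak_dx f fx" "AE t in U. (LINT x|U. (fx (x, t))\<^sup>2) \<le> C" by (rule f_weak_dx[OF H1])
  obtain C' where C': "AE t in U. (LINT x|U. (f (x, t))\<^sup>2) \<le> C'" using f_bounded by blast
  have "AE t in U. H1_norm (\<lambda>x. f (x, t)) \<le> sqrt (C' + C)"
    using has_weak_dxD(3)[OF fx(1)] fx(2) C'
    by eventually_elim (simp add: H1_norm_eq add_mono)
  then show ?thesis using fx(1) by (auto simp: Linf_H1_def L2_H1_def)
qed

text \<open>f and f_x are bounded in time with values in L2, u and u_x are square integrable in time
  with values in the bounded functions, so both terms of the product rule are in L2.\<close>

lemma V_space_times_f: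
  assumes fx: "has_weak_dx f fx" "AE t in U. (LINT x|U. (fx (x, t))\<^sup>2) \<le> C" and u: "u \<in> V_space"
  shows "has_weak_dx (\<lambda>p. u p * f p) (\<lambda>p. weak_dx u p * f p + u p * fx p)"
proof -
  obtain a where a: "a \<in> L2 U" "\<And>t. 0 \<le> a t" "AE t in U. AE x in U. \<bar>u (x, t)\<bar> \<le> a t"
    "AE t in U. AE x in U. \<bar>weak_dx u (x, t)\<bar> \<le> a t"
    "AE t in U. AE x in U. \<bar>u (x, t)\<bar> \<le> a t * x \<and> \<bar>u (x, t)\<bar> \<le> a t * (1 - x)"
    by (rule V_space_slices[OF u], rule that)
  obtain C' where C': "AE t in U. (LINT x|U. (f (x, t))\<^sup>2) \<le> C'" using f_bounded by blast
  note fm = L2D(1)[OF admD(1)] and um = L2D(1)[OF V_L2(1)[OF u]] L2D(1)[OF V_L2(2)[OF u]]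
  have fxL: "fx \<in> L2 US" using has_weak_dxD[OF fx(1)] by simp
  have L1: "(\<lambda>p. u p * f p) \<in> L2 US" by (rule product_L2[OF L2_slices(1)[OF admD(1)] C' fm um(1) a(3) a(1,2)])
  have "(\<lambda>p. weak_dx u p * f p) \<in> L2 US" by (rule product_L2[OF L2_slices(1)[OF admD(1)] C' fm um(2) a(4) a(1,2)])
  moreover have "(\<lambda>p. u p * fx p) \<in> L2 US" by (rule product_L2[OF L2_slices(1)[OF fxL] fx(2) L2D(1)[OF fxL] um(1) a(3) a(1,2)])
  ultimately have L2: "(\<lambda>p. weak_dx u p * f p + u p * fx p) \<in> L2 US" by (rule L2_add)
  have "AE t in U. has_weak_deriv (\<lambda>x. u (x, t) * f (x, t)) (\<lambda>x. weak_dx u (x, t) * f (x, t) + u (x, t) * fx (x, t))"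
    using has_weak_dxD(3)[OF V_spaceD(1)[OF u]] has_weak_dxD(3)[OF fx(1)] L2_slices(1)[OF L1] L2_slices(1)[OF L2]
  proof eventually_elim
    case (elim t)
    obtain c c' where c: "AE x in U. u (x, t) = c + prim (\<lambda>x. weak_dx u (x, t)) x"
      and c': "AE x in U. f (x, t) = c' + prim (\<lambda>x. fx (x, t)) x"
      and uL: "(\<lambda>x. weak_dx u (x, t)) \<in> L2 U" and fL: "(\<lambda>x. fx (x, t)) \<in> L2 U"
      using elim(1,2) by (auto simp: has_weak_deriv_iff)
    let ?k = "\<lambda>x. weak_dx u (x, t) * (c' + prim (\<lambda>x. fx (x, t)) x) + (c + prim (\<lambda>x. weak_dx u (x, t)) x) * fx (x, t)"
    have k: "?k \<in> L2 U" by (intro L2_add L2_mult_AC uL fL)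
    have "prim ?k = prim (\<lambda>x. weak_dx u (x, t) * f (x, t) + u (x, t) * fx (x, t))"
      by (rule prim_cong_AE_L2[OF k elim(4)]) (use c c' in \<open>eventually_elim, simp\<close>)
    moreover have "AE x in U. u (x, t) * f (x, t) = c * c' + prim ?k x"
      using c c' by eventually_elim (simp add: prim_mult_all[OF uL fL])
    ultimately show ?case using elim(3,4) by (auto simp: has_weak_deriv_iff)
  qed
  then show ?thesis using L1 L2 by (simp add: has_weak_dx_def unit_square_def)
qed

lemma weak_boundary_value:
  assumes H1: "f0 \<in> H1" "f1 \<in> H1" shows "weak_boundary_value_problem \<kappa> lam \<epsilon> f z v"
  unfolding weak_boundary_value_problem_def unit_square_def
proof (intro conjI ballI admD(2))
  fix u assume u: "u \<in> V_space"
  obtain fx C where fx: "has_weak_dx f fx" "AE t in U. (LINT x|U. (fx (x, t))\<^sup>2) \<le> C" by (rule f_weak_dx[OF H1])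
  note uf = V_space_times_f[OF fx u]
  have R: "u \<in> R_T f" using u uf by (auto simp: R_T_def L2_H1_def)
  note [measurable] = L2D(1)[OF admD(3)] L2D(1)[OF V_L2(1)[OF admD(2)]] L2D(1)[OF V_L2(2)[OF admD(2)]] L2D(1)[OF V_L2(3)[OF admD(2)]]
    L2D(1)[OF V_L2(1)[OF u]] L2D(1)[OF V_L2(2)[OF u]] L2D(1)[OF V_L2(3)[OF u]] L2D(1)[OF times_dx_L2[OF R]]
    L2D(1)[OF has_weak_dxD(2)[OF has_weak_dx_weak_dx[OF fx(1)]]]
  have "AE p in US. times_dx u f p = weak_dx f p * u p"
    using weak_dx_AE[OF uf] weak_dx_AE[OF fx(1)] by eventually_elim (simp add: times_dx_def)
  then have "(LINT p|US. \<kappa> * v p * u p + lam * weak_dx v p * weak_dx u p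
      + \<epsilon> * weak_dx (weak_dx v) p * weak_dx (weak_dx u) p + z p * weak_dx f p * u p)
    = (LINT p|US. \<kappa> * v p * u p + lam * weak_dx v p * weak_dx u p
      + \<epsilon> * weak_dx (weak_dx v) p * weak_dx (weak_dx u) p + z p * times_dx u f p)"
    by (intro integral_cong_AE) (measurable, auto elim!: eventually_mono)
  also have "\<dots> = 0" by (rule euler_lagrange[OF R])
  finally show "(LINT p|US. \<kappa> * v p * u p + lam * weak_dx v p * weak_dx u p
      + \<epsilon> * weak_dx (weak_dx v) p * weak_dx (weak_dx u) p + z p * weak_dx f p * u p) = 0" .
qed

end

theorem mainTheorem8:
  fixes \<kappa> lam \<epsilon> :: real
    and f0 f1 :: "real \<Rightarrow> real"
    and f v z :: "real \<times> real \<Rightarrow> real"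
  assumes "\<kappa> > 0" and "lam \<ge> 0" and "\<epsilon> > 0"
    and "f0 \<in> L2 unit_interval" and "f1 \<in> L2 unit_interval"
    and "(f, v, z) \<in> admissible f0 f1"
    and "\<forall>q\<in>admissible f0 f1. action \<kappa> lam \<epsilon> (f, v, z) \<le> action \<kappa> lam \<epsilon> q"
  shows "(\<forall>u\<in>R_T f. times_dx u f \<in> L2 unit_square \<and>
           (LINT p|unit_square. \<kappa> * v p * u p + lam * weak_dx v p * weak_dx u p
             + \<epsilon> * weak_dx (weak_dx v) p * weak_dx (weak_dx u) p + z p * times_dx u f p) = 0)
    \<and> weak_continuity_equation z v
    \<and> (f0 \<in> H1 \<and> f1 \<in> H1 \<longrightarrow>
         f \<in> Linf_H1 \<and> weak_boundary_value_problem \<kappa> lam \<epsilon> f z v)"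
proof -
  have m: "minimizer \<kappa> lam \<epsilon> f0 f1 f v z" using assms(4-7) by (simp add: minimizer_def)
  have "v \<in> V_space" using assms(6) by (simp add: admissible_def)
  then obtain h where h: "velocity h" "AE p in US. weak_dx v p = velocity.vel_x h (fst p) (snd p)"
    "AE p in US. v p = velocity.vel h (fst p) (snd p)" by (rule V_space_velocity)
  have "minimizer_velocity \<kappa> lam \<epsilon> f0 f1 f v z h"
    using m h by (simp add: minimizer_velocity_def minimizer_velocity_axioms_def)
  then interpret minimizer_velocity \<kappa> lam \<epsilon> f0 f1 f v z h .
  show ?thesis
    using times_dx_L2 euler_lagrange z_continuity_equation f_Linf_H1 weak_boundary_value
    by (auto simp: unit_square_def)
qed

end
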